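(* Let $k$ be a perfect field of characteristic $p>0$, and let $A, B$ be connected graded commutative $k$-algebras of finite type. Then the following are equivalent: (a) $\bar A \simeq \bar B$ as $F$-modules; (b) $J^{\vee}(A) \simeq J^{\vee}(B)$ as graded algebras; (c) $J^{\vee}(A) \simeq J^{\vee}(B)$ as graded Hopf algebras.
   Context: Graded vector spaces $M=\{M_n\}_{n\ge 0}$ are non-negatively graded over $k$ and of finite type (each $M_n$ finite dimensional); $\bar M$ denotes the positive degree part, and $M$ is reduced if $M_0=0$. The tensor product is the graded one, with braiding $x\otimes y\mapsto (-1)^{|x||y|}y\otimes x$, so "commutative" means graded commutative. "Connected" means the degree $0$ part is $k$. An $F$-module is a reduced graded $k$-vector space $M$ of finite type with maps $F:M_n\to M_{pn}$, for all $n$ if $p=2$ and for even $n$ if $p$ is odd, such that $F(x+y)=F(x)+F(y)$ and $F(\lambda x)=\lambda^pF(x)$ for $\lambda\in k$; morphisms are degree preserving linear maps commuting with $F$. For a connected commutative graded algebra $A$, $\bar A$ is an $F$-module via $F(x)=x^p$. $\mathcal A^*(k)$ is the category of connected commutative graded algebras of finite type, and $\mathcal H^*(k)$ is the category of connected commutative graded Hopf algebras of finite type. $J^{\vee}:\mathcal A^*(k)\to\mathcal H^*(k)$ is the right adjoint of the forgetful functor. Explicitly, $J^{\vee}(A)=\bigoplus_{r\ge 0}\bar A^{\otimes r}$, with coproduct given by deconcatenation of tensors and with the quasi-shuffle product: the component $\bar A^{\otimes l}\otimes\bar A^{\otimes m}\to\bar A^{\otimes n}$ of the product is the sum, over all pairs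 of order preserving injections $\alpha:\{1,\dots,l\}\to\{1,\dots,n\}$, $\beta:\{1,\dots,m\}\to\{1,\dots,n\}$ whose images together cover $\{1,\dots,n\}$, of the map sending $a_1\otimes\cdots\otimes a_{l+m}$ to $\bigotimes_{i=1}^n\prod_{j\in\gamma^{-1}(i)}a_j$ (with Koszul signs), where $\gamma:\{1,\dots,l+m\}\to\{1,\dots,n\}$ is $\alpha$ on the first $l$ elements and $\beta$ on the last $m$. *)

theory Defs
  imports "HOL-Library.FuncSet" "HOL-Library.Function_Algebras" "HOL-Computational_Algebra.Computational_Algebra"
begin

section \<open>Graded vector spaces and graded algebras\<close>

text \<open>
  The grading is external: a graded space is the family of its components \<open>gr M n\<close>.  The components
  are subspaces of one ambient vector space, but they are not required to be independent there, so a
  homogeneous element is a pair consisting of a degree and a vector.  Operations and maps are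
  accordingly indexed by degrees, and their values outside the components are irrelevant.
\<close>

record ('k, 'a) gspace =
  scl :: "'k \<Rightarrow> 'a \<Rightarrow> 'a"
  gr :: "nat \<Rightarrow> 'a set"

record ('k, 'a) galgebra = "('k, 'a) gspace" +
  mul :: "nat \<Rightarrow> nat \<Rightarrow> 'a \<Rightarrow> 'a \<Rightarrow> 'a"
  unit :: 'a

locale graded_space = vector_space "scl M"
  for M :: "('k::field, 'a::ab_group_add, 'm) gspace_scheme" +
  assumes finite_type: "\<exists>B. finite B \<and> gr M n = span B"

locale connected_comm_galgebra = graded_space A
  for A :: "('k::field, 'a::ab_group_add, 'm) galgebra_scheme" +
  assumes mul_closed: "a \<in> gr A i \<Longrightarrow> b \<in> gr A j \<Longrightarrow> mul A i j a b \<in> gr A (i + j)"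
    and mul_add_left: "a \<in> gr A i \<Longrightarrow> a' \<in> gr A i \<Longrightarrow> b \<in> gr A j \<Longrightarrow>
      mul A i j (a + a') b = mul A i j a b + mul A i j a' b"
    and mul_add_right: "a \<in> gr A i \<Longrightarrow> b \<in> gr A j \<Longrightarrow> b' \<in> gr A j \<Longrightarrow>
      mul A i j a (b + b') = mul A i j a b + mul A i j a b'"
    and mul_scl_left: "a \<in> gr A i \<Longrightarrow> b \<in> gr A j \<Longrightarrow>
      mul A i j (scl A c a) b = scl A c (mul A i j a b)"
    and mul_scl_right: "a \<in> gr A i \<Longrightarrow> b \<in> gr A j \<Longrightarrow>
      mul A i j a (scl A c b) = scl A c (mul A i j a b)"
    and mul_assoc: "a \<in> gr A i \<Longrightarrow> b \<in> gr A j \<Longrightarrow> d \<in> gr A l \<Longrightarrow>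
      mul A (i + j) l (mul A i j a b) d = mul A i (j + l) a (mul A j l b d)"
    and unit_closed: "unit A \<in> gr A 0"
    and unit_left: "a \<in> gr A n \<Longrightarrow> mul A 0 n (unit A) a = a"
    and unit_right: "a \<in> gr A n \<Longrightarrow> mul A n 0 a (unit A) = a"
    and graded_comm: "a \<in> gr A i \<Longrightarrow> b \<in> gr A j \<Longrightarrow>
      mul A i j a b = scl A ((-1) ^ (i * j)) (mul A j i b a)"
    and connected: "gr A 0 = range (\<lambda>c. scl A c (unit A))" "unit A \<noteq> 0"

definition glinear_iso ::
    "('k, 'a::plus, 'm) gspace_scheme \<Rightarrow> ('k, 'b::plus, 'n) gspace_scheme \<Rightarrow> (nat \<Rightarrow> 'a \<Rightarrow> 'b) \<Rightarrow> bool"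
  where "glinear_iso M N f \<longleftrightarrow> (\<forall>n. bij_betw (f n) (gr M n) (gr N n) \<and>
     (\<forall>x\<in>gr M n. \<forall>y\<in>gr M n. f n (x + y) = f n x + f n y) \<and>
     (\<forall>c. \<forall>x\<in>gr M n. f n (scl M c x) = scl N c (f n x)))"

definition galgebra_iso ::
    "('k, 'a::plus, 'm) galgebra_scheme \<Rightarrow> ('k, 'b::plus, 'n) galgebra_scheme \<Rightarrow> (nat \<Rightarrow> 'a \<Rightarrow> 'b) \<Rightarrow> bool"
  where "galgebra_iso A B f \<longleftrightarrow> glinear_iso A B f \<and> f 0 (unit A) = unit B \<and>
     (\<forall>i j. \<forall>a\<in>gr A i. \<forall>b\<in>gr A j. f (i + j) (mul A i j a b) = mul B i j (f i a) (f j b))"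

text \<open>Product of a list of homogeneous elements, together with its degree.\<close>

definition lprod :: "('k, 'a, 'm) galgebra_scheme \<Rightarrow> (nat \<times> 'a) list \<Rightarrow> nat \<times> 'a"
  where "lprod A xs = foldr (\<lambda>(i, a) (j, b). (i + j, mul A i j a b)) xs (0, unit A)"


section \<open>\<open>F\<close>-modules\<close>

record ('k, 'a) fmodule = "('k, 'a) gspace" +
  frob :: "nat \<Rightarrow> 'a \<Rightarrow> 'a"

text \<open>The positive degree part of \<open>A\<close> with \<open>F(x) = x\<^sup>p\<close>.  The field \<open>frob\<close> is a total function, but
  only its values in the degrees where \<open>F\<close> is defined are used by \<open>fmodule_iso\<close>.\<close>

definition aug_fmodule :: "nat \<Rightarrow> ('k, 'a::zero, 'm) galgebra_scheme \<Rightarrow> ('k, 'a) fmodule"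
  where "aug_fmodule p A = \<lparr>scl = scl A, gr = (\<lambda>n. if n = 0 then {0} else gr A n),
     frob = (\<lambda>n x. snd (lprod A (replicate p (n, x))))\<rparr>"

definition fmodule_iso ::
    "nat \<Rightarrow> ('k, 'a::plus, 'm) fmodule_scheme \<Rightarrow> ('k, 'b::plus, 'n) fmodule_scheme \<Rightarrow> (nat \<Rightarrow> 'a \<Rightarrow> 'b) \<Rightarrow> bool"
  where "fmodule_iso p M N f \<longleftrightarrow> glinear_iso M N f \<and>
     (\<forall>n. p = 2 \<or> even n \<longrightarrow> (\<forall>x\<in>gr M n. f (p * n) (frob M n x) = frob N n (f n x)))"


section \<open>Tensor products and graded Hopf algebras\<close>

text \<open>
  Tensors are realised as functionals on (multi)linear forms: \<open>x \<otimes> y\<close> is the evaluation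
  \<open>\<psi> \<mapsto> \<psi>(x, y)\<close> on the space of bilinear forms, and the tensor product is the linear span of these
  evaluations.  Over a field this is the usual tensor product, since linear functionals separate the
  points of the latter.  To make tensors that agree on all forms equal, they are set to \<open>0\<close> on
  functions that are not forms.
\<close>

type_synonym ('k, 'a, 'b) tensor2 = "((nat \<times> 'a) \<times> (nat \<times> 'b) \<Rightarrow> 'k) \<Rightarrow> 'k"

definition bilinear_form ::
    "('k::field, 'a::plus, 'm) gspace_scheme \<Rightarrow> ('k, 'b::plus, 'n) gspace_scheme \<Rightarrow>
     ((nat \<times> 'a) \<times> (nat \<times> 'b) \<Rightarrow> 'k) \<Rightarrow> bool"
  where "bilinear_form M N \<psi> \<longleftrightarrow> (\<forall>i j. \<forall>x\<in>gr M i. \<forall>y\<in>gr N j.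
     (\<forall>x'\<in>gr M i. \<psi> ((i, x + x'), (j, y)) = \<psi> ((i, x), (j, y)) + \<psi> ((i, x'), (j, y))) \<and>
     (\<forall>y'\<in>gr N j. \<psi> ((i, x), (j, y + y')) = \<psi> ((i, x), (j, y)) + \<psi> ((i, x), (j, y'))) \<and>
     (\<forall>c. \<psi> ((i, scl M c x), (j, y)) = c * \<psi> ((i, x), (j, y))) \<and>
     (\<forall>c. \<psi> ((i, x), (j, scl N c y)) = c * \<psi> ((i, x), (j, y))))"

definition tensor2 ::
    "('k::field, 'a::plus, 'm) gspace_scheme \<Rightarrow> ('k, 'b::plus, 'n) gspace_scheme \<Rightarrow>
     nat \<times> 'a \<Rightarrow> nat \<times> 'b \<Rightarrow> ('k, 'a, 'b) tensor2"
  where "tensor2 M N x y = (\<lambda>\<psi>. if bilinear_form M N \<psi> then \<psi> (x, y) else 0)"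

text \<open>The map \<open>f \<otimes> g\<close> from \<open>M \<otimes> N\<close> to \<open>M' \<otimes> N'\<close>; see \<open>map_tensor2_tensor2\<close> below.\<close>

definition map_tensor2 ::
    "('k::field, 'c::plus, 'm) gspace_scheme \<Rightarrow> ('k, 'd::plus, 'n) gspace_scheme \<Rightarrow>
     (nat \<Rightarrow> 'a \<Rightarrow> 'c) \<Rightarrow> (nat \<Rightarrow> 'b \<Rightarrow> 'd) \<Rightarrow> ('k, 'a, 'b) tensor2 \<Rightarrow> ('k, 'c, 'd) tensor2"
  where "map_tensor2 M' N' f g t = (\<lambda>\<psi>. if bilinear_form M' N' \<psi>
     then t (\<lambda>((i, x), (j, y)). \<psi> ((i, f i x), (j, g j y))) else 0)"

record ('k, 'a) ghopf = "('k, 'a) galgebra" +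
  comul :: "nat \<Rightarrow> 'a \<Rightarrow> ('k, 'a, 'a) tensor2"
  counit :: "'a \<Rightarrow> 'k"

text \<open>\<open>counit\<close> is the counit on the component of degree \<open>0\<close>; it vanishes on the other components.
  Antipodes need not be mentioned: a bialgebra map between Hopf algebras commutes with them.\<close>

definition ghopf_iso ::
    "('k::field, 'a::plus, 'm) ghopf_scheme \<Rightarrow> ('k, 'b::plus, 'n) ghopf_scheme \<Rightarrow> (nat \<Rightarrow> 'a \<Rightarrow> 'b) \<Rightarrow> bool"
  where "ghopf_iso H K f \<longleftrightarrow> galgebra_iso H K f \<and>
     (\<forall>x\<in>gr H 0. counit K (f 0 x) = counit H x) \<and>
     (\<forall>n. \<forall>x\<in>gr H n. comul K n (f n x) = map_tensor2 K K f f (comul H n x))"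


section \<open>The quasi-shuffle Hopf algebra \<open>J\<^sup>\<or>(A)\<close>\<close>

text \<open>A word \<open>[(n\<^sub>1, a\<^sub>1), \<dots>, (n\<^sub>r, a\<^sub>r)]\<close> of homogeneous elements of positive degree stands for the
  pure tensor \<open>a\<^sub>1 \<otimes> \<dots> \<otimes> a\<^sub>r\<close>.\<close>

type_synonym ('k, 'a) tensor_word = "((nat \<times> 'a) list \<Rightarrow> 'k) \<Rightarrow> 'k"

definition aug_words :: "('k, 'a, 'm) gspace_scheme \<Rightarrow> (nat \<times> 'a) list set"
  where "aug_words A = {w. \<forall>(n, a)\<in>set w. n > 0 \<and> a \<in> gr A n}"

definition wdeg :: "(nat \<times> 'a) list \<Rightarrow> nat"
  where "wdeg w = sum_list (map fst w)"

definition multilinear_form ::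
    "('k::field, 'a::plus, 'm) gspace_scheme \<Rightarrow> ((nat \<times> 'a) list \<Rightarrow> 'k) \<Rightarrow> bool"
  where "multilinear_form A \<phi> \<longleftrightarrow> (\<forall>u\<in>aug_words A. \<forall>v\<in>aug_words A. \<forall>n>0. \<forall>a\<in>gr A n.
     (\<forall>b\<in>gr A n. \<phi> (u @ (n, a + b) # v) = \<phi> (u @ (n, a) # v) + \<phi> (u @ (n, b) # v)) \<and>
     (\<forall>c. \<phi> (u @ (n, scl A c a) # v) = c * \<phi> (u @ (n, a) # v)))"

definition tensor_word ::
    "('k::field, 'a::plus, 'm) gspace_scheme \<Rightarrow> (nat \<times> 'a) list \<Rightarrow> ('k, 'a) tensor_word"
  where "tensor_word A w = (\<lambda>\<phi>. if multilinear_form A \<phi> then \<phi> w else 0)"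

text \<open>Pairs of order preserving injections of \<open>{0,\<dots>,l-1}\<close> and \<open>{0,\<dots>,m-1}\<close> into \<open>{0,\<dots>,n-1}\<close>
  which are jointly surjective.\<close>

definition qshuffles :: "nat \<Rightarrow> nat \<Rightarrow> nat \<Rightarrow> ((nat \<Rightarrow> nat) \<times> (nat \<Rightarrow> nat)) set"
  where "qshuffles l m n = {(\<alpha>, \<beta>). \<alpha> \<in> {..<l} \<rightarrow>\<^sub>E {..<n} \<and> \<beta> \<in> {..<m} \<rightarrow>\<^sub>E {..<n} \<and>
     strict_mono_on {..<l} \<alpha> \<and> strict_mono_on {..<m} \<beta> \<and> \<alpha> ` {..<l} \<union> \<beta> ` {..<m} = {..<n}}"

definition join :: "nat \<Rightarrow> (nat \<Rightarrow> nat) \<Rightarrow> (nat \<Rightarrow> nat) \<Rightarrow> nat \<Rightarrow> nat"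
  where "join l \<alpha> \<beta> j = (if j < l then \<alpha> j else \<beta> (j - l))"

text \<open>The word whose \<open>i\<close>-th letter is the product of the letters of \<open>w\<close> at the positions in
  \<open>\<gamma>\<^sup>-\<^sup>1(i)\<close>, and the Koszul sign of the rearrangement of \<open>w\<close> that it requires.\<close>

definition contract ::
    "('k, 'a, 'm) galgebra_scheme \<Rightarrow> nat \<Rightarrow> (nat \<Rightarrow> nat) \<Rightarrow> (nat \<times> 'a) list \<Rightarrow> (nat \<times> 'a) list"
  where "contract A n \<gamma> w =
     map (\<lambda>i. lprod A (map (\<lambda>j. w ! j) (filter (\<lambda>j. \<gamma> j = i) [0..<length w]))) [0..<n]"

definition koszul_sign :: "(nat \<Rightarrow> nat) \<Rightarrow> (nat \<times> 'a) list \<Rightarrow> 'k::field"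
  where "koszul_sign \<gamma> w =
     (\<Prod>(i, j)\<in>{(i, j). i < j \<and> j < length w \<and> \<gamma> i > \<gamma> j}. (-1) ^ (fst (w ! i) * fst (w ! j)))"

text \<open>The value of a form \<open>\<phi>\<close> on the quasi-shuffle product of the words \<open>u\<close> and \<open>v\<close>.  There are no
  quasi-shuffles with \<open>n > length u + length v\<close>.\<close>

definition qshuffle_eval ::
    "('k::field, 'a, 'm) galgebra_scheme \<Rightarrow> ((nat \<times> 'a) list \<Rightarrow> 'k) \<Rightarrow> (nat \<times> 'a) list \<Rightarrow> (nat \<times> 'a) list \<Rightarrow> 'k"
  where "qshuffle_eval A \<phi> u v =
     (\<Sum>n\<le>length u + length v. \<Sum>(\<alpha>, \<beta>)\<in>qshuffles (length u) (length v) n.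
        koszul_sign (join (length u) \<alpha> \<beta>) (u @ v) *
        \<phi> (contract A n (join (length u) \<alpha> \<beta>) (u @ v)))"

definition Jv_space :: "('k::field, 'a::plus, 'm) gspace_scheme \<Rightarrow> ('k, ('k, 'a) tensor_word) gspace"
  where "Jv_space A = \<lparr>scl = (\<lambda>c x \<phi>. c * x \<phi>),
     gr = (\<lambda>n. module.span (\<lambda>c x \<phi>. c * x \<phi>) (tensor_word A ` {w \<in> aug_words A. wdeg w = n}))\<rparr>"

text \<open>As tensors are functionals, a bilinear operation given on pure tensors is extended by
  evaluating both arguments; \<open>Jv_mul\<close>, \<open>Jv_comul\<close> and \<open>Jv_counit\<close> below record the values of the
  structure maps on pure tensors.\<close>

definition Jv :: "('k::field, 'a::plus, 'm) galgebra_scheme \<Rightarrow> ('k, ('k, 'a) tensor_word) ghopf"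
  where "Jv A = \<lparr>scl = scl (Jv_space A), gr = gr (Jv_space A),
     mul = (\<lambda>i j x y \<phi>. if multilinear_form A \<phi> then x (\<lambda>u. y (\<lambda>v. qshuffle_eval A \<phi> u v)) else 0),
     unit = tensor_word A [],
     comul = (\<lambda>n x \<psi>. if bilinear_form (Jv_space A) (Jv_space A) \<psi>
       then x (\<lambda>w. \<Sum>r\<le>length w. \<psi> ((wdeg (take r w), tensor_word A (take r w)),
                                    (wdeg (drop r w), tensor_word A (drop r w)))) else 0),
     counit = (\<lambda>x. x (\<lambda>w. if w = [] then 1 else 0))\<rparr>"


section \<open>Values of the structure maps on pure tensors\<close>

lemma map_tensor2_tensor2:
  assumes f: "\<And>i x. x \<in> gr M i \<Longrightarrow> f i x \<in> gr M' i"
      "\<And>i x y. x \<in> gr M i \<Longrightarrow> y \<in> gr M i \<Longrightarrow> f i (x + y) = f i x + f i y"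
      "\<And>i c x. x \<in> gr M i \<Longrightarrow> f i (scl M c x) = scl M' c (f i x)"
    and g: "\<And>i y. y \<in> gr N i \<Longrightarrow> g i y \<in> gr N' i"
      "\<And>i x y. x \<in> gr N i \<Longrightarrow> y \<in> gr N i \<Longrightarrow> g i (x + y) = g i x + g i y"
      "\<And>i c y. y \<in> gr N i \<Longrightarrow> g i (scl N c y) = scl N' c (g i y)"
  shows "map_tensor2 M' N' f g (tensor2 M N (i, x) (j, y)) = tensor2 M' N' (i, f i x) (j, g j y)"
proof -
  have "bilinear_form M N (\<lambda>((i, x), (j, y)). \<psi> ((i, f i x), (j, g j y)))" if "bilinear_form M' N' \<psi>" for \<psi>
    using that by (simp add: bilinear_form_def f g)
  then show ?thesis
    by (auto simp: map_tensor2_def tensor2_def)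
qed

lemma koszul_sign_cong:
  assumes "map fst w = map fst w'"
  shows "koszul_sign \<gamma> w = koszul_sign \<gamma> w'"
proof -
  have l: "length w = length w'" using assms by (metis length_map)
  have "fst (w ! i) = fst (w' ! i)" if "i < length w" for i
    using assms l that by (metis nth_map)
  then show ?thesis
    unfolding koszul_sign_def l by (intro prod.cong) (use l in auto)
qed

lemma aug_words_simps [simp]:
  "[] \<in> aug_words A"
  "(n, a) # w \<in> aug_words A \<longleftrightarrow> n > 0 \<and> a \<in> gr A n \<and> w \<in> aug_words A"
  "u @ v \<in> aug_words A \<longleftrightarrow> u \<in> aug_words A \<and> v \<in> aug_words A"
  by (auto simp: aug_words_def)

lemma wdeg_simps [simp]: "wdeg [] = 0" "wdeg (x # w) = fst x + wdeg w" "wdeg (u @ v) = wdeg u + wdeg v"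
  by (auto simp: wdeg_def)

lemma multilinear_formI:
  assumes "\<And>u v n a b. u \<in> aug_words A \<Longrightarrow> v \<in> aug_words A \<Longrightarrow> n > 0 \<Longrightarrow> a \<in> gr A n \<Longrightarrow> b \<in> gr A n \<Longrightarrow>
      \<phi> (u @ (n, a + b) # v) = \<phi> (u @ (n, a) # v) + \<phi> (u @ (n, b) # v)"
    and "\<And>u v n a c. u \<in> aug_words A \<Longrightarrow> v \<in> aug_words A \<Longrightarrow> n > 0 \<Longrightarrow> a \<in> gr A n \<Longrightarrow>
      \<phi> (u @ (n, scl A c a) # v) = c * \<phi> (u @ (n, a) # v)"
  shows "multilinear_form A \<phi>"
  using assms by (auto simp: multilinear_form_def)

lemma multilinear_formD:
  assumes "multilinear_form A \<phi>" "u \<in> aug_words A" "v \<in> aug_words A" "n > 0" "a \<in> gr A n"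
  shows "b \<in> gr A n \<Longrightarrow> \<phi> (u @ (n, a + b) # v) = \<phi> (u @ (n, a) # v) + \<phi> (u @ (n, b) # v)"
    "\<phi> (u @ (n, scl A c a) # v) = c * \<phi> (u @ (n, a) # v)"
  using assms by (auto simp: multilinear_form_def)

context graded_space
begin

lemma subspace_gr: "subspace (gr M n)"
  using finite_type[of n] by auto

lemma gr_add: "a \<in> gr M n \<Longrightarrow> b \<in> gr M n \<Longrightarrow> a + b \<in> gr M n"
  by (rule subspace_add[OF subspace_gr])

lemma gr_scl: "a \<in> gr M n \<Longrightarrow> scl M c a \<in> gr M n"
  by (rule subspace_scale[OF subspace_gr])

end

context connected_comm_galgebra
begin

lemma lprod_Nil [simp]: "lprod A [] = (0, unit A)"
  by (simp add: lprod_def)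

lemma lprod_Cons [simp]:
  "lprod A ((i, a) # xs) = (i + fst (lprod A xs), mul A i (fst (lprod A xs)) a (snd (lprod A xs)))"
  by (simp add: lprod_def split: prod.splits)

lemma fst_lprod: "fst (lprod A xs) = wdeg xs"
  by (induction xs) (auto simp: wdeg_def)

definition hom_words :: "(nat \<times> 'a) list set"
  where "hom_words = {w. \<forall>(n, a)\<in>set w. a \<in> gr A n}"

lemma hom_words_simps [simp]:
  "[] \<in> hom_words"
  "(n, a) # w \<in> hom_words \<longleftrightarrow> a \<in> gr A n \<and> w \<in> hom_words"
  "u @ v \<in> hom_words \<longleftrightarrow> u \<in> hom_words \<and> v \<in> hom_words"
  by (auto simp: hom_words_def)

lemma lprod_closed: "xs \<in> hom_words \<Longrightarrow> snd (lprod A xs) \<in> gr A (wdeg xs)"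
  by (induction xs) (auto simp: unit_closed fst_lprod intro: mul_closed)

lemma lprod_linear:
  assumes "xs \<in> hom_words" "ys \<in> hom_words" "a \<in> gr A n"
  shows "b \<in> gr A n \<Longrightarrow> snd (lprod A (xs @ (n, a + b) # ys)) = snd (lprod A (xs @ (n, a) # ys)) + snd (lprod A (xs @ (n, b) # ys))"
    "snd (lprod A (xs @ (n, scl A c a) # ys)) = scl A c (snd (lprod A (xs @ (n, a) # ys)))"
proof -
  have cl: "snd (lprod A (xs @ (n, b) # ys)) \<in> gr A (wdeg xs + (n + wdeg ys))"
    if "xs \<in> hom_words" "b \<in> gr A n" for b xs
    using lprod_closed[of "xs @ (n, b) # ys"] that assms(2) by auto
  show "b \<in> gr A n \<Longrightarrow> snd (lprod A (xs @ (n, a + b) # ys)) = snd (lprod A (xs @ (n, a) # ys)) + snd (lprod A (xs @ (n, b) # ys))"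
    using assms(1) 
    by (induction xs) (use assms(2,3) cl in \<open>auto simp: fst_lprod mul_add_left mul_add_right lprod_closed gr_add\<close>)
  show "snd (lprod A (xs @ (n, scl A c a) # ys)) = scl A c (snd (lprod A (xs @ (n, a) # ys)))"
    using assms(1) 
    by (induction xs) (use assms(2,3) cl in \<open>auto simp: fst_lprod mul_scl_left mul_scl_right lprod_closed gr_scl\<close>)
qed

lemma contract_split:
  assumes "\<gamma> (length u) < n"
  obtains xs ys us vs where
    "\<And>x. contract A n \<gamma> (u @ x # v) = us @ lprod A (xs @ x # ys) # vs"
    "set xs \<subseteq> set u" "set ys \<subseteq> set v"
proof -
  define q where "q = length u"
  define N where "N = length u + Suc (length v)"
  define F where "F x i = lprod A (map (\<lambda>j. (u @ x # v) ! j) (filter (\<lambda>j. \<gamma> j = i) [0..<N]))" for x i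
  define xs where "xs = map (\<lambda>j. u ! j) (filter (\<lambda>j. \<gamma> j = \<gamma> q) [0..<q])"
  define ys where "ys = map (\<lambda>j. v ! (j - Suc q)) (filter (\<lambda>j. \<gamma> j = \<gamma> q) [Suc q..<N])"
  have s: "[0..<N] = [0..<q] @ q # [Suc q..<N]"
    unfolding N_def q_def by (metis add_Suc_right less_add_Suc1 upt_add_eq_append upt_conv_Cons zero_le le_add1 less_or_eq_imp_le)
  have s': "[0..<n] = [0..<\<gamma> q] @ \<gamma> q # [Suc (\<gamma> q)..<n]"
    using assms unfolding q_def by (metis less_imp_add_positive upt_add_eq_append upt_conv_Cons zero_le)
  have F1: "F x i = F x' i" if "i \<noteq> \<gamma> q" for x x' i
    unfolding F_def by (rule arg_cong[where f = "lprod A"], rule map_cong) (use that in \<open>auto simp: nth_append q_def nth_Cons'\<close>)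
  have F2: "F x (\<gamma> q) = lprod A (xs @ x # ys)" for x
    unfolding F_def s xs_def ys_def
    by (rule arg_cong[where f = "lprod A"]) (auto simp: nth_append q_def)
  have c: "contract A n \<gamma> (u @ x # v) = map (F x) [0..<n]" for x
    by (simp add: contract_def F_def[abs_def] N_def)
  show ?thesis
  proof (rule that[of "map (F undefined) [0..<\<gamma> q]" xs ys "map (F undefined) [Suc (\<gamma> q)..<n]"])
    show "contract A n \<gamma> (u @ x # v) = map (F undefined) [0..<\<gamma> q] @ lprod A (xs @ x # ys) # map (F undefined) [Suc (\<gamma> q)..<n]" for x
      unfolding c s' by (auto simp: F2 intro: F1)
    show "set xs \<subseteq> set u" by (auto simp: xs_def q_def)
    show "set ys \<subseteq> set v" by (auto simp: ys_def q_def N_def intro!: nth_mem)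
  qed
qed

lemma aug_words_hom: "w \<in> aug_words A \<Longrightarrow> w \<in> hom_words"
  by (auto simp: aug_words_def hom_words_def)

lemma wdeg_aug_pos: "w \<in> aug_words A \<Longrightarrow> w \<noteq> [] \<Longrightarrow> wdeg w > 0"
  by (cases w) auto

lemma contract_aug:
  assumes "w \<in> aug_words A" "\<gamma> ` {..<length w} \<supseteq> {..<n}"
  shows "contract A n \<gamma> w \<in> aug_words A"
proof -
  have "fst (lprod A xs) > 0 \<and> snd (lprod A xs) \<in> gr A (fst (lprod A xs))"
    if "i < n" and xs: "xs = map (\<lambda>j. w ! j) (filter (\<lambda>j. \<gamma> j = i) [0..<length w])" for i xs
  proof -
    have "i \<in> \<gamma> ` {..<length w}" using assms(2) that(1) by blast
    then obtain j where "j < length w" "\<gamma> j = i" by auto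
    then have "xs \<noteq> []" by (auto simp: xs filter_empty_conv)
    moreover have "set xs \<subseteq> set w" by (auto simp: xs)
    then have "xs \<in> aug_words A" using assms(1) by (auto simp: aug_words_def)
    ultimately show ?thesis using wdeg_aug_pos lprod_closed aug_words_hom by (auto simp: fst_lprod)
  qed
  then show ?thesis by (auto simp: contract_def aug_words_def case_prod_beta)
qed

lemma contract_linear:
  assumes uv: "u \<in> aug_words A" "v \<in> aug_words A" "m > 0" "a \<in> gr A m"
    and g: "\<gamma> ` {..<length u + Suc (length v)} = {..<n}" and phi: "multilinear_form A \<phi>"
  shows "b \<in> gr A m \<Longrightarrow> \<phi> (contract A n \<gamma> (u @ (m, a + b) # v)) = \<phi> (contract A n \<gamma> (u @ (m, a) # v)) + \<phi> (contract A n \<gamma> (u @ (m, b) # v))"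
    "\<phi> (contract A n \<gamma> (u @ (m, scl A c a) # v)) = c * \<phi> (contract A n \<gamma> (u @ (m, a) # v))"
proof -
  have "\<gamma> (length u) < n" using g by auto
  then obtain xs ys us vs where c: "\<And>x. contract A n \<gamma> (u @ x # v) = us @ lprod A (xs @ x # ys) # vs"
    and st: "set xs \<subseteq> set u" "set ys \<subseteq> set v" by (rule contract_split) blast
  have xy: "xs \<in> aug_words A" "ys \<in> aug_words A" using uv st by (auto simp: aug_words_def)
  define d where "d = wdeg xs + (m + wdeg ys)"
  have d: "d > 0" using uv by (simp add: d_def)
  have l: "lprod A (xs @ (m, z) # ys) = (d, snd (lprod A (xs @ (m, z) # ys)))" for z
    by (rule prod_eqI) (auto simp: fst_lprod d_def)
  have cl: "snd (lprod A (xs @ (m, z) # ys)) \<in> gr A d" if "z \<in> gr A m" for z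
    using lprod_closed[of "xs @ (m, z) # ys"] xy that by (auto simp: d_def aug_words_hom)
  have "contract A n \<gamma> (u @ (m, a) # v) \<in> aug_words A"
    by (rule contract_aug) (use uv g in auto)
  then have us: "us \<in> aug_words A" "vs \<in> aug_words A" 
    unfolding c by (auto simp: aug_words_def)
  have c': "contract A n \<gamma> (u @ (m, z) # v) = us @ (d, snd (lprod A (xs @ (m, z) # ys))) # vs" for z
    unfolding c using l[of z] by metis
  note lin = multilinear_formD[OF phi us d]
  show "b \<in> gr A m \<Longrightarrow> \<phi> (contract A n \<gamma> (u @ (m, a + b) # v)) = \<phi> (contract A n \<gamma> (u @ (m, a) # v)) + \<phi> (contract A n \<gamma> (u @ (m, b) # v))"
    unfolding c' using uv by (simp add: lprod_linear aug_words_hom xy lin cl)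
  show "\<phi> (contract A n \<gamma> (u @ (m, scl A c a) # v)) = c * \<phi> (contract A n \<gamma> (u @ (m, a) # v))"
    unfolding c' using uv by (simp add: lprod_linear aug_words_hom xy lin cl)
qed

lemma qshuffles_join:
  assumes "(\<alpha>, \<beta>) \<in> qshuffles l m n"
  shows "join l \<alpha> \<beta> ` {..<l + m} = {..<n}"
proof -
  have "join l \<alpha> \<beta> ` {..<l + m} = join l \<alpha> \<beta> ` ({..<l} \<union> {l..<l + m})"
    by (rule arg_cong[where f = "image _"]) auto
  also have "\<dots> = join l \<alpha> \<beta> ` {..<l} \<union> join l \<alpha> \<beta> ` (\<lambda>j. j + l) ` {..<m}"
    by (simp add: image_Un image_add_atLeastLessThan' lessThan_atLeast0 add.commute)
  also have "\<dots> = \<alpha> ` {..<l} \<union> \<beta> ` {..<m}"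
    unfolding image_image by (intro arg_cong2[where f = "(\<union>)"] image_cong refl) (auto simp: join_def)
  finally have "join l \<alpha> \<beta> ` {..<l + m} = \<alpha> ` {..<l} \<union> \<beta> ` {..<m}" .
  then show ?thesis using assms by (auto simp: qshuffles_def)
qed

lemma multilinear_form_qshuffle_left:
  assumes "multilinear_form A \<phi>" "v \<in> aug_words A"
  shows "multilinear_form A (\<lambda>u. qshuffle_eval A \<phi> u v)"
proof (rule multilinear_formI)
  fix u1 u2 m a b c assume u: "u1 \<in> aug_words A" "u2 \<in> aug_words A" "m > 0" "a \<in> gr A m"
  have u2: "u2 @ v \<in> aug_words A" using u assms by simp
  have j: "join (length u1 + Suc (length u2)) \<alpha> \<beta> ` {..<length u1 + Suc (length (u2 @ v))} = {..<n}"
    if "(\<alpha>, \<beta>) \<in> qshuffles (length u1 + Suc (length u2)) (length v) n" for \<alpha> \<beta> n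
    using qshuffles_join[OF that] by (simp add: add.assoc)
  have s: "koszul_sign \<gamma> (u1 @ (m, z) # u2 @ v) = (koszul_sign \<gamma> (u1 @ (m, 0) # u2 @ v) :: 'k)" for \<gamma> z
    by (rule koszul_sign_cong) simp
  note lin = contract_linear[OF u(1) u2 u(3,4) j assms(1)]
  define T where "T n x z = koszul_sign (join (length u1 + Suc (length u2)) (fst x) (snd x)) (u1 @ (m, 0) # u2 @ v) *
      \<phi> (contract A n (join (length u1 + Suc (length u2)) (fst x) (snd x)) (u1 @ (m, z) # u2 @ v))" for n x z
  have ev: "qshuffle_eval A \<phi> (u1 @ (m, z) # u2) v =
     (\<Sum>n\<le>length u1 + Suc (length u2) + (length v). \<Sum>x\<in>qshuffles (length u1 + Suc (length u2)) (length v) n. T n x z)" for z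
    unfolding qshuffle_eval_def T_def by (simp add: s[of _ z] case_prod_beta)
  have T: "T n x (scl A c a) = c * T n x a" "b \<in> gr A m \<Longrightarrow> T n x (a + b) = T n x a + T n x b"
    if "x \<in> qshuffles (length u1 + Suc (length u2)) (length v) n" for n x
    using lin[of "fst x" "snd x" n] that by (simp_all add: T_def ring_distribs)
  show "qshuffle_eval A \<phi> (u1 @ (m, a + b) # u2) v = qshuffle_eval A \<phi> (u1 @ (m, a) # u2) v + qshuffle_eval A \<phi> (u1 @ (m, b) # u2) v"
    if "b \<in> gr A m"
    unfolding ev sum.distrib[symmetric] by (intro sum.cong refl T that)
  show "qshuffle_eval A \<phi> (u1 @ (m, scl A c a) # u2) v = c * qshuffle_eval A \<phi> (u1 @ (m, a) # u2) v"
    unfolding ev sum_distrib_left by (intro sum.cong refl T)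
qed

lemma multilinear_form_qshuffle_right:
  assumes "multilinear_form A \<phi>" "u \<in> aug_words A"
  shows "multilinear_form A (\<lambda>v. qshuffle_eval A \<phi> u v)"
proof (rule multilinear_formI)
  fix v1 v2 m a b c assume v: "v1 \<in> aug_words A" "v2 \<in> aug_words A" "m > 0" "a \<in> gr A m"
  have v1: "u @ v1 \<in> aug_words A" using v assms by simp
  have j: "join (length u) \<alpha> \<beta> ` {..<length (u @ v1) + Suc (length v2)} = {..<n}"
    if "(\<alpha>, \<beta>) \<in> qshuffles (length u) (length v1 + Suc (length v2)) n" for \<alpha> \<beta> n
    using qshuffles_join[OF that] by (simp add: add.assoc)
  have s: "koszul_sign \<gamma> (u @ v1 @ (m, z) # v2) = (koszul_sign \<gamma> (u @ v1 @ (m, 0) # v2) :: 'k)" for \<gamma> z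
    by (rule koszul_sign_cong) simp
  note lin = contract_linear[OF v1 v(2,3,4) j assms(1), unfolded append_assoc]
  define T where "T n x z = koszul_sign (join (length u) (fst x) (snd x)) (u @ v1 @ (m, 0) # v2) *
      \<phi> (contract A n (join (length u) (fst x) (snd x)) (u @ v1 @ (m, z) # v2))" for n x z
  have ev: "qshuffle_eval A \<phi> u (v1 @ (m, z) # v2) =
     (\<Sum>n\<le>length u + (length v1 + Suc (length v2)). \<Sum>x\<in>qshuffles (length u) (length v1 + Suc (length v2)) n. T n x z)" for z
    unfolding qshuffle_eval_def T_def by (simp add: s[of _ z] case_prod_beta)
  have T: "T n x (scl A c a) = c * T n x a" "b \<in> gr A m \<Longrightarrow> T n x (a + b) = T n x a + T n x b"
    if "x \<in> qshuffles (length u) (length v1 + Suc (length v2)) n" for n x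
    using lin[of "fst x" "snd x" n] that by (simp_all add: T_def ring_distribs)
  show "qshuffle_eval A \<phi> u (v1 @ (m, a + b) # v2) = qshuffle_eval A \<phi> u (v1 @ (m, a) # v2) + qshuffle_eval A \<phi> u (v1 @ (m, b) # v2)"
    if "b \<in> gr A m"
    unfolding ev sum.distrib[symmetric] by (intro sum.cong refl T that)
  show "qshuffle_eval A \<phi> u (v1 @ (m, scl A c a) # v2) = c * qshuffle_eval A \<phi> u (v1 @ (m, a) # v2)"
    unfolding ev sum_distrib_left by (intro sum.cong refl T)
qed

lemma multilinear_form_cong:
  assumes "\<And>w. w \<in> aug_words A \<Longrightarrow> \<phi> w = \<psi> w"
  shows "multilinear_form A \<phi> = multilinear_form A \<psi>"
  unfolding multilinear_form_def using assms by (simp add: gr_add gr_scl)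

lemma Jv_mul:
  assumes u: "u \<in> aug_words A" and v: "v \<in> aug_words A"
  shows "mul (Jv A) i j (tensor_word A u) (tensor_word A v) =
     (\<Sum>n\<le>length u + length v. \<Sum>(\<alpha>, \<beta>)\<in>qshuffles (length u) (length v) n.
        scl (Jv A) (koszul_sign (join (length u) \<alpha> \<beta>) (u @ v))
          (tensor_word A (contract A n (join (length u) \<alpha> \<beta>) (u @ v))))"
proof (rule ext)
  have sum_ev: "(\<Sum>x\<in>S. f x) \<phi> = (\<Sum>x\<in>S. f x \<phi>)" for f :: "_ \<Rightarrow> ('k, 'a) tensor_word" and S \<phi>
    by (induction S rule: infinite_finite_induct) auto
  have sum_ev2: "(\<Sum>x\<in>S. f x) \<phi> = (\<Sum>x\<in>S. f x \<phi>)" for f :: "nat \<Rightarrow> ('k, 'a) tensor_word" and S \<phi>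
    by (induction S rule: infinite_finite_induct) auto
  have scl_Jv: "scl (Jv A) c x \<phi> = c * x \<phi>" for c x \<phi> by (simp add: Jv_def Jv_space_def)
  fix \<phi>
  show "mul (Jv A) i j (tensor_word A u) (tensor_word A v) \<phi> = (\<Sum>n\<le>length u + length v. \<Sum>(\<alpha>, \<beta>)\<in>qshuffles (length u) (length v) n.
        scl (Jv A) (koszul_sign (join (length u) \<alpha> \<beta>) (u @ v))
          (tensor_word A (contract A n (join (length u) \<alpha> \<beta>) (u @ v)))) \<phi>"
  proof (cases "multilinear_form A \<phi>")
    case True
    have inner: "tensor_word A v (\<lambda>v. qshuffle_eval A \<phi> w v) = qshuffle_eval A \<phi> w v" if "w \<in> aug_words A" for w
      using multilinear_form_qshuffle_right[OF True that] by (simp add: tensor_word_def)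
    have "multilinear_form A (\<lambda>w. tensor_word A v (\<lambda>v. qshuffle_eval A \<phi> w v))"
      using multilinear_form_qshuffle_left[OF True v] multilinear_form_cong[OF inner] by simp
    then have "mul (Jv A) i j (tensor_word A u) (tensor_word A v) \<phi> = qshuffle_eval A \<phi> u v"
      using True inner[OF u] by (simp add: Jv_def tensor_word_def)
    then show ?thesis using True
      by (simp add: sum_ev sum_ev2 qshuffle_eval_def case_prod_beta scl_Jv tensor_word_def)
  next
    case False
    then have "mul (Jv A) i j (tensor_word A u) (tensor_word A v) \<phi> = 0" by (simp add: Jv_def)
    then show ?thesis using False by (simp add: sum_ev sum_ev2 case_prod_beta scl_Jv tensor_word_def)
  qed
qed

lemma vector_space_Jv: "vector_space (scl (Jv A))"
  by unfold_locales (auto simp: Jv_def Jv_space_def algebra_simps)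

lemma tensor_word_mem: "w \<in> aug_words A \<Longrightarrow> tensor_word A w \<in> gr (Jv_space A) (wdeg w)"
proof -
  interpret J: vector_space "scl (Jv A)" by (rule vector_space_Jv)
  show "w \<in> aug_words A \<Longrightarrow> tensor_word A w \<in> gr (Jv_space A) (wdeg w)"
    using J.span_base[of "tensor_word A w" "tensor_word A ` {w' \<in> aug_words A. wdeg w' = wdeg w}"]
    by (simp add: Jv_def Jv_space_def)
qed

lemma tensor_word_linear:
  assumes "u \<in> aug_words A" "v \<in> aug_words A" "n > 0" "a \<in> gr A n"
  shows "b \<in> gr A n \<Longrightarrow> tensor_word A (u @ (n, a + b) # v) = tensor_word A (u @ (n, a) # v) + tensor_word A (u @ (n, b) # v)"
    "tensor_word A (u @ (n, scl A c a) # v) = scl (Jv_space A) c (tensor_word A (u @ (n, a) # v))"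
  using multilinear_formD[OF _ assms] by (auto simp: tensor_word_def Jv_space_def fun_eq_iff)

lemma Jv_comul:
  assumes w: "w \<in> aug_words A"
  shows "comul (Jv A) n (tensor_word A w) =
     (\<Sum>r\<le>length w. tensor2 (Jv_space A) (Jv_space A) (wdeg (take r w), tensor_word A (take r w))
                                            (wdeg (drop r w), tensor_word A (drop r w)))"
proof (rule ext)
  fix \<psi> :: "(nat \<times> ('k, 'a) tensor_word) \<times> (nat \<times> ('k, 'a) tensor_word) \<Rightarrow> 'k"
  have sum_ev: "(\<Sum>x\<in>S. f x) \<psi> = (\<Sum>x\<in>S. f x \<psi>)" for f :: "nat \<Rightarrow> (_ \<Rightarrow> 'k)" and S
    by (induction S rule: infinite_finite_induct) auto
  define g where "g r w = \<psi> ((wdeg (take r w), tensor_word A (take r w)), (wdeg (drop r w), tensor_word A (drop r w)))" for r w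
  have "multilinear_form A (\<lambda>w. \<Sum>r\<le>length w. g r w)" if \<psi>: "bilinear_form (Jv_space A) (Jv_space A) \<psi>"
  proof -
    note B = \<psi>[unfolded bilinear_form_def, rule_format]
    note B1 = B[THEN conjunct1, rule_format] B[THEN conjunct2, THEN conjunct1, rule_format]
       B[THEN conjunct2, THEN conjunct2, THEN conjunct1, rule_format]
       B[THEN conjunct2, THEN conjunct2, THEN conjunct2, rule_format]
    have sub: "take r u \<in> aug_words A" "drop r u \<in> aug_words A" if "u \<in> aug_words A" for r u
      using that by (auto simp: aug_words_def dest: in_set_takeD in_set_dropD)
    have mem: "tensor_word A (u @ (m, z) # v) \<in> gr (Jv_space A) (wdeg u + (m + wdeg v))"
      if "u \<in> aug_words A" "v \<in> aug_words A" "m > 0" "z \<in> gr A m" for u v m z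
      using tensor_word_mem[of "u @ (m, z) # v"] that by simp
    have g: "(b \<in> gr A m \<longrightarrow> g r (u @ (m, a + b) # v) = g r (u @ (m, a) # v) + g r (u @ (m, b) # v)) \<and>
       g r (u @ (m, scl A c a) # v) = c * g r (u @ (m, a) # v)"
      if uv: "u \<in> aug_words A" "v \<in> aug_words A" "m > 0" "a \<in> gr A m" for u v m a b c r
    proof (cases "r \<le> length u")
      case True
      then show ?thesis using uv sub[OF uv(1), of r] 
        by (simp add: g_def tensor_word_linear B1 mem tensor_word_mem)
    next
      case False
      then obtain s where "r = Suc (length u + s)" by (metis not_less_eq_eq le_Suc_ex add_Suc)
      then show ?thesis using uv sub[OF uv(2), of s] 
        by (simp add: g_def tensor_word_linear B1 mem tensor_word_mem)
    qed
    show ?thesis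
      by (rule multilinear_formI) (simp_all add: g sum.distrib sum_distrib_left distrib_left)
  qed
  then show "comul (Jv A) n (tensor_word A w) \<psi> = (\<Sum>r\<le>length w. tensor2 (Jv_space A) (Jv_space A) (wdeg (take r w), tensor_word A (take r w))
                                            (wdeg (drop r w), tensor_word A (drop r w))) \<psi>"
    by (simp add: sum_ev Jv_def tensor2_def tensor_word_def[of A w] g_def)
qed

lemma Jv_counit: "counit (Jv A) (tensor_word A w) = (if w = [] then 1 else 0)"
proof -
  have "multilinear_form A (\<lambda>w. if w = [] then 1 else 0)" by (rule multilinear_formI) auto
  then show ?thesis by (simp add: Jv_def tensor_word_def)
qed

end

end

theory Submission
  imports Defs
begin

text \<open>
  A basis of the augmentation ideal identifies \<open>J\<^sup>\<or>(A)\<close> with functions on words, where the \<open>p\<close>-th power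
  is the letterwise Frobenius map.

  From (b) to (a): over a perfect field there is a homogeneous basis that \<open>F\<close> maps to itself or to
  \<open>0\<close>, injectively off its kernel.  The kernel of the \<open>p\<^sup>j\<close>-th power on \<open>J\<^sup>\<or>(A)\<close> is then spanned by words,
  so the algebra \<open>J\<^sup>\<or>(A)\<close> determines the number of basis elements of each degree that survive \<open>F\<^sup>j\<close>;
  these numbers classify \<open>F\<close>-modules.

  From (a) to (c): both products live on the same coalgebra of words.  By cofreeness a Hopf map is given
  by an algebra map from \<open>J\<^sup>\<or>(A)\<close> to \<open>B\<close>, that is, to the quotient of \<open>J\<^sup>\<or>(B)\<close> by the words of length at
  least two.  Zorn's lemma extends the given map of \<open>F\<close>-modules to such an algebra map through graded
  left coideal subalgebras \<open>K\<close> that are pure for Frobenius.  A step adjoins an element \<open>y\<close> of minimal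
  degree: a functional vanishing on \<open>K\<close> but not at \<open>y\<close> induces a derivation, which shows that the powers
  of \<open>y\<close> satisfy no relations except those that purity controls.  The resulting Hopf map is
  unitriangular with respect to word length, hence bijective.
\<close>

section \<open>Quasi-shuffle products in coordinates\<close>

text \<open>The obstacle is that neither product is free. An iterated \<open>p\<close>-th power of a
  new element \<open>y\<close> may fall into the part already treated, where its value is
  prescribed, so the value \<open>b\<close> of \<open>y\<close> has to fit all these prescriptions
  at once. Purity makes this possible: it replaces \<open>y\<close>, up to the kernel of an iterate,
  by an element whose value is known. A second danger is that a non-primitive \<open>y\<close> drags
  new primitive elements into the domain, where the value is fixed as well; the second purity
  condition, together with adjoining primitive elements before others of the same degree, excludes
  this.

  Both conditions survive a step because polynomials in \<open>y\<close> are expanded in base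
  \<open>p\<close>: the digits are coefficients of \<open>y^s\<close> with \<open>s < p\<close>,
  they are polynomials in \<open>y^p\<close>, and the derivation acts as differentiation by
  \<open>y\<close>, with invertible factors \<open>s\<close>. Values matter only modulo an ideal, so
  a relation is extended and shown to be single valued afterwards.

  Since both algebras live on one set of words, an isomorphism of \<open>F\<close>-modules becomes
  the equality of two matrices \<open>f\<close>, and each direction of the theorem reduces to
  choosing bases with equal matrices.\<close>

type_synonym ('k, 'x) ser = "(nat \<times> 'x) list \<Rightarrow> 'k"

lemma sum_fun_apply: "(\<Sum>i\<in>I. f i) w = (\<Sum>i\<in>I. f i w)"
  for f :: "'i \<Rightarrow> 'a \<Rightarrow> 'b::comm_monoid_add"
  by (induction I rule: infinite_finite_induct) auto

definition sc :: "'k::field \<Rightarrow> ('k, 'x) ser \<Rightarrow> ('k, 'x) ser" where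
  "sc c x = (\<lambda>w. c * x w)"

text \<open>The Koszul sign for carrying an element of degree \<open>n\<close> past
  \<open>x\<close>.\<close>

definition tw :: "nat \<Rightarrow> ('k::field, 'x) ser \<Rightarrow> ('k, 'x) ser" where
  "tw n x = (\<lambda>w. (-1) ^ (n * wdeg w) * x w)"

text \<open>The index of degree \<open>0\<close> stands for the unit of the algebra.\<close>

definition Lo :: "nat \<times> 'x \<Rightarrow> ('k::field, 'x) ser \<Rightarrow> ('k, 'x) ser" where
  "Lo a x = (if fst a = 0 then x else (\<lambda>w. x (a # w)))"

definition bs :: "(nat \<times> 'x) list \<Rightarrow> ('k::field, 'x) ser" where
  "bs w = (\<lambda>v. if v = w then 1 else 0)"

lemma sc_simps [simp]:
  "sc c 0 = 0" "sc 0 x = 0" "sc 1 x = x" "sc c (sc d x) = sc (c * d) x" "sc c x w = c * x w"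
  by (auto simp: sc_def fun_eq_iff)

lemma sc_add: "sc c (x + y) = sc c x + sc c y" "sc (c + d) x = sc c x + sc d x"
  by (auto simp: sc_def fun_eq_iff algebra_simps)

lemma sc_minus: "sc (-1) x = - x" "sc c (- x) = - sc c x" "sc (- c) x = - sc c x"
  by (auto simp: sc_def fun_eq_iff)

lemma tw_simps [simp]: "tw n 0 = 0" "tw 0 x = x" "tw n (tw k x) = tw (n + k) x" "tw n x [] = x []"
  by (auto simp: tw_def fun_eq_iff algebra_simps power_add)

lemma tw_add: "tw n (x + y) = tw n x + tw n y"
  by (auto simp: tw_def fun_eq_iff algebra_simps)

lemma tw_sc: "tw n (sc c x) = sc c (tw n x)"
  by (auto simp: tw_def fun_eq_iff algebra_simps)

lemma tw_sum: "tw n (\<Sum>i\<in>I. f i) = (\<Sum>i\<in>I. tw n (f i))"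
  by (auto simp: tw_def fun_eq_iff sum_fun_apply sum_distrib_left)

lemma tw_even: "even n \<Longrightarrow> tw n x = x"
  by (auto simp: tw_def fun_eq_iff)

lemma tw_char2: "(-1 :: 'k::field) = 1 \<Longrightarrow> tw n x = (x :: ('k, 'x) ser)"
  by (simp only: tw_def power_one mult_1_left)

lemma Lo_simps [simp]: "Lo a 0 = 0" "fst a = 0 \<Longrightarrow> Lo a x = x" "fst a > 0 \<Longrightarrow> Lo a x w = x (a # w)"
  by (auto simp: Lo_def fun_eq_iff)

lemma Lo_add: "Lo a (x + y) = Lo a x + Lo a y"
  by (auto simp: Lo_def fun_eq_iff)

lemma Lo_sc: "Lo a (sc c x) = sc c (Lo a x)"
  by (auto simp: Lo_def fun_eq_iff)

lemma Lo_sum: "Lo a (\<Sum>i\<in>I. f i) = (\<Sum>i\<in>I. Lo a (f i))"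
  by (auto simp: Lo_def fun_eq_iff sum_fun_apply)

lemma Lo_tw: "Lo a (tw n x) = sc ((-1) ^ (n * fst a)) (tw n (Lo a x))"
  by (auto simp: Lo_def tw_def fun_eq_iff algebra_simps power_add)

lemma Lo_bs: "fst a > 0 \<Longrightarrow> Lo a (bs (b # w)) = (if a = b then bs w else 0)"
  "fst a > 0 \<Longrightarrow> Lo a (bs []) = 0"
  by (auto simp: Lo_def bs_def fun_eq_iff)

lemma neg1_sq [simp]: "(-1) ^ n * (-1) ^ n = (1 :: 'k::field)" "(-1) ^ n * ((-1) ^ n * x) = (x :: 'k::field)"
  by (metis power_mult_distrib mult_minus1 minus_minus power_one)
    (metis mult.assoc mult.left_neutral power_mult_distrib mult_minus1 minus_minus power_one)

section \<open>Graded alphabets and homogeneous functions on words\<close>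

locale letters =
  fixes X :: "(nat \<times> 'x) set" and u0 :: "nat \<times> 'x"
  assumes letter_pos: "c \<in> X \<Longrightarrow> fst c > 0"
    and letter_fin: "finite {c \<in> X. fst c = n}"
    and fst_u0 [simp]: "fst u0 = 0"
begin

abbreviation "Y \<equiv> insert u0 X"

text \<open>The range of summation in formulas with structure constants: \<open>Y\<close> may be
  infinite, but a component of degree \<open>n\<close> of a product involves only factors of degree
  at most \<open>n\<close>.\<close>

definition Yl :: "nat \<Rightarrow> (nat \<times> 'x) set" where "Yl n = {a \<in> Y. fst a \<le> n}"

definition W :: "nat \<Rightarrow> (nat \<times> 'x) list set" where "W n = {w \<in> lists X. wdeg w = n}"

definition hom :: "nat \<Rightarrow> ('k::field, 'x) ser set" where "hom n = {x. \<forall>w. x w \<noteq> 0 \<longrightarrow> w \<in> W n}"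

lemma finite_le: "finite {c \<in> X. fst c \<le> n}"
proof -
  have "{c \<in> X. fst c \<le> n} = (\<Union>k\<le>n. {c \<in> X. fst c = k})" by auto
  then show ?thesis using letter_fin by simp
qed

lemma finite_Yl [simp]: "finite (Yl n)"
proof -
  have "Yl n \<subseteq> insert u0 {c \<in> X. fst c \<le> n}" by (auto simp: Yl_def)
  then show ?thesis using finite_le finite_subset by blast
qed

lemma u0_Yl: "u0 \<in> Yl n" by (simp add: Yl_def)

lemma length_le_wdeg: "w \<in> lists X \<Longrightarrow> length w \<le> wdeg w"
  by (induction w) (auto dest: letter_pos)

lemma finite_W [simp]: "finite (W n)"
proof -
  have le: "fst c \<le> wdeg w" if "c \<in> set w" for c and w :: "(nat \<times> 'x) list"
    using that by (induction w) auto
  have "W n \<subseteq> {w. set w \<subseteq> {c \<in> X. fst c \<le> n} \<and> length w \<le> n}"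
    using length_le_wdeg le by (auto simp: W_def)
  then show ?thesis using finite_lists_length_le[OF finite_le] finite_subset by blast
qed

lemma W_0: "W 0 = {[]}"
  using length_le_wdeg by (force simp: W_def)

lemma u0_notin: "u0 \<notin> X" using letter_pos by fastforce

lemma Y_deg0: "a \<in> Y \<Longrightarrow> fst a = 0 \<longleftrightarrow> a = u0" using letter_pos by fastforce

lemma hom_0 [simp]: "0 \<in> hom n" by (auto simp: hom_def)

lemma hom_add: "x \<in> hom n \<Longrightarrow> y \<in> hom n \<Longrightarrow> x + y \<in> hom n"
  by (force simp: hom_def)

lemma hom_sc: "x \<in> hom n \<Longrightarrow> sc c x \<in> hom n"
  by (force simp: hom_def)

lemma hom_minus: "x \<in> hom n \<Longrightarrow> - x \<in> hom n"
  by (force simp: hom_def)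

lemma hom_diff: "x \<in> hom n \<Longrightarrow> y \<in> hom n \<Longrightarrow> x - y \<in> hom n"
  using hom_add[OF _ hom_minus] by fastforce

lemma hom_sum: "(\<And>i. i \<in> I \<Longrightarrow> f i \<in> hom n) \<Longrightarrow> (\<Sum>i\<in>I. f i) \<in> hom n"
  by (induction I rule: infinite_finite_induct) (auto intro: hom_add)

lemma hom_bs: "w \<in> W n \<Longrightarrow> bs w \<in> hom n"
  by (auto simp: hom_def bs_def)

lemma hom_zero_iff: "x \<in> hom 0 \<Longrightarrow> x = sc (x []) (bs [])"
  by (force simp: hom_def W_0 bs_def fun_eq_iff)

lemma hom_expand: "x \<in> hom n \<Longrightarrow> x = (\<Sum>w\<in>W n. sc (x w) (bs w))"
  by (rule ext) (auto simp: hom_def sum_fun_apply bs_def if_distrib[of "(*) _"] cong: if_cong)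

lemma hom_tw: "x \<in> hom n \<Longrightarrow> tw k x = sc ((-1) ^ (k * n)) x"
proof (rule ext)
  fix w assume "x \<in> hom n"
  then show "tw k x w = sc ((-1) ^ (k * n)) x w"
    by (cases "x w = 0") (auto simp: hom_def tw_def W_def)
qed

lemma hom_Lo: "x \<in> hom n \<Longrightarrow> fst a \<le> n \<Longrightarrow> Lo a x \<in> hom (n - fst a)"
  by (fastforce simp: hom_def Lo_def W_def)

lemma hom_Lo_add: "x \<in> hom (fst a + n) \<Longrightarrow> Lo a x \<in> hom n"
  using hom_Lo[of x "fst a + n" a] by simp

lemma hom_Lo_0: "x \<in> hom n \<Longrightarrow> n < fst a \<Longrightarrow> Lo a x = 0"
  by (force simp: hom_def Lo_def W_def fun_eq_iff)

lemma hom_Nil: "x \<in> hom n \<Longrightarrow> n > 0 \<Longrightarrow> x [] = 0"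
  by (force simp: hom_def W_def)

lemma hom_notX: "x \<in> hom n \<Longrightarrow> w \<notin> lists X \<Longrightarrow> x w = 0"
  by (force simp: hom_def W_def)

lemma hom_unique: "x \<in> hom n \<Longrightarrow> x \<in> hom k \<Longrightarrow> n \<noteq> k \<Longrightarrow> x = 0"
  by (rule ext) (force simp: hom_def W_def)

end

section \<open>The quasi-shuffle product given by structure constants\<close>

locale qsh = letters X u0
  for X :: "(nat \<times> 'x) set" and u0 :: "nat \<times> 'x" +
  fixes m :: "nat \<times> 'x \<Rightarrow> nat \<times> 'x \<Rightarrow> nat \<times> 'x \<Rightarrow> 'k::field"
  assumes m_supp: "m a b c \<noteq> 0 \<Longrightarrow> a \<in> Y \<and> b \<in> Y \<and> c \<in> Y \<and> fst c = fst a + fst b"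
    and m_unit: "a \<in> Y \<Longrightarrow> m u0 a c = (if c = a then 1 else 0)"
    and m_comm: "m a b c = (-1) ^ (fst a * fst b) * m b a c"
    and m_assoc: "(\<Sum>d\<in>Yl (fst e). m a b d * m d c e) = (\<Sum>d\<in>Yl (fst e). m b c d * m a d e)"
begin

text \<open>The first letter \<open>c\<close> of the result is a component of the product of the
  first letters \<open>a\<close> of \<open>x\<close> and \<open>b\<close> of \<open>y\<close>; the
  index \<open>u0\<close> means that nothing is taken from that side. The letter \<open>b\<close>
  has to pass what remains of \<open>x\<close>, hence the twist. Recursion on the word of the result
  makes the product total on all functions, with no finiteness of support to maintain.\<close>

primrec qmw :: "(nat \<times> 'x) list \<Rightarrow> ('k, 'x) ser \<Rightarrow> ('k, 'x) ser \<Rightarrow> 'k" where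
  "qmw [] x y = x [] * y []"
| "qmw (c # w) x y = (if c \<in> X then \<Sum>a\<in>Yl (fst c). \<Sum>b\<in>Yl (fst c). m a b c * qmw w (tw (fst b) (Lo a x)) (Lo b y) else 0)"

definition qm (infixl "\<star>" 70) where "x \<star> y = (\<lambda>w. qmw w x y)"

lemma qm_Nil: "(x \<star> y) [] = x [] * y []" by (simp add: qm_def)

lemma m_unit_right: "a \<in> Y \<Longrightarrow> m a u0 c = (if c = a then 1 else 0)"
  using m_comm[of a u0 c] m_unit[of a c] by simp

lemma qmw_add: "qmw w (x + x') y = qmw w x y + qmw w x' y" "qmw w x (y + y') = qmw w x y + qmw w x y'"
  by (induction w arbitrary: x x' y y')
    (auto simp: algebra_simps Lo_add tw_add sum.distrib)

lemma qmw_sc: "qmw w (sc c x) y = c * qmw w x y" "qmw w x (sc c y) = c * qmw w x y"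
  by (induction w arbitrary: x y)
    (auto simp: algebra_simps Lo_sc tw_sc sum_distrib_left)

lemma qm_add: "(x + x') \<star> y = x \<star> y + x' \<star> y" "x \<star> (y + y') = x \<star> y + x \<star> y'"
  by (auto simp: qm_def qmw_add)

lemma qm_sc: "sc c x \<star> y = sc c (x \<star> y)" "x \<star> sc c y = sc c (x \<star> y)"
  by (auto simp: qm_def qmw_sc)

lemma qmw_0 [simp]: "qmw w 0 x = 0" "qmw w x 0 = 0"
  using qmw_sc[where c = 0 and x = x and y = x and w = w] by auto

lemma qm_0 [simp]: "0 \<star> x = 0" "x \<star> 0 = 0"
  by (auto simp: qm_def fun_eq_iff)

lemma qm_minus: "(- x) \<star> y = - (x \<star> y)" "x \<star> (- y) = - (x \<star> y)"
  using qm_sc[where c = "-1"] by (auto simp: sc_minus)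

lemma qm_diff: "(x - x') \<star> y = x \<star> y - x' \<star> y" "x \<star> (y - y') = x \<star> y - x \<star> y'"
  using qm_add(1)[of x "- x'" y] qm_add(2)[of x y "- y'"] by (auto simp: qm_minus)

lemma qm_sum: "(\<Sum>i\<in>I. f i) \<star> y = (\<Sum>i\<in>I. f i \<star> y)" "y \<star> (\<Sum>i\<in>I. f i) = (\<Sum>i\<in>I. y \<star> f i)"
  by (induction I rule: infinite_finite_induct) (auto simp: qm_add)

lemma qmw_sum: "qmw w (\<Sum>i\<in>I. f i) y = (\<Sum>i\<in>I. qmw w (f i) y)" "qmw w y (\<Sum>i\<in>I. f i) = (\<Sum>i\<in>I. qmw w y (f i))"
  using qm_sum[where f = f and I = I and y = y] by (auto simp: qm_def fun_eq_iff sum_fun_apply)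

text \<open>The case \<open>d = u0\<close> fits the same formula because only the pair of units has
  a component at the unit. The bound \<open>n\<close> is left free so that nested sums can share one
  range, as associativity requires.\<close>

lemma Lo_qm:
  assumes "d \<in> Y" "fst d \<le> n"
  shows "Lo d (x \<star> y) = (\<Sum>a\<in>Yl n. \<Sum>b\<in>Yl n. sc (m a b d) (tw (fst b) (Lo a x) \<star> Lo b y))"
proof (cases "d = u0")
  case True
  have "m a b u0 = (if a = u0 \<and> b = u0 then 1 else 0)" for a b
    using m_supp[of a b u0] m_unit[of u0 u0] Y_deg0[of a] Y_deg0[of b] by (cases "m a b u0 = 0") auto
  then have "(\<Sum>a\<in>Yl n. \<Sum>b\<in>Yl n. sc (m a b d) (tw (fst b) (Lo a x) \<star> Lo b y))
     = (\<Sum>a\<in>Yl n. \<Sum>b\<in>Yl n. if b = u0 then (if a = u0 then x \<star> y else 0) else 0)"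
    unfolding True by (intro sum.cong refl) auto
  also have "\<dots> = x \<star> y"
    using u0_Yl by simp
  finally show ?thesis using True by simp
next
  case False
  then have d: "d \<in> X" using assms by auto
  then have pos: "fst d > 0" by (rule letter_pos)
  have "(\<Sum>a\<in>Yl (fst d). \<Sum>b\<in>Yl (fst d). m a b d * q a b) = (\<Sum>a\<in>Yl n. \<Sum>b\<in>Yl n. m a b d * q a b)" for q
  proof -
    have "(\<Sum>b\<in>Yl (fst d). m a b d * q a b) = (\<Sum>b\<in>Yl n. m a b d * q a b)" for a
    proof (rule sum.mono_neutral_left)
      show "\<forall>i\<in>Yl n - Yl (fst d). m a i d * q a i = 0"
        using m_supp[of a _ d] by (fastforce simp: Yl_def)
      show "Yl (fst d) \<subseteq> Yl n" using assms by (auto simp: Yl_def)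
    qed (rule finite_Yl)
    moreover have "(\<Sum>a\<in>Yl (fst d). \<Sum>b\<in>Yl n. m a b d * q a b) = (\<Sum>a\<in>Yl n. \<Sum>b\<in>Yl n. m a b d * q a b)"
    proof (rule sum.mono_neutral_left)
      show "\<forall>i\<in>Yl n - Yl (fst d). (\<Sum>b\<in>Yl n. m i b d * q i b) = 0"
      proof
        fix i assume i: "i \<in> Yl n - Yl (fst d)"
        then have "m i b d = 0" for b using m_supp[of i b d] by (fastforce simp: Yl_def)
        then show "(\<Sum>b\<in>Yl n. m i b d * q i b) = 0" by simp
      qed
      show "Yl (fst d) \<subseteq> Yl n" using assms by (auto simp: Yl_def)
    qed (rule finite_Yl)
    ultimately show ?thesis by simp
  qed
  then show ?thesis using pos d by (auto simp: fun_eq_iff qm_def sum_fun_apply)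
qed

lemma qm_word_Cons: "c \<in> X \<Longrightarrow> (x \<star> y) (c # w) = (\<Sum>a\<in>Yl (fst c). \<Sum>b\<in>Yl (fst c). m a b c * (tw (fst b) (Lo a x) \<star> Lo b y) w)"
  by (simp add: qm_def)

lemma qm_notX: "w \<notin> lists X \<Longrightarrow> (x \<star> y) w = 0"
proof (induction w arbitrary: x y)
  case (Cons c w) then show ?case by (cases "c \<in> X") (auto simp: qm_def)
qed auto

lemma tw_qm: "tw n (x \<star> y) = tw n x \<star> tw n y"
proof -
  have "(-1) ^ (n * wdeg w) * qmw w x y = qmw w (tw n x) (tw n y)" for w
  proof (induction w arbitrary: x y)
    case (Cons c w)
    have "(-1) ^ (n * wdeg (c # w)) * (m a b c * qmw w (tw (fst b) (Lo a x)) (Lo b y))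
       = m a b c * qmw w (tw (fst b) (Lo a (tw n x))) (Lo b (tw n y))" for a b
    proof (cases "m a b c = 0")
      case False
      then have "fst c = fst a + fst b" using m_supp by blast
      then show ?thesis
        using Cons[of "tw (fst b) (Lo a x)" "Lo b y"]
        by (simp add: Lo_tw qmw_sc tw_sc add_ac ring_distribs power_add mult_ac)
    qed auto
    then show ?case
      by (cases "c \<in> X") (simp_all only: qmw.simps if_True if_False sum_distrib_left mult_zero_right)
  qed auto
  then show ?thesis by (simp add: qm_def tw_def)
qed

text \<open>Induction on the word of the result. Both bracketings become sums over the first letters
  \<open>a\<close>, \<open>b\<close>, \<open>e\<close> of the three factors with the same remainder
  \<open>Q a b e\<close>; the weights are the two sides of \<open>m_assoc\<close> once the
  intermediate letter \<open>d\<close> is summed innermost.\<close>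

lemma qm_assoc: "(x \<star> y) \<star> z = x \<star> (y \<star> z)"
proof -
  have "qmw w (x \<star> y) z = qmw w x (y \<star> z)" for w
  proof (induction w arbitrary: x y z)
    case (Cons c w)
    show ?case
    proof (cases "c \<in> X")
      case True
      let ?S = "Yl (fst c)"
      define Q where "Q a b e = qmw w (tw (fst e + fst b) (Lo a x)) (tw (fst e) (Lo b y) \<star> Lo e z)" for a b e
      have S: "d \<in> Y" "fst d \<le> fst c" if "d \<in> ?S" for d using that by (auto simp: Yl_def)
      have "qmw (c # w) (x \<star> y) z = (\<Sum>d\<in>?S. \<Sum>e\<in>?S. m d e c * qmw w (tw (fst e) (Lo d (x \<star> y))) (Lo e z))"
        using True by simp
      also have "\<dots> = (\<Sum>d\<in>?S. \<Sum>e\<in>?S. \<Sum>a\<in>?S. \<Sum>b\<in>?S. m a b d * m d e c * Q a b e)"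
        by (intro sum.cong refl)
          (simp add: Lo_qm[OF S] tw_sum qmw_sum tw_sc qmw_sc tw_qm Cons Q_def sum_distrib_left mult_ac)
      also have "\<dots> = (\<Sum>a\<in>?S. \<Sum>b\<in>?S. \<Sum>e\<in>?S. \<Sum>d\<in>?S. m a b d * m d e c * Q a b e)"
      proof -
        have "(\<Sum>d\<in>?S. \<Sum>e\<in>?S. \<Sum>a\<in>?S. \<Sum>b\<in>?S. f a b d e) = (\<Sum>a\<in>?S. \<Sum>b\<in>?S. \<Sum>e\<in>?S. \<Sum>d\<in>?S. f a b d e)"
          for f :: "_ \<Rightarrow> _ \<Rightarrow> _ \<Rightarrow> _ \<Rightarrow> 'k"
        proof -
          have "(\<Sum>d\<in>?S. \<Sum>e\<in>?S. \<Sum>a\<in>?S. \<Sum>b\<in>?S. f a b d e) = (\<Sum>d\<in>?S. \<Sum>a\<in>?S. \<Sum>e\<in>?S. \<Sum>b\<in>?S. f a b d e)"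
            by (rule sum.cong[OF refl], rule sum.swap)
          also have "\<dots> = (\<Sum>a\<in>?S. \<Sum>d\<in>?S. \<Sum>e\<in>?S. \<Sum>b\<in>?S. f a b d e)" by (rule sum.swap)
          also have "\<dots> = (\<Sum>a\<in>?S. \<Sum>d\<in>?S. \<Sum>b\<in>?S. \<Sum>e\<in>?S. f a b d e)"
            by (rule sum.cong[OF refl], rule sum.cong[OF refl], rule sum.swap)
          also have "\<dots> = (\<Sum>a\<in>?S. \<Sum>b\<in>?S. \<Sum>d\<in>?S. \<Sum>e\<in>?S. f a b d e)"
            by (rule sum.cong[OF refl], rule sum.swap)
          also have "\<dots> = (\<Sum>a\<in>?S. \<Sum>b\<in>?S. \<Sum>e\<in>?S. \<Sum>d\<in>?S. f a b d e)"
            by (rule sum.cong[OF refl], rule sum.cong[OF refl], rule sum.swap)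
          finally show ?thesis .
        qed
        then show ?thesis .
      qed
      also have "\<dots> = (\<Sum>a\<in>?S. \<Sum>b\<in>?S. \<Sum>e\<in>?S. \<Sum>d\<in>?S. m b e d * m a d c * Q a b e)"
        by (simp add: sum_distrib_right[symmetric] m_assoc)
      also have "\<dots> = (\<Sum>a\<in>?S. \<Sum>d\<in>?S. \<Sum>b\<in>?S. \<Sum>e\<in>?S. m b e d * m a d c * Q a b e)"
      proof (rule sum.cong[OF refl])
        fix a
        have "(\<Sum>b\<in>?S. \<Sum>e\<in>?S. \<Sum>d\<in>?S. f b e d) = (\<Sum>d\<in>?S. \<Sum>b\<in>?S. \<Sum>e\<in>?S. f b e d)" for f :: "_ \<Rightarrow> _ \<Rightarrow> _ \<Rightarrow> 'k"
        proof -
          have "(\<Sum>b\<in>?S. \<Sum>e\<in>?S. \<Sum>d\<in>?S. f b e d) = (\<Sum>b\<in>?S. \<Sum>d\<in>?S. \<Sum>e\<in>?S. f b e d)"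
            by (rule sum.cong[OF refl], rule sum.swap)
          also have "\<dots> = (\<Sum>d\<in>?S. \<Sum>b\<in>?S. \<Sum>e\<in>?S. f b e d)" by (rule sum.swap)
          finally show ?thesis .
        qed
        then show "(\<Sum>b\<in>?S. \<Sum>e\<in>?S. \<Sum>d\<in>?S. m b e d * m a d c * Q a b e) = (\<Sum>d\<in>?S. \<Sum>b\<in>?S. \<Sum>e\<in>?S. m b e d * m a d c * Q a b e)" .
      qed
      also have "\<dots> = (\<Sum>a\<in>?S. \<Sum>d\<in>?S. m a d c * qmw w (tw (fst d) (Lo a x)) (Lo d (y \<star> z)))"
      proof (intro sum.cong refl)
        fix a d assume d: "a \<in> ?S" "d \<in> ?S"
        \<comment> \<open>Where \<open>m b e d\<close> does not vanish, the degree of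
          \<open>d\<close> is the sum of those of \<open>b\<close> and \<open>e\<close>, so the two
          twists of \<open>x\<close> coincide.\<close>
        have "m b e d * m a d c * Q a b e = m a d c * (m b e d * qmw w (tw (fst d) (Lo a x)) (tw (fst e) (Lo b y) \<star> Lo e z))" for b e
          using m_supp[of b e d] by (cases "m b e d = 0") (auto simp: Q_def add_ac)
        then show "(\<Sum>b\<in>?S. \<Sum>e\<in>?S. m b e d * m a d c * Q a b e) = m a d c * qmw w (tw (fst d) (Lo a x)) (Lo d (y \<star> z))"
          by (simp only: Lo_qm[OF S[OF d(2)]] qmw_sum qmw_sc sum_distrib_left)
      qed
      finally show ?thesis using True by simp
    qed auto
  qed (simp add: qm_def)
  then show ?thesis by (simp add: qm_def)
qed

lemma hom_qm:
  assumes "x \<in> hom i" "y \<in> hom j" shows "x \<star> y \<in> hom (i + j)"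
proof -
  have "w \<in> lists X \<and> wdeg w = i + j" if "qmw w x y \<noteq> 0" for w
    using that assms
  proof (induction w arbitrary: x y i j)
    case Nil then show ?case by (auto simp: hom_def W_def)
  next
    case (Cons c w)
    then have c: "c \<in> X" by (auto split: if_splits)
    then obtain a b where "m a b c * qmw w (tw (fst b) (Lo a x)) (Lo b y) \<noteq> 0"
      using Cons.prems(1) by (auto elim!: sum.not_neutral_contains_not_neutral)
    then have ab: "fst c = fst a + fst b" "qmw w (tw (fst b) (Lo a x)) (Lo b y) \<noteq> 0" using m_supp by auto
    then have "Lo a x \<noteq> 0" "Lo b y \<noteq> 0" by auto
    then have le: "fst a \<le> i" "fst b \<le> j" using hom_Lo_0 Cons.prems not_le by blast+
    have h: "Lo a x \<in> hom (i - fst a)" "Lo b y \<in> hom (j - fst b)" using hom_Lo le Cons.prems by blast+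
    then have "tw (fst b) (Lo a x) \<in> hom (i - fst a)" using hom_tw hom_sc by metis
    from Cons.IH[OF ab(2) this h(2)] show ?case using c ab le by simp
  qed
  then show ?thesis by (auto simp: hom_def qm_def W_def)
qed

lemma qm_commute:
  assumes "x \<in> hom i" "y \<in> hom j" shows "x \<star> y = sc ((-1) ^ (i * j)) (y \<star> x)"
proof -
  have "qmw w x y = (-1) ^ (i * j) * qmw w y x" for w
    using assms
  proof (induction w arbitrary: x y i j)
    case Nil
    then show ?case using hom_Nil[of x i] hom_Nil[of y j] by (cases "i = 0 \<or> j = 0") auto
  next
    case (Cons c w)
    have eq: "m a b c * qmw w (tw (fst b) (Lo a x)) (Lo b y) = (-1) ^ (i * j) * (m b a c * qmw w (tw (fst a) (Lo b y)) (Lo a x))" for a b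
    proof (cases "fst a \<le> i \<and> fst b \<le> j")
      case True
      then obtain i' j' where ij: "i = fst a + i'" "j = fst b + j'" by (metis le_Suc_ex)
      have h: "Lo a x \<in> hom i'" "Lo b y \<in> hom j'" using Cons.prems by (auto simp: ij hom_Lo_add)
      show ?thesis
        by (subst m_comm) (simp add: ij hom_tw[OF h(1)] hom_tw[OF h(2)] qmw_sc Cons.IH[OF h] ring_distribs power_add mult_ac)
    next
      case False
      then have "Lo a x = 0 \<or> Lo b y = 0" using hom_Lo_0 Cons.prems not_le by blast
      then show ?thesis by auto
    qed
    show ?case
      by (simp add: eq sum_distrib_left) (rule impI, rule sum.swap)
  qed
  then show ?thesis by (auto simp: qm_def)
qed

lemma qm_one_left: "x \<in> hom n \<Longrightarrow> bs [] \<star> x = x"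
proof -
  have "qmw w (bs []) x = x w" if "w \<in> lists X" for w x
    using that
  proof (induction w arbitrary: x)
    case (Cons c w)
    then have c: "c \<in> X" by auto
    have "m a b c * qmw w (tw (fst b) (Lo a (bs []))) (Lo b x) = (if a = u0 then if b = c then x (c # w) else 0 else 0)"
      if "a \<in> Yl (fst c)" "b \<in> Yl (fst c)" for a b
    proof (cases "a = u0")
      case True
      have "tw (fst b) (bs []) = (bs [] :: ('k, 'x) ser)" by (auto simp: tw_def bs_def fun_eq_iff)
      then show ?thesis using True Cons c that by (auto simp: m_unit Yl_def letter_pos)
    next
      case False
      then have "fst a > 0" using that letter_pos by (auto simp: Yl_def)
      then show ?thesis using False by (auto simp: Lo_bs)
    qed
    then have "qmw (c # w) (bs []) x = (\<Sum>a\<in>Yl (fst c). \<Sum>b\<in>Yl (fst c). if a = u0 then if b = c then x (c # w) else 0 else 0)"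
      using c by simp
    also have "\<dots> = (\<Sum>a\<in>Yl (fst c). if a = u0 then (\<Sum>b\<in>Yl (fst c). if b = c then x (c # w) else 0) else 0)"
      by (intro sum.cong refl) auto
    also have "\<dots> = x (c # w)" using c by (simp add: u0_Yl) (simp add: Yl_def)
    finally show ?case .
  qed (simp add: bs_def)
  then have "(bs [] \<star> x) w = x w" if "w \<in> lists X" for w using that by (simp add: qm_def)
  moreover assume "x \<in> hom n"
  ultimately show ?thesis using hom_notX qm_notX by (metis ext)
qed

lemma qm_one_right: "x \<in> hom n \<Longrightarrow> x \<star> bs [] = x"
  using qm_commute[of x n "bs []" 0] qm_one_left[of x n] by (simp add: hom_bs W_0)

end

section \<open>Contracting the right factor of the coproduct with a functional\<close>

context letters
begin

text \<open>\<open>R d f\<close> is the map \<open>(1 \<otimes> f) \<circ> \<Delta>\<close> for a functional \<open>f\<close> of degree \<open>d\<close>.\<close>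

definition R :: "nat \<Rightarrow> ('k::field, 'x) ser \<Rightarrow> ('k, 'x) ser \<Rightarrow> ('k, 'x) ser" where
  "R d f x = (\<lambda>u. \<Sum>v\<in>W d. f v * x (u @ v))"

lemma R_add: "R d f (x + y) = R d f x + R d f y"
  by (auto simp: R_def fun_eq_iff algebra_simps sum.distrib)

lemma R_sc: "R d f (sc c x) = sc c (R d f x)"
  by (auto simp: R_def fun_eq_iff algebra_simps sum_distrib_left)

lemma R_0 [simp]: "R d f 0 = 0" by (auto simp: R_def fun_eq_iff)

lemma R_minus: "R d f (- x) = - R d f x" by (auto simp: R_def fun_eq_iff sum_negf)

lemma R_diff: "R d f (x - y) = R d f x - R d f y"
  using R_add[of d f x "- y"] by (simp add: R_minus)

lemma R_sum: "R d f (\<Sum>i\<in>I. g i) = (\<Sum>i\<in>I. R d f (g i))"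
  unfolding R_def fun_eq_iff sum_fun_apply sum_distrib_left by (intro allI sum.swap)

lemma Lo_R: "Lo c (R d f x) = R d f (Lo c x)"
  by (auto simp: R_def Lo_def fun_eq_iff)

lemma R_tw: "R d f (tw n x) = sc ((-1) ^ (n * d)) (tw n (R d f x))"
  unfolding R_def tw_def sc_def fun_eq_iff
  by (auto simp: sum_distrib_left W_def ring_distribs power_add mult_ac intro!: sum.cong)

lemma R_eq_0: "(\<And>v. v \<in> W d \<Longrightarrow> f v = 0) \<Longrightarrow> R d f x = 0"
  by (auto simp: R_def fun_eq_iff)

lemma hom_R: "x \<in> hom n \<Longrightarrow> d \<le> n \<Longrightarrow> R d f x \<in> hom (n - d)"
proof -
  assume x: "x \<in> hom n" and d: "d \<le> n"
  { fix u assume "R d f x u \<noteq> 0"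
    then obtain v where v: "v \<in> W d" "x (u @ v) \<noteq> 0"
      unfolding R_def by (auto elim!: sum.not_neutral_contains_not_neutral)
    then have "u @ v \<in> W n" using x by (auto simp: hom_def)
    then have "u \<in> W (n - d)" using v(1) by (auto simp: W_def) }
  then show ?thesis by (auto simp: hom_def)
qed

lemma R_hom_0: "x \<in> hom n \<Longrightarrow> n < d \<Longrightarrow> R d f x = 0"
  by (rule ext) (force simp: R_def hom_def W_def intro!: sum.neutral)

lemma W_split: "n > 0 \<Longrightarrow> (\<Sum>w\<in>W n. h w) = (\<Sum>a\<in>{a \<in> X. fst a \<le> n}. \<Sum>w\<in>W (n - fst a). h (a # w))"
  for h :: "_ \<Rightarrow> 'a::comm_monoid_add"
proof -
  assume n: "n > 0"
  have "W n = (\<lambda>(a, w). a # w) ` (SIGMA a:{a \<in> X. fst a \<le> n}. W (n - fst a))"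
  proof (rule set_eqI, rule iffI)
    fix w assume "w \<in> W n"
    then show "w \<in> (\<lambda>(a, w). a # w) ` (SIGMA a:{a \<in> X. fst a \<le> n}. W (n - fst a))"
      using n by (cases w) (auto simp: W_def image_iff)
  qed (auto simp: W_def)
  moreover have "inj_on (\<lambda>(a, w). a # w) S" for S :: "((nat \<times> 'x) \<times> (nat \<times> 'x) list) set" by (auto simp: inj_on_def)
  then have "sum h ((\<lambda>(a, w). a # w) ` S) = (\<Sum>x\<in>S. h (fst x # snd x))" for S
    by (subst sum.reindex) (simp_all add: case_prod_unfold)
  ultimately show ?thesis
    by (subst sum.Sigma) (simp_all add: finite_le case_prod_unfold case_prod_unfold)
qed

end

context qsh
begin

text \<open>Deconcatenation is an algebra map, so the behaviour of \<open>R d f\<close> on products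
  is decided by the functional alone, that is, by the value at the empty word. The class
  \<open>S\<close> only has to be stable under stripping letters and twisting. This form covers both
  a Leibniz rule and a multiplicativity rule with structure constants.\<close>

lemma R_qm:
  assumes S: "\<And>x c. x \<in> S \<Longrightarrow> Lo c x \<in> S" "\<And>x n. x \<in> S \<Longrightarrow> tw n x \<in> S"
    and ev: "\<And>x y. x \<in> S \<Longrightarrow> y \<in> S \<Longrightarrow> R d f (x \<star> y) [] = (\<Sum>i\<in>I. q i * (R (d1 i) (f1 i) x [] * R (d2 i) (f2 i) y []))"
    and xy: "x \<in> S" "y \<in> S"
  shows "R d f (x \<star> y) = (\<Sum>i\<in>I. sc (q i) (R (d1 i) (f1 i) x \<star> tw (d1 i) (R (d2 i) (f2 i) y)))"
proof -
  have "R d f (x \<star> y) u = (\<Sum>i\<in>I. q i * (R (d1 i) (f1 i) x \<star> tw (d1 i) (R (d2 i) (f2 i) y)) u)" for u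
    using xy
  proof (induction u arbitrary: x y)
    case Nil then show ?case by (simp add: ev qm_Nil)
  next
    case (Cons c u)
    show ?case
    proof (cases "c \<in> X")
      case False
      then show ?thesis by (simp add: R_def qm_notX)
    next
      case True
      then have c: "fst c > 0" "c \<in> Y" by (auto simp: letter_pos)
      have st: "tw (fst b) (Lo a x) \<in> S" "Lo b y \<in> S" for a b using S Cons.prems by auto
      have "R d f (x \<star> y) (c # u) = R d f (Lo c (x \<star> y)) u" using c by (simp add: Lo_R[symmetric])
      also have "\<dots> = (\<Sum>a\<in>Yl (fst c). \<Sum>b\<in>Yl (fst c). m a b c * (\<Sum>i\<in>I. q i * (R (d1 i) (f1 i) (tw (fst b) (Lo a x)) \<star> tw (d1 i) (R (d2 i) (f2 i) (Lo b y))) u))"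
        by (simp add: Lo_qm[OF c(2) order_refl] R_sum R_sc sum_fun_apply Cons.IH[OF st])
      also have "\<dots> = (\<Sum>a\<in>Yl (fst c). \<Sum>b\<in>Yl (fst c). \<Sum>i\<in>I. q i * (m a b c * (tw (fst b) (Lo a (R (d1 i) (f1 i) x)) \<star> Lo b (tw (d1 i) (R (d2 i) (f2 i) y))) u))"
        by (intro sum.cong refl) (simp add: R_tw Lo_R Lo_tw qm_sc sum_distrib_left mult_ac)
      also have "\<dots> = (\<Sum>i\<in>I. \<Sum>a\<in>Yl (fst c). \<Sum>b\<in>Yl (fst c). q i * (m a b c * (tw (fst b) (Lo a (R (d1 i) (f1 i) x)) \<star> Lo b (tw (d1 i) (R (d2 i) (f2 i) y))) u))"
        by (subst sum.swap, subst (2) sum.swap) (rule refl)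
      also have "\<dots> = (\<Sum>i\<in>I. q i * (R (d1 i) (f1 i) x \<star> tw (d1 i) (R (d2 i) (f2 i) y)) (c # u))"
        by (simp add: qm_word_Cons[OF True] sum_distrib_left)
      finally show ?thesis .
    qed
  qed
  then show ?thesis by (auto simp: fun_eq_iff sum_fun_apply)
qed

section \<open>Powers and the binomial formula in characteristic \<open>p\<close>\<close>

primrec pw :: "('k, 'x) ser \<Rightarrow> nat \<Rightarrow> ('k, 'x) ser" where
  "pw x 0 = bs []"
| "pw x (Suc n) = x \<star> pw x n"

lemma one_hom: "bs [] \<in> hom 0" by (simp add: hom_bs W_0)

lemma pw_hom: "x \<in> hom n \<Longrightarrow> pw x k \<in> hom (k * n)"
  by (induction k) (auto simp: one_hom intro: hom_qm)

lemma pw_add: "x \<in> hom n \<Longrightarrow> pw x (a + b) = pw x a \<star> pw x b"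
  by (induction a) (auto simp: qm_one_left[OF pw_hom] qm_assoc)

lemma pw_1: "x \<in> hom n \<Longrightarrow> pw x 1 = x" "x \<in> hom n \<Longrightarrow> pw x (Suc 0) = x"
  by (auto simp: qm_one_right)

lemma pw_mult: "x \<in> hom n \<Longrightarrow> pw x (a * b) = pw (pw x a) b"
  by (induction b) (auto simp: pw_add)

lemma pw_0: "k > 0 \<Longrightarrow> pw 0 k = 0"
  by (cases k) auto

lemma qm_pw_commute: "y \<star> x = x \<star> y \<Longrightarrow> x \<in> hom i \<Longrightarrow> y \<in> hom j \<Longrightarrow> y \<star> pw x k = pw x k \<star> y"
proof (induction k)
  case 0 then show ?case by (simp add: qm_one_left qm_one_right)
next
  case (Suc k)
  then have "y \<star> (x \<star> pw x k) = x \<star> (y \<star> pw x k)" by (metis qm_assoc)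
  then show ?case using Suc by (simp add: qm_assoc)
qed

end

lemma pascal_sum:
  fixes g :: "nat \<Rightarrow> 'k::comm_ring_1"
  shows "(\<Sum>i\<le>q. of_nat (q choose i) * g i) + (\<Sum>i\<le>q. of_nat (q choose i) * g (Suc i)) = (\<Sum>i\<le>Suc q. of_nat (Suc q choose i) * g i)"
proof -
  have [simp]: "q choose Suc q = 0" by simp
  have "(\<Sum>i\<le>Suc q. of_nat (Suc q choose i) * g i) = g 0 + (\<Sum>i\<le>q. of_nat (Suc q choose Suc i) * g (Suc i))"
    by (subst sum.atMost_Suc_shift) simp
  also have "\<dots> = (g 0 + (\<Sum>i\<le>q. of_nat (q choose Suc i) * g (Suc i))) + (\<Sum>i\<le>q. of_nat (q choose i) * g (Suc i))"
    by (simp add: algebra_simps sum.distrib)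
  also have "g 0 + (\<Sum>i\<le>q. of_nat (q choose Suc i) * g (Suc i)) = (\<Sum>i\<le>Suc q. of_nat (q choose i) * g i)"
    by (subst sum.atMost_Suc_shift) simp
  also have "\<dots> = (\<Sum>i\<le>q. of_nat (q choose i) * g i)" by simp
  finally show ?thesis by simp
qed

lemma binomial_sum_char:
  fixes g :: "nat \<Rightarrow> 'k::field"
  assumes "CHAR('k) = p" "p > 0"
  shows "(\<Sum>i\<le>p. of_nat (p choose i) * g i) = g 0 + g p"
proof -
  have pr: "prime p" using prime_CHAR_semidom[where 'a = 'k] assms by simp
  have "of_nat (p choose i) * g i = (if i = 0 then g 0 else 0) + (if i = p then g p else 0)" if "i \<le> p" for i
  proof (cases "i = 0 \<or> i = p")
    case False
    then have "p dvd (p choose i)" using that pr by (intro dvd_choose_prime) auto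
    then have "of_nat (p choose i) = (0::'k)" using assms by (simp add: of_nat_eq_0_iff_char_dvd)
    then show ?thesis using False by simp
  qed (use assms in auto)
  then have "(\<Sum>i\<le>p. of_nat (p choose i) * g i) = (\<Sum>i\<le>p. (if i = 0 then g 0 else 0) + (if i = p then g p else 0))"
    by (intro sum.cong) auto
  then show ?thesis by (simp add: sum.distrib)
qed

context qsh
begin

lemma pw_binomial:
  assumes h: "x \<in> hom n" "y \<in> hom n" and c: "x \<star> y = y \<star> x"
  shows "pw (x + y) q = (\<Sum>i\<le>q. sc (of_nat (q choose i)) (pw x i \<star> pw y (q - i)))"
proof (induction q)
  case 0 then show ?case by (simp add: qm_one_left[OF one_hom])
next
  case (Suc q)
  have 1: "x \<star> (pw x i \<star> pw y (q - i)) = pw x (Suc i) \<star> pw y (Suc q - Suc i)" for i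
    by (simp add: qm_assoc)
  have 2: "y \<star> (pw x i \<star> pw y (q - i)) = pw x i \<star> pw y (Suc q - i)" if "i \<le> q" for i
    using that qm_pw_commute[OF c[symmetric] h] by (simp add: Suc_diff_le qm_assoc[symmetric])
  have "pw (x + y) (Suc q) = (\<Sum>i\<le>q. sc (of_nat (q choose i)) (pw x (Suc i) \<star> pw y (Suc q - Suc i))) +
      (\<Sum>i\<le>q. sc (of_nat (q choose i)) (pw x i \<star> pw y (Suc q - i)))"
  proof -
    have "x \<star> (\<Sum>i\<le>q. sc (of_nat (q choose i)) (pw x i \<star> pw y (q - i))) = (\<Sum>i\<le>q. sc (of_nat (q choose i)) (pw x (Suc i) \<star> pw y (Suc q - Suc i)))"
      unfolding qm_sum qm_sc 1 ..
    moreover have "y \<star> (\<Sum>i\<le>q. sc (of_nat (q choose i)) (pw x i \<star> pw y (q - i))) = (\<Sum>i\<le>q. sc (of_nat (q choose i)) (pw x i \<star> pw y (Suc q - i)))"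
      unfolding qm_sum qm_sc by (intro sum.cong refl) (simp only: 2 atMost_iff)
    ultimately show ?thesis by (simp only: pw.simps(2)[of "x + y"] Suc qm_add)
  qed
  also have "\<dots> = (\<Sum>i\<le>Suc q. sc (of_nat (Suc q choose i)) (pw x i \<star> pw y (Suc q - i)))"
    by (rule ext, simp only: plus_fun_apply sum_fun_apply sc_simps)
      (subst add.commute, rule pascal_sum)
  finally show ?case .
qed

lemma pw_add_char:
  assumes h: "x \<in> hom n" "y \<in> hom n" and c: "x \<star> y = y \<star> x" and p: "CHAR('k) = p" "p > 0"
  shows "pw (x + y) p = pw x p + pw y p"
proof (rule ext)
  fix u
  have "pw (x + y) p u = (\<Sum>i\<le>p. of_nat (p choose i) * (pw x i \<star> pw y (p - i)) u)"
    by (simp only: pw_binomial[OF h c] sum_fun_apply sc_simps)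
  also have "\<dots> = (pw x p + pw y p) u"
    by (subst binomial_sum_char[OF p]) (simp add: qm_one_left[OF pw_hom[OF h(2)]] qm_one_right[OF pw_hom[OF h(1)]] add.commute)
  finally show "pw (x + y) p u = (pw x p + pw y p) u" .
qed

lemma pw_sc: "x \<in> hom n \<Longrightarrow> pw (sc c x) k = sc (c ^ k) (pw x k)"
  by (induction k) (auto simp: qm_sc)

end

section \<open>The letterwise Frobenius map and its iterates\<close>

locale lfrob = letters X u0
  for X :: "(nat \<times> 'x) set" and u0 :: "nat \<times> 'x" +
  fixes p :: nat and f :: "nat \<times> 'x \<Rightarrow> nat \<times> 'x \<Rightarrow> 'k::field"
  assumes char_p: "CHAR('k) = p" and p_pos: "p > 0"
    and perfect: "\<And>x::'k. \<exists>y. y ^ p = x"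
    and f_supp: "f a c \<noteq> 0 \<Longrightarrow> a \<in> X \<and> c \<in> X \<and> fst c = p * fst a"
    and f_odd: "p \<noteq> 2 \<Longrightarrow> odd (fst a) \<Longrightarrow> f a c = 0"
begin

lemma prime_p: "prime p" using prime_CHAR_semidom[where 'a = 'k] char_p p_pos by simp

lemma p_ge2: "p \<ge> 2" using prime_p by (rule prime_ge_2_nat)

lemma pow_add: "(a + b) ^ p = a ^ p + (b ^ p :: 'k)"
  using freshmans_dream[where 'a = 'k] prime_p char_p by simp

lemma pow_sum: "(\<Sum>i\<in>I. g i) ^ p = (\<Sum>i\<in>I. (g i ^ p :: 'k))"
  using freshmans_dream_sum[where 'a = 'k] prime_p char_p by simp

definition rt :: "'k \<Rightarrow> 'k" where "rt c = (SOME y. y ^ p = c)"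

lemma rt_pow: "rt c ^ p = c" unfolding rt_def by (rule someI_ex) (rule perfect)

text \<open>With \<open>f a c\<close> read as the coefficient of \<open>c\<close> in the
  \<open>p\<close>-th power of the letter \<open>a\<close>, this is the tensor product of the
  \<open>p\<close>-th powers of the letters.\<close>

primrec fr :: "(nat \<times> 'x) list \<Rightarrow> ('k, 'x) ser" where
  "fr [] = (\<lambda>v. if v = [] then 1 else 0)"
| "fr (a # w) = (\<lambda>v. case v of [] \<Rightarrow> 0 | c # v' \<Rightarrow> f a c * fr w v')"

text \<open>The \<open>p\<close>-semilinear extension of \<open>fr\<close>. Rounding in the division
  is harmless: if \<open>p\<close> does not divide the degree of \<open>u\<close>, every
  \<open>fr w u\<close> vanishes.\<close>

definition Fr :: "('k, 'x) ser \<Rightarrow> ('k, 'x) ser" where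
  "Fr x = (\<lambda>u. \<Sum>w\<in>W (wdeg u div p). x w ^ p * fr w u)"

lemma fr_supp: "fr w u \<noteq> 0 \<Longrightarrow> u \<in> lists X \<and> w \<in> lists X \<and> wdeg u = p * wdeg w \<and> length u = length w"
proof (induction w arbitrary: u)
  case (Cons a w)
  then obtain c v where u: "u = c # v" "f a c \<noteq> 0" "fr w v \<noteq> 0" by (cases u) auto
  then show ?case using Cons.IH[of v] f_supp[of a c] by (simp add: algebra_simps)
qed (auto split: if_splits)

lemma fr_odd: "p \<noteq> 2 \<Longrightarrow> odd (wdeg w) \<Longrightarrow> fr w u = 0"
proof (induction w arbitrary: u)
  case (Cons a w)
  then show ?case using f_odd by (cases u; cases "even (fst a)") auto
qed auto

lemma Fr_supp: "Fr x u \<noteq> 0 \<Longrightarrow> \<exists>w. x w \<noteq> 0 \<and> fr w u \<noteq> 0"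
  unfolding Fr_def using p_pos by (auto elim!: sum.not_neutral_contains_not_neutral)

lemma Fr_Nil: "Fr x [] = x [] ^ p"
  by (simp add: Fr_def W_0)

lemma Fr_add: "Fr (x + y) = Fr x + Fr y"
  by (auto simp: Fr_def fun_eq_iff pow_add algebra_simps sum.distrib)

lemma Fr_sc: "Fr (sc c x) = sc (c ^ p) (Fr x)"
  by (auto simp: Fr_def fun_eq_iff power_mult_distrib algebra_simps sum_distrib_left)

lemma Fr_0 [simp]: "Fr 0 = 0"
  using Fr_sc[of 0 0] p_pos by (simp add: power_0_left)

lemma Fr_minus: "Fr (- x) = - Fr x"
  using Fr_add[of x "- x"] by (simp add: eq_neg_iff_add_eq_0 add.commute)

lemma Fr_diff: "Fr (x - y) = Fr x - Fr y"
  using Fr_add[of x "- y"] by (simp add: Fr_minus)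

lemma hom_Fr: "x \<in> hom n \<Longrightarrow> Fr x \<in> hom (p * n)"
proof -
  assume x: "x \<in> hom n"
  have "u \<in> W (p * n)" if u: "Fr x u \<noteq> 0" for u :: "(nat \<times> 'x) list"
  proof -
    obtain w where "x w \<noteq> 0" "fr w u \<noteq> 0" using Fr_supp u by blast
    then show ?thesis using x fr_supp[of w u] by (auto simp: hom_def W_def)
  qed
  then show ?thesis by (auto simp: hom_def)
qed

lemma Fr_expand: "x \<in> hom n \<Longrightarrow> Fr x = (\<Sum>w\<in>W n. sc (x w ^ p) (fr w))"
proof (rule ext)
  fix u :: "(nat \<times> 'x) list" assume x: "x \<in> hom n"
  show "Fr x u = (\<Sum>w\<in>W n. sc (x w ^ p) (fr w)) u"
  proof (cases "wdeg u = p * n")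
    case True then show ?thesis using p_pos by (simp add: Fr_def sum_fun_apply)
  next
    case False
    have "fr w u = 0" if "w \<in> W n" for w using False fr_supp[of w u] that by (auto simp: W_def)
    moreover have "Fr x u = 0" using hom_Fr[OF x] False by (auto simp: hom_def W_def)
    ultimately show ?thesis by (simp add: sum_fun_apply)
  qed
qed

lemma Fr_bs: "w \<in> lists X \<Longrightarrow> Fr (bs w) = fr w"
proof -
  assume "w \<in> lists X"
  then have w: "w \<in> W (wdeg w)" by (simp add: W_def)
  have "Fr (bs w) = (\<Sum>v\<in>W (wdeg w). sc (bs w v ^ p) (fr v))" using Fr_expand[OF hom_bs[OF w]] .
  also have "\<dots> = (\<Sum>v\<in>W (wdeg w). if v = w then fr w else 0)"
    using p_pos by (intro sum.cong refl) (auto simp: bs_def)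
  finally show ?thesis using w by simp
qed

text \<open>Frobenius acts on each tensor factor separately, so stripping \<open>c\<close> from an
  image amounts to stripping those letters \<open>a\<close> whose power involves \<open>c\<close>.
  This opens \<open>Fr\<close> to induction on words.\<close>

lemma Fr_Cons:
  assumes c: "fst c > 0"
  shows "Lo c (Fr x) = (\<Sum>a\<in>Yl (fst c). sc (f a c) (Fr (Lo a x)))"
proof (rule ext)
  fix u :: "(nat \<times> 'x) list"
  define N where "N = (fst c + wdeg u) div p"
  have le: "fst a \<le> fst c" if "f a c \<noteq> 0" for a using f_supp[OF that] p_pos by auto
  have N: "N - fst a = wdeg u div p" "fst a \<le> N" if "f a c \<noteq> 0" for a
    using f_supp[OF that] p_pos by (auto simp: N_def)
  have r: "(\<Sum>a\<in>Yl (fst c). sc (f a c) (Fr (Lo a x))) u = (\<Sum>a\<in>{a \<in> X. fst a \<le> N}. f a c * (\<Sum>w\<in>W (wdeg u div p). x (a # w) ^ p * fr w u))"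
    unfolding sum_fun_apply sc_simps
  proof (rule sum.mono_neutral_cong)
    show "f i c * Fr (Lo i x) u = 0" if "i \<in> Yl (fst c) - {a \<in> X. fst a \<le> N}" for i
      using N(2)[of i] f_supp[of i c] that by fastforce
    show "f i c * (\<Sum>w\<in>W (wdeg u div p). x (i # w) ^ p * fr w u) = 0" if "i \<in> {a \<in> X. fst a \<le> N} - Yl (fst c)" for i
      using le[of i] f_supp[of i c] that by (fastforce simp: Yl_def)
  qed (auto simp: finite_le Fr_def letter_pos Lo_def dest: letter_pos)
  show "Lo c (Fr x) u = (\<Sum>a\<in>Yl (fst c). sc (f a c) (Fr (Lo a x))) u"
  proof (cases "N = 0")
    case True
    then have "f a c = 0" if "a \<in> X" for a using N(2)[of a] letter_pos[OF that] by auto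
    moreover have "Lo c (Fr x) u = 0" using c True by (simp add: Fr_def N_def[symmetric] W_0)
    ultimately show ?thesis unfolding r by simp
  next
    case False
    have "Lo c (Fr x) u = (\<Sum>w\<in>W N. x w ^ p * fr w (c # u))" using c by (simp add: Fr_def N_def)
    also have "\<dots> = (\<Sum>a\<in>{a \<in> X. fst a \<le> N}. \<Sum>w\<in>W (N - fst a). f a c * (x (a # w) ^ p * fr w u))"
      using False by (subst W_split) (auto intro!: sum.cong)
    also have "\<dots> = (\<Sum>a\<in>{a \<in> X. fst a \<le> N}. f a c * (\<Sum>w\<in>W (wdeg u div p). x (a # w) ^ p * fr w u))"
      unfolding sum_distrib_left
    proof (rule sum.cong[OF refl])
      fix a
      show "(\<Sum>w\<in>W (N - fst a). f a c * (x (a # w) ^ p * fr w u)) = (\<Sum>w\<in>W (wdeg u div p). f a c * (x (a # w) ^ p * fr w u))"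
        by (cases "f a c = 0") (simp_all add: N)
    qed
    finally show ?thesis unfolding r .
  qed
qed

lemma Fr_notX: "u \<notin> lists X \<Longrightarrow> Fr x u = 0"
  using Fr_supp[of x u] fr_supp by blast

text \<open>Frobenius is a semilinear coalgebra map, so it commutes with \<open>R\<close> up to a change of the functional.\<close>

lemma R_Fr: "\<exists>g'. \<forall>x. R d g (Fr x) = Fr (R (d div p) g' x)"
proof -
  \<comment> \<open>A functional composed with Frobenius is \<open>p\<close>-semilinear; over a
    perfect field its \<open>p\<close>-th root is a linear functional.\<close>
  define g' where "g' w = rt (\<Sum>v\<in>W d. g v * fr w v)" for w
  have "R d g (Fr x) u = Fr (R (d div p) g' x) u" for x u
  proof (induction u arbitrary: x)
    case Nil
    have "R d g (Fr x) [] = (\<Sum>v\<in>W d. \<Sum>w\<in>W (d div p). g v * (x w ^ p * fr w v))"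
      by (simp add: R_def Fr_def sum_distrib_left W_def)
    also have "\<dots> = (\<Sum>w\<in>W (d div p). \<Sum>v\<in>W d. g v * (x w ^ p * fr w v))" by (rule sum.swap)
    also have "\<dots> = (\<Sum>w\<in>W (d div p). (g' w * x w) ^ p)"
      by (simp add: power_mult_distrib g'_def rt_pow sum_distrib_left sum_distrib_right mult_ac)
    also have "\<dots> = Fr (R (d div p) g' x) []" by (simp add: Fr_Nil R_def pow_sum)
    finally show ?case .
  next
    case (Cons c u)
    show ?case
    proof (cases "fst c > 0")
      case True
      have "R d g (Fr x) (c # u) = R d g (Lo c (Fr x)) u" using True by (simp add: Lo_R[symmetric])
      also have "\<dots> = (\<Sum>a\<in>Yl (fst c). f a c * Fr (R (d div p) g' (Lo a x)) u)"
        by (simp add: Fr_Cons[OF True] R_sum R_sc sum_fun_apply Cons.IH)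
      also have "\<dots> = Lo c (Fr (R (d div p) g' x)) u"
        by (simp add: Fr_Cons[OF True] sum_fun_apply Lo_R)
      finally show ?thesis using True by simp
    next
      case False
      then have "c \<notin> X" using letter_pos[of c] by auto
      then show ?thesis by (simp add: R_def Fr_notX)
    qed
  qed
  then show ?thesis by blast
qed

definition Fj :: "nat \<Rightarrow> ('k, 'x) ser \<Rightarrow> ('k, 'x) ser" where "Fj j = Fr ^^ j"

lemma Fj_simps [simp]: "Fj 0 x = x" "Fj (Suc j) x = Fr (Fj j x)" "Fj j 0 = 0"
proof -
  show "Fj 0 x = x" "\<And>j. Fj (Suc j) x = Fr (Fj j x)" by (auto simp: Fj_def)
  then show "Fj j 0 = 0" by (induction j) (auto simp: Fj_def)
qed

lemma Fj_minus: "Fj j (- x) = - Fj j x" by (induction j) (auto simp: Fr_minus simp del: uminus_apply)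

lemma Fj_diff: "Fj j (x - y) = Fj j x - Fj j y" by (induction j) (auto simp: Fr_diff simp del: minus_apply)

lemma Fj_sc: "Fj j (sc c x) = sc (c ^ (p ^ j)) (Fj j x)"
  by (induction j) (auto simp: Fr_sc power_mult[symmetric] mult.commute simp del: sc_simps(5))

lemma Fj_Fj: "Fj i (Fj j x) = Fj (i + j) x" by (induction i) auto

lemma hom_Fj: "x \<in> hom n \<Longrightarrow> Fj j x \<in> hom (p ^ j * n)"
  by (induction j) (auto simp: mult.assoc intro: hom_Fr)

lemma R_Fj: "\<exists>g'. \<forall>x. R d g (Fj j x) = Fj j (R (d div p ^ j) g' x)"
proof (induction j arbitrary: d g)
  case (Suc j)
  obtain g1 where "\<forall>x. R d g (Fr x) = Fr (R (d div p) g1 x)" using R_Fr by blast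
  moreover obtain g2 where "\<forall>x. R (d div p) g1 (Fj j x) = Fj j (R (d div p div p ^ j) g2 x)" using Suc by blast
  ultimately show ?case by (auto simp: div_mult2_eq)
qed auto

lemma root_ex: "\<exists>y::'k. y ^ (p ^ j) = c"
proof (induction j arbitrary: c)
  case (Suc j)
  then obtain y where "y ^ p ^ j = rt c" by blast
  then have "y ^ p ^ Suc j = c" using rt_pow[of c] by (metis power_Suc2 power_mult)
  then show ?case by blast
qed (auto intro: exI[of _ c])

text \<open>This is the augmentation ideal inside the tensor coalgebra.\<close>

definition V :: "nat \<Rightarrow> ('k, 'x) ser set" where "V n = {x \<in> hom n. \<forall>w. x w \<noteq> 0 \<longrightarrow> length w = 1}"

lemma V_hom: "x \<in> V n \<Longrightarrow> x \<in> hom n" by (simp add: V_def)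

lemma V_0 [simp]: "0 \<in> V n" by (simp add: V_def)

lemma V_add: "x \<in> V n \<Longrightarrow> y \<in> V n \<Longrightarrow> x + y \<in> V n"
  by (force simp: V_def hom_add)

lemma V_sc: "x \<in> V n \<Longrightarrow> sc c x \<in> V n" by (auto simp: V_def hom_sc)

lemma V_minus: "x \<in> V n \<Longrightarrow> - x \<in> V n" by (auto simp: V_def hom_minus)

lemma V_diff: "x \<in> V n \<Longrightarrow> y \<in> V n \<Longrightarrow> x - y \<in> V n"
  using V_add[of x n "- y"] V_minus by auto

lemma V_Fr: "x \<in> V n \<Longrightarrow> Fr x \<in> V (p * n)"
  using Fr_supp[of x] fr_supp hom_Fr by (fastforce simp: V_def)

lemma V_Fj: "x \<in> V n \<Longrightarrow> Fj j x \<in> V (p ^ j * n)"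
  by (induction j) (auto simp: mult.assoc intro: V_Fr)

text \<open>A word of length one has no proper splitting, so a right factor of positive degree
  leaves nothing but a scalar on the left.\<close>

lemma V_R: "x \<in> V n \<Longrightarrow> d > 0 \<Longrightarrow> R d g x = sc (R d g x []) (bs [])"
proof (rule ext)
  fix u assume x: "x \<in> V n" "d > 0"
  have "x (u @ v) = 0" if "u \<noteq> []" "v \<in> W d" for v
  proof -
    have "v \<noteq> []" using that x(2) by (auto simp: W_def)
    then have "length (u @ v) \<noteq> 1" using that by (cases u; cases v) auto
    then show ?thesis using x by (auto simp: V_def)
  qed
  then show "R d g x u = sc (R d g x []) (bs []) u" by (auto simp: R_def bs_def)
qed

end

section \<open>The \<open>p\<close>-th power is the letterwise Frobenius map\<close>

locale qshf = qsh X u0 m + lfrob X u0 p f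
  for X :: "(nat \<times> 'x) set" and u0 :: "nat \<times> 'x" and m :: "nat \<times> 'x \<Rightarrow> nat \<times> 'x \<Rightarrow> nat \<times> 'x \<Rightarrow> 'k::field"
    and p :: nat and f :: "nat \<times> 'x \<Rightarrow> nat \<times> 'x \<Rightarrow> 'k" +
  fixes pc :: "nat \<times> 'x \<Rightarrow> nat \<Rightarrow> nat \<times> 'x \<Rightarrow> 'k"
  assumes pc_0: "pc a 0 c = (if c = u0 then 1 else 0)"
    and pc_Suc: "pc a (Suc i) c = (\<Sum>b\<in>Yl (fst c). m a b c * pc a i b)"
    and f_pc: "a \<in> X \<Longrightarrow> c \<in> X \<Longrightarrow> f a c = pc a p c"
begin

lemma pc_1: "a \<in> X \<Longrightarrow> c \<in> Y \<Longrightarrow> pc a (Suc 0) c = (if c = a then 1 else 0)"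
  by (simp add: pc_Suc pc_0 m_unit_right u0_Yl if_distrib[of "(*) _"] cong: if_cong)

lemma pc_supp: "pc a i c \<noteq> 0 \<Longrightarrow> fst c = i * fst a"
proof (induction i arbitrary: c)
  case 0 then show ?case by (auto simp: pc_0 split: if_splits)
next
  case (Suc i)
  then obtain b where "m a b c * pc a i b \<noteq> 0" unfolding pc_Suc by (auto elim!: sum.not_neutral_contains_not_neutral)
  then show ?case using Suc.IH[of b] m_supp[of a b c] by auto
qed

lemma two_neq_0: "p \<noteq> 2 \<Longrightarrow> (2::'k) \<noteq> 0"
proof
  assume "p \<noteq> 2" "(2::'k) = 0"
  then have "of_nat 2 = (0::'k)" by simp
  then have "p dvd 2" using char_p by (simp only: of_nat_eq_0_iff_char_dvd)
  then show False using \<open>p \<noteq> 2\<close> p_ge2 by (auto dest: dvd_imp_le)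
qed

lemma char2: "p = 2 \<Longrightarrow> (-1::'k) = 1"
proof -
  assume "p = 2"
  then have "of_nat 2 = (0::'k)" using char_p by (simp only: of_nat_eq_0_iff_char_dvd dvd_refl)
  then have "(1::'k) + 1 = 0" by simp
  then show ?thesis by (metis add_eq_0_iff)
qed

lemma sign_one: "even n \<or> p = 2 \<Longrightarrow> (-1) ^ (n * k) = (1::'k)"
  using char2 by (cases "even n") (simp, metis power_one)

lemma pc_odd: "p \<noteq> 2 \<Longrightarrow> odd (fst a) \<Longrightarrow> a \<in> X \<Longrightarrow> pc a (i + 2) c = 0"
proof (induction i arbitrary: c)
  case 0
  have "m a b c * pc a (Suc 0) b = 0" if "b \<in> Yl (fst c)" for b
  proof -
    have "m a a c = - m a a c" using m_comm[of a a c] 0 by simp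
    then have "2 * m a a c = 0" by (metis add.right_inverse mult_2)
    then have "m a a c = 0" using two_neq_0 0 by simp
    then show ?thesis using that 0 by (auto simp: pc_1 Yl_def)
  qed
  then show ?case by (simp only: numeral_2_eq_2 pc_Suc[of a "Suc 0"] add_0) (rule sum.neutral, blast)
next
  case (Suc i) then show ?case by (simp add: pc_Suc)
qed

text \<open>For odd \<open>p\<close> a letter of odd degree squares to zero, so it annihilates its
  own nontrivial powers. This removes the terms of the next expansion in which a Koszul sign could
  survive.\<close>

lemma m_pc_odd: "p \<noteq> 2 \<Longrightarrow> odd (fst a) \<Longrightarrow> a \<in> X \<Longrightarrow> b \<noteq> u0 \<Longrightarrow> b \<in> Y \<Longrightarrow> m a b c * pc a i b = 0"
proof -
  assume a: "p \<noteq> 2" "odd (fst a)" "a \<in> X" "b \<noteq> u0" "b \<in> Y"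
  consider "i = 0" | "i = 1" | j where "i = j + 2" by (metis One_nat_def add_2_eq_Suc' not0_implies_Suc)
  then show ?thesis
  proof cases
    case 1 then show ?thesis using a by (simp add: pc_0)
  next
    case 2
    have "m a a c = - m a a c" using m_comm[of a a c] a by simp
    then have "2 * m a a c = 0" by (metis add.right_inverse mult_2)
    then have "m a a c = 0" using two_neq_0 a by simp
    then show ?thesis using 2 a by (auto simp: pc_1)
  next
    case 3 then show ?thesis using pc_odd a by simp
  qed
qed

text \<open>In a product of \<open>q\<close> copies of \<open>a # w\<close>, the letter
  \<open>c\<close> in front collects \<open>a\<close> from \<open>i\<close> of the copies, which
  contributes the \<open>c\<close>-component of the \<open>i\<close>-th power of \<open>a\<close>;
  behind it stand the \<open>i\<close> freed copies of \<open>w\<close> and the untouched copies.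
  Even degree, or \<open>p = 2\<close>, makes everything involved commute, and the choices are
  counted by a binomial coefficient.\<close>

lemma Lo_pw_bs:
  assumes w: "a # w \<in> W n" and n: "even n \<or> p = 2" and c: "c \<in> Y"
  shows "Lo c (pw (bs (a # w)) q) u = (\<Sum>i\<le>q. of_nat (q choose i) * (pc a i c * (pw (bs w) i \<star> pw (bs (a # w)) (q - i)) u))"
  using c
proof (induction q arbitrary: c u)
  case 0
  then show ?case using letter_pos[of c] by (auto simp: pc_0 qm_one_left[OF one_hom] Lo_bs(2))
next
  case (Suc q)
  let ?x = "bs (a # w) :: ('k, 'x) ser" and ?S = "Yl (fst c)"
  define k where "k = wdeg w"
  have a: "a \<in> X" "fst a > 0" and wk: "w \<in> W k" and nk: "n = fst a + k" using w by (auto simp: W_def letter_pos k_def)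
  have x: "?x \<in> hom n" "bs w \<in> hom k" using w wk by (auto intro: hom_bs)
  have twx: "tw (fst b) ?x = ?x" for b using n hom_tw[OF x(1)] by (auto simp: tw_char2[OF char2])
  have comm: "?x \<star> bs w = bs w \<star> ?x" using qm_commute[OF x] sign_one[OF n, of k] by simp
  note comm' = qm_pw_commute[OF comm x(2,1)]
  \<comment> \<open>The sign for moving \<open>b\<close> past \<open>w\<close> never matters:
    \<open>b\<close> is a component of a power of \<open>a\<close>, hence of even degree if
    \<open>a\<close> is; for odd \<open>a\<close> and odd \<open>p\<close> the term vanishes unless
    \<open>b\<close> is the unit.\<close>
  have ind: "m a b c * (pc a i b * (tw (fst b) (bs w) \<star> z) u) = m a b c * (pc a i b * (bs w \<star> z) u)" if "b \<in> ?S" for b i z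
  proof (cases "even (fst a) \<or> p = 2")
    case False
    then show ?thesis using m_pc_odd[of a b c i] a that by (cases "b = u0") (auto simp: Yl_def)
  next
    case True
    have "tw (fst b) (bs w) = (bs w :: ('k, 'x) ser) \<or> pc a i b = 0"
      using True pc_supp[of a i b] by (auto simp: tw_even tw_char2[OF char2])
    then show ?thesis by auto
  qed
  have "Lo c (pw ?x (Suc q)) u = (\<Sum>b\<in>?S. \<Sum>b'\<in>?S. m b b' c * (tw (fst b') (Lo b ?x) \<star> Lo b' (pw ?x q)) u)"
    by (simp only: pw.simps Lo_qm[OF Suc.prems order_refl] sum_fun_apply sc_simps)
  also have "\<dots> = (\<Sum>b\<in>?S. (if b = u0 then (\<Sum>b'\<in>?S. m u0 b' c * (tw (fst b') ?x \<star> Lo b' (pw ?x q)) u) else 0) +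
        (if b = a then (\<Sum>b'\<in>?S. m a b' c * (tw (fst b') (bs w) \<star> Lo b' (pw ?x q)) u) else 0))"
  proof (intro sum.cong refl)
    fix b assume b: "b \<in> ?S"
    have "Lo b ?x = (if b = u0 then ?x else if b = a then bs w else 0)"
      using b letter_pos[of b] by (auto simp: Lo_bs Yl_def)
    then show "(\<Sum>b'\<in>?S. m b b' c * (tw (fst b') (Lo b ?x) \<star> Lo b' (pw ?x q)) u) = (if b = u0 then (\<Sum>b'\<in>?S. m u0 b' c * (tw (fst b') ?x \<star> Lo b' (pw ?x q)) u) else 0) +
        (if b = a then (\<Sum>b'\<in>?S. m a b' c * (tw (fst b') (bs w) \<star> Lo b' (pw ?x q)) u) else 0)"
      using u0_notin a by auto
  qed
  also have "\<dots> = (\<Sum>b'\<in>?S. m u0 b' c * (tw (fst b') ?x \<star> Lo b' (pw ?x q)) u) +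
        (if a \<in> ?S then (\<Sum>b'\<in>?S. m a b' c * (tw (fst b') (bs w) \<star> Lo b' (pw ?x q)) u) else 0)"
    by (simp add: sum.distrib u0_Yl)
  also have "(\<Sum>b'\<in>?S. m u0 b' c * (tw (fst b') ?x \<star> Lo b' (pw ?x q)) u) = (\<Sum>b'\<in>?S. if b' = c then (?x \<star> Lo c (pw ?x q)) u else 0)"
    by (intro sum.cong refl) (auto simp: m_unit Yl_def twx)
  also have "\<dots> = (?x \<star> Lo c (pw ?x q)) u"
  proof -
    have "c \<in> ?S" using Suc.prems by (simp add: Yl_def)
    then show ?thesis by simp
  qed
  also have "\<dots> = (\<Sum>i\<le>q. of_nat (q choose i) * (pc a i c * (pw (bs w) i \<star> pw ?x (Suc q - i)) u))"
  proof -
    have eq: "Lo c (pw ?x q) = (\<Sum>i\<le>q. sc (of_nat (q choose i) * pc a i c) (pw (bs w) i \<star> pw ?x (q - i)))"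
      using Suc.IH[OF Suc.prems] by (auto simp: fun_eq_iff sum_fun_apply mult_ac)
    have "?x \<star> (pw (bs w) i \<star> pw ?x (q - i)) = pw (bs w) i \<star> pw ?x (Suc q - i)" if "i \<le> q" for i
      using comm' that by (simp add: Suc_diff_le qm_assoc[symmetric])
    then show ?thesis unfolding eq qm_sum qm_sc by (simp add: sum_fun_apply mult_ac)
  qed
  also have "(if a \<in> ?S then (\<Sum>b'\<in>?S. m a b' c * (tw (fst b') (bs w) \<star> Lo b' (pw ?x q)) u) else 0)
     = (\<Sum>b'\<in>?S. m a b' c * (tw (fst b') (bs w) \<star> Lo b' (pw ?x q)) u)"
  proof (cases "a \<in> ?S")
    case False
    then have "m a b' c = 0" for b' using m_supp[of a b' c] by (cases "m a b' c = 0") (auto simp: Yl_def)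
    then show ?thesis by simp
  qed simp
  also have "\<dots> = (\<Sum>b'\<in>?S. \<Sum>i\<le>q. m a b' c * (of_nat (q choose i) * (pc a i b' * (bs w \<star> (pw (bs w) i \<star> pw ?x (q - i))) u)))"
  proof (intro sum.cong refl)
    fix b assume b: "b \<in> ?S"
    then have "b \<in> Y" by (simp add: Yl_def)
    then have eq: "Lo b (pw ?x q) = (\<Sum>i\<le>q. sc (of_nat (q choose i) * pc a i b) (pw (bs w) i \<star> pw ?x (q - i)))"
      using Suc.IH by (auto simp: fun_eq_iff sum_fun_apply mult_ac)
    show "m a b c * (tw (fst b) (bs w) \<star> Lo b (pw ?x q)) u = (\<Sum>i\<le>q. m a b c * (of_nat (q choose i) * (pc a i b * (bs w \<star> (pw (bs w) i \<star> pw ?x (q - i))) u)))"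
      unfolding eq qm_sum qm_sc sum_fun_apply sum_distrib_left sc_simps
      by (intro sum.cong refl) (use ind[OF b] in \<open>simp add: mult.left_commute mult.assoc\<close>)
  qed
  also have "\<dots> = (\<Sum>i\<le>q. \<Sum>b'\<in>?S. m a b' c * (of_nat (q choose i) * (pc a i b' * (bs w \<star> (pw (bs w) i \<star> pw ?x (q - i))) u)))"
    by (rule sum.swap)
  also have "\<dots> = (\<Sum>i\<le>q. of_nat (q choose i) * (pc a (Suc i) c * (pw (bs w) (Suc i) \<star> pw ?x (Suc q - Suc i)) u))"
    by (simp add: pc_Suc sum_distrib_left sum_distrib_right qm_assoc mult_ac)
  finally show ?case by (simp only: pascal_sum[where g = "\<lambda>i. pc a i c * (pw (bs w) i \<star> pw ?x (Suc q - i)) u"])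
qed

text \<open>For \<open>q = p\<close> only \<open>i = 0\<close> and \<open>i = p\<close> survive in
  \<open>Lo_pw_bs\<close>. The first vanishes because \<open>c\<close> is not the unit, the second
  is \<open>f a c\<close> times the \<open>p\<close>-th power of \<open>w\<close>, so letters can be
  peeled off. The parity assumption passes to \<open>w\<close> because \<open>f a c\<close> vanishes
  for odd \<open>a\<close> when \<open>p\<close> is odd.\<close>

lemma pw_bs: "w \<in> W n \<Longrightarrow> even n \<or> p = 2 \<Longrightarrow> pw (bs w) p = fr w"
proof (induction w arbitrary: n)
  case Nil
  have "pw (bs []) k = bs []" for k by (induction k) (auto simp: qm_one_left[OF one_hom])
  then show ?case by (simp add: bs_def)
next
  case (Cons a w)
  have aw: "a \<in> X" "w \<in> W (wdeg w)" "n = fst a + wdeg w" using Cons.prems by (auto simp: W_def)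
  have h: "pw (bs (a # w)) p \<in> hom (p * n)" using pw_hom hom_bs Cons.prems by blast
  show ?case
  proof (rule ext)
    fix v
    show "pw (bs (a # w)) p v = fr (a # w) v"
    proof (cases v)
      case Nil
      have "p * n > 0" using p_pos aw letter_pos by auto
      then show ?thesis using Nil hom_Nil[OF h] by simp
    next
      case (Cons c v')
      show ?thesis
      proof (cases "c \<in> X")
        case False
        then show ?thesis using Cons hom_notX[OF h, of v] f_supp[of a c] by auto
      next
        case True
        have "pw (bs (a # w)) p v = Lo c (pw (bs (a # w)) p) v'" using True Cons by (simp add: letter_pos)
        also have "\<dots> = pc a 0 c * (pw (bs w) 0 \<star> pw (bs (a # w)) (p - 0)) v' + pc a p c * (pw (bs w) p \<star> pw (bs (a # w)) (p - p)) v'"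
          using True by (subst Lo_pw_bs[OF Cons.prems]) (simp_all only: binomial_sum_char[OF char_p p_pos] insert_iff simp_thms)
        also have "\<dots> = f a c * pw (bs w) p v'"
          using True u0_notin aw f_pc by (auto simp: pc_0 qm_one_right[OF pw_hom[OF hom_bs]])
        also have "\<dots> = f a c * fr w v'"
        proof (cases "f a c = 0")
          case False
          then have "even (wdeg w) \<or> p = 2" using f_odd[of a c] aw Cons.prems by auto
          then show ?thesis using Cons.IH aw by auto
        qed simp
        finally show ?thesis using Cons by simp
      qed
    qed
  qed
qed

text \<open>In the even case words of one degree commute, so the \<open>p\<close>-th power is
  additive and only basis words matter. In odd degree with \<open>p\<close> odd both sides vanish:
  \<open>x\<close> squares to zero, and a word of odd degree contains a letter killed by
  \<open>f\<close>.\<close>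

theorem pw_Fr: "x \<in> hom n \<Longrightarrow> pw x p = Fr x"
proof (cases "even n \<or> p = 2")
  case True
  assume x: "x \<in> hom n"
  have "pw (\<Sum>w\<in>F. sc (x w) (bs w)) p = (\<Sum>w\<in>F. sc (x w ^ p) (fr w))" if "F \<subseteq> W n" for F
    using finite_subset[OF that finite_W] that
  proof (induction F rule: finite_induct)
    case empty then show ?case using pw_0[OF p_pos] by (simp del: zero_fun_apply)
  next
    case (insert w F)
    have h: "sc (x w) (bs w) \<in> hom n" "(\<Sum>w\<in>F. sc (x w) (bs w)) \<in> hom n"
      using insert.prems by (auto intro!: hom_sum hom_sc hom_bs)
    have c: "sc (x w) (bs w) \<star> (\<Sum>w\<in>F. sc (x w) (bs w)) = (\<Sum>w\<in>F. sc (x w) (bs w)) \<star> sc (x w) (bs w)"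
      using qm_commute[OF h] sign_one[OF True, of n] by simp
    have w: "w \<in> W n" using insert.prems by simp
    have "pw (sc (x w) (bs w) + (\<Sum>w\<in>F. sc (x w) (bs w))) p = sc (x w ^ p) (fr w) + (\<Sum>w\<in>F. sc (x w ^ p) (fr w))"
      using insert.IH insert.prems pw_add_char[OF h c char_p p_pos] pw_sc[OF hom_bs[OF w]] pw_bs[OF w True]
      by (simp del: plus_fun_apply sc_simps(5))
    then show ?case using insert.hyps by (simp del: plus_fun_apply sc_simps(5))
  qed
  from this[OF order_refl] show ?thesis using hom_expand[OF x] Fr_expand[OF x] by simp
next
  case False
  assume x: "x \<in> hom n"
  have "x \<star> x = - (x \<star> x)" using qm_commute[OF x x] False by (simp add: sc_minus)
  then have "2 * (x \<star> x) u = 0" for u by (metis add.right_inverse mult_2 uminus_apply)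
  then have "x \<star> x = 0" using two_neq_0 False by (auto simp: fun_eq_iff)
  moreover obtain q where "p = Suc (Suc q)" using p_ge2 by (metis add_2_eq_Suc le_Suc_ex)
  ultimately have "pw x p = 0" by (simp add: qm_assoc[symmetric])
  moreover have "Fr x u = 0" for u
    using Fr_supp[of x u] fr_odd False x by (auto simp: hom_def W_def)
  ultimately show ?thesis by (simp add: fun_eq_iff)
qed

end

section \<open>Extending algebra maps from the primitive elements\<close>

lemmas fun_app = plus_fun_apply zero_fun_apply minus_apply uminus_apply sc_simps(5)
declare fun_app [simp del]

lemma (in vector_space) functional_ex:
  assumes S: "subspace S" and z: "z \<notin> S"
  shows "\<exists>g. Vector_Spaces.linear scale (*) g \<and> (\<forall>x\<in>S. g x = 0) \<and> g z = 1"
proof -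
  obtain B where B: "B \<subseteq> S" "independent B" "S \<subseteq> span B" using maximal_independent_subset by blast
  have zB: "z \<notin> span B" using z span_minimal[OF B(1) S] by blast
  interpret P: vector_space_pair scale "(*)" by unfold_locales (auto simp: algebra_simps)
  obtain g where g: "Vector_Spaces.linear scale (*) g" "\<forall>x\<in>insert z B. g x = (if x = z then 1 else 0)"
    using P.linear_independent_extend[OF independent_insertI[OF zB B(2)], of "\<lambda>x. if x = z then 1 else 0"] by blast
  have "z \<notin> B" using zB span_superset by blast
  then have "g x = 0" if "x \<in> B" for x using g(2) that by auto
  then have "g x = 0" if "x \<in> S" for x using P.linear_eq_0_on_span[OF g(1)] B(3) that by blast
  then show ?thesis using g by auto
qed

lemma vector_space_sc: "vector_space (sc :: 'k::field \<Rightarrow> ('k, 'x) ser \<Rightarrow> ('k, 'x) ser)"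
  by unfold_locales (auto simp: sc_def fun_eq_iff algebra_simps fun_app)

text \<open>Two products on the same coalgebra of words that share the matrix \<open>f\<close>. This
  sharing is the form in which an isomorphism of \<open>F\<close>-modules enters.\<close>

locale qsh2 = lfrob X u0 p f + A: qshf X u0 mA p f pcA + B: qshf X u0 mB p f pcB
  for X :: "(nat \<times> 'x) set" and u0 :: "nat \<times> 'x" and p :: nat and f :: "nat \<times> 'x \<Rightarrow> nat \<times> 'x \<Rightarrow> 'k::field"
    and mA pcA mB pcB
begin

no_notation A.qm (infixl "\<star>" 70)
no_notation B.qm (infixl "\<star>" 70)
notation A.qm (infixl "\<star>" 70)
notation B.qm (infixl "\<bullet>" 70)

text \<open>The products on \<open>T = \<Oplus> V\<^bsup>\<otimes>r\<^esup>\<close> are \<open>\<star>\<close> and \<open>\<bullet>\<close>; the quotient of \<open>(T, \<bullet>)\<close> by the ideal \<open>I\<close> of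
  the words of length at least two is the second algebra.\<close>

definition I :: "nat \<Rightarrow> ('k, 'x) ser set" where
  "I n = {b \<in> hom n. \<forall>w. length w \<le> 1 \<longrightarrow> b w = 0}"

lemma I_hom: "b \<in> I n \<Longrightarrow> b \<in> hom n" by (simp add: I_def)
lemma I_0 [simp]: "0 \<in> I n" by (simp add: I_def fun_app)
lemma I_add: "b \<in> I n \<Longrightarrow> c \<in> I n \<Longrightarrow> b + c \<in> I n" by (auto simp: I_def hom_add fun_app)
lemma I_sc: "b \<in> I n \<Longrightarrow> sc a b \<in> I n" by (auto simp: I_def hom_sc fun_app)
lemma I_minus: "b \<in> I n \<Longrightarrow> - b \<in> I n" by (auto simp: I_def hom_minus fun_app)
lemma I_sum: "(\<And>i. i \<in> S \<Longrightarrow> g i \<in> I n) \<Longrightarrow> (\<Sum>i\<in>S. g i) \<in> I n"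
  by (induction S rule: infinite_finite_induct) (auto intro: I_add)

lemma qm_one_letter: "c \<in> X \<Longrightarrow> (x \<bullet> y) [c] = (\<Sum>a\<in>Yl (fst c). \<Sum>b\<in>Yl (fst c). mB a b c * (Lo a x [] * Lo b y []))"
  by (simp add: B.qm_word_Cons B.qm_Nil)

lemma Lo_I_Nil: "b \<in> I n \<Longrightarrow> Lo a b [] = 0"
  by (cases "fst a = 0") (auto simp: I_def)

text \<open>The coefficients of a product at words of length at most one involve only coefficients
  of the same kind of the two factors; if these vanish for one factor, they vanish for the
  product.\<close>

lemma I_mult:
  assumes "b \<in> I i" "c \<in> hom j" shows "b \<bullet> c \<in> I (i + j)" "c \<bullet> b \<in> I (j + i)"
proof -
  have h: "b \<bullet> c \<in> hom (i + j)" "c \<bullet> b \<in> hom (j + i)" using assms by (auto intro: B.hom_qm I_hom)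
  have 1: "(b \<bullet> c) w = 0 \<and> (c \<bullet> b) w = 0" if "length w \<le> 1" for w
  proof (cases w)
    case Nil
    then show ?thesis using assms by (auto simp: B.qm_Nil I_def)
  next
    case (Cons a v)
    then have w: "w = [a]" using that by auto
    show ?thesis
    proof (cases "a \<in> X")
      case True then show ?thesis unfolding w using Lo_I_Nil[OF assms(1)] by (simp add: qm_one_letter)
    next
      case False then show ?thesis unfolding w by (simp add: B.qm_notX)
    qed
  qed
  then show "b \<bullet> c \<in> I (i + j)" "c \<bullet> b \<in> I (j + i)" using h by (auto simp: I_def)
qed

definition K :: "(nat \<times> ('k, 'x) ser \<times> ('k, 'x) ser) set \<Rightarrow> nat \<Rightarrow> ('k, 'x) ser set" where
  "K G n = {x. \<exists>b. (n, x, b) \<in> G}"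

end

text \<open>The graph \<open>G\<close> of an algebra map to \<open>(T, \<bullet>)/I\<close> that is defined on a graded left coideal subalgebra
  \<open>K G\<close> of \<open>(T, \<star>)\<close> and is the identity on primitive elements.  The last two conditions are purity
  with respect to the iterated Frobenius maps.\<close>

locale gd = qsh2 X u0 p f mA pcA mB pcB
  for X :: "(nat \<times> 'x) set" and u0 :: "nat \<times> 'x" and p :: nat and f :: "nat \<times> 'x \<Rightarrow> nat \<times> 'x \<Rightarrow> 'k::field"
    and mA pcA mB pcB +
  fixes G :: "(nat \<times> ('k, 'x) ser \<times> ('k, 'x) ser) set"
  assumes G_hom: "(n, x, b) \<in> G \<Longrightarrow> x \<in> hom n \<and> b \<in> hom n"
    and G_add: "(n, x, b) \<in> G \<Longrightarrow> (n, y, c) \<in> G \<Longrightarrow> (n, x + y, b + c) \<in> G"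
    and G_sc: "(n, x, b) \<in> G \<Longrightarrow> (n, sc a x, sc a b) \<in> G"
    and G_mult: "(i, x, b) \<in> G \<Longrightarrow> (j, y, c) \<in> G \<Longrightarrow> (i + j, A.qm x y, B.qm b c) \<in> G"
    and G_one: "(0, bs [], bs []) \<in> G"
    and G_I: "b \<in> I n \<Longrightarrow> (n, 0, b) \<in> G"
    and G_0: "(n, 0, b) \<in> G \<Longrightarrow> b \<in> I n"
    and G_Lo: "x \<in> K G n \<Longrightarrow> l \<in> X \<Longrightarrow> fst l \<le> n \<Longrightarrow> Lo l x \<in> K G (n - fst l)"
    and G_V: "(n, x, b) \<in> G \<Longrightarrow> x \<in> V n \<Longrightarrow> b - x \<in> I n"
    and G_pure: "x \<in> hom n \<Longrightarrow> Fj j x \<in> K G (p ^ j * n) \<Longrightarrow> \<exists>k\<in>K G n. Fj j k = Fj j x"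
    and G_vpure: "x \<in> hom n \<Longrightarrow> v \<in> V (p ^ j * n) \<Longrightarrow> Fj j x + v \<in> K G (p ^ j * n) \<Longrightarrow>
       \<exists>v'\<in>V n. v - Fj j v' \<in> K G (p ^ j * n)"
begin

lemma G_unit: "(n, x, b) \<in> G \<Longrightarrow> A.qm x (bs []) = x \<and> B.qm b (bs []) = b"
  using G_hom A.qm_one_right B.qm_one_right by blast

lemma K_hom: "x \<in> K G n \<Longrightarrow> x \<in> hom n" using G_hom by (auto simp: K_def)
lemma K_add: "x \<in> K G n \<Longrightarrow> y \<in> K G n \<Longrightarrow> x + y \<in> K G n" using G_add by (fastforce simp: K_def)
lemma K_sc: "x \<in> K G n \<Longrightarrow> sc a x \<in> K G n" using G_sc by (fastforce simp: K_def)
lemma K_0 [simp]: "0 \<in> K G n" using G_I[OF I_0] by (auto simp: K_def)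
lemma K_minus: "x \<in> K G n \<Longrightarrow> - x \<in> K G n" using K_sc[of x n "-1"] by (simp add: sc_minus)
lemma K_diff: "x \<in> K G n \<Longrightarrow> y \<in> K G n \<Longrightarrow> x - y \<in> K G n" using K_add[OF _ K_minus] by fastforce
lemma K_mult: "x \<in> K G i \<Longrightarrow> y \<in> K G j \<Longrightarrow> A.qm x y \<in> K G (i + j)" using G_mult by (fastforce simp: K_def)
lemma K_one: "bs [] \<in> K G 0" using G_one by (auto simp: K_def)
lemma K_sum: "(\<And>i. i \<in> S \<Longrightarrow> g i \<in> K G n) \<Longrightarrow> (\<Sum>i\<in>S. g i) \<in> K G n"
  by (induction S rule: infinite_finite_induct) (auto intro: K_add)
lemma G_00: "(n, 0, 0) \<in> G" using G_I[OF I_0] .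

lemma G_pw: "(n, x, b) \<in> G \<Longrightarrow> (k * n, A.pw x k, B.pw b k) \<in> G"
  by (induction k) (auto simp: G_one intro: G_mult)

lemma G_Fr: "(n, x, b) \<in> G \<Longrightarrow> (p * n, Fr x, Fr b) \<in> G"
  using G_pw[of n x b p] G_hom[of n x b] A.pw_Fr[of x n] B.pw_Fr[of b n] by simp

lemma G_Fj: "(n, x, b) \<in> G \<Longrightarrow> (p ^ j * n, Fj j x, Fj j b) \<in> G"
  by (induction j) (auto simp: mult.assoc intro: G_Fr)

lemma K_Fr: "x \<in> K G n \<Longrightarrow> Fr x \<in> K G (p * n)" using G_Fr by (fastforce simp: K_def)
lemma K_Fj: "x \<in> K G n \<Longrightarrow> Fj j x \<in> K G (p ^ j * n)" using G_Fj by (fastforce simp: K_def)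

end

text \<open>The assumption \<open>tgt\<close> says that \<open>b\<close> is an admissible value for
  \<open>y\<close>: wherever an iterate of \<open>y\<close> already lies in the domain, its value
  there is that of \<open>b\<close>. The assumption \<open>alt\<close> records the order of
  adjunction, primitive elements of degree \<open>d\<close> before all others.\<close>

locale gdext = gd X u0 p f mA pcA mB pcB G
  for X :: "(nat \<times> 'x) set" and u0 :: "nat \<times> 'x" and p :: nat and f :: "nat \<times> 'x \<Rightarrow> nat \<times> 'x \<Rightarrow> 'k::field"
    and mA pcA mB pcB and G :: "(nat \<times> ('k, 'x) ser \<times> ('k, 'x) ser) set" +
  fixes d :: nat and y b :: "('k, 'x) ser"
  assumes y_hom: "y \<in> hom d" and y_K: "y \<notin> K G d" and b_hom: "b \<in> hom d"
    and low: "n < d \<Longrightarrow> hom n \<subseteq> K G n"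
    and tgt: "Fj j y \<in> K G (p ^ j * d) \<Longrightarrow> (p ^ j * d, Fj j y, Fj j b) \<in> G"
    and alt: "y \<in> V d \<and> b = y \<or> V d \<subseteq> K G d"
begin

lemma d_pos: "d > 0"
proof (rule ccontr)
  assume "\<not> d > 0"
  then have "y = sc (y []) (bs [])" using y_hom hom_zero_iff by auto
  then have "y \<in> K G 0" using K_sc[OF K_one, of "y []"] by simp
  then show False using y_K \<open>\<not> d > 0\<close> by simp
qed

section \<open>Polynomials in the iterated \<open>p\<close>-th powers of the new element\<close>

definition z where "z i = Fj i y"
definition c where "c i = Fj i b"
definition e where "e i = p ^ i * d"

lemma e_pos: "e i > 0" using d_pos p_pos by (simp add: e_def)
lemma e_Suc: "e (Suc i) = p * e i" by (simp add: e_def)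
lemma e_less: "e i < e (Suc i)" using e_pos[of i] p_ge2 by (simp add: e_Suc)
lemma z_hom: "z i \<in> hom (e i)" and c_hom: "c i \<in> hom (e i)"
  using hom_Fj y_hom b_hom by (auto simp: z_def c_def e_def)
lemma z_Suc: "z (Suc i) = A.pw (z i) p" and c_Suc: "c (Suc i) = B.pw (c i) p"
  using A.pw_Fr[OF z_hom] B.pw_Fr[OF c_hom] by (auto simp: z_def c_def)
lemma zpw_hom: "A.pw (z i) t \<in> hom (t * e i)" and cpw_hom: "B.pw (c i) t \<in> hom (t * e i)"
  using A.pw_hom[OF z_hom] B.pw_hom[OF c_hom] by auto
lemma zc_G: "z i \<in> K G (e i) \<Longrightarrow> (e i, z i, c i) \<in> G"
  using tgt by (auto simp: z_def c_def e_def)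

text \<open>The graph of the extended map on \<open>K[z\<^sub>i]\<close>, restricted to polynomials of degree less than \<open>T\<close>.\<close>

inductive_set GS :: "nat \<Rightarrow> nat \<Rightarrow> (nat \<times> ('k, 'x) ser \<times> ('k, 'x) ser) set" for T i where
  base: "(n, k, \<beta>) \<in> G \<Longrightarrow> t < T \<Longrightarrow> (n + t * e i, A.qm k (A.pw (z i) t), B.qm \<beta> (B.pw (c i) t)) \<in> GS T i"
| add: "(N, x, \<beta>) \<in> GS T i \<Longrightarrow> (N, x', \<beta>') \<in> GS T i \<Longrightarrow> (N, x + x', \<beta> + \<beta>') \<in> GS T i"

lemma GS_hom: "(N, x, \<beta>) \<in> GS T i \<Longrightarrow> x \<in> hom N \<and> \<beta> \<in> hom N"
  by (induction N x \<beta> rule: GS.induct)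
    (auto intro: hom_add A.hom_qm B.hom_qm zpw_hom cpw_hom dest: G_hom)

lemma GS_mono: "(N, x, \<beta>) \<in> GS T i \<Longrightarrow> T \<le> T' \<Longrightarrow> (N, x, \<beta>) \<in> GS T' i"
  by (induction N x \<beta> rule: GS.induct) (auto intro: GS.base GS.add)

lemma GS_G: "(N, x, \<beta>) \<in> G \<Longrightarrow> T > 0 \<Longrightarrow> (N, x, \<beta>) \<in> GS T i"
  using GS.base[of N x \<beta> 0 T i] G_unit[of N x \<beta>] by simp

lemma GS_0: "T > 0 \<Longrightarrow> (N, 0, 0) \<in> GS T i" using GS_G[OF G_00] .

lemma GS_sc: "(N, x, \<beta>) \<in> GS T i \<Longrightarrow> (N, sc a x, sc a \<beta>) \<in> GS T i"
proof (induction N x \<beta> rule: GS.induct)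
  case (base n k \<beta> t)
  then show ?case using GS.base[OF G_sc[OF base(1), of a] base(2)] by (simp add: A.qm_sc B.qm_sc)
next
  case (add N x \<beta> x' \<beta>')
  then show ?case using GS.add by (simp add: sc_add)
qed

lemma GS_diff: "(N, x, \<beta>) \<in> GS T i \<Longrightarrow> (N, x', \<beta>') \<in> GS T i \<Longrightarrow> (N, x - x', \<beta> - \<beta>') \<in> GS T i"
  using GS.add[OF _ GS_sc[of N x' \<beta>' T i "-1"], of x \<beta>] by (simp add: sc_minus)

lemma GS_1: "(N, x, \<beta>) \<in> GS 1 i \<Longrightarrow> (N, x, \<beta>) \<in> G"
proof (induction N x \<beta> rule: GS.induct)
  case (base n k \<beta> t)
  then show ?case using G_unit[OF base(1)] by simp
qed (rule G_add)

lemma GS_low: "(N, x, \<beta>) \<in> GS T i \<Longrightarrow> N < e i \<Longrightarrow> (N, x, \<beta>) \<in> G"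
proof (induction N x \<beta> rule: GS.induct)
  case (base n k \<beta> t)
  then have "t = 0" by (cases t) auto
  then show ?case using base G_unit[OF base(1)] by simp
qed (auto intro: G_add)

lemma GS_inK:
  assumes "z i \<in> K G (e i)"
  shows "(N, x, \<beta>) \<in> GS T i \<Longrightarrow> (N, x, \<beta>) \<in> G"
  by (induction N x \<beta> rule: GS.induct) (auto intro: G_add G_mult G_pw zc_G assms)

text \<open>The degree of \<open>z\<^sub>i\<close> is even or \<open>p = 2\<close>, unless \<open>z\<^sub>i\<close> squares to zero.\<close>

definition r where "r i = (if odd (e i) \<and> p \<noteq> 2 then 2 else p)"

lemma r_le: "r i \<le> p" "r i \<ge> 2" using p_ge2 by (auto simp: r_def)

lemma odd_sq: "odd (e i) \<and> p \<noteq> 2 \<Longrightarrow> A.qm (z i) (z i) = 0" "odd (e i) \<and> p \<noteq> 2 \<Longrightarrow> B.qm (c i) (c i) = 0"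
proof -
  assume o: "odd (e i) \<and> p \<noteq> 2"
  have *: "x = 0" if "x = - x" for x :: "('k, 'x) ser"
  proof (rule ext)
    fix w have "x w = - x w" using that by (metis uminus_apply)
    then have "2 * x w = 0" by (metis add.right_inverse mult_2)
    then show "x w = 0 w" using A.two_neq_0 o by (simp add: fun_app)
  qed
  show "A.qm (z i) (z i) = 0" using A.qm_commute[OF z_hom z_hom, of i i] o by (intro *) (simp add: sc_minus)
  show "B.qm (c i) (c i) = 0" using B.qm_commute[OF c_hom c_hom, of i i] o by (intro *) (simp add: sc_minus)
qed

lemma odd_pw: "odd (e i) \<and> p \<noteq> 2 \<Longrightarrow> t \<ge> 2 \<Longrightarrow> A.pw (z i) t = 0 \<and> B.pw (c i) t = 0"
proof -
  assume o: "odd (e i) \<and> p \<noteq> 2" and "t \<ge> 2"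
  then obtain s where "t = Suc (Suc s)" by (metis add_2_eq_Suc le_Suc_ex)
  then show ?thesis using odd_sq[OF o] by (simp add: A.qm_assoc[symmetric] B.qm_assoc[symmetric])
qed

text \<open>Writing an exponent as \<open>t = p * t' + s\<close> turns a polynomial of degree below
  \<open>p ^ Suc q\<close> in \<open>z i\<close> into digits that are polynomials of degree below
  \<open>p ^ q\<close> in \<open>z (Suc i)\<close>, with the values carried along. Inductions on
  \<open>q\<close> through this lemma end in \<open>G\<close> itself at \<open>q = 0\<close>. Digits
  of would-be negative degree must be declared \<open>0\<close>, since subtraction
  truncates.\<close>

lemma GS_digits:
  assumes "(N, x, \<beta>) \<in> GS (p ^ Suc q) i"
  shows "\<exists>k \<mu>. (\<forall>s<r i. s * e i \<le> N \<longrightarrow> (N - s * e i, k s, \<mu> s) \<in> GS (p ^ q) (Suc i)) \<and>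
     (\<forall>s<r i. N < s * e i \<longrightarrow> k s = 0 \<and> \<mu> s = 0) \<and>
     x = (\<Sum>s<r i. A.qm (k s) (A.pw (z i) s)) \<and> \<beta> = (\<Sum>s<r i. B.qm (\<mu> s) (B.pw (c i) s))"
  using assms
proof (induction N x \<beta> rule: GS.induct)
  case (base n k \<beta> t)
  note G0 = GS_0[of "p ^ q" _ "Suc i"]
  have pq: "p ^ q > 0" using p_pos by simp
  show ?case
  proof (cases "odd (e i) \<and> p \<noteq> 2 \<and> t \<ge> 2")
    case True
    then show ?thesis using odd_pw[of i t] G0[OF pq]
      by (intro exI[of _ "\<lambda>_. 0"]) simp
  next
    case False
    define s t' where "s = t mod p" and "t' = t div p"
    have p0: "p > 0" using p_pos .
    \<comment> \<open>For an element of square zero only the digits \<open>0\<close> and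
      \<open>1\<close> are left.\<close>
    have s: "s < r i"
    proof (cases "odd (e i) \<and> p \<noteq> 2")
      case True
      then have "t < 2" using False by auto
      then have "s < 2" unfolding s_def by (rule le_less_trans[OF mod_less_eq_dividend])
      then show ?thesis using True by (simp add: r_def)
    qed (use p0 in \<open>auto simp: r_def s_def\<close>)
    have t: "t = p * t' + s" by (simp add: s_def t'_def)
    have t': "t' < p ^ q" using base(2) by (simp add: t'_def less_mult_imp_div_less mult.commute)
    have kh: "k \<in> hom n" "\<beta> \<in> hom n" using G_hom[OF base(1)] by auto
    have x: "A.qm k (A.pw (z i) t) = A.qm (A.qm k (A.pw (z (Suc i)) t')) (A.pw (z i) s)"
      by (simp add: t A.pw_add[OF z_hom] A.pw_mult[OF z_hom] z_Suc A.qm_assoc)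
    have b: "B.qm \<beta> (B.pw (c i) t) = B.qm (B.qm \<beta> (B.pw (c (Suc i)) t')) (B.pw (c i) s)"
      by (simp add: t B.pw_add[OF c_hom] B.pw_mult[OF c_hom] c_Suc B.qm_assoc)
    have deg: "n + t * e i - s * e i = n + t' * e (Suc i)" "s * e i \<le> n + t * e i"
      by (auto simp: t e_Suc algebra_simps)
    have GS1: "(n + t' * e (Suc i), A.qm k (A.pw (z (Suc i)) t'), B.qm \<beta> (B.pw (c (Suc i)) t')) \<in> GS (p ^ q) (Suc i)"
      by (rule GS.base[OF base(1) t'])
    let ?k = "\<lambda>s'. if s' = s then A.qm k (A.pw (z (Suc i)) t') else 0"
    let ?m = "\<lambda>s'. if s' = s then B.qm \<beta> (B.pw (c (Suc i)) t') else 0"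
    have sx: "(\<Sum>s'<r i. A.qm (?k s') (A.pw (z i) s')) = A.qm k (A.pw (z i) t)"
    proof -
      have "(\<Sum>s'<r i. A.qm (?k s') (A.pw (z i) s')) = (\<Sum>s'<r i. if s' = s then A.qm k (A.pw (z i) t) else 0)"
        by (intro sum.cong refl) (simp add: x)
      then show ?thesis using s by simp
    qed
    have sb: "(\<Sum>s'<r i. B.qm (?m s') (B.pw (c i) s')) = B.qm \<beta> (B.pw (c i) t)"
    proof -
      have "(\<Sum>s'<r i. B.qm (?m s') (B.pw (c i) s')) = (\<Sum>s'<r i. if s' = s then B.qm \<beta> (B.pw (c i) t) else 0)"
        by (intro sum.cong refl) (simp add: b)
      then show ?thesis using s by simp
    qed
    show ?thesis
      by (rule exI[of _ ?k], rule exI[of _ ?m]) (use sx sb deg GS1 G0[OF pq] in auto)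
  qed
next
  case (add N x \<beta> x' \<beta>')
  from add.IH obtain k \<mu> where 1: "\<forall>s<r i. s * e i \<le> N \<longrightarrow> (N - s * e i, k s, \<mu> s) \<in> GS (p ^ q) (Suc i)"
     "\<forall>s<r i. N < s * e i \<longrightarrow> k s = 0 \<and> \<mu> s = 0"
     "x = (\<Sum>s<r i. A.qm (k s) (A.pw (z i) s))" "\<beta> = (\<Sum>s<r i. B.qm (\<mu> s) (B.pw (c i) s))" by blast
  from add.IH obtain k' \<mu>' where 2: "\<forall>s<r i. s * e i \<le> N \<longrightarrow> (N - s * e i, k' s, \<mu>' s) \<in> GS (p ^ q) (Suc i)"
     "\<forall>s<r i. N < s * e i \<longrightarrow> k' s = 0 \<and> \<mu>' s = 0"
     "x' = (\<Sum>s<r i. A.qm (k' s) (A.pw (z i) s))" "\<beta>' = (\<Sum>s<r i. B.qm (\<mu>' s) (B.pw (c i) s))" by blast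
  show ?case
    using 1 2 by (intro exI[of _ "\<lambda>s. k s + k' s"] exI[of _ "\<lambda>s. \<mu> s + \<mu>' s"])
      (simp add: A.qm_add B.qm_add sum.distrib GS.add)
qed

end

section \<open>Multiplicativity of Frobenius and images of its iterates\<close>

context qshf
begin

lemma pw_qm: "x \<star> y = y \<star> x \<Longrightarrow> x \<in> hom i \<Longrightarrow> y \<in> hom j \<Longrightarrow> pw (x \<star> y) k = pw x k \<star> pw y k"
proof (induction k)
  case (Suc k)
  have "(x \<star> y) \<star> (pw x k \<star> pw y k) = x \<star> ((y \<star> pw x k) \<star> pw y k)" by (simp add: qm_assoc)
  also have "y \<star> pw x k = pw x k \<star> y" using qm_pw_commute[of y x i j k] Suc.prems by simp
  finally show ?case using Suc by (simp add: qm_assoc)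
qed (simp add: qm_one_left[OF one_hom])

text \<open>If the factors commute this is the power of a product. Otherwise \<open>p\<close> and
  both degrees are odd, \<open>x\<close> and the product both square to zero, and both sides
  vanish.\<close>

lemma Fr_qm: "x \<in> hom i \<Longrightarrow> y \<in> hom j \<Longrightarrow> Fr (x \<star> y) = Fr x \<star> Fr y"
proof -
  assume x: "x \<in> hom i" and y: "y \<in> hom j"
  have F: "Fr (x \<star> y) = pw (x \<star> y) p" "Fr x = pw x p" "Fr y = pw y p"
    using pw_Fr x y hom_qm by metis+
  show ?thesis
  proof (cases "p = 2 \<or> even (i * j)")
    case True
    then have "(-1) ^ (i * j) = (1::'k)" using char2 by (cases "even (i * j)") (simp, metis power_one)
    then have "x \<star> y = y \<star> x" using qm_commute[OF x y] by simp
    then show ?thesis using pw_qm[OF _ x y] F by simp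
  next
    case False
    have "x \<star> x = - (x \<star> x)" using qm_commute[OF x x] False by (simp add: sc_minus)
    then have "2 * (x \<star> x) u = 0" for u by (metis add.right_inverse mult_2 uminus_apply)
    then have xx: "x \<star> x = 0" using two_neq_0 False by (auto simp: fun_eq_iff zero_fun_def)
    have yx: "y \<star> x = - (x \<star> y)" using qm_commute[OF y x] False by (simp add: sc_minus mult.commute)
    obtain q where q: "p = Suc (Suc q)" using p_ge2 by (metis add_2_eq_Suc le_Suc_ex)
    have "(x \<star> y) \<star> (x \<star> y) = x \<star> ((y \<star> x) \<star> y)" by (simp add: qm_assoc)
    also have "\<dots> = - ((x \<star> x) \<star> (y \<star> y))" by (simp add: yx qm_minus qm_assoc)
    finally have "(x \<star> y) \<star> (x \<star> y) = 0" using xx by simp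
    then show ?thesis using xx F by (simp add: q qm_assoc[symmetric])
  qed
qed

lemma Fj_qm: "x \<in> hom i \<Longrightarrow> y \<in> hom k \<Longrightarrow> Fj j (x \<star> y) = Fj j x \<star> Fj j y"
  by (induction j) (auto simp: Fr_qm[OF hom_Fj hom_Fj])

text \<open>Stripping a letter from a product strips a letter, or nothing, from each factor. Hence
  the left coideal property needs to be checked on generators only.\<close>

lemma Lo_qm_closed:
  assumes M: "\<And>n. M n \<subseteq> hom n" "\<And>n. 0 \<in> M n" "\<And>n x y. x \<in> M n \<Longrightarrow> y \<in> M n \<Longrightarrow> x + y \<in> M n"
    "\<And>n x c. x \<in> M n \<Longrightarrow> sc c x \<in> M n" "\<And>i j x y. x \<in> M i \<Longrightarrow> y \<in> M j \<Longrightarrow> x \<star> y \<in> M (i + j)"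
    and xy: "x \<in> M i" "y \<in> M j"
    and L: "\<And>l. l \<in> X \<Longrightarrow> fst l \<le> i \<Longrightarrow> Lo l x \<in> M (i - fst l)" "\<And>l. l \<in> X \<Longrightarrow> fst l \<le> j \<Longrightarrow> Lo l y \<in> M (j - fst l)"
    and l: "l \<in> X" "fst l \<le> i + j"
  shows "Lo l (x \<star> y) \<in> M (i + j - fst l)"
proof -
  have sum: "(\<Sum>i\<in>S. g i) \<in> M n" if "\<And>i. i \<in> S \<Longrightarrow> g i \<in> M n" for S :: "(nat \<times> 'x) set" and g n
    using that
  proof (induction S rule: infinite_finite_induct)
    case (insert i S) then show ?case using M(3)[of "g i" n "sum g S"] by simp
  qed (simp_all add: M(2))
  have L': "Lo a x \<in> M (i - fst a)" if "a \<in> Y" "fst a \<le> i" for a using that L(1)[of a] xy by auto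
  have L'': "Lo a y \<in> M (j - fst a)" if "a \<in> Y" "fst a \<le> j" for a using that L(2)[of a] xy by auto
  have "sc (m a b l) (tw (fst b) (Lo a x) \<star> Lo b y) \<in> M (i + j - fst l)"
    if ab: "a \<in> Yl (fst l)" "b \<in> Yl (fst l)" for a b
  proof (cases "m a b l = 0 \<or> i < fst a \<or> j < fst b")
    case True
    then have "sc (m a b l) (tw (fst b) (Lo a x) \<star> Lo b y) = 0"
      using hom_Lo_0[of x i a] hom_Lo_0[of y j b] subsetD[OF M(1) xy(1)] subsetD[OF M(1) xy(2)] by auto
    then show ?thesis using M(2) by simp
  next
    case False
    then have le: "fst a \<le> i" "fst b \<le> j" "fst l = fst a + fst b" using m_supp[of a b l] by auto
    have Y: "a \<in> Y" "b \<in> Y" using ab by (auto simp: Yl_def)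
    have "tw (fst b) (Lo a x) \<in> M (i - fst a)"
      using L'[OF Y(1) le(1)] M(1,4) hom_tw by (metis subsetD)
    then have "tw (fst b) (Lo a x) \<star> Lo b y \<in> M ((i - fst a) + (j - fst b))" using L''[OF Y(2) le(2)] M(5) by blast
    moreover have "(i - fst a) + (j - fst b) = i + j - fst l" using le by simp
    ultimately show ?thesis using M(4) by metis
  qed
  then have "(\<Sum>a\<in>Yl (fst l). \<Sum>b\<in>Yl (fst l). sc (m a b l) (tw (fst b) (Lo a x) \<star> Lo b y)) \<in> M (i + j - fst l)"
    by (intro sum) blast
  then show ?thesis using l by (simp add: Lo_qm[of l "fst l"])
qed

end

context lfrob
begin

text \<open>The image of \<open>S\<close> under the \<open>j\<close>-th iterate, arranged by degree.
  Admitting \<open>0\<close> in every degree, also where \<open>p ^ j\<close> does not divide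
  \<open>N\<close>, makes it a graded family to which the closure arguments for coefficients
  apply.\<close>

definition FF :: "(nat \<Rightarrow> ('k, 'x) ser set) \<Rightarrow> nat \<Rightarrow> nat \<Rightarrow> ('k, 'x) ser set" where
  "FF S j N = {x. \<exists>n w. w \<in> S n \<and> x = Fj j w \<and> (N = p ^ j * n \<or> x = 0)}"

lemma FF_I: "w \<in> S n \<Longrightarrow> Fj j w \<in> FF S j (p ^ j * n)" by (auto simp: FF_def)

lemma FF_0: "0 \<in> S n \<Longrightarrow> 0 \<in> FF S j N"
  unfolding FF_def by (rule CollectI, rule exI[of _ n], rule exI[of _ 0]) simp

lemma FF_E: "x \<in> FF S j N \<Longrightarrow> x = 0 \<or> (\<exists>n w. w \<in> S n \<and> x = Fj j w \<and> N = p ^ j * n)"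
  by (auto simp: FF_def)

lemma FF_diff:
  assumes "\<And>n x y. x \<in> S n \<Longrightarrow> y \<in> S n \<Longrightarrow> x - y \<in> S n" "\<And>n. 0 \<in> S n" "x \<in> FF S j N" "y \<in> FF S j N"
  shows "x - y \<in> FF S j N"
proof (cases "y = 0")
  case True then show ?thesis using assms by simp
next
  case False
  then obtain n w' where 2: "w' \<in> S n" "y = Fj j w'" "N = p ^ j * n" using FF_E[OF assms(4)] by blast
  have "\<exists>w\<in>S n. x = Fj j w"
  proof (cases "x = 0")
    case True then show ?thesis using assms(2) by (intro bexI[of _ 0]) auto
  next
    case False
    then obtain n' w where "w \<in> S n'" "x = Fj j w" "N = p ^ j * n'" using FF_E[OF assms(3)] by blast
    moreover from this have "n' = n" using 2 p_pos by simp
    ultimately show ?thesis by blast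
  qed
  then obtain w where "w \<in> S n" "x = Fj j w" by blast
  then have "w - w' \<in> S n" "x - y = Fj j (w - w')" using assms(1) 2 by (auto simp: Fj_diff)
  then show ?thesis using FF_I[where S = S and n = n and w = "w - w'" and j = j] 2(3) by simp
qed

text \<open>The iterate is only semilinear, so its image absorbs scalars because these have
  \<open>p ^ j\<close>-th roots.\<close>

lemma FF_sc:
  assumes "\<And>n x a. x \<in> S n \<Longrightarrow> sc a x \<in> S n" "x \<in> FF S j N"
  shows "sc a x \<in> FF S j N"
proof -
  obtain n w where w: "w \<in> S n" "x = Fj j w" "N = p ^ j * n \<or> x = 0" using assms(2) by (auto simp: FF_def)
  obtain q where "q ^ (p ^ j) = a" using root_ex by blast
  then have "sc a x = Fj j (sc q w)" by (simp add: w Fj_sc)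
  then show ?thesis using FF_I[of "sc q w" S n j] FF_0[of S n j N] w assms(1)[of w n] assms(1)[of w n 0] by auto
qed

lemma FF_hom: "x \<in> FF hom j N \<Longrightarrow> x \<in> hom N"
  using FF_E[of x hom j N] hom_Fj by auto

lemma FF_R: "x \<in> FF hom j N \<Longrightarrow> d \<le> N \<Longrightarrow> R d g x \<in> FF hom j (N - d)"
proof -
  assume x: "x \<in> FF hom j N" and d: "d \<le> N"
  from FF_E[OF x] show ?thesis
  proof
    assume "x = 0" then show ?thesis using FF_0[of hom 0] by simp
  next
    assume "\<exists>n w. w \<in> hom n \<and> x = Fj j w \<and> N = p ^ j * n"
    then obtain n w where w: "w \<in> hom n" "x = Fj j w" "N = p ^ j * n" by blast
    obtain g' where g': "R d g x = Fj j (R (d div p ^ j) g' w)" using R_Fj[of d g j] w by blast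
    have le: "d div p ^ j \<le> n" using d w(3) div_le_mono[of d N "p ^ j"] p_pos by simp
    have w': "R (d div p ^ j) g' w \<in> hom (n - d div p ^ j)" using hom_R w(1) le by blast
    have "R d g x \<in> hom (N - d)" using hom_R FF_hom[OF x] d by blast
    moreover have "R d g x \<in> hom (p ^ j * (n - d div p ^ j))" using hom_Fj[OF w'] g' by simp
    \<comment> \<open>The two degrees differ exactly when \<open>p ^ j\<close> does not divide
      \<open>d\<close>; the contraction lies in both components and is then zero.\<close>
    ultimately have "N - d = p ^ j * (n - d div p ^ j) \<or> R d g x = 0" using hom_unique by blast
    then show ?thesis using w' g' unfolding FF_def by blast
  qed
qed

end

lemma (in qshf) FF_mult:
  assumes "\<And>n. S n \<subseteq> hom n" "\<And>n. 0 \<in> S n" "\<And>i j x y. x \<in> S i \<Longrightarrow> y \<in> S j \<Longrightarrow> x \<star> y \<in> S (i + j)"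
    and "x \<in> FF S j N" "y \<in> FF S j N'"
  shows "x \<star> y \<in> FF S j (N + N')"
proof (cases "x = 0 \<or> y = 0")
  case True then show ?thesis using FF_0[of S 0] assms(2) by auto
next
  case False
  then obtain n w n' w' where w: "w \<in> S n" "x = Fj j w" "N = p ^ j * n" "w' \<in> S n'" "y = Fj j w'" "N' = p ^ j * n'"
    using FF_E[OF assms(4)] FF_E[OF assms(5)] by blast
  then have "x \<star> y = Fj j (w \<star> w')" using assms(1) by (subst Fj_qm[of w n w' n']) auto
  then show ?thesis using FF_I[of "w \<star> w'" S "n + n'" j] assms(3) w by (simp add: distrib_left)
qed

section \<open>The domain of the extended map\<close>

context gdext
begin

text \<open>Moving powers of \<open>z i\<close> past coefficients costs the same sign in the domain
  and among the values.\<close>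

lemma GS_mult:
  assumes "(N, x, \<beta>) \<in> GS T i" "(N', x', \<beta>') \<in> GS T' i"
  shows "(N + N', A.qm x x', B.qm \<beta> \<beta>') \<in> GS (T + T') i"
  using assms(1)
proof (induction N x \<beta> rule: GS.induct)
  case (base n k \<beta> t)
  note G1 = base(1) and t1 = base(2)
  from assms(2) show ?case
  proof (induction N' x' \<beta>' rule: GS.induct)
    case (base n' k' \<beta>' u)
    have kh: "k' \<in> hom n'" "\<beta>' \<in> hom n'" using G_hom[OF base(1)] by auto
    define s where "s = ((-1) ^ (t * e i * n') :: 'k)"
    have a: "A.qm (A.qm k (A.pw (z i) t)) (A.qm k' (A.pw (z i) u)) = sc s (A.qm (A.qm k k') (A.pw (z i) (t + u)))"
    proof -
      have "A.qm (A.qm k (A.pw (z i) t)) (A.qm k' (A.pw (z i) u)) = A.qm k (A.qm (A.qm (A.pw (z i) t) k') (A.pw (z i) u))"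
        by (simp add: A.qm_assoc)
      also have "A.qm (A.pw (z i) t) k' = sc s (A.qm k' (A.pw (z i) t))"
        using A.qm_commute[OF zpw_hom kh(1)] by (simp add: s_def)
      finally show ?thesis by (simp add: A.qm_sc A.qm_assoc A.pw_add[OF z_hom])
    qed
    have b: "B.qm (B.qm \<beta> (B.pw (c i) t)) (B.qm \<beta>' (B.pw (c i) u)) = sc s (B.qm (B.qm \<beta> \<beta>') (B.pw (c i) (t + u)))"
    proof -
      have "B.qm (B.qm \<beta> (B.pw (c i) t)) (B.qm \<beta>' (B.pw (c i) u)) = B.qm \<beta> (B.qm (B.qm (B.pw (c i) t) \<beta>') (B.pw (c i) u))"
        by (simp add: B.qm_assoc)
      also have "B.qm (B.pw (c i) t) \<beta>' = sc s (B.qm \<beta>' (B.pw (c i) t))"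
        using B.qm_commute[OF cpw_hom kh(2)] by (simp add: s_def)
      finally show ?thesis by (simp add: B.qm_sc B.qm_assoc B.pw_add[OF c_hom])
    qed
    have "((n + n') + (t + u) * e i, A.qm (A.qm k k') (A.pw (z i) (t + u)), B.qm (B.qm \<beta> \<beta>') (B.pw (c i) (t + u))) \<in> GS (T + T') i"
      by (rule GS.base[OF G_mult[OF G1 base(1)]]) (use t1 base(2) in simp)
    from GS_sc[OF this, of s] show ?case unfolding a b by (simp add: algebra_simps)
  next
    case (add N x \<beta>1 x' \<beta>1')
    then show ?case by (simp add: A.qm_add B.qm_add GS.add)
  qed
next
  case (add N x \<beta> x' \<beta>')
  then show ?case by (simp add: A.qm_add B.qm_add GS.add)
qed

text \<open>The component of degree \<open>N\<close> of the subalgebra generated by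
  \<open>K G\<close> and \<open>z i\<close>, with the values forgotten.\<close>

definition M where "M i N = {x. \<exists>T \<beta>. T > 0 \<and> (N, x, \<beta>) \<in> GS T i}"

lemma M_I: "(N, x, \<beta>) \<in> GS T i \<Longrightarrow> T > 0 \<Longrightarrow> x \<in> M i N" by (auto simp: M_def)
lemma M_hom: "M i N \<subseteq> hom N" by (auto simp: M_def dest: GS_hom)
lemma K_M: "x \<in> K G N \<Longrightarrow> x \<in> M i N" using GS_G[where T = 1] by (auto simp: K_def intro!: M_I)
lemma M_0 [simp]: "0 \<in> M i N" using K_M K_0 by blast
lemma M_add: "x \<in> M i N \<Longrightarrow> x' \<in> M i N \<Longrightarrow> x + x' \<in> M i N"
proof -
  assume "x \<in> M i N" "x' \<in> M i N"
  then obtain T \<beta> T' \<beta>' where "T > 0" "(N, x, \<beta>) \<in> GS T i" "(N, x', \<beta>') \<in> GS T' i" by (auto simp: M_def)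
  then have "(N, x + x', \<beta> + \<beta>') \<in> GS (T + T') i" by (intro GS.add GS_mono[of N _ _ T i "T + T'"] GS_mono[of N _ _ T' i "T + T'"]) auto
  then show ?thesis using \<open>T > 0\<close> by (auto intro: M_I)
qed
lemma M_sc: "x \<in> M i N \<Longrightarrow> sc a x \<in> M i N" using GS_sc by (fastforce simp: M_def)
lemma M_diff: "x \<in> M i N \<Longrightarrow> x' \<in> M i N \<Longrightarrow> x - x' \<in> M i N"
  using M_add[of x i N "- x'"] M_sc[of x' i N "-1"] by (simp add: sc_minus)
lemma M_mult: "x \<in> M i N \<Longrightarrow> x' \<in> M i N' \<Longrightarrow> A.qm x x' \<in> M i (N + N')"
proof -
  assume "x \<in> M i N" "x' \<in> M i N'"
  then obtain T \<beta> T' \<beta>' where "T > 0" "(N, x, \<beta>) \<in> GS T i" "(N', x', \<beta>') \<in> GS T' i" by (auto simp: M_def)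
  from M_I[OF GS_mult[OF this(2,3)]] this(1) show ?thesis by simp
qed
lemma M_low: "x \<in> M i N \<Longrightarrow> N < e i \<Longrightarrow> x \<in> K G N"
  using GS_low by (fastforce simp: M_def K_def)
lemma M_one: "bs [] \<in> M i 0" by (rule K_M[OF K_one])

lemma zc_GS: "(e i, z i, c i) \<in> GS 2 i"
  using GS.base[OF G_one, of 1 2 i] A.qm_one_left[OF z_hom] B.qm_one_left[OF c_hom] A.qm_one_right[OF z_hom] B.qm_one_right[OF c_hom] by simp

lemma z_M: "z i \<in> M i (e i)" by (rule M_I[OF zc_GS]) simp

lemma zpw_M: "A.pw (z i) t \<in> M i (t * e i)"
  using M_mult[OF z_M] M_one by (induction t) simp_all

lemma GS_next: "(N, x, \<beta>) \<in> GS T (Suc i) \<Longrightarrow> (N, x, \<beta>) \<in> GS (p * T) i"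
proof (induction N x \<beta> rule: GS.induct)
  case (base n k \<beta> t)
  have "(n + (p * t) * e i, A.qm k (A.pw (z i) (p * t)), B.qm \<beta> (B.pw (c i) (p * t))) \<in> GS (p * T) i"
    by (rule GS.base[OF base(1)]) (use base p_pos in simp)
  then show ?case by (simp add: A.pw_mult[OF z_hom] B.pw_mult[OF c_hom] z_Suc c_Suc e_Suc mult_ac)
qed (rule GS.add)

lemma M_next: "x \<in> M (Suc i) N \<Longrightarrow> x \<in> M i N"
proof -
  assume "x \<in> M (Suc i) N"
  then obtain T \<beta> where "T > 0" "(N, x, \<beta>) \<in> GS T (Suc i)" by (auto simp: M_def)
  from M_I[OF GS_next[OF this(2)]] this(1) p_pos show ?thesis by simp
qed

lemma M_to_0: "x \<in> M i N \<Longrightarrow> x \<in> M 0 N"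
  by (induction i) (simp, blast intro: M_next)

lemma z_M0: "z i \<in> M 0 (e i)" by (rule M_to_0[OF z_M])

text \<open>For \<open>i = 0\<close> this is the minimality of \<open>d\<close>: a stripped
  \<open>y\<close> has smaller degree, where \<open>K G\<close> is everything. Frobenius carries it
  along, because stripping a letter from an image leaves images of stripped elements.\<close>

lemma z_Lo: "l \<in> X \<Longrightarrow> fst l \<le> e i \<Longrightarrow> Lo l (z i) \<in> K G (e i - fst l)"
proof (induction i arbitrary: l)
  case 0
  have "Lo l y \<in> hom (d - fst l)" using hom_Lo[OF y_hom] 0 by (simp add: e_def)
  moreover have "d - fst l < d" using d_pos letter_pos[OF 0(1)] by simp
  ultimately have "Lo l y \<in> K G (d - fst l)" using low by blast
  then show ?case by (simp add: z_def e_def)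
next
  case (Suc i)
  have "sc (f a l) (Fr (Lo a (z i))) \<in> K G (e (Suc i) - fst l)" for a
  proof (cases "f a l = 0")
    case False
    then have a: "a \<in> X" "fst l = p * fst a" using f_supp by auto
    then have "fst a \<le> e i" using Suc.prems p_pos by (simp add: e_Suc)
    then have "Fr (Lo a (z i)) \<in> K G (p * (e i - fst a))" using Suc.IH a K_Fr by blast
    then show ?thesis using a by (simp add: e_Suc diff_mult_distrib2 K_sc)
  qed simp
  then have "Lo l (Fr (z i)) \<in> K G (e (Suc i) - fst l)"
    unfolding Fr_Cons[OF letter_pos[OF Suc.prems(1)]] by (intro K_sum) auto
  then show ?case by (simp add: z_def)
qed

lemma zpw_Lo: "l \<in> X \<Longrightarrow> fst l \<le> t * e i \<Longrightarrow> Lo l (A.pw (z i) t) \<in> M i (t * e i - fst l)"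
proof (induction t arbitrary: l)
  case 0 then show ?case using letter_pos[of l] by simp
next
  case (Suc t)
  have "Lo l (A.qm (z i) (A.pw (z i) t)) \<in> M i (e i + t * e i - fst l)"
    by (rule A.Lo_qm_closed[where M = "M i", OF M_hom M_0 M_add M_sc M_mult z_M zpw_M K_M[OF z_Lo] Suc.IH Suc.prems(1)])
      (use Suc.prems in auto)
  then show ?case by simp
qed

lemma M_Lo: "x \<in> M i N \<Longrightarrow> l \<in> X \<Longrightarrow> fst l \<le> N \<Longrightarrow> Lo l x \<in> M i (N - fst l)"
proof -
  assume x: "x \<in> M i N" and l: "l \<in> X" "fst l \<le> N"
  from x obtain T \<beta> where "(N, x, \<beta>) \<in> GS T i" unfolding M_def by blast
  then show ?thesis using l(2)
  proof (induction N x \<beta> rule: GS.induct)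
    case (base n k \<beta> t)
    have k: "k \<in> K G n" using base by (auto simp: K_def)
    show ?case
      by (rule A.Lo_qm_closed[where M = "M i", OF M_hom M_0 M_add M_sc M_mult K_M[OF k] zpw_M K_M[OF G_Lo[OF k]] zpw_Lo l(1) base(3)])
  next
    case (add N x \<beta> x' \<beta>')
    have "Lo l x + Lo l x' \<in> M i (N - fst l)" by (rule M_add) (use add in blast)+
    then show ?case by (simp add: Lo_add)
  qed
qed

end

section \<open>The derivation attached to a functional\<close>

context gdext
begin

text \<open>A functional that separates \<open>z i\<close> from \<open>K G\<close>. It has this
  property only if \<open>z i\<close> lies outside \<open>K G\<close>, which the users of
  \<open>pi\<close> have to provide.\<close>

definition pi where
  "pi i = (SOME \<pi>. (\<forall>x\<in>K G (e i). R (e i) \<pi> x [] = 0) \<and> R (e i) \<pi> (z i) [] = 1)"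

text \<open>The operator that differentiates polynomials in \<open>z i\<close> with respect to
  \<open>z i\<close>, realised through the coproduct.\<close>

definition D where "D i x = R (e i) (pi i) x"

lemma pi_props:
  assumes "z i \<notin> K G (e i)"
  shows "x \<in> K G (e i) \<Longrightarrow> D i x [] = 0" "D i (z i) [] = 1"
proof -
  interpret VS: vector_space "sc :: 'k \<Rightarrow> ('k, 'x) ser \<Rightarrow> _" by (rule vector_space_sc)
  have "VS.subspace (K G (e i))" by (rule VS.subspaceI) (auto intro: K_add K_sc)
  then obtain g where g: "Vector_Spaces.linear sc (*) g" "\<forall>x\<in>K G (e i). g x = 0" "g (z i) = 1"
    using VS.functional_ex assms by blast
  interpret L: Vector_Spaces.linear sc "(*)" g by (rule g(1))
  have "R (e i) (\<lambda>v. g (bs v)) x [] = g x" if "x \<in> hom (e i)" for x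
  proof -
    have "g x = g (\<Sum>w\<in>W (e i). sc (x w) (bs w))" using hom_expand[OF that] by simp
    also have "\<dots> = (\<Sum>w\<in>W (e i). x w * g (bs w))" by (simp add: L.sum L.scale)
    finally show ?thesis by (simp add: R_def mult.commute)
  qed
  then have "\<exists>\<pi>. (\<forall>x\<in>K G (e i). R (e i) \<pi> x [] = 0) \<and> R (e i) \<pi> (z i) [] = 1"
    using g K_hom z_hom by (intro exI[of _ "\<lambda>v. g (bs v)"]) auto
  from someI_ex[OF this]
  show "x \<in> K G (e i) \<Longrightarrow> D i x [] = 0" "D i (z i) [] = 1" unfolding D_def pi_def by blast+
qed

lemma D_add: "D i (x + x') = D i x + D i x'" by (simp add: D_def R_add)
lemma D_diff: "D i (x - x') = D i x - D i x'" by (simp add: D_def R_diff)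
lemma D_sc: "D i (sc a x) = sc a (D i x)" by (simp add: D_def R_sc)
lemma D_0 [simp]: "D i 0 = 0" by (simp add: D_def)
lemma D_sum: "D i (\<Sum>s\<in>S. g s) = (\<Sum>s\<in>S. D i (g s))" by (simp add: D_def R_sum)
lemma D_hom: "x \<in> hom N \<Longrightarrow> e i \<le> N \<Longrightarrow> D i x \<in> hom (N - e i)" by (simp add: D_def hom_R)
lemma D_hom_0: "x \<in> hom N \<Longrightarrow> N < e i \<Longrightarrow> D i x = 0" by (simp add: D_def R_hom_0)

end

locale gdstep = gdext X u0 p f mA pcA mB pcB G d y b
  for X :: "(nat \<times> 'x) set" and u0 :: "nat \<times> 'x" and p :: nat and f :: "nat \<times> 'x \<Rightarrow> nat \<times> 'x \<Rightarrow> 'k::field"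
    and mA pcA mB pcB and G :: "(nat \<times> ('k, 'x) ser \<times> ('k, 'x) ser) set"
    and d :: nat and y b :: "('k, 'x) ser" +
  fixes i :: nat
  assumes zK: "z i \<notin> K G (e i)"
begin

text \<open>\<open>K G\<close> is a left coideal: the right factors of the coproducts of its
  elements stay in \<open>K G\<close>, where the functional vanishes.\<close>

lemma D_K: "x \<in> K G n \<Longrightarrow> D i x = 0"
proof (rule ext)
  fix u assume "x \<in> K G n"
  then show "D i x u = 0 u"
  proof (induction u arbitrary: x n)
    case Nil
    show ?case
    proof (cases "n = e i")
      case True then show ?thesis using pi_props(1)[OF zK] Nil by (simp add: fun_app)
    next
      case False
      then have "x v = 0" if "v \<in> W (e i)" for v using K_hom[OF Nil] that by (auto simp: hom_def W_def)
      then show ?thesis by (simp add: D_def R_def fun_app)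
    qed
  next
    case (Cons l u)
    show ?case
    proof (cases "l \<in> X \<and> fst l \<le> n")
      case True
      then have "Lo l x \<in> K G (n - fst l)" using G_Lo Cons.prems by blast
      then have "D i (Lo l x) u = 0" using Cons.IH by (simp add: fun_app)
      moreover have "D i (Lo l x) u = Lo l (D i x) u" by (simp add: D_def Lo_R)
      ultimately show ?thesis using True letter_pos[of l] by (simp add: fun_app)
    next
      case False
      then have "x (l # u @ v) = 0" for v using K_hom[OF Cons.prems] by (auto simp: hom_def W_def)
      then show ?thesis by (simp add: D_def R_def fun_app)
    qed
  qed
qed

lemma R_eps: "R 0 (\<lambda>_. 1) x = x"
  by (simp add: R_def W_0)

lemma hom_Lo_S:
  assumes "x \<in> M i N"
  shows "Lo l x \<in> {x. \<exists>N. x \<in> M i N}"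
proof -
  have h: "x \<in> hom N" using assms M_hom by blast
  consider "fst l = 0" | "l \<in> X" "fst l \<le> N" | "fst l > N" | "fst l > 0" "l \<notin> X"
    by (cases "fst l = 0"; cases "l \<in> X"; cases "fst l \<le> N") auto
  then have "\<exists>N. Lo l x \<in> M i N"
  proof cases
    case 1 then show ?thesis using assms by auto
  next
    case 2 then show ?thesis using M_Lo[OF assms] by blast
  next
    case 3 then show ?thesis using hom_Lo_0[OF h] by (metis M_0)
  next
    case 4
    then have "Lo l x = 0" using h by (auto simp: Lo_def fun_eq_iff hom_def W_def fun_app)
    then show ?thesis by (metis M_0)
  qed
  then show ?thesis by blast
qed

text \<open>By \<open>R_qm\<close> the functional has to be a derivation at the counit. If both
  factors have positive degree and together degree \<open>e i\<close>, each lies below degree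
  \<open>e i\<close>, where \<open>M i\<close> is just \<open>K G\<close>; so their product is in
  \<open>K G\<close> and the functional kills it. A factor of degree \<open>0\<close> is a
  scalar.\<close>

lemma D_prod:
  assumes "x \<in> M i N" "x' \<in> M i N'"
  shows "D i (A.qm x x') = A.qm x (D i x') + A.qm (D i x) (tw (e i) x')"
proof -
  let ?S = "{x. \<exists>N. x \<in> M i N}"
  have tw: "tw n x \<in> ?S" if xS: "x \<in> ?S" for x n
  proof -
    obtain N where N: "x \<in> M i N" using xS by blast
    then have "x \<in> hom N" using M_hom by blast
    then show ?thesis using M_sc[OF N] by (auto simp: hom_tw)
  qed
  have ev: "D i (A.qm x x') [] = x [] * D i x' [] + D i x [] * x' []" if xx: "x \<in> M i N" "x' \<in> M i N'" for x x' N N'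
  proof -
    have h: "x \<in> hom N" "x' \<in> hom N'" using xx M_hom by blast+
    show ?thesis
    proof (cases "N = 0 \<or> N' = 0")
      case True
      then show ?thesis
      proof
        assume N: "N = 0"
        then have "x = sc (x []) (bs [])" using h hom_zero_iff by blast
        then have "A.qm x x' = A.qm (sc (x []) (bs [])) x'" by (rule arg_cong)
        then have "A.qm x x' = sc (x []) x'" using A.qm_sc(1)[of "x []" "bs []" x'] A.qm_one_left[OF h(2)] by simp
        moreover have "D i x = 0" using D_hom_0[OF h(1)] e_pos N by simp
        ultimately show ?thesis by (simp add: D_sc fun_app)
      next
        assume N: "N' = 0"
        then have "x' = sc (x' []) (bs [])" using h hom_zero_iff by blast
        then have "A.qm x x' = A.qm x (sc (x' []) (bs []))" by (rule arg_cong)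
        then have "A.qm x x' = sc (x' []) x" using A.qm_sc(2)[of x "x' []" "bs []"] A.qm_one_right[OF h(1)] by simp
        moreover have "D i x' = 0" using D_hom_0[OF h(2)] e_pos N by simp
        ultimately show ?thesis by (simp add: D_sc fun_app mult.commute)
      qed
    next
      case False
      then have 0: "x [] = 0" "x' [] = 0" using hom_Nil h by auto
      have "D i (A.qm x x') [] = 0"
      proof (cases "N + N' = e i")
        case True
        then have "x \<in> K G N" "x' \<in> K G N'" using M_low xx False by auto
        then have "A.qm x x' \<in> K G (e i)" using K_mult[of x N x' N'] True by simp
        then show ?thesis using pi_props(1)[OF zK] by blast
      next
        case neq: False
        have "(A.qm x x') v = 0" if "v \<in> W (e i)" for v
          using A.hom_qm[OF h] neq that by (auto simp: hom_def W_def)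
        then show ?thesis by (simp add: D_def R_def)
      qed
      then show ?thesis using 0 by simp
    qed
  qed
  \<comment> \<open>The two terms of the Leibniz rule: \<open>True\<close> contracts the second
    factor with the functional, \<open>False\<close> the first one; the other factor is contracted
    with the counit.\<close>
  define d1 f1 d2 f2 where "d1 s = (if s then 0 else e i)" and "f1 s = (if s then (\<lambda>_. 1) else pi i)"
    and "d2 s = (if s then e i else 0)" and "f2 s = (if s then pi i else (\<lambda>_. 1))" for s
  have "R (e i) (pi i) (A.qm x x') = (\<Sum>s\<in>{True, False}. sc 1 (A.qm (R (d1 s) (f1 s) x) (tw (d1 s) (R (d2 s) (f2 s) x'))))"
  proof (rule A.R_qm[where S = ?S and q = "\<lambda>_. 1"])
    show "Lo l x \<in> ?S" if "x \<in> ?S" for x l using that hom_Lo_S by blast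
    show "tw n x \<in> ?S" if "x \<in> ?S" for x n by (rule tw[OF that])
    show "R (e i) (pi i) (A.qm x x') [] = (\<Sum>s\<in>{True, False}. 1 * (R (d1 s) (f1 s) x [] * R (d2 s) (f2 s) x' []))"
      if "x \<in> ?S" "x' \<in> ?S" for x x'
      using ev that by (auto simp: d1_def d2_def f1_def f2_def R_eps D_def)
  qed (use assms in blast)+
  then show ?thesis by (simp add: d1_def d2_def f1_def f2_def R_eps D_def)
qed

lemma D_z: "D i (z i) = bs []"
  using hom_zero_iff[of "D i (z i)"] D_hom[OF z_hom order_refl] pi_props(2)[OF zK] by simp

lemma D_one: "D i (bs []) = 0" using D_K[OF K_one] .

lemma tw_e: "\<not> (odd (e i) \<and> p \<noteq> 2) \<Longrightarrow> tw (e i) x = (x :: ('k, 'x) ser)"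
  by (cases "p = 2") (auto simp: tw_even tw_char2[OF A.char2])

lemma D_zpw_even: "\<not> (odd (e i) \<and> p \<noteq> 2) \<Longrightarrow> D i (A.pw (z i) (Suc s)) = sc (of_nat (Suc s)) (A.pw (z i) s)"
proof (induction s)
  case 0
  then show ?case using D_z A.pw_1(2)[OF z_hom] by simp
next
  case (Suc s)
  have "D i (A.pw (z i) (Suc (Suc s))) = A.qm (z i) (D i (A.pw (z i) (Suc s))) + A.qm (D i (z i)) (tw (e i) (A.pw (z i) (Suc s)))"
    using D_prod[OF z_M zpw_M[of i "Suc s"]] by simp
  also have "\<dots> = A.qm (z i) (sc (of_nat (Suc s)) (A.pw (z i) s)) + A.qm (bs []) (A.pw (z i) (Suc s))"
    using Suc tw_e D_z by simp
  also have "\<dots> = sc (of_nat (Suc s)) (A.pw (z i) (Suc s)) + A.pw (z i) (Suc s)"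
    using A.qm_one_left[OF zpw_hom] by (simp only: A.qm_sc A.pw.simps(2)[symmetric])
  also have "\<dots> = sc (of_nat (Suc (Suc s))) (A.pw (z i) (Suc s))"
    by (auto simp: fun_eq_iff fun_app algebra_simps simp del: A.pw.simps)
  finally show ?case .
qed

lemma D_zpw: "s < r i \<Longrightarrow> D i (A.pw (z i) s) = sc (of_nat s) (A.pw (z i) (s - 1))"
proof -
  assume s: "s < r i"
  show ?thesis
  proof (cases "odd (e i) \<and> p \<noteq> 2")
    case True
    then have "s = 0 \<or> s = 1" using s by (auto simp: r_def)
    then show ?thesis using D_one D_z A.pw_1(2)[OF z_hom] by auto
  next
    case False
    then show ?thesis using D_zpw_even D_one by (cases s) (auto simp del: A.pw.simps(2))
  qed
qed

lemma D_zSuc: "D i (z (Suc i)) = 0"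
proof (cases "odd (e i) \<and> p \<noteq> 2")
  case True
  then show ?thesis using odd_pw[of i p] p_ge2 by (simp add: z_Suc)
next
  case False
  obtain q where q: "p = Suc q" using p_pos by (cases p) auto
  have "of_nat (Suc q) = (0::'k)" using char_p q by (metis of_nat_CHAR)
  then have "D i (A.pw (z i) (Suc q)) = 0" using D_zpw_even[OF False, of q] by (simp only: sc_simps)
  then show ?thesis unfolding z_Suc by (simp only: q[symmetric])
qed

lemma D_zSuc_pw: "D i (A.pw (z (Suc i)) t) = 0"
proof (induction t)
  case (Suc t)
  have "A.pw (z (Suc i)) t \<in> M i (t * e (Suc i))" "z (Suc i) \<in> M i (e (Suc i))"
    using M_next zpw_M z_M by blast+
  then show ?case using D_prod[of "z (Suc i)" _ "A.pw (z (Suc i)) t"] D_zSuc Suc by simp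
qed (simp add: D_one)

text \<open>The next iterate \<open>z (Suc i)\<close> is the \<open>p\<close>-th power of
  \<open>z i\<close>, so its derivative has the factor \<open>p\<close>, or it is zero already; the
  coefficients from \<open>K G\<close> have derivative zero too.\<close>

lemma D_next: "x \<in> M (Suc i) N \<Longrightarrow> D i x = 0"
proof -
  assume "x \<in> M (Suc i) N"
  then obtain T \<beta> where "(N, x, \<beta>) \<in> GS T (Suc i)" by (auto simp: M_def)
  then show ?thesis
  proof (induction N x \<beta> rule: GS.induct)
    case (base n k \<beta> t)
    have k: "k \<in> K G n" using base by (auto simp: K_def)
    then show ?case
      using D_prod[OF K_M[OF k] M_next[OF zpw_M]] D_zSuc_pw D_K[OF k] by simp
  qed (simp add: D_add)
qed

lemma D_term: "x \<in> M (Suc i) N \<Longrightarrow> s < r i \<Longrightarrow> D i (A.qm x (A.pw (z i) s)) = sc (of_nat s) (A.qm x (A.pw (z i) (s - 1)))"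
  using D_prod[OF M_next zpw_M] D_next D_zpw by (simp add: A.qm_sc)

lemma of_nat_ne: "0 < s \<Longrightarrow> s < p \<Longrightarrow> of_nat s \<noteq> (0::'k)"
  using char_p by (auto simp: of_nat_eq_0_iff_char_dvd dest: dvd_imp_le)

lemma D_poly:
  assumes "Suc t \<le> r i" "\<And>s. s < Suc t \<Longrightarrow> k s \<in> M (Suc i) (n s)"
  shows "D i (\<Sum>s<Suc t. A.qm (k s) (A.pw (z i) s)) = (\<Sum>s<t. A.qm (sc (of_nat (Suc s)) (k (Suc s))) (A.pw (z i) s))"
proof -
  have "D i (A.qm (k s) (A.pw (z i) s)) = sc (of_nat s) (A.qm (k s) (A.pw (z i) (s - 1)))" if "s < Suc t" for s
    using D_term[OF assms(2)[OF that]] assms(1) that by simp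
  then have "D i (\<Sum>s<Suc t. A.qm (k s) (A.pw (z i) s)) = (\<Sum>s<Suc t. sc (of_nat s) (A.qm (k s) (A.pw (z i) (s - 1))))"
    unfolding D_sum by (intro sum.cong) auto
  also have "\<dots> = (\<Sum>s<t. sc (of_nat (Suc s)) (A.qm (k (Suc s)) (A.pw (z i) s)))"
    by (subst sum.lessThan_Suc_shift) (simp del: of_nat_Suc)
  finally show ?thesis by (simp only: A.qm_sc)
qed

text \<open>The coefficients of a polynomial in \<open>z\<^sub>i\<close> over \<open>M (Suc i)\<close> lie in every family that contains the
  polynomial and is stable under \<open>D i\<close> and multiplication by \<open>z\<^sub>i\<close>.\<close>

lemma coeff_mem:
  assumes Q: "\<And>n. Q n \<subseteq> hom n" "\<And>n x x'. x \<in> Q n \<Longrightarrow> x' \<in> Q n \<Longrightarrow> x - x' \<in> Q n" "\<And>n x a. x \<in> Q n \<Longrightarrow> sc a x \<in> Q n"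
    "\<And>n. 0 \<in> Q n" "\<And>n x. x \<in> Q n \<Longrightarrow> e i \<le> n \<Longrightarrow> D i x \<in> Q (n - e i)" "\<And>n x. x \<in> Q n \<Longrightarrow> A.qm x (z i) \<in> Q (n + e i)"
    and t: "t \<le> r i"
    and k: "\<And>s. s < t \<Longrightarrow> s * e i \<le> N \<Longrightarrow> k s \<in> M (Suc i) (N - s * e i)" "\<And>s. s < t \<Longrightarrow> N < s * e i \<Longrightarrow> k s = 0"
    and x: "(\<Sum>s<t. A.qm (k s) (A.pw (z i) s)) \<in> Q N"
    and s: "s < t" "s * e i \<le> N"
  shows "k s \<in> Q (N - s * e i)"
  using t k x s
proof (induction t arbitrary: k N s)
  case 0 then show ?case by simp
next
  case (Suc t)
  have kM: "\<exists>n. k s \<in> M (Suc i) n" if "s < Suc t" for s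
    using Suc.prems(2,3)[OF that] by (cases "s * e i \<le> N") (auto intro: exI[of _ 0])
  then obtain n where n: "\<And>s. s < Suc t \<Longrightarrow> k s \<in> M (Suc i) (n s)" by metis
  let ?x = "\<Sum>s<Suc t. A.qm (k s) (A.pw (z i) s)"
  have Qpw: "A.qm x (A.pw (z i) s) \<in> Q (n + s * e i)" if "x \<in> Q n" for x n s
    using that
  proof (induction s arbitrary: x n)
    case 0
    then have "x \<in> hom n" using Q(1) by blast
    then show ?case using 0 A.qm_one_right by simp
  next
    case (Suc s)
    from Suc.IH[OF Q(6)[OF Suc.prems]] show ?case by (simp add: A.qm_assoc add.assoc)
  qed
  \<comment> \<open>Differentiation shifts the coefficients down by one place with factors
    \<open>Suc s\<close>; these are invertible because they stay below \<open>r i\<close>, which is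
    at most \<open>p\<close>.\<close>
  have ks: "k (Suc s) \<in> Q (N - Suc s * e i)" if s: "s < t" "Suc s * e i \<le> N" for s
  proof -
    have le: "e i \<le> N" using s by simp
    have 1: "D i ?x \<in> Q (N - e i)" by (rule Q(5)[OF Suc.prems(4) le])
    have "D i ?x = (\<Sum>s<t. A.qm (sc (of_nat (Suc s)) (k (Suc s))) (A.pw (z i) s))"
      by (rule D_poly[OF Suc.prems(1) n])
    with 1 have 2: "(\<Sum>s<t. A.qm (sc (of_nat (Suc s)) (k (Suc s))) (A.pw (z i) s)) \<in> Q (N - e i)" by simp
    have "sc (of_nat (Suc s)) (k (Suc s)) \<in> Q (N - e i - s * e i)"
    proof (rule Suc.IH[OF _ _ _ 2 s(1)])
      show "t \<le> r i" using Suc.prems(1) by simp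
      show "sc (of_nat (Suc s)) (k (Suc s)) \<in> M (Suc i) (N - e i - s * e i)" if "s < t" "s * e i \<le> N - e i" for s
        using M_sc[OF Suc.prems(2)[of "Suc s"]] that le by simp
      show "sc (of_nat (Suc s)) (k (Suc s)) = 0" if "s < t" "N - e i < s * e i" for s
        using Suc.prems(3)[of "Suc s"] that le by simp
      show "s * e i \<le> N - e i" using s by simp
    qed
    from Q(3)[OF this, of "inverse (of_nat (Suc s))"]
    have "sc (inverse (of_nat (Suc s)) * of_nat (Suc s)) (k (Suc s)) \<in> Q (N - Suc s * e i)" by (simp add: add.commute)
    moreover have "of_nat (Suc s) \<noteq> (0::'k)" using of_nat_ne[of "Suc s"] s Suc.prems(1) r_le(1)[of i] by simp
    ultimately show ?thesis by (simp del: of_nat_Suc)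
  qed
  have k0: "k 0 \<in> Q N"
  proof -
    have "(\<Sum>s<t'. A.qm (k (Suc s)) (A.pw (z i) (Suc s))) \<in> Q N" if "t' \<le> t" for t'
      using that
    proof (induction t')
      case 0 show ?case using Q(4) by simp
    next
      case (Suc t')
      have "A.qm (k (Suc t')) (A.pw (z i) (Suc t')) \<in> Q N"
      proof (cases "Suc t' * e i \<le> N")
        case True
        then show ?thesis using Qpw[OF ks[of t'], of "Suc t'"] Suc.prems by simp
      next
        case False
        then have "k (Suc t') = 0" using \<open>\<And>s. s < Suc t \<Longrightarrow> N < s * e i \<Longrightarrow> k s = 0\<close> Suc.prems by simp
        then show ?thesis using Q(4) by simp
      qed
      moreover have "x + x' \<in> Q N" if "x \<in> Q N" "x' \<in> Q N" for x x'
        using Q(2)[OF that(1) Q(2)[OF Q(4) that(2)]] by simp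
      ultimately show ?case using Suc by simp
    qed
    then have 1: "(\<Sum>s<t. A.qm (k (Suc s)) (A.pw (z i) (Suc s))) \<in> Q N" by blast
    have "k 0 \<in> hom (n 0)" using n[of 0] M_hom by blast
    then have "A.qm (k 0) (bs []) = k 0" by (rule A.qm_one_right)
    then have "?x = k 0 + (\<Sum>s<t. A.qm (k (Suc s)) (A.pw (z i) (Suc s)))"
      by (subst sum.lessThan_Suc_shift) simp
    then have "k 0 = ?x - (\<Sum>s<t. A.qm (k (Suc s)) (A.pw (z i) (Suc s)))" by simp
    then show ?thesis using Q(2)[OF Suc.prems(4) 1] by simp
  qed
  show ?case
  proof (cases s)
    case 0 then show ?thesis using k0 by simp
  next
    case (Suc s')
    then show ?thesis using ks[of s'] \<open>s < Suc t\<close> \<open>s * e i \<le> N\<close> by simp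
  qed
qed

text \<open>Knowledge of the derivative alone still controls every coefficient except the constant
  one. This serves elements that lie in the family only up to a term with a known
  derivative.\<close>

lemma coeff_mem_D:
  assumes Q: "\<And>n. Q n \<subseteq> hom n" "\<And>n x x'. x \<in> Q n \<Longrightarrow> x' \<in> Q n \<Longrightarrow> x - x' \<in> Q n" "\<And>n x a. x \<in> Q n \<Longrightarrow> sc a x \<in> Q n"
    "\<And>n. 0 \<in> Q n" "\<And>n x. x \<in> Q n \<Longrightarrow> e i \<le> n \<Longrightarrow> D i x \<in> Q (n - e i)" "\<And>n x. x \<in> Q n \<Longrightarrow> A.qm x (z i) \<in> Q (n + e i)"
    and k: "\<And>s. s < r i \<Longrightarrow> s * e i \<le> N \<Longrightarrow> k s \<in> M (Suc i) (N - s * e i)" "\<And>s. s < r i \<Longrightarrow> N < s * e i \<Longrightarrow> k s = 0"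
    and x: "e i \<le> N \<Longrightarrow> D i (\<Sum>s<r i. A.qm (k s) (A.pw (z i) s)) \<in> Q (N - e i)"
    and s: "Suc s < r i" "Suc s * e i \<le> N"
  shows "k (Suc s) \<in> Q (N - Suc s * e i)"
proof -
  obtain t where t: "r i = Suc t" using s by (cases "r i") auto
  have kM: "\<exists>n. k s \<in> M (Suc i) n" if "s < Suc t" for s
    using k that t by (cases "s * e i \<le> N") (auto intro: exI[of _ 0])
  then obtain n where n: "\<And>s. s < Suc t \<Longrightarrow> k s \<in> M (Suc i) (n s)" by metis
  have le: "e i \<le> N" using s by simp
  have 2: "(\<Sum>s<t. A.qm (sc (of_nat (Suc s)) (k (Suc s))) (A.pw (z i) s)) \<in> Q (N - e i)"
    using x[OF le] D_poly[of t k n] n t by simp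
  have "sc (of_nat (Suc s)) (k (Suc s)) \<in> Q (N - e i - s * e i)"
  proof (rule coeff_mem[OF Q _ _ _ 2])
    show "t \<le> r i" using t by simp
    show "sc (of_nat (Suc s)) (k (Suc s)) \<in> M (Suc i) (N - e i - s * e i)" if "s < t" "s * e i \<le> N - e i" for s
      using M_sc[OF k(1)[of "Suc s"]] that le t by simp
    show "sc (of_nat (Suc s)) (k (Suc s)) = 0" if "s < t" "N - e i < s * e i" for s
      using k(2)[of "Suc s"] that le t by simp
    show "s * e i \<le> N - e i" "s < t" using s t by simp_all
  qed
  from Q(3)[OF this, of "inverse (of_nat (Suc s))"]
  have "sc (inverse (of_nat (Suc s)) * of_nat (Suc s)) (k (Suc s)) \<in> Q (N - Suc s * e i)" by (simp add: add.commute)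
  moreover have "of_nat (Suc s) \<noteq> (0::'k)" using of_nat_ne[of "Suc s"] s r_le(1)[of i] by simp
  ultimately show ?thesis by (simp del: of_nat_Suc)
qed

end

context lfrob
begin

lemma FF_mono: "(\<And>n. S n \<subseteq> S' n) \<Longrightarrow> FF S j N \<subseteq> FF S' j N"
  unfolding FF_def by blast

lemma FF_add:
  assumes "\<And>n x y. x \<in> S n \<Longrightarrow> y \<in> S n \<Longrightarrow> x - y \<in> S n" "\<And>n. 0 \<in> S n" "x \<in> FF S j N" "y \<in> FF S j N"
  shows "x + y \<in> FF S j N"
  using FF_diff[OF assms(1,2,3) FF_diff[OF assms(1,2) FF_0[OF assms(2)] assms(4)]] by simp

lemma FF_sum:
  assumes "\<And>n x y. x \<in> S n \<Longrightarrow> y \<in> S n \<Longrightarrow> x - y \<in> S n" "\<And>n. 0 \<in> S n" "\<And>s. s \<in> C \<Longrightarrow> g s \<in> FF S j N"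
  shows "(\<Sum>s\<in>C. g s) \<in> FF S j N"
  using assms(3) FF_0[OF assms(2)] FF_add[OF assms(1,2)]
  by (induction C rule: infinite_finite_induct) auto

lemma Fj_one: "Fj j (bs []) = bs []"
proof (induction j)
  case (Suc j)
  have "fr [] = (bs [] :: ('k, 'x) ser)" by (auto simp: bs_def)
  then show ?case using Suc Fr_bs[of "[]"] by simp
qed simp

lemma FF_exact: "x \<in> FF S j (p ^ j * n) \<Longrightarrow> 0 \<in> S n \<Longrightarrow> \<exists>w\<in>S n. x = Fj j w"
proof -
  assume x: "x \<in> FF S j (p ^ j * n)" and 0: "0 \<in> S n"
  obtain n' w where "w \<in> S n'" "x = Fj j w" "p ^ j * n = p ^ j * n' \<or> x = 0" using x by (auto simp: FF_def)
  then show ?thesis using 0 p_pos bexI[of "\<lambda>w. x = Fj j w" 0 "S n"] by (cases "x = 0") auto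
qed

end

context gdstep
begin

text \<open>The case of the zero family: the powers of \<open>z i\<close> below \<open>r i\<close>
  are linearly independent over \<open>M (Suc i)\<close>.\<close>

lemma coeff_zero:
  assumes "\<And>s. s < r i \<Longrightarrow> s * e i \<le> N \<Longrightarrow> k s \<in> M (Suc i) (N - s * e i)" "\<And>s. s < r i \<Longrightarrow> N < s * e i \<Longrightarrow> k s = 0"
    and "(\<Sum>s<r i. A.qm (k s) (A.pw (z i) s)) = 0" "s < r i" "s * e i \<le> N"
  shows "k s = 0"
proof -
  have "k s \<in> {0}"
  proof (rule coeff_mem[where Q = "\<lambda>_. {0}" and k = k and N = N and t = "r i"])
    show "k s \<in> M (Suc i) (N - s * e i)" if "s < r i" "s * e i \<le> N" for s using assms(1) that .
    show "k s = 0" if "s < r i" "N < s * e i" for s using assms(2) that .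
  qed (simp_all add: assms(3-5))
  then show ?thesis by simp
qed

lemma coeff_zero_D:
  assumes "\<And>s. s < r i \<Longrightarrow> s * e i \<le> N \<Longrightarrow> k s \<in> M (Suc i) (N - s * e i)" "\<And>s. s < r i \<Longrightarrow> N < s * e i \<Longrightarrow> k s = 0"
    and "D i (\<Sum>s<r i. A.qm (k s) (A.pw (z i) s)) = 0" "Suc s < r i" "Suc s * e i \<le> N"
  shows "k (Suc s) = 0"
proof -
  have "k (Suc s) \<in> {0}"
  proof (rule coeff_mem_D[where Q = "\<lambda>_. {0}" and k = k and N = N])
    show "k s \<in> M (Suc i) (N - s * e i)" if "s < r i" "s * e i \<le> N" for s using assms(1) that .
    show "k s = 0" if "s < r i" "N < s * e i" for s using assms(2) that .
  qed (use assms(3-5) in simp_all)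
  then show ?thesis by simp
qed

end

section \<open>Single-valuedness, purity and primitive elements for the extended map\<close>

context gdext
begin

lemma GS_Mp: "(N, x, \<beta>) \<in> GS (p ^ q) i \<Longrightarrow> x \<in> M i N"
  using M_I[of N x \<beta> "p ^ q" i] p_pos by simp

lemma gdstepI: "z i \<notin> K G (e i) \<Longrightarrow> gdstep X u0 p f mA pcA mB pcB G d y b i"
  by unfold_locales

text \<open>Puts an arbitrary bound on the degree into the shape that expansion in base
  \<open>p\<close> expects.\<close>

lemma GS_pow: "(N, x, \<beta>) \<in> GS T i \<Longrightarrow> (N, x, \<beta>) \<in> GS (p ^ T) i"
proof (rule GS_mono)
  have "T < 2 ^ T" by (rule less_exp)
  also have "(2::nat) ^ T \<le> p ^ T" using p_ge2 by (rule power_mono) simp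
  finally show "T \<le> p ^ T" by simp
qed

text \<open>The values are well defined modulo \<open>I\<close>. A vanishing polynomial has
  vanishing digits, so their values lie in \<open>I\<close> by induction and \<open>I\<close> is an
  ideal. The descent stops at \<open>q = 0\<close>, or as soon as \<open>z i\<close> lies in
  \<open>K G\<close> and the whole relation is contained in \<open>G\<close>.\<close>

lemma GS_zero: "(N, 0, \<beta>) \<in> GS (p ^ q) i \<Longrightarrow> \<beta> \<in> I N"
proof (induction q arbitrary: i N \<beta>)
  case 0 then show ?case using GS_1 G_0 by simp
next
  case (Suc q)
  show ?case
  proof (cases "z i \<in> K G (e i)")
    case True then show ?thesis using GS_inK Suc.prems G_0 by blast
  next
    case False
    interpret S: gdstep X u0 p f mA pcA mB pcB G d y b i by (rule gdstepI[OF False])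
    obtain k \<mu> where km: "\<And>s. s < r i \<Longrightarrow> s * e i \<le> N \<Longrightarrow> (N - s * e i, k s, \<mu> s) \<in> GS (p ^ q) (Suc i)"
      "\<And>s. s < r i \<Longrightarrow> N < s * e i \<Longrightarrow> k s = 0 \<and> \<mu> s = 0"
      "0 = (\<Sum>s<r i. A.qm (k s) (A.pw (z i) s))" "\<beta> = (\<Sum>s<r i. B.qm (\<mu> s) (B.pw (c i) s))"
      using GS_digits[OF Suc.prems] by blast
    have "B.qm (\<mu> s) (B.pw (c i) s) \<in> I N" if s: "s < r i" for s
    proof (cases "s * e i \<le> N")
      case True
      have "k s = 0"
        by (rule S.coeff_zero[OF GS_Mp[OF km(1)] conjunct1[OF km(2)] km(3)[symmetric] s True])
      then have "\<mu> s \<in> I (N - s * e i)" using Suc.IH[of "N - s * e i" "\<mu> s" "Suc i"] km(1)[OF s True] by simp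
      from I_mult(1)[OF this cpw_hom[of i s]] True show ?thesis by simp
    qed (use km(2)[OF s] in simp)
    then show ?thesis unfolding km(4) by (intro I_sum) simp
  qed
qed

text \<open>A vanishing derivative leaves only the constant digit, which is a polynomial in
  \<open>z (Suc i)\<close>. The discarded digits are zero, so by \<open>GS_zero\<close> their values
  disturb the target only within \<open>I\<close>.\<close>

lemma digits_const:
  assumes "(N, x, \<beta>) \<in> GS (p ^ Suc q) i" "z i \<notin> K G (e i)" "D i x = 0"
  shows "\<exists>\<mu>. (N, x, \<mu>) \<in> GS (p ^ q) (Suc i) \<and> \<beta> - \<mu> \<in> I N"
proof -
  interpret S: gdstep X u0 p f mA pcA mB pcB G d y b i by (rule gdstepI[OF assms(2)])
  obtain k \<mu> where km: "\<And>s. s < r i \<Longrightarrow> s * e i \<le> N \<Longrightarrow> (N - s * e i, k s, \<mu> s) \<in> GS (p ^ q) (Suc i)"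
    "\<And>s. s < r i \<Longrightarrow> N < s * e i \<Longrightarrow> k s = 0 \<and> \<mu> s = 0"
    "x = (\<Sum>s<r i. A.qm (k s) (A.pw (z i) s))" "\<beta> = (\<Sum>s<r i. B.qm (\<mu> s) (B.pw (c i) s))"
    using GS_digits[OF assms(1)] by blast
  have k0: "k (Suc s) = 0" if s: "Suc s < r i" for s
  proof (cases "Suc s * e i \<le> N")
    case True
    have "D i (\<Sum>s<r i. A.qm (k s) (A.pw (z i) s)) = 0" using assms(3) km(3) by simp
    from S.coeff_zero_D[OF GS_Mp[OF km(1)] conjunct1[OF km(2)] this s True] show ?thesis by simp
  qed (use km(2)[OF s] in simp)
  have \<mu>0: "B.qm (\<mu> (Suc s)) (B.pw (c i) (Suc s)) \<in> I N" if s: "Suc s < r i" for s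
  proof (cases "Suc s * e i \<le> N")
    case True
    then have "\<mu> (Suc s) \<in> I (N - Suc s * e i)" using GS_zero km(1)[OF s True] k0[OF s] by simp
    from I_mult(1)[OF this cpw_hom[of i "Suc s"]] True show ?thesis by simp
  qed (use km(2)[OF s] in simp)
  obtain t where t: "r i = Suc t" using r_le(2)[of i] by (cases "r i") auto
  have G0: "(N, k 0, \<mu> 0) \<in> GS (p ^ q) (Suc i)" using km(1)[of 0] t by simp
  have h: "k 0 \<in> hom N" "\<mu> 0 \<in> hom N" using GS_hom[OF G0] by auto
  have "x = A.qm (k 0) (bs []) + (\<Sum>s<t. A.qm (k (Suc s)) (A.pw (z i) (Suc s)))"
    unfolding km(3) t by (subst sum.lessThan_Suc_shift) simp
  also have "(\<Sum>s<t. A.qm (k (Suc s)) (A.pw (z i) (Suc s))) = 0"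
    by (rule sum.neutral) (use k0 t in auto)
  finally have x: "x = k 0" using A.qm_one_right[OF h(1)] by simp
  have "\<beta> = B.qm (\<mu> 0) (bs []) + (\<Sum>s<t. B.qm (\<mu> (Suc s)) (B.pw (c i) (Suc s)))"
    unfolding km(4) t by (subst sum.lessThan_Suc_shift) simp
  then have "\<beta> - \<mu> 0 = (\<Sum>s<t. B.qm (\<mu> (Suc s)) (B.pw (c i) (Suc s)))"
    using B.qm_one_right[OF h(2)] by simp
  also have "\<dots> \<in> I N" by (rule I_sum) (use \<mu>0 t in simp)
  finally show ?thesis using G0 x by blast
qed

lemma K_FF: "x \<in> K G N \<Longrightarrow> x \<in> FF hom j N \<Longrightarrow> x \<in> FF (M 0) j N"
proof -
  assume x: "x \<in> K G N" "x \<in> FF hom j N"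
  show ?thesis
  proof (cases "x = 0")
    case True then show ?thesis using FF_0[of "M 0"] by simp
  next
    case False
    then obtain n w where w: "w \<in> hom n" "x = Fj j w" "N = p ^ j * n" using FF_E[OF x(2)] by blast
    then obtain k where "k \<in> K G n" "Fj j k = x" using G_pure[of w n j] x by auto
    then show ?thesis using FF_I[of k "M 0" n j] K_M w by auto
  qed
qed

lemma z_Fj: "j \<le> i \<Longrightarrow> z i = Fj j (z (i - j)) \<and> e i = p ^ j * e (i - j)"
  by (simp add: z_def e_def Fj_Fj mult.assoc[symmetric] power_add[symmetric])

lemma M_FF_mult: "x \<in> FF (M 0) j N \<Longrightarrow> x' \<in> FF (M 0) j N' \<Longrightarrow> A.qm x x' \<in> FF (M 0) j (N + N')"
  by (rule A.FF_mult[where S = "M 0"]) (rule M_hom M_0 M_mult | assumption)+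

lemma hom_FF_mult: "x \<in> FF hom j N \<Longrightarrow> x' \<in> FF hom j N' \<Longrightarrow> A.qm x x' \<in> FF hom j (N + N')"
  by (rule A.FF_mult[where S = hom]) (rule order_refl hom_0 A.hom_qm | assumption)+

lemma zpw_FF: "j \<le> i \<Longrightarrow> A.pw (z i) s \<in> FF (M 0) j (s * e i)"
proof (induction s)
  case 0
  then show ?case using FF_I[where S = "M 0", OF M_one, of j] by (simp add: Fj_one)
next
  case (Suc s)
  have "z i \<in> FF (M 0) j (e i)" using z_Fj[OF Suc.prems] FF_I[where S = "M 0", OF z_M0[of "i - j"], of j] by simp
  then have "A.qm (z i) (A.pw (z i) s) \<in> FF (M 0) j (e i + s * e i)"
    by (rule M_FF_mult[OF _ Suc.IH[OF Suc.prems]])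
  then show ?case by simp
qed

lemma FF_hom_props: "FF hom j n \<subseteq> hom n" "x \<in> FF hom j n \<Longrightarrow> x' \<in> FF hom j n \<Longrightarrow> x - x' \<in> FF hom j n"
  "x \<in> FF hom j n \<Longrightarrow> sc a x \<in> FF hom j n" "0 \<in> FF hom j n"
  "x \<in> FF hom j n \<Longrightarrow> e i \<le> n \<Longrightarrow> D i x \<in> FF hom j (n - e i)"
  "j \<le> i \<Longrightarrow> x \<in> FF hom j n \<Longrightarrow> A.qm x (z i) \<in> FF hom j (n + e i)"
proof -
  show "FF hom j n \<subseteq> hom n" using FF_hom by blast
  show "x \<in> FF hom j n \<Longrightarrow> x' \<in> FF hom j n \<Longrightarrow> x - x' \<in> FF hom j n" by (rule FF_diff) (auto intro: hom_diff)
  show "x \<in> FF hom j n \<Longrightarrow> sc a x \<in> FF hom j n" by (rule FF_sc) (auto intro: hom_sc)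
  show "0 \<in> FF hom j n" using FF_0[of hom] by simp
  show "x \<in> FF hom j n \<Longrightarrow> e i \<le> n \<Longrightarrow> D i x \<in> FF hom j (n - e i)" unfolding D_def by (rule FF_R)
  assume "j \<le> i" and x: "x \<in> FF hom j n"
  then have "z i \<in> FF hom j (e i)" using z_Fj FF_I[where S = hom, OF z_hom[of "i - j"], of j] by simp
  then show "A.qm x (z i) \<in> FF hom j (n + e i)" by (rule hom_FF_mult[OF x])
qed

text \<open>For \<open>j \<le> i\<close> the element \<open>z i\<close> is itself a
  \<open>j\<close>-fold Frobenius image. The images are then stable under \<open>D i\<close> and
  under multiplication by \<open>z i\<close>, so every digit of \<open>x\<close> is such an image;
  by induction it has a preimage in the new domain, and so has the sum.\<close>

lemma pure_ge:
  assumes "j \<le> i"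
  shows "(N, x, \<beta>) \<in> GS (p ^ q) i \<Longrightarrow> x \<in> FF hom j N \<Longrightarrow> x \<in> FF (M 0) j N"
  using assms
proof (induction q arbitrary: i N x \<beta>)
  case 0
  have "(N, x, \<beta>) \<in> G" using GS_1[of N x \<beta> i] 0(1) by simp
  then have "x \<in> K G N" unfolding K_def by blast
  then show ?case using K_FF 0(2) by blast
next
  case (Suc q)
  show ?case
  proof (cases "z i \<in> K G (e i)")
    case True
    then have "x \<in> K G N" using GS_inK[OF _ Suc.prems(1)] unfolding K_def by blast
    then show ?thesis using K_FF Suc.prems by blast
  next
    case False
    interpret S: gdstep X u0 p f mA pcA mB pcB G d y b i by (rule gdstepI[OF False])
    obtain k \<mu> where km: "\<And>s. s < r i \<Longrightarrow> s * e i \<le> N \<Longrightarrow> (N - s * e i, k s, \<mu> s) \<in> GS (p ^ q) (Suc i)"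
      "\<And>s. s < r i \<Longrightarrow> N < s * e i \<Longrightarrow> k s = 0 \<and> \<mu> s = 0"
      "x = (\<Sum>s<r i. A.qm (k s) (A.pw (z i) s))"
      using GS_digits[OF Suc.prems(1)] by blast
    have "A.qm (k s) (A.pw (z i) s) \<in> FF (M 0) j N" if s: "s < r i" for s
    proof (cases "s * e i \<le> N")
      case True
      have "k s \<in> FF hom j (N - s * e i)"
        by (rule S.coeff_mem[where Q = "FF hom j", OF FF_hom_props(1-5) FF_hom_props(6)[OF Suc.prems(3)] order_refl
              GS_Mp[OF km(1)] conjunct1[OF km(2)] Suc.prems(2)[unfolded km(3)] s True])
      then have "k s \<in> FF (M 0) j (N - s * e i)"
        by (rule Suc.IH[OF km(1)[OF s True]]) (use Suc.prems(3) in simp)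
      then have "A.qm (k s) (A.pw (z i) s) \<in> FF (M 0) j (N - s * e i + s * e i)"
        by (rule M_FF_mult[OF _ zpw_FF[OF Suc.prems(3)]])
      then show ?thesis using True by simp
    next
      case False
      then show ?thesis using km(2)[OF s] FF_0[of "M 0", OF M_0] by simp
    qed
    then show ?thesis unfolding km(3) by (intro FF_sum) (auto intro: M_diff)
  qed
qed

text \<open>The functional defining \<open>D i\<close> vanishes on \<open>K\<close>, which is everything in degrees below \<open>d\<close>.\<close>

lemma D_FF:
  assumes z: "z i \<notin> K G (e i)" and "i < j" and x: "x \<in> FF hom j N"
  shows "D i x = 0"
proof -
  interpret S: gdstep X u0 p f mA pcA mB pcB G d y b i by (rule gdstepI[OF z])
  obtain g' where g': "\<And>w. D i (Fj j w) = Fj j (R (e i div p ^ j) g' w)" using R_Fj[of "e i" "pi i" j] unfolding D_def by blast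
  \<comment> \<open>Here \<open>e i = p ^ i * d\<close> and \<open>i < j\<close>, so at least one
    factor \<open>p\<close> is divided out of \<open>d\<close>.\<close>
  have lt: "e i div p ^ j < d"
  proof -
    obtain l where l: "j = Suc (i + l)" using less_imp_Suc_add[OF assms(2)] by blast
    have "p ^ j = p ^ i * (p * p ^ l)" by (simp add: l power_add)
    then have "e i div p ^ j = d div (p * p ^ l)" using p_pos by (simp add: e_def)
    also have "\<dots> < d"
    proof -
      have "p * p ^ l \<ge> 2 * 1" using p_ge2 p_pos by (intro mult_mono) auto
      then show ?thesis using d_pos by (simp add: div_less_dividend)
    qed
    finally show ?thesis .
  qed
  \<comment> \<open>In degrees below \<open>d\<close> the word \<open>v\<close> belongs to
    \<open>K G\<close>, and so does its Frobenius image, which \<open>D i\<close> kills. The value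
    at the empty word is a power of \<open>g' v\<close>.\<close>
  have "g' v = 0" if v: "v \<in> W (e i div p ^ j)" for v
  proof -
    have "bs v \<in> K G (e i div p ^ j)" using low[OF lt] hom_bs[OF v] by blast
    then have "D i (Fj j (bs v)) = 0" using S.D_K K_Fj by blast
    then have "Fj j (R (e i div p ^ j) g' (bs v)) [] = 0" using g' by (simp add: fun_app)
    moreover have "Fj j w [] = w [] ^ (p ^ j)" for w
      by (induction j arbitrary: w) (simp_all add: Fr_Nil power_mult[symmetric] mult.commute)
    ultimately have "R (e i div p ^ j) g' (bs v) [] = 0" by simp
    moreover have "R (e i div p ^ j) g' (bs v) [] = g' v"
      using v by (simp add: R_def bs_def if_distrib[of "(*) _"] cong: if_cong)
    ultimately show ?thesis by simp
  qed
  then have "D i (Fj j w) = 0" for w using g' R_eq_0[of "e i div p ^ j" g'] by simp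
  then show ?thesis using FF_E[OF x] by auto
qed

text \<open>As long as \<open>i < j\<close>, the derivative of a \<open>j\<close>-fold Frobenius
  image vanishes, so the element is a polynomial in the next iterate of \<open>y\<close>. At
  \<open>i = j\<close> the case \<open>pure_ge\<close> applies.\<close>

lemma pure_M:
  assumes "i \<le> j" "x \<in> M i N" "x \<in> FF hom j N"
  shows "x \<in> FF (M 0) j N"
  using assms
proof (induction "j - i" arbitrary: i)
  case 0
  then obtain T \<beta> where "(N, x, \<beta>) \<in> GS T i" unfolding M_def by blast
  from pure_ge[OF _ GS_pow[OF this], of j] show ?case using 0 by simp
next
  case (Suc l)
  obtain T \<beta> where T: "(N, x, \<beta>) \<in> GS T i" using Suc.prems(2) unfolding M_def by blast
  show ?case
  proof (cases "z i \<in> K G (e i)")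
    case True
    then have "x \<in> K G N" using GS_inK[OF _ T] unfolding K_def by blast
    then show ?thesis using K_FF Suc.prems by blast
  next
    case False
    have "i < j" using Suc.hyps(2) by simp
    then have "D i x = 0" using D_FF[OF False _ Suc.prems(3)] by simp
    moreover have "(N, x, \<beta>) \<in> GS (p ^ Suc T) i"
      using GS_mono[OF GS_pow[OF T], of "p ^ Suc T"] p_pos by simp
    ultimately obtain \<mu> where "(N, x, \<mu>) \<in> GS (p ^ T) (Suc i)" using digits_const[OF _ False] by blast
    then have "x \<in> M (Suc i) N" by (rule GS_Mp)
    then show ?thesis using Suc.hyps(1)[of "Suc i"] Suc.hyps(2) Suc.prems by simp
  qed
qed

lemma D_V: "v \<in> V N \<Longrightarrow> D i v = sc (D i v []) (bs []) \<and> (D i v [] \<noteq> 0 \<longrightarrow> N = e i)"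
proof -
  assume v: "v \<in> V N"
  have 1: "D i v = sc (D i v []) (bs [])" unfolding D_def using V_R[OF v e_pos] .
  have "D i v [] = 0" if "N \<noteq> e i"
  proof -
    have "v w = 0" if "w \<in> W (e i)" for w using V_hom[OF v] \<open>N \<noteq> e i\<close> that by (auto simp: hom_def W_def)
    then show ?thesis by (simp add: D_def R_def)
  qed
  with 1 show ?thesis by blast
qed

text \<open>The argument of \<open>pure_ge\<close> relative to a primitive \<open>v\<close>. Since
  \<open>D i v\<close> is a scalar, the derivative of \<open>x\<close> is still a Frobenius image,
  hence so are all digits of \<open>x\<close> except the constant one. Subtracting them replaces
  \<open>x\<close> by its constant digit, one level up.\<close>

lemma vpure_ge:
  assumes "j \<le> i" "v \<in> V N" "N = p ^ j * n"
  shows "(N, x, \<beta>) \<in> GS (p ^ q) i \<Longrightarrow> x - v \<in> FF hom j N \<Longrightarrow> \<exists>v'\<in>V n. v - Fj j v' \<in> M 0 N"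
  using assms(1)
proof (induction q arbitrary: i x \<beta>)
  have base: "\<exists>v'\<in>V n. v - Fj j v' \<in> M 0 N" if xx: "x \<in> K G N" "x - v \<in> FF hom j N" for x
  proof -
    obtain w where "w \<in> hom n" "x - v = Fj j w" using FF_exact[of "x - v" hom j n] xx(2) assms(3) by auto
    then have "w \<in> hom n" "Fj j w + v = x" by (auto simp: algebra_simps)
    then show ?thesis using G_vpure[of w n v j] xx(1) assms K_M by blast
  qed
  {
    case 0
    then have "(N, x, \<beta>) \<in> G" using GS_1[of N x \<beta> i] by simp
    then have "x \<in> K G N" unfolding K_def by blast
    then show ?case using base 0 by blast
  next
    case (Suc q)
    show ?case
    proof (cases "z i \<in> K G (e i)")
      case True
      then have "x \<in> K G N" using GS_inK[OF _ Suc.prems(1)] unfolding K_def by blast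
      then show ?thesis using base Suc.prems by blast
    next
      case False
      interpret S: gdstep X u0 p f mA pcA mB pcB G d y b i by (rule gdstepI[OF False])
      obtain k \<mu> where km: "\<And>s. s < r i \<Longrightarrow> s * e i \<le> N \<Longrightarrow> (N - s * e i, k s, \<mu> s) \<in> GS (p ^ q) (Suc i)"
        "\<And>s. s < r i \<Longrightarrow> N < s * e i \<Longrightarrow> k s = 0 \<and> \<mu> s = 0"
        "x = (\<Sum>s<r i. A.qm (k s) (A.pw (z i) s))"
        using GS_digits[OF Suc.prems(1)] by blast
      have Dx: "D i x \<in> FF hom j (N - e i)" if le: "e i \<le> N"
      proof -
        have 1: "D i (x - v) \<in> FF hom j (N - e i)" using FF_hom_props(5)[OF Suc.prems(2) le] .
        have 2: "D i v \<in> FF hom j (N - e i)"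
        proof (cases "D i v [] = 0")
          case True then show ?thesis using D_V[OF assms(2), of i] FF_hom_props(4) by simp
        next
          case False
          then have "N = e i" using D_V[OF assms(2)] by blast
          moreover have "bs [] \<in> FF hom j 0" using FF_I[where S = hom, OF A.one_hom, of j] by (simp add: Fj_one)
          ultimately show ?thesis using D_V[OF assms(2), of i] FF_hom_props(3)[of "bs []" j 0 "D i v []"] by simp
        qed
        have "D i (x - v) + D i v \<in> FF hom j (N - e i)" using FF_add[OF _ _ 1 2] hom_diff by auto
        then show ?thesis by (simp add: D_diff)
      qed
      have ks: "k (Suc s) \<in> FF hom j (N - Suc s * e i)" if s: "Suc s < r i" "Suc s * e i \<le> N" for s
        by (rule S.coeff_mem_D[where Q = "FF hom j", OF FF_hom_props(1-5) FF_hom_props(6)[OF Suc.prems(3)]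
              GS_Mp[OF km(1)] conjunct1[OF km(2)] Dx[unfolded km(3)] s])
      obtain t where t: "r i = Suc t" using r_le(2)[of i] by (cases "r i") auto
      have G0: "(N, k 0, \<mu> 0) \<in> GS (p ^ q) (Suc i)" using km(1)[of 0] t by simp
      have h: "k 0 \<in> hom N" using GS_hom[OF G0] by auto
      have x: "x = k 0 + (\<Sum>s<t. A.qm (k (Suc s)) (A.pw (z i) (Suc s)))"
        unfolding km(3) t using A.qm_one_right[OF h] by (subst sum.lessThan_Suc_shift) simp
      have "A.qm (k (Suc s)) (A.pw (z i) (Suc s)) \<in> FF hom j N" if "s < t" for s
      proof (cases "Suc s * e i \<le> N")
        case True
        have 1: "A.pw (z i) (Suc s) \<in> FF hom j (Suc s * e i)"
          using zpw_FF[OF Suc.prems(3)] FF_mono[of "M 0" hom, OF M_hom] by blast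
        have "A.qm (k (Suc s)) (A.pw (z i) (Suc s)) \<in> FF hom j (N - Suc s * e i + Suc s * e i)"
          by (rule hom_FF_mult[OF ks 1]) (use that t True in auto)
        then show ?thesis using True by (simp del: A.pw.simps)
      next
        case False
        then show ?thesis using km(2)[of "Suc s"] that t FF_hom_props(4) by simp
      qed
      then have "(\<Sum>s<t. A.qm (k (Suc s)) (A.pw (z i) (Suc s))) \<in> FF hom j N"
        by (intro FF_sum) (auto intro: hom_diff)
      from FF_hom_props(2)[OF Suc.prems(2) this] have "k 0 - v \<in> FF hom j N" unfolding x by (simp add: algebra_simps)
      then show ?thesis using Suc.IH[OF G0] Suc.prems(3) by simp
    qed
  }
qed

lemma zc_pow: "(e i, z i, c i) \<in> GS (p ^ Suc q) i"
proof (rule GS_mono[OF zc_GS])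
  have "2 * 1 \<le> p * p ^ q" using p_ge2 p_pos by (intro mult_mono) auto
  then show "2 \<le> p ^ Suc q" by simp
qed

text \<open>For \<open>i < j\<close> the elements \<open>x\<close> and \<open>v\<close> have the
  same derivative, a scalar. If it is zero, \<open>x\<close> moves up one level. If not, the common
  degree is \<open>e i\<close>, so the Frobenius preimage has degree below \<open>d\<close> and lies
  in \<open>K G\<close>; then \<open>v\<close> itself is in the new domain and \<open>v' = 0\<close>
  serves.\<close>

lemma vpure_M:
  assumes "i \<le> j" "v \<in> V N" "N = p ^ j * n" "x \<in> M i N" "x - v \<in> FF hom j N"
  shows "\<exists>v'\<in>V n. v - Fj j v' \<in> M 0 N"
  using assms(1,4,5)
proof (induction "j - i" arbitrary: i x)
  case 0
  then obtain T \<beta> where "(N, x, \<beta>) \<in> GS T i" unfolding M_def by blast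
  from vpure_ge[OF _ assms(2,3) GS_pow[OF this]] show ?case using 0 by simp
next
  case (Suc l)
  obtain w where w: "w \<in> hom n" "x - v = Fj j w" using FF_exact[of "x - v" hom j n] Suc.prems assms(3) by auto
  have xw: "Fj j w + v = x" using w(2) by (metis diff_add_cancel)
  obtain T \<beta> where T: "(N, x, \<beta>) \<in> GS T i" using Suc.prems(2) unfolding M_def by blast
  have T': "(N, x, \<beta>) \<in> GS (p ^ Suc T) i"
      using GS_mono[OF GS_pow[OF T], of "p ^ Suc T"] p_pos by simp
  show ?case
  proof (cases "z i \<in> K G (e i)")
    case True
    then have "x \<in> K G N" using GS_inK[OF _ T] unfolding K_def by blast
    then show ?thesis using G_vpure[of w n v j] w(1) xw assms K_M by blast
  next
    case False
    interpret S: gdstep X u0 p f mA pcA mB pcB G d y b i by (rule gdstepI[OF False])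
    have ij: "i < j" using Suc.hyps(2) by simp
    then have "D i (x - v) = 0" using D_FF[OF False _ Suc.prems(3)] by simp
    then have Dx: "D i x = D i v" by (simp add: D_diff)
    define a where "a = D i v []"
    have Da: "D i v = sc a (bs [])" "a \<noteq> 0 \<Longrightarrow> N = e i" using D_V[OF assms(2), of i] by (auto simp: a_def)
    show ?thesis
    proof (cases "a = 0")
      case True
      then have "D i x = 0" using Dx Da by simp
      then obtain \<mu> where "(N, x, \<mu>) \<in> GS (p ^ T) (Suc i)" using digits_const[OF T' False] by blast
      then have "x \<in> M (Suc i) N" by (rule GS_Mp)
      then show ?thesis using Suc.hyps(1)[of "Suc i" x] Suc.hyps(2) Suc.prems by simp
    next
      case nz: False
      then have N: "N = e i" using Da by simp
      have "(N, sc a (z i), sc a (c i)) \<in> GS (p ^ Suc T) i" unfolding N by (rule GS_sc[OF zc_pow])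
      from GS_diff[OF T' this] have "(N, x - sc a (z i), \<beta> - sc a (c i)) \<in> GS (p ^ Suc T) i" .
      moreover have "D i (x - sc a (z i)) = 0" using Dx Da S.D_z by (simp add: D_diff D_sc)
      ultimately obtain \<mu> where "(N, x - sc a (z i), \<mu>) \<in> GS (p ^ T) (Suc i)" using digits_const[OF _ False] by blast
      then have 1: "x - sc a (z i) \<in> M 0 N" by (rule M_to_0[OF GS_Mp])
      have "n < d"
      proof (rule ccontr)
        assume "\<not> n < d"
        then have "p ^ j * d \<le> p ^ i * d" using N assms(3) e_def by (metis mult_le_mono2 not_less)
        then have "p ^ j \<le> p ^ i" using d_pos by simp
        then show False using ij p_ge2 by (metis power_strict_increasing_iff not_less Suc_1 Suc_le_lessD)
      qed
      then have "w \<in> K G n" using low w by blast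
      then have 2: "Fj j w \<in> M 0 N" using K_M K_Fj assms(3) by blast
      have "v = (x - sc a (z i)) - Fj j w + sc a (z i)" using xw by (simp add: algebra_simps)
      moreover have "(x - sc a (z i)) - Fj j w + sc a (z i) \<in> M 0 N"
        using M_add[OF M_diff[OF 1 2] M_sc[of "z i" 0 N a]] z_M0[of i] N by simp
      ultimately have "v - Fj j 0 \<in> M 0 N" by simp
      then show ?thesis using V_0 by blast
    qed
  qed
qed

text \<open>Let \<open>a\<close> be the derivative of the primitive element, a scalar. For
  \<open>a = 0\<close> the element descends one level. Otherwise it has degree \<open>e i\<close>
  and differs from \<open>a\<close> times \<open>z i\<close> by an element of the next level. If
  \<open>y\<close> is primitive, then \<open>z i\<close> is primitive with itself as value. If all
  primitive elements of degree \<open>d\<close> are in \<open>K G\<close>, the second purity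
  condition forces \<open>z i\<close> into \<open>K G\<close>, a contradiction.\<close>

lemma GS_V: "(N, x, \<beta>) \<in> GS (p ^ q) i \<Longrightarrow> x \<in> V N \<Longrightarrow> \<beta> - x \<in> I N"
proof (induction q arbitrary: i N x \<beta>)
  case 0 then show ?case using GS_1 G_V by simp
next
  case (Suc q)
  show ?case
  proof (cases "z i \<in> K G (e i)")
    case True then show ?thesis using GS_inK[OF True Suc.prems(1)] Suc.prems(2) G_V by simp
  next
    case False
    interpret S: gdstep X u0 p f mA pcA mB pcB G d y b i by (rule gdstepI[OF False])
    define a where "a = D i x []"
    have Da: "D i x = sc a (bs [])" "a \<noteq> 0 \<Longrightarrow> N = e i" using D_V[OF Suc.prems(2), of i] by (auto simp: a_def)
    show ?thesis
    proof (cases "a = 0")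
      case True
      then obtain \<mu> where \<mu>: "(N, x, \<mu>) \<in> GS (p ^ q) (Suc i)" "\<beta> - \<mu> \<in> I N"
        using digits_const[OF Suc.prems(1) False] Da by auto
      then show ?thesis using I_add[OF \<mu>(2) Suc.IH[OF \<mu>(1) Suc.prems(2)]] by simp
    next
      case nz: False
      then have N: "N = e i" using Da by simp
      have "(N, sc a (z i), sc a (c i)) \<in> GS (p ^ Suc q) i" unfolding N by (rule GS_sc[OF zc_pow])
      from GS_diff[OF Suc.prems(1) this] have "(N, x - sc a (z i), \<beta> - sc a (c i)) \<in> GS (p ^ Suc q) i" .
      moreover have "D i (x - sc a (z i)) = 0" using Da S.D_z by (simp add: D_diff D_sc)
      ultimately obtain \<mu> where \<mu>: "(N, x - sc a (z i), \<mu>) \<in> GS (p ^ q) (Suc i)" "\<beta> - sc a (c i) - \<mu> \<in> I N"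
        using digits_const[OF _ False] by blast
      from alt show ?thesis
      proof
        assume yb: "y \<in> V d \<and> b = y"
        then have zc: "z i \<in> V N" "c i = z i" using V_Fj[of y d i] N yb unfolding z_def c_def e_def by simp_all
        then have "x - sc a (z i) \<in> V N" using Suc.prems(2) V_diff V_sc by blast
        from I_add[OF \<mu>(2) Suc.IH[OF \<mu>(1) this]] show ?thesis using zc by (simp add: algebra_simps)
      next
        assume VK: "V d \<subseteq> K G d"
        \<comment> \<open>The scalar \<open>- a\<close> is moved inside the iterate, so that the
          multiple of \<open>z i\<close> takes the form demanded by \<open>G_vpure\<close>.\<close>
        obtain q0 where q0: "q0 ^ (p ^ i) = - a" using root_ex by blast
        have "(N, x - sc a (z i), \<mu>) \<in> G" using GS_low[OF \<mu>(1)] N e_less by simp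
        then have xK: "x - sc a (z i) \<in> K G N" by (auto simp: K_def)
        have "Fj i (sc q0 y) + x = x - sc a (z i)" by (simp add: Fj_sc q0 z_def sc_minus)
        then have "Fj i (sc q0 y) + x \<in> K G (p ^ i * d)" using xK N by (simp add: e_def)
        then obtain v' where v': "v' \<in> V d" "x - Fj i v' \<in> K G (p ^ i * d)"
          using G_vpure[OF hom_sc[OF y_hom], of x i] Suc.prems(2) N by (auto simp: e_def)
        have "Fj i v' \<in> K G (p ^ i * d)" using K_Fj VK v'(1) by blast
        from K_add[OF v'(2) this] have "x \<in> K G N" using N by (simp add: e_def)
        from K_diff[OF this xK] have "sc a (z i) \<in> K G N" by simp
        from K_sc[OF this, of "inverse a"] have "z i \<in> K G N" using nz by simp
        then show ?thesis using False N by simp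
      qed
    qed
  qed
qed

definition G' where "G' = {(N, x, \<beta>). \<exists>T>0. (N, x, \<beta>) \<in> GS T 0}"

lemma K_G': "K G' N = M 0 N" by (auto simp: K_def G'_def M_def)

lemma gd_G': "gd X u0 p f mA pcA mB pcB G'"
proof (unfold_locales)
  show "x \<in> hom n \<and> b \<in> hom n" if "(n, x, b) \<in> G'" for n x b using that GS_hom by (auto simp: G'_def)
  show "(n, x + x', b + b') \<in> G'" if 1: "(n, x, b) \<in> G'" and 2: "(n, x', b') \<in> G'" for n x b x' b'
  proof -
    obtain T T' where "T > 0" "(n, x, b) \<in> GS T 0" "(n, x', b') \<in> GS T' 0" using 1 2 by (auto simp: G'_def)
    then have "(n, x + x', b + b') \<in> GS (T + T') 0" by (intro GS.add GS_mono[of n _ _ T 0 "T + T'"] GS_mono[of n _ _ T' 0 "T + T'"]) auto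
    then show ?thesis using \<open>T > 0\<close> unfolding G'_def by (auto intro!: exI[of _ "T + T'"])
  qed
  show "(n, sc a x, sc a b) \<in> G'" if "(n, x, b) \<in> G'" for n x b a using that GS_sc by (auto simp: G'_def)
  show "(i + j, A.qm x x', B.qm b b') \<in> G'" if 1: "(i, x, b) \<in> G'" and 2: "(j, x', b') \<in> G'" for i x b j x' b'
  proof -
    obtain T T' where T: "T > 0" "(i, x, b) \<in> GS T 0" "(j, x', b') \<in> GS T' 0" using 1 2 by (auto simp: G'_def)
    from GS_mult[OF T(2,3)] T(1) show ?thesis unfolding G'_def by (auto intro!: exI[of _ "T + T'"])
  qed
  show "(0, bs [], bs []) \<in> G'" using GS_G[OF G_one, of 1] unfolding G'_def by (auto intro!: exI[of _ 1])
  show "(n, 0, b) \<in> G'" if "b \<in> I n" for n b using GS_G[OF G_I[OF that], of 1] unfolding G'_def by (auto intro!: exI[of _ 1])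
  show "b \<in> I n" if "(n, 0, b) \<in> G'" for n b
  proof -
    obtain T where "(n, 0, b) \<in> GS T 0" using \<open>(n, 0, b) \<in> G'\<close> by (auto simp: G'_def)
    then show ?thesis using GS_zero GS_pow by blast
  qed
  show "Lo l x \<in> K G' (n - fst l)" if "x \<in> K G' n" "l \<in> X" "fst l \<le> n" for x n l
    using M_Lo that unfolding K_G' by blast
  show "b - x \<in> I n" if "(n, x, b) \<in> G'" "x \<in> V n" for n x b
  proof -
    obtain T where "(n, x, b) \<in> GS T 0" using \<open>(n, x, b) \<in> G'\<close> by (auto simp: G'_def)
    then show ?thesis using GS_V GS_pow \<open>x \<in> V n\<close> by blast
  qed
  show "\<exists>k\<in>K G' n. Fj j k = Fj j x" if x: "x \<in> hom n" "Fj j x \<in> K G' (p ^ j * n)" for x n j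
  proof -
    have "Fj j x \<in> FF (M 0) j (p ^ j * n)" using pure_M[of 0 j "Fj j x"] x FF_I[of x hom n j] unfolding K_G' by simp
    then show ?thesis using FF_exact[where S = "M 0"] unfolding K_G' by (metis M_0)
  qed
  show "\<exists>v'\<in>V n. v - Fj j v' \<in> K G' (p ^ j * n)" if x: "x \<in> hom n" "v \<in> V (p ^ j * n)" "Fj j x + v \<in> K G' (p ^ j * n)" for x n v j
    using vpure_M[of 0 j v "p ^ j * n" n "Fj j x + v"] x FF_I[of x hom n j] unfolding K_G' by simp
qed

lemma G_less_G': "G \<subseteq> G'" "(d, y, b) \<in> G'"
proof -
  show "G \<subseteq> G'" using GS_G[where T = 1] unfolding G'_def by (auto intro!: exI[of _ 1])
  show "(d, y, b) \<in> G'" using zc_GS[of 0] unfolding G'_def by (auto simp: e_def z_def c_def intro!: exI[of _ 2])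
qed

end

section \<open>The relation on scalars, unions of chains and Zorn's lemma\<close>

context qsh2
begin

lemma gd_init: "gd X u0 p f mA pcA mB pcB {(n, x, b). b \<in> hom n \<and> (\<exists>s. x = sc s (bs []) \<and> (n = 0 \<or> s = 0) \<and> b - x \<in> I n)}"
  (is "gd X u0 p f mA pcA mB pcB ?G")
proof -
  have one: "sc s (bs []) \<in> hom n" if "n = 0 \<or> s = 0" for s :: 'k and n
    using that hom_sc[OF A.one_hom] by auto
  have KG: "K ?G n = {sc s (bs []) | s. n = 0 \<or> s = 0}" for n
  proof (rule set_eqI, rule iffI)
    fix x :: "('k, 'x) ser" assume "x \<in> {sc s (bs []) | s. n = 0 \<or> s = (0::'k)}"
    then obtain s where s: "x = sc s (bs [])" "n = 0 \<or> s = 0" by blast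
    then have "(n, x, x) \<in> ?G" using one[OF s(2)] by auto
    then show "x \<in> K ?G n" unfolding K_def by blast
  qed (auto simp: K_def)
  have K0: "0 \<in> K ?G n" for n unfolding KG by (auto intro!: exI[of _ 0])
  have Khom: "K ?G 0 = hom 0" unfolding KG using hom_zero_iff one by blast
  show ?thesis
  proof (unfold_locales)
    show "x \<in> hom n \<and> b \<in> hom n" if "(n, x, b) \<in> ?G" for n x b using that one by auto
    show "(n, x + x', b + b') \<in> ?G" if gg: "(n, x, b) \<in> ?G" "(n, x', b') \<in> ?G" for n x b x' b'
    proof -
      obtain s s' where s: "x = sc s (bs [])" "n = 0 \<or> s = 0" "b - x \<in> I n" "x' = sc s' (bs [])" "n = 0 \<or> s' = 0" "b' - x' \<in> I n" "b \<in> hom n" "b' \<in> hom n"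
        using gg by auto
      have "b + b' - (x + x') = (b - x) + (b' - x')" by simp
      then have "b + b' - (x + x') \<in> I n" using I_add s by metis
      moreover have "x + x' = sc (s + s') (bs [])" using s by (simp add: sc_add)
      ultimately show ?thesis using s hom_add by (auto intro!: exI[of _ "s + s'"])
    qed
    show "(n, sc a x, sc a b) \<in> ?G" if gg: "(n, x, b) \<in> ?G" for n x b a
    proof -
      obtain s where s: "x = sc s (bs [])" "n = 0 \<or> s = 0" "b - x \<in> I n" "b \<in> hom n" using gg by auto
      have "sc a b - sc a x = sc a (b - x)" by (auto simp: fun_eq_iff fun_app algebra_simps)
      then have "sc a b - sc a x \<in> I n" using I_sc s by metis
      then show ?thesis using s hom_sc by (auto intro!: exI[of _ "a * s"])
    qed
    show "(i + j, A.qm x x', B.qm b b') \<in> ?G" if gg: "(i, x, b) \<in> ?G" "(j, x', b') \<in> ?G" for i x b j x' b'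
    proof -
      obtain s s' where s: "x = sc s (bs [])" "i = 0 \<or> s = 0" "b - x \<in> I i" "x' = sc s' (bs [])" "j = 0 \<or> s' = 0" "b' - x' \<in> I j" "b \<in> hom i" "b' \<in> hom j"
        using gg by auto
      have xx: "A.qm x x' = sc (s * s') (bs [])" "B.qm x x' = sc (s * s') (bs [])"
        using s A.qm_one_left[OF A.one_hom] B.qm_one_left[OF A.one_hom] by (auto simp: A.qm_sc B.qm_sc mult.commute)
      have x: "x \<in> hom i" "x' \<in> hom j" using s one by auto
      have "B.qm b b' - A.qm x x' = B.qm (b - x) b' + B.qm x (b' - x')" by (simp add: xx[symmetric] B.qm_diff)
          (simp add: xx)
      then have "B.qm b b' - A.qm x x' \<in> I (i + j)" using I_add[OF I_mult(1)[OF s(3) s(8)] I_mult(2)[OF s(6) x(1)]] by simp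
      then show ?thesis using s B.hom_qm xx by (auto intro!: exI[of _ "s * s'"])
    qed
    show "(0, bs [], bs []) \<in> ?G" using A.one_hom by (auto intro!: exI[of _ 1])
    show "(n, 0, b) \<in> ?G" if "b \<in> I n" for n b using that I_hom by (auto intro!: exI[of _ 0])
    show "b \<in> I n" if gg: "(n, 0, b) \<in> ?G" for n b
      using gg by auto
    show "Lo l x \<in> K ?G (n - fst l)" if gg: "x \<in> K ?G n" "l \<in> X" "fst l \<le> n" for x n l
    proof -
      obtain s where "x = sc s (bs [])" using gg(1) unfolding KG by auto
      then have "Lo l x = 0" using letter_pos[OF gg(2)] by (simp add: Lo_sc Lo_bs(2))
      then show ?thesis using K0 by simp
    qed
    show "b - x \<in> I n" if "(n, x, b) \<in> ?G" "x \<in> V n" for n x b using that by auto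
    have zero: "x = 0" if "x \<in> K ?G n" "n > 0" for x n using that unfolding KG by auto
    show "\<exists>k\<in>K ?G n. Fj j k = Fj j x" if x: "x \<in> hom n" "Fj j x \<in> K ?G (p ^ j * n)" for x n j
    proof (cases "n = 0")
      case True then show ?thesis using x Khom by auto
    next
      case False
      then have "Fj j x = 0" using zero[OF x(2)] p_pos by simp
      then show ?thesis using K0 by (intro bexI[of _ 0]) auto
    qed
    show "\<exists>v'\<in>V n. v - Fj j v' \<in> K ?G (p ^ j * n)" if x: "x \<in> hom n" "v \<in> V (p ^ j * n)" "Fj j x + v \<in> K ?G (p ^ j * n)" for x n v j
    proof (cases "n = 0")
      case True
      then have "v - Fj j 0 \<in> K ?G (p ^ j * n)" using x(2) V_hom Khom by auto
      then show ?thesis using V_0 by blast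
    next
      case False
      then have z: "Fj j x + v = 0" using zero[OF x(3)] p_pos by simp
      \<comment> \<open>Frobenius preserves the length of words, so only the one-letter part of
        \<open>x\<close> can cancel a primitive \<open>v\<close>.\<close>
      define x1 where "x1 = (\<lambda>w. if length w = 1 then x w else 0)"
      have x1: "x1 \<in> V n" using x(1) by (auto simp: V_def hom_def x1_def)
      have "Fj j x w = Fj j x1 w" if "length w = 1" for w
        using that
      proof (induction j arbitrary: w)
        case 0 then show ?case by (simp add: x1_def)
      next
        case (Suc j)
        have "Fj j x v ^ p * fr v w = Fj j x1 v ^ p * fr v w" for v
          using Suc fr_supp[of v w] by (cases "fr v w = 0") auto
        then show ?case unfolding Fj_simps Fr_def by (intro sum.cong refl)
      qed
      moreover have "v w = - Fj j x w" for w using fun_cong[OF z, of w] by (simp add: fun_app eq_neg_iff_add_eq_0 add.commute)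
      moreover have "v w = 0" "Fj j x1 w = 0" if "length w \<noteq> 1" for w using that x(2) V_Fj[OF x1, of j] by (auto simp: V_def)
      ultimately have "v - Fj j (- x1) = 0" by (auto simp: fun_eq_iff fun_app Fj_minus) (metis add.left_inverse)
      then show ?thesis using K0 V_minus[OF x1] by (intro bexI[of _ "- x1"]) auto
    qed
  qed
qed

lemma gd_Union:
  assumes C: "C \<noteq> {}" "subset.chain {G. gd X u0 p f mA pcA mB pcB G} C"
  shows "gd X u0 p f mA pcA mB pcB (\<Union>C)"
proof -
  have g: "gd X u0 p f mA pcA mB pcB G" if "G \<in> C" for G using C(2) that by (auto simp: subset.chain_def)
  have two: "\<exists>G\<in>C. a \<in> G \<and> b \<in> G" if ab: "a \<in> \<Union>C" "b \<in> \<Union>C" for a b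
  proof -
    obtain G1 G2 where G: "G1 \<in> C" "a \<in> G1" "G2 \<in> C" "b \<in> G2" using ab by blast
    then have "G1 \<subseteq> G2 \<or> G2 \<subseteq> G1" using C(2) unfolding subset.chain_def by blast
    then show ?thesis using G by blast
  qed
  obtain G0 where G0: "G0 \<in> C" using C(1) by blast
  have KU: "x \<in> K (\<Union>C) n \<longleftrightarrow> (\<exists>G\<in>C. x \<in> K G n)" for x n by (auto simp: K_def)
  show ?thesis
  proof (unfold_locales)
    show "x \<in> hom n \<and> b \<in> hom n" if "(n, x, b) \<in> \<Union>C" for n x b using that gd.G_hom[OF g] by blast
    show "(n, x + x', b + b') \<in> \<Union>C" if "(n, x, b) \<in> \<Union>C" "(n, x', b') \<in> \<Union>C" for n x b x' b'
      using two[OF that] gd.G_add[OF g] by blast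
    show "(n, sc a x, sc a b) \<in> \<Union>C" if "(n, x, b) \<in> \<Union>C" for n x b a using that gd.G_sc[OF g] by blast
    show "(i + j, A.qm x x', B.qm b b') \<in> \<Union>C" if "(i, x, b) \<in> \<Union>C" "(j, x', b') \<in> \<Union>C" for i x b j x' b'
      using two[OF that] gd.G_mult[OF g] by blast
    show "(0, bs [], bs []) \<in> \<Union>C" using gd.G_one[OF g[OF G0]] G0 by blast
    show "(n, 0, b) \<in> \<Union>C" if "b \<in> I n" for n b using gd.G_I[OF g[OF G0] that] G0 by blast
    show "b \<in> I n" if "(n, 0, b) \<in> \<Union>C" for n b using that gd.G_0[OF g] by blast
    show "Lo l x \<in> K (\<Union>C) (n - fst l)" if "x \<in> K (\<Union>C) n" "l \<in> X" "fst l \<le> n" for x n l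
      using that gd.G_Lo[OF g] unfolding KU by blast
    show "b - x \<in> I n" if "(n, x, b) \<in> \<Union>C" "x \<in> V n" for n x b using that gd.G_V[OF g] by blast
    show "\<exists>k\<in>K (\<Union>C) n. Fj j k = Fj j x" if "x \<in> hom n" "Fj j x \<in> K (\<Union>C) (p ^ j * n)" for x n j
      using that gd.G_pure[OF g] KU by blast
    show "\<exists>v'\<in>V n. v - Fj j v' \<in> K (\<Union>C) (p ^ j * n)" if "x \<in> hom n" "v \<in> V (p ^ j * n)" "Fj j x + v \<in> K (\<Union>C) (p ^ j * n)" for x n v j
      using that gd.G_vpure[OF g] KU by blast
  qed
qed

text \<open>A maximal relation that misses an element could be extended at the least degree
  \<open>d\<close> with a gap. What has to be found is a pair \<open>y\<close>, \<open>b\<close>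
  meeting the assumptions of \<open>gdext\<close>.\<close>

theorem gd_total: "\<exists>G. gd X u0 p f mA pcA mB pcB G \<and> (\<forall>n. K G n = hom n)"
proof -
  let ?\<G> = "{G. gd X u0 p f mA pcA mB pcB G}"
  have ne: "?\<G> \<noteq> {}" using gd_init by blast
  have "\<exists>G\<in>?\<G>. \<forall>H\<in>?\<G>. G \<subseteq> H \<longrightarrow> H = G"
    by (rule subset_Zorn_nonempty[OF ne]) (use gd_Union in simp)
  then obtain G where G: "gd X u0 p f mA pcA mB pcB G" and max: "\<And>H. gd X u0 p f mA pcA mB pcB H \<Longrightarrow> G \<subseteq> H \<Longrightarrow> H = G" by auto
  interpret G: gd X u0 p f mA pcA mB pcB G by (rule G)
  have "hom n \<subseteq> K G n" for n
  proof (rule ccontr)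
    assume "\<not> hom n \<subseteq> K G n"
    define d where "d = (LEAST n. \<not> hom n \<subseteq> K G n)"
    have d: "\<not> hom d \<subseteq> K G d" unfolding d_def by (rule LeastI) fact
    have low: "hom n \<subseteq> K G n" if "n < d" for n using not_less_Least that unfolding d_def by blast
    obtain y b where yb: "y \<in> hom d" "y \<notin> K G d" "b \<in> hom d"
      "\<And>j. Fj j y \<in> K G (p ^ j * d) \<Longrightarrow> (p ^ j * d, Fj j y, Fj j b) \<in> G" "y \<in> V d \<and> b = y \<or> V d \<subseteq> K G d"
    proof (cases "V d \<subseteq> K G d")
      case False
      \<comment> \<open>A primitive element is its own value. This is admissible because its
        iterates are primitive, and on those in the domain the relation is the identity modulo
        \<open>I\<close>.\<close>
      then obtain y where y: "y \<in> V d" "y \<notin> K G d" by blast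
      have "(p ^ j * d, Fj j y, Fj j y) \<in> G" if j: "Fj j y \<in> K G (p ^ j * d)" for j
      proof -
        obtain b' where b': "(p ^ j * d, Fj j y, b') \<in> G" using j by (auto simp: K_def)
        then have "b' - Fj j y \<in> I (p ^ j * d)" using G.G_V V_Fj y by blast
        then have "(p ^ j * d, 0, - (b' - Fj j y)) \<in> G" using G.G_I I_minus by blast
        from G.G_add[OF b' this] show ?thesis by simp
      qed
      then show ?thesis using that[of y y] y V_hom by blast
    next
      case True
      obtain y where y: "y \<in> hom d" "y \<notin> K G d" using d by blast
      show ?thesis
      proof (cases "\<exists>j. Fj j y \<in> K G (p ^ j * d)")
        case False
        \<comment> \<open>No iterate of \<open>y\<close> lies in the domain, so nothing is
          prescribed and \<open>0\<close> is an admissible value.\<close>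
        then show ?thesis using that[of y 0] y True by auto
      next
        case ex: True
        \<comment> \<open>From the first iterate inside the domain onwards, \<open>y\<close> and the
          element \<open>k\<close> supplied by purity have the same iterates, so the value of
          \<open>k\<close> is admissible for \<open>y\<close>.\<close>
        define h where "h = (LEAST j. Fj j y \<in> K G (p ^ j * d))"
        have "Fj h y \<in> K G (p ^ h * d)" unfolding h_def using ex by (rule LeastI_ex)
        then obtain k where k: "k \<in> K G d" "Fj h k = Fj h y" using G.G_pure[OF y(1)] by blast
        obtain b where b: "(d, k, b) \<in> G" using k by (auto simp: K_def)
        have "(p ^ j * d, Fj j y, Fj j b) \<in> G" if "Fj j y \<in> K G (p ^ j * d)" for j
        proof -
          have "h \<le> j" unfolding h_def using that by (rule Least_le)
          then have "Fj j y = Fj j k" using k(2) Fj_Fj[of "j - h" h y] Fj_Fj[of "j - h" h k] by simp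
          then show ?thesis using G.G_Fj[OF b] by simp
        qed
        then show ?thesis using that[of y b] y True G.G_hom[OF b] by blast
      qed
    qed
    interpret E: gdext X u0 p f mA pcA mB pcB G d y b
      by unfold_locales (use yb low in auto)
    have "E.G' = G" using max[OF E.gd_G' E.G_less_G'(1)] .
    then have "(d, y, b) \<in> G" using E.G_less_G'(2) by simp
    then show False using yb(2) by (auto simp: K_def)
  qed
  then show ?thesis using G.K_hom G by blast
qed

end

section \<open>The induced isomorphism of Hopf algebras\<close>

locale gdtotal = gd X u0 p f mA pcA mB pcB G
  for X :: "(nat \<times> 'x) set" and u0 :: "nat \<times> 'x" and p :: nat and f :: "nat \<times> 'x \<Rightarrow> nat \<times> 'x \<Rightarrow> 'k::field"
    and mA pcA mB pcB and G :: "(nat \<times> ('k, 'x) ser \<times> ('k, 'x) ser) set" +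
  assumes total: "K G n = hom n"
begin

text \<open>The \<open>c\<close>-component of the algebra map, as a functional on words. The choice
  of a value is immaterial, since two values differ by an element of \<open>I\<close> and
  \<open>Lo c b []\<close> reads only words of length at most one.\<close>

definition \<gamma> :: "nat \<times> 'x \<Rightarrow> ('k, 'x) ser" where
  "\<gamma> c w = Lo c (SOME b. (wdeg w, bs w, b) \<in> G) []"

text \<open>Removal of a last tensor factor in \<open>T\<close> by the component \<open>c\<close> of the algebra map with graph \<open>G\<close>.\<close>

definition Nc :: "nat \<times> 'x \<Rightarrow> ('k, 'x) ser \<Rightarrow> ('k, 'x) ser" where
  "Nc c x = R (fst c) (\<gamma> c) x"

lemma G_unique: "(n, x, b) \<in> G \<Longrightarrow> (n, x, b') \<in> G \<Longrightarrow> Lo c b [] = Lo c b' []"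
proof -
  assume "(n, x, b) \<in> G" "(n, x, b') \<in> G"
  then have "(n, x + sc (-1) x, b + sc (-1) b') \<in> G" using G_add G_sc by blast
  then have "b - b' \<in> I n" using G_0 by (simp add: sc_minus)
  then have "Lo c (b - b') [] = 0" by (rule Lo_I_Nil)
  then show ?thesis by (simp add: Lo_def fun_app split: if_splits)
qed

lemma G_sum: "(\<And>i. i \<in> S \<Longrightarrow> (n, g i, h i) \<in> G) \<Longrightarrow> (n, \<Sum>i\<in>S. g i, \<Sum>i\<in>S. h i) \<in> G"
  by (induction S rule: infinite_finite_induct) (auto intro: G_add simp: G_00)

lemma Nc_Nil: "(n, x, b) \<in> G \<Longrightarrow> Nc c x [] = Lo c b []"
proof -
  assume xb: "(n, x, b) \<in> G"
  then have x: "x \<in> hom n" and b: "b \<in> hom n" using G_hom by auto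
  show ?thesis
  proof (cases "n = fst c")
    case False
    then have "Nc c x [] = 0" using x by (auto simp: Nc_def R_def hom_def W_def intro!: sum.neutral)
    moreover have "Lo c b [] = 0" using b False by (cases "fst c = 0") (auto simp: Lo_def hom_def W_def)
    ultimately show ?thesis by simp
  next
    case True
    define h where "h w = (SOME b. (wdeg w, bs w, b) \<in> G)" for w
    have h: "(n, bs w, h w) \<in> G" if w: "w \<in> W n" for w
    proof -
      have "wdeg w = n" using w by (simp add: W_def)
      moreover have "bs w \<in> K G n" using hom_bs[OF w] total by simp
      ultimately have "\<exists>b. (wdeg w, bs w, b) \<in> G" by (auto simp: K_def)
      from someI_ex[OF this] show ?thesis using \<open>wdeg w = n\<close> by (simp add: h_def)
    qed
    have "(n, \<Sum>w\<in>W n. sc (x w) (bs w), \<Sum>w\<in>W n. sc (x w) (h w)) \<in> G"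
      by (rule G_sum) (use h G_sc in blast)
    then have "Lo c b [] = Lo c (\<Sum>w\<in>W n. sc (x w) (h w)) []"
      using G_unique[OF xb] hom_expand[OF x] by simp
    also have "\<dots> = (\<Sum>w\<in>W n. x w * Lo c (h w) [])"
      by (simp add: Lo_sum Lo_sc sum_fun_apply fun_app)
    also have "\<dots> = Nc c x []"
      unfolding Nc_def R_def True[symmetric] by (simp add: \<gamma>_def h_def mult.commute)
    finally show ?thesis by simp
  qed
qed

lemma Nc_add: "Nc c (x + y) = Nc c x + Nc c y" by (simp add: Nc_def R_add)
lemma Nc_sc: "Nc c (sc a x) = sc a (Nc c x)" by (simp add: Nc_def R_sc)
lemma Nc_hom: "x \<in> hom n \<Longrightarrow> fst c \<le> n \<Longrightarrow> Nc c x \<in> hom (n - fst c)" by (simp add: Nc_def hom_R)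
lemma Nc_hom_0: "x \<in> hom n \<Longrightarrow> n < fst c \<Longrightarrow> Nc c x = 0" by (simp add: Nc_def R_hom_0)

lemma Nc_homog: "x \<in> hom n \<Longrightarrow> \<exists>k. Nc c x \<in> hom k"
  using Nc_hom[of x n c] Nc_hom_0[of x n c] hom_0 by (cases "fst c \<le> n") auto

lemma Nc_u0: "fst c = 0 \<Longrightarrow> Nc c x = x"
proof -
  assume c: "fst c = 0"
  have "Nc c (bs []) [] = (bs [] :: ('k, 'x) ser) []" using Nc_Nil[OF G_one] c by simp
  then have "\<gamma> c [] = 1" using c by (simp add: Nc_def R_def W_0 bs_def)
  then show ?thesis using c by (simp add: Nc_def R_def W_0)
qed

text \<open>The algebra map is the identity on primitive elements; this is the source of
  unitriangularity.\<close>

lemma \<gamma>_letter: "c \<in> X \<Longrightarrow> l \<in> X \<Longrightarrow> fst l = fst c \<Longrightarrow> \<gamma> c [l] = (if l = c then 1 else 0)"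
proof -
  assume c: "c \<in> X" and l: "l \<in> X" "fst l = fst c"
  have w: "[l] \<in> W (fst c)" using l by (simp add: W_def)
  have "bs [l] \<in> V (fst c)" using hom_bs[OF w] by (auto simp: V_def bs_def)
  moreover obtain b where b: "(fst c, bs [l], b) \<in> G" using total hom_bs[OF w] by (auto simp: K_def)
  ultimately have "b - bs [l] \<in> I (fst c)" by (rule_tac G_V)
  then have "Lo c (b - bs [l]) [] = 0" by (rule Lo_I_Nil)
  then have "Lo c b [] = bs [l] [c]" using letter_pos[OF c] by (simp add: fun_app)
  moreover have "Nc c (bs [l]) [] = \<gamma> c [l]"
    using w by (simp add: Nc_def R_def bs_def if_distrib[of "(*) _"] cong: if_cong)
  ultimately show ?thesis using Nc_Nil[OF b, of c] by (simp add: bs_def)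
qed

lemma homog_Lo: "x \<in> {x. \<exists>n. x \<in> hom n} \<Longrightarrow> Lo l x \<in> {x. \<exists>n. x \<in> hom n}"
proof -
  assume "x \<in> {x. \<exists>n. x \<in> hom n}"
  then obtain n where "x \<in> hom n" by blast
  then show ?thesis using hom_Lo[of x n l] hom_Lo_0[of x n l] hom_0[of 0] by (cases "fst l \<le> n") auto
qed

lemma homog_tw: "x \<in> {x. \<exists>n. x \<in> hom n} \<Longrightarrow> tw k x \<in> {x. \<exists>n. x \<in> hom n}"
proof -
  assume "x \<in> {x. \<exists>n. x \<in> hom n}"
  then obtain n where "x \<in> hom n" by blast
  then show ?thesis using hom_tw[of x n k] hom_sc[of x n] by auto
qed

text \<open>The relation is multiplicative, so the \<open>c\<close>-component of a product is given
  by the structure constants of the second algebra; \<open>R_qm\<close> turns this into a rule for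
  splitting off a last factor. The rule \<open>bl_qm\<close> for genuine last letters in the second
  product has the same shape.\<close>

lemma Nc_qm:
  assumes x: "x \<in> hom i" and y: "y \<in> hom j" and c: "c \<in> X"
  shows "Nc c (A.qm x y) = (\<Sum>s\<in>Yl (fst c) \<times> Yl (fst c). sc (mB (fst s) (snd s) c) (A.qm (Nc (fst s) x) (tw (fst (fst s)) (Nc (snd s) y))))"
  unfolding Nc_def
proof (rule A.R_qm[where S = "{x. \<exists>n. x \<in> hom n}" and ?d1.0 = "\<lambda>s. fst (fst s)" and ?d2.0 = "\<lambda>s. fst (snd s)"
      and ?f1.0 = "\<lambda>s. \<gamma> (fst s)" and ?f2.0 = "\<lambda>s. \<gamma> (snd s)", OF homog_Lo homog_tw])
  fix x y :: "('k, 'x) ser" assume "x \<in> {x. \<exists>n. x \<in> hom n}" "y \<in> {x. \<exists>n. x \<in> hom n}"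
  then obtain i j where ij: "x \<in> hom i" "y \<in> hom j" by blast
  then have "x \<in> K G i" "y \<in> K G j" using total by simp_all
  then obtain b b' where b: "(i, x, b) \<in> G" "(j, y, b') \<in> G" unfolding K_def by blast
  have "Nc c (A.qm x y) [] = Lo c (B.qm b b') []" by (rule Nc_Nil[OF G_mult[OF b]])
  also have "\<dots> = (\<Sum>a\<in>Yl (fst c). \<Sum>a'\<in>Yl (fst c). mB a a' c * (Lo a b [] * Lo a' b' []))"
    using qm_one_letter[OF c] letter_pos[OF c] by simp
  also have "\<dots> = (\<Sum>s\<in>Yl (fst c) \<times> Yl (fst c). mB (fst s) (snd s) c * (Nc (fst s) x [] * Nc (snd s) y []))"
    by (simp add: sum.cartesian_product case_prod_unfold Nc_Nil[OF b(1)] Nc_Nil[OF b(2)])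
  finally show "R (fst c) (\<gamma> c) (A.qm x y) [] = (\<Sum>s\<in>Yl (fst c) \<times> Yl (fst c). mB (fst s) (snd s) c * (R (fst (fst s)) (\<gamma> (fst s)) x [] * R (fst (snd s)) (\<gamma> (snd s)) y []))"
    by (simp add: Nc_def)
qed (use x y in blast)+

text \<open>The functional that reads off the letter \<open>a\<close>. For the unit index it is the
  counit, since the empty word is the only one of degree \<open>0\<close>.\<close>

definition bl :: "nat \<times> 'x \<Rightarrow> ('k, 'x) ser" where "bl a = (if fst a = 0 then (\<lambda>_. 1) else bs [a])"

lemma R_bl: "a \<in> X \<Longrightarrow> R (fst a) (bl a) x u = x (u @ [a])"
proof -
  assume a: "a \<in> X"
  then have "[a] \<in> W (fst a)" by (simp add: W_def)
  moreover have "R (fst a) (bl a) x u = (\<Sum>v\<in>W (fst a). if v = [a] then x (u @ [a]) else 0)"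
    using letter_pos[OF a] unfolding R_def by (intro sum.cong refl) (auto simp: bl_def bs_def)
  ultimately show ?thesis by simp
qed

lemma R_bl_0: "fst a = 0 \<Longrightarrow> R (fst a) (bl a) x = x"
  by (simp add: R_def bl_def W_0)

lemma R_bl_Nil: "a \<in> Y \<Longrightarrow> R (fst a) (bl a) x [] = Lo a x []"
  using R_bl[of a x "[]"] R_bl_0[of a x] letter_pos[of a] by (cases "fst a = 0") auto

lemma bl_qm:
  assumes c: "c \<in> X"
  shows "R (fst c) (bl c) (B.qm x y) = (\<Sum>s\<in>Yl (fst c) \<times> Yl (fst c). sc (mB (fst s) (snd s) c)
     (B.qm (R (fst (fst s)) (bl (fst s)) x) (tw (fst (fst s)) (R (fst (snd s)) (bl (snd s)) y))))"
proof (rule B.R_qm[where S = UNIV and ?d1.0 = "\<lambda>s. fst (fst s)" and ?d2.0 = "\<lambda>s. fst (snd s)"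
      and ?f1.0 = "\<lambda>s. bl (fst s)" and ?f2.0 = "\<lambda>s. bl (snd s)"])
  fix x y :: "('k, 'x) ser"
  have "R (fst c) (bl c) (B.qm x y) [] = (\<Sum>a\<in>Yl (fst c). \<Sum>a'\<in>Yl (fst c). mB a a' c * (Lo a x [] * Lo a' y []))"
    using qm_one_letter[OF c] R_bl[OF c] by simp
  also have "\<dots> = (\<Sum>s\<in>Yl (fst c) \<times> Yl (fst c). mB (fst s) (snd s) c * (R (fst (fst s)) (bl (fst s)) x [] * R (fst (snd s)) (bl (snd s)) y []))"
    unfolding sum.cartesian_product case_prod_unfold
  proof (rule sum.cong[OF refl])
    fix s assume "s \<in> Yl (fst c) \<times> Yl (fst c)"
    then have "fst s \<in> Y" "snd s \<in> Y" by (auto simp: Yl_def)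
    then show "mB (fst s) (snd s) c * (Lo (fst s) x [] * Lo (snd s) y []) = mB (fst s) (snd s) c * (R (fst (fst s)) (bl (fst s)) x [] * R (fst (snd s)) (bl (snd s)) y [])"
      by (simp only: R_bl_Nil)
  qed
  finally show "R (fst c) (bl c) (B.qm x y) [] = (\<Sum>s\<in>Yl (fst c) \<times> Yl (fst c). mB (fst s) (snd s) c * (R (fst (fst s)) (bl (fst s)) x [] * R (fst (snd s)) (bl (snd s)) y []))" .
qed auto

text \<open>Cofreeness of the tensor coalgebra: a coalgebra map is determined by its components in
  letters. Words of the result are produced from their last letter backwards, so the recursion runs
  over the reversed word.\<close>

primrec phr :: "(nat \<times> 'x) list \<Rightarrow> ('k, 'x) ser \<Rightarrow> 'k" where
  "phr [] x = x []"
| "phr (c # w) x = (if c \<in> X then phr w (Nc c x) else 0)"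

definition \<Phi> :: "('k, 'x) ser \<Rightarrow> ('k, 'x) ser" where "\<Phi> x = (\<lambda>w. phr (rev w) x)"

lemma \<Phi>_Nil: "\<Phi> x [] = x []" by (simp add: \<Phi>_def)
lemma \<Phi>_snoc: "c \<in> X \<Longrightarrow> \<Phi> x (w @ [c]) = \<Phi> (Nc c x) w" by (simp add: \<Phi>_def)
lemma \<Phi>_notX: "w \<notin> lists X \<Longrightarrow> \<Phi> x w = 0"
  by (induction w arbitrary: x rule: rev_induct) (auto simp: \<Phi>_def)

lemma \<Phi>_add: "\<Phi> (x + y) = \<Phi> x + \<Phi> y"
proof (rule ext)
  show "\<Phi> (x + y) w = (\<Phi> x + \<Phi> y) w" for w
    by (induction w arbitrary: x y rule: rev_induct) (auto simp: \<Phi>_def Nc_add fun_app)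
qed

lemma \<Phi>_sc: "\<Phi> (sc a x) = sc a (\<Phi> x)"
proof (rule ext)
  show "\<Phi> (sc a x) w = (sc a (\<Phi> x)) w" for w
    by (induction w arbitrary: x rule: rev_induct) (auto simp: \<Phi>_def Nc_sc fun_app)
qed

lemma \<Phi>_0 [simp]: "\<Phi> 0 = 0" using \<Phi>_sc[of 0 0] by simp

lemma \<Phi>_diff: "\<Phi> (x - y) = \<Phi> x - \<Phi> y"
  using \<Phi>_add[of x "sc (-1) y"] \<Phi>_sc[of "-1" y] by (simp add: sc_minus)

lemma \<Phi>_sum: "\<Phi> (\<Sum>i\<in>S. g i) = (\<Sum>i\<in>S. \<Phi> (g i))"
  by (induction S rule: infinite_finite_induct) (simp_all add: \<Phi>_add)

lemma \<Phi>_hom: "x \<in> hom n \<Longrightarrow> \<Phi> x \<in> hom n"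
proof -
  have "w \<in> W n" if "\<Phi> x w \<noteq> 0" "x \<in> hom n" for w x n
    using that
  proof (induction w arbitrary: x n rule: rev_induct)
    case Nil then show ?case by (auto simp: \<Phi>_Nil hom_def)
  next
    case (snoc c w)
    have c: "c \<in> X" using snoc.prems(1) \<Phi>_notX[of "w @ [c]" x] by auto
    then have nz: "\<Phi> (Nc c x) w \<noteq> 0" using snoc.prems by (simp add: \<Phi>_snoc)
    then have le: "fst c \<le> n" using Nc_hom_0[OF snoc.prems(2), of c] by (cases "fst c \<le> n") (auto simp: fun_app)
    from snoc.IH[OF nz Nc_hom[OF snoc.prems(2) le]] show ?case using c le by (auto simp: W_def)
  qed
  then show "x \<in> hom n \<Longrightarrow> \<Phi> x \<in> hom n" by (auto simp: hom_def)
qed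

lemma \<Phi>_tw: "x \<in> hom n \<Longrightarrow> \<Phi> (tw k x) = tw k (\<Phi> x)"
  using hom_tw[of x n k] hom_tw[OF \<Phi>_hom, of x n k] by (simp add: \<Phi>_sc)

lemma R_bl_\<Phi>: "a \<in> Y \<Longrightarrow> R (fst a) (bl a) (\<Phi> x) = \<Phi> (Nc a x)"
  using R_bl[of a "\<Phi> x"] R_bl_0[of a "\<Phi> x"] Nc_u0[of a x] by (cases "a = u0") (simp, auto simp: \<Phi>_snoc)

text \<open>Induction on the word from its end: by \<open>R_bl_\<Phi>\<close>, the summands of
  \<open>Nc_qm\<close> on one side become those of \<open>bl_qm\<close> on the other.\<close>

lemma \<Phi>_mult: "x \<in> hom i \<Longrightarrow> y \<in> hom j \<Longrightarrow> \<Phi> (A.qm x y) = B.qm (\<Phi> x) (\<Phi> y)"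
proof (rule ext)
  fix w assume "x \<in> hom i" "y \<in> hom j"
  then show "\<Phi> (A.qm x y) w = B.qm (\<Phi> x) (\<Phi> y) w"
  proof (induction w arbitrary: x y i j rule: rev_induct)
    case Nil then show ?case by (simp add: \<Phi>_Nil A.qm_Nil B.qm_Nil)
  next
    case (snoc c w)
    show ?case
    proof (cases "c \<in> X")
      case False
      then have "w @ [c] \<notin> lists X" by simp
      then show ?thesis using \<Phi>_notX B.qm_notX by metis
    next
      case c: True
      let ?S = "Yl (fst c) \<times> Yl (fst c)"
      have IH: "\<Phi> (A.qm (Nc a x) (tw k (Nc b y))) w = B.qm (\<Phi> (Nc a x)) (tw k (\<Phi> (Nc b y))) w" for a b k
      proof -
        obtain i' j' where h: "Nc a x \<in> hom i'" "Nc b y \<in> hom j'" using Nc_homog snoc.prems by blast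
        have "tw k (Nc b y) \<in> hom j'" using hom_tw[OF h(2), of k] hom_sc[OF h(2)] by simp
        from snoc.IH[OF h(1) this] show ?thesis by (simp add: \<Phi>_tw[OF h(2)])
      qed
      have "\<Phi> (A.qm x y) (w @ [c]) = (\<Sum>s\<in>?S. mB (fst s) (snd s) c * B.qm (\<Phi> (Nc (fst s) x)) (tw (fst (fst s)) (\<Phi> (Nc (snd s) y))) w)"
        by (simp add: \<Phi>_snoc[OF c] Nc_qm[OF snoc.prems c] \<Phi>_sum \<Phi>_sc sum_fun_apply fun_app IH)
      also have "\<dots> = (\<Sum>s\<in>?S. sc (mB (fst s) (snd s) c) (B.qm (R (fst (fst s)) (bl (fst s)) (\<Phi> x)) (tw (fst (fst s)) (R (fst (snd s)) (bl (snd s)) (\<Phi> y))))) w"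
        unfolding sum_fun_apply sc_simps
      proof (rule sum.cong[OF refl])
        fix s assume "s \<in> ?S"
        then have "fst s \<in> Y" "snd s \<in> Y" by (auto simp: Yl_def)
        then show "mB (fst s) (snd s) c * B.qm (\<Phi> (Nc (fst s) x)) (tw (fst (fst s)) (\<Phi> (Nc (snd s) y))) w =
          mB (fst s) (snd s) c * B.qm (R (fst (fst s)) (bl (fst s)) (\<Phi> x)) (tw (fst (fst s)) (R (fst (snd s)) (bl (snd s)) (\<Phi> y))) w"
          by (simp only: R_bl_\<Phi>)
      qed
      also have "\<dots> = R (fst c) (bl c) (B.qm (\<Phi> x) (\<Phi> y)) w" by (simp only: bl_qm[OF c])
      also have "\<dots> = B.qm (\<Phi> x) (\<Phi> y) (w @ [c])" by (rule R_bl[OF c])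
      finally show ?thesis .
    qed
  qed
qed

text \<open>No homogeneity of \<open>x\<close> is assumed, because \<open>\<Phi>_comul\<close>
  applies this to slices such as the function sending \<open>t\<close> to
  \<open>x (s @ t)\<close>.\<close>

lemma \<Phi>_expand: "u \<in> lists X \<Longrightarrow> \<Phi> x u = (\<Sum>s\<in>W (wdeg u). x s * \<Phi> (bs s) u)"
proof (induction u arbitrary: x rule: rev_induct)
  case Nil then show ?case by (simp add: W_0 \<Phi>_Nil bs_def)
next
  case (snoc c u)
  then have c: "c \<in> X" and u: "u \<in> lists X" by auto
  have N: "\<Phi> z (u @ [c]) = (\<Sum>s\<in>W (wdeg u). \<Sum>t\<in>W (fst c). \<gamma> c t * z (s @ t) * \<Phi> (bs s) u)" for z
    unfolding \<Phi>_snoc[OF c] snoc.IH[OF u, of "Nc c z"] by (simp add: Nc_def R_def sum_distrib_right)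
  have st: "s @ t \<in> W (wdeg (u @ [c]))" if "s \<in> W (wdeg u)" "t \<in> W (fst c)" for s t
    using that by (auto simp: W_def)
  have "(\<Sum>w\<in>W (wdeg (u @ [c])). x w * \<Phi> (bs w) (u @ [c])) = (\<Sum>w\<in>W (wdeg (u @ [c])). \<Sum>s\<in>W (wdeg u). \<Sum>t\<in>W (fst c). \<gamma> c t * (x w * bs w (s @ t)) * \<Phi> (bs s) u)"
    unfolding N sum_distrib_left by (intro sum.cong refl) (simp add: mult_ac)
  also have "\<dots> = (\<Sum>s\<in>W (wdeg u). \<Sum>t\<in>W (fst c). \<Sum>w\<in>W (wdeg (u @ [c])). \<gamma> c t * (x w * bs w (s @ t)) * \<Phi> (bs s) u)"
    by (subst sum.swap, rule sum.cong[OF refl], rule sum.swap)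
  also have "\<dots> = (\<Sum>s\<in>W (wdeg u). \<Sum>t\<in>W (fst c). \<gamma> c t * x (s @ t) * \<Phi> (bs s) u)"
  proof (intro sum.cong refl)
    fix s t assume "s \<in> W (wdeg u)" "t \<in> W (fst c)"
    note S = st[OF this]
    have "(\<Sum>w\<in>W (wdeg (u @ [c])). \<gamma> c t * (x w * bs w (s @ t)) * \<Phi> (bs s) u)
      = (\<Sum>w\<in>W (wdeg (u @ [c])). if w = s @ t then \<gamma> c t * x (s @ t) * \<Phi> (bs s) u else 0)"
      by (intro sum.cong refl) (auto simp: bs_def)
    then show "(\<Sum>w\<in>W (wdeg (u @ [c])). \<gamma> c t * (x w * bs w (s @ t)) * \<Phi> (bs s) u) = \<gamma> c t * x (s @ t) * \<Phi> (bs s) u"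
      using S by simp
  qed
  finally show ?case by (simp add: N)
qed

lemma \<Phi>_comul:
  assumes "u \<in> lists X" "v \<in> lists X"
  shows "\<Phi> x (u @ v) = (\<Sum>s\<in>W (wdeg u). \<Sum>t\<in>W (wdeg v). x (s @ t) * (\<Phi> (bs s) u * \<Phi> (bs t) v))"
  using assms(2)
proof (induction v arbitrary: x rule: rev_induct)
  case Nil
  then show ?case using \<Phi>_expand[OF assms(1), of x] by (simp add: W_0 \<Phi>_Nil bs_def)
next
  case (snoc c v)
  then have c: "c \<in> X" and v: "v \<in> lists X" by auto
  have "\<Phi> x (u @ v @ [c]) = \<Phi> (Nc c x) (u @ v)" using \<Phi>_snoc[OF c, of x "u @ v"] by simp
  also have "\<dots> = (\<Sum>s\<in>W (wdeg u). \<Sum>t\<in>W (wdeg v). Nc c x (s @ t) * (\<Phi> (bs s) u * \<Phi> (bs t) v))"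
    by (rule snoc.IH[OF v])
  also have "\<dots> = (\<Sum>s\<in>W (wdeg u). \<Phi> (bs s) u * (\<Sum>t\<in>W (wdeg v). Nc c (\<lambda>t. x (s @ t)) t * \<Phi> (bs t) v))"
    by (simp add: sum_distrib_left mult_ac Nc_def R_def)
  also have "\<dots> = (\<Sum>s\<in>W (wdeg u). \<Phi> (bs s) u * \<Phi> (\<lambda>t. x (s @ t)) (v @ [c]))"
    by (simp add: \<Phi>_snoc[OF c] \<Phi>_expand[OF v, of "Nc c _"])
  also have "\<dots> = (\<Sum>s\<in>W (wdeg u). \<Sum>t\<in>W (wdeg (v @ [c])). x (s @ t) * (\<Phi> (bs s) u * \<Phi> (bs t) (v @ [c])))"
    by (subst \<Phi>_expand[of "v @ [c]"]) (use c v in \<open>simp_all add: sum_distrib_left mult_ac del: wdeg_simps\<close>)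
  finally show ?case .
qed

text \<open>\<open>\<Phi>\<close> is unitriangular with respect to the length of words.\<close>

lemma \<Phi>_top:
  assumes "w \<in> lists X" "\<And>s. s \<in> lists X \<Longrightarrow> length s > r \<Longrightarrow> x s = 0" "length w \<ge> r"
  shows "\<Phi> x w = x w"
  using assms
proof (induction w arbitrary: x r rule: rev_induct)
  case Nil then show ?case by (simp add: \<Phi>_Nil)
next
  case (snoc c w)
  then have c: "c \<in> X" and w: "w \<in> lists X" by auto
  have tpos: "length t \<ge> 1" "t \<in> lists X" if "t \<in> W (fst c)" for t
    using that letter_pos[OF c] by (cases t; auto simp: W_def)+
  have "\<Phi> x (w @ [c]) = \<Phi> (Nc c x) w" by (rule \<Phi>_snoc[OF c])
  also have "\<dots> = Nc c x w"
  proof (rule snoc.IH[OF w, of "r - 1"])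
    fix s assume s: "s \<in> lists X" "length s > r - 1"
    have "x (s @ t) = 0" if "t \<in> W (fst c)" for t
      using tpos[OF that] s by (intro snoc.prems(2)) auto
    then show "Nc c x s = 0" by (simp add: Nc_def R_def)
  qed (use snoc.prems(3) in simp)
  also have "\<dots> = (\<Sum>t\<in>W (fst c). if t = [c] then x (w @ [c]) else 0)"
    unfolding Nc_def R_def
  proof (rule sum.cong[OF refl])
    fix t assume t: "t \<in> W (fst c)"
    show "\<gamma> c t * x (w @ t) = (if t = [c] then x (w @ [c]) else 0)"
    proof (cases "length t = 1")
      case True
      then obtain l where l: "t = [l]" by (cases t) auto
      then have "\<gamma> c t = (if l = c then 1 else 0)" using \<gamma>_letter[OF c, of l] t by (auto simp: W_def)
      then show ?thesis using l by simp
    next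
      case False
      then have "length (w @ t) > r" "w @ t \<in> lists X" using tpos[OF t] snoc.prems(3) w by auto
      then show ?thesis using False snoc.prems(2) by auto
    qed
  qed
  also have "\<dots> = x (w @ [c])"
  proof -
    have "[c] \<in> W (fst c)" using c by (simp add: W_def)
    then show ?thesis by simp
  qed
  finally show ?case .
qed

lemma \<Phi>_bij: "bij_betw \<Phi> (hom n) (hom n)"
  unfolding bij_betw_def
proof
  have len: "length w \<le> n" if "x w \<noteq> 0" "x \<in> hom n" for x :: "('k, 'x) ser" and w
    using that length_le_wdeg[of w] by (auto simp: hom_def W_def)
  have inj0: "x = 0" if x: "x \<in> hom n" "\<Phi> x = 0" for x
  proof (rule ccontr)
    assume "x \<noteq> 0"
    then obtain w0 where w0: "x w0 \<noteq> 0" by (auto simp: fun_eq_iff fun_app)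
    define r where "r = Max (length ` {w \<in> W n. x w \<noteq> 0})"
    have ne: "{w \<in> W n. x w \<noteq> 0} \<noteq> {}" using w0 x by (auto simp: hom_def)
    then have "r \<in> length ` {w \<in> W n. x w \<noteq> 0}" unfolding r_def by (intro Max_in) auto
    then obtain w where w: "w \<in> W n" "x w \<noteq> 0" "length w = r" by auto
    have "x s = 0" if "length s > r" for s
    proof (rule ccontr)
      assume "x s \<noteq> 0"
      then have "length s \<in> length ` {w \<in> W n. x w \<noteq> 0}" using x by (auto simp: hom_def)
      then have "length s \<le> r" unfolding r_def by (intro Max_ge) auto
      then show False using that by simp
    qed
    then have "\<Phi> x w = x w" using w by (intro \<Phi>_top[of w r]) (auto simp: W_def)
    then show False using w x by (simp add: fun_app)
  qed
  show "inj_on \<Phi> (hom n)"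
  proof (rule inj_onI)
    fix x y assume "x \<in> hom n" "y \<in> hom n" "\<Phi> x = \<Phi> y"
    then have "x - y \<in> hom n" "\<Phi> (x - y) = 0" using hom_diff[of x n y] by (simp_all add: \<Phi>_diff)
    then have "x - y = 0" by (rule inj0)
    then show "x = y" by simp
  qed
  have surj: "\<exists>x\<in>hom n. \<Phi> x = y" if "y \<in> hom n" "\<And>s. length s > r \<Longrightarrow> y s = 0" for y r
    using that
  proof (induction r arbitrary: y)
    case 0
    have "\<Phi> y = y"
    proof (rule ext)
      fix w
      show "\<Phi> y w = y w"
      proof (cases "w \<in> lists X")
        case True then show ?thesis using 0 by (intro \<Phi>_top[of w 0]) auto
      next
        case False then show ?thesis using \<Phi>_notX[of w y] hom_notX[of y n w] 0 by simp
      qed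
    qed
    then show ?case using 0 by blast
  next
    case (Suc r)
    \<comment> \<open>The correction \<open>y - \<Phi> y\<close> has only shorter words. If
      \<open>x\<close> is a preimage of it, then \<open>x + y\<close> is a preimage of
      \<open>y\<close>.\<close>
    have h: "y - \<Phi> y \<in> hom n" using Suc.prems \<Phi>_hom hom_diff by blast
    have "(y - \<Phi> y) s = 0" if s: "length s > r" for s
    proof (cases "s \<in> lists X")
      case True
      then have "\<Phi> y s = y s" using s Suc.prems by (intro \<Phi>_top[of s "Suc r"]) auto
      then show ?thesis by (simp add: fun_app)
    next
      case False then show ?thesis using hom_notX[OF h] by blast
    qed
    from Suc.IH[OF h this] obtain x where "x \<in> hom n" "\<Phi> x = y - \<Phi> y" by blast
    then have "x + y \<in> hom n" "\<Phi> (x + y) = y" using Suc.prems hom_add by (auto simp: \<Phi>_add)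
    then show ?case by blast
  qed
  show "\<Phi> ` hom n = hom n"
  proof
    show "\<Phi> ` hom n \<subseteq> hom n" using \<Phi>_hom by blast
    show "hom n \<subseteq> \<Phi> ` hom n"
    proof
      fix y :: "('k, 'x) ser" assume y: "y \<in> hom n"
      have "y s = 0" if "length s > n" for s using len[of y s, OF _ y] that by (cases "y s = 0") auto
      then show "y \<in> \<Phi> ` hom n" using surj[OF y, of n] by blast
    qed
  qed
qed

lemma \<Phi>_one: "\<Phi> (bs []) = bs []"
  using hom_zero_iff[OF \<Phi>_hom[OF A.one_hom]] by (simp add: \<Phi>_Nil bs_def)

end

context qsh2
begin

theorem coordinate_hopf_iso:
  obtains \<Phi> where "\<And>x y. \<Phi> (x + y) = \<Phi> x + \<Phi> y" "\<And>a x. \<Phi> (sc a x) = sc a (\<Phi> x)" "\<And>n. bij_betw \<Phi> (hom n) (hom n)"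
    "\<Phi> (bs []) = bs []" "\<And>i j x y. x \<in> hom i \<Longrightarrow> y \<in> hom j \<Longrightarrow> \<Phi> (A.qm x y) = B.qm (\<Phi> x) (\<Phi> y)"
    "\<And>x. \<Phi> x [] = x []" "\<And>x u v. u \<in> lists X \<Longrightarrow> v \<in> lists X \<Longrightarrow>
       \<Phi> x (u @ v) = (\<Sum>s\<in>W (wdeg u). \<Sum>t\<in>W (wdeg v). x (s @ t) * (\<Phi> (bs s) u * \<Phi> (bs t) v))"
proof -
  obtain G where G: "gd X u0 p f mA pcA mB pcB G" "\<And>n. K G n = hom n" using gd_total by blast
  interpret gd X u0 p f mA pcA mB pcB G by (rule G)
  interpret gdtotal X u0 p f mA pcA mB pcB G by unfold_locales (rule G)
  show ?thesis
    by (rule that[of \<Phi>, OF \<Phi>_add \<Phi>_sc \<Phi>_bij \<Phi>_one \<Phi>_mult \<Phi>_Nil \<Phi>_comul])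
qed

end

section \<open>The recursive form of the quasi-shuffle product\<close>

text \<open>\<open>lab \<alpha> u\<close> labels the letters of \<open>u\<close> by their positions in the contracted word.\<close>

definition lab :: "(nat \<Rightarrow> nat) \<Rightarrow> 'b list \<Rightarrow> (nat \<times> 'b) list" where
  "lab \<alpha> u = zip (map \<alpha> [0..<length u]) u"

text \<open>Contraction and sign depend only on the list of labelled letters. In this form,
  concatenating words and shifting positions become list recursions instead of reindexings of
  \<open>join\<close>.\<close>

definition contract_lab :: "('k, 'a, 'm) galgebra_scheme \<Rightarrow> nat \<Rightarrow> (nat \<times> nat \<times> 'a) list \<Rightarrow> (nat \<times> 'a) list" where
  "contract_lab A n L = map (\<lambda>i. lprod A (map snd (filter (\<lambda>q. fst q = i) L))) [0..<n]"

primrec sign_lab :: "(nat \<times> nat \<times> 'a) list \<Rightarrow> 'k::field" where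
  "sign_lab [] = 1"
| "sign_lab (q # L) = (\<Prod>h\<leftarrow>L. if fst q > fst h then (-1) ^ (fst (snd q) * fst (snd h)) else 1) * sign_lab L"

lemma contract_lab_eq: "contract A n \<gamma> w = contract_lab A n (lab \<gamma> w)"
proof -
  have "map ((!) w) (filter (\<lambda>j. \<gamma> j = i) [0..<length w]) = map snd (filter (\<lambda>q. fst q = i) (lab \<gamma> w))" for i
  proof -
    have "lab \<gamma> w = map (\<lambda>j. (\<gamma> j, w ! j)) [0..<length w]"
      by (rule nth_equalityI) (auto simp: lab_def)
    then show ?thesis by (simp add: filter_map o_def)
  qed
  then show ?thesis by (simp add: contract_def contract_lab_def)
qed

lemma lab_append: "lab (join (length u) \<alpha> \<beta>) (u @ v) = lab \<alpha> u @ lab \<beta> v"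
proof (rule nth_equalityI)
  fix i assume "i < length (lab (join (length u) \<alpha> \<beta>) (u @ v))"
  then show "lab (join (length u) \<alpha> \<beta>) (u @ v) ! i = (lab \<alpha> u @ lab \<beta> v) ! i"
    by (auto simp: lab_def join_def nth_append)
qed (simp add: lab_def)

lemma lab_Cons: "lab \<alpha> (x # u) = (\<alpha> 0, x) # lab (\<lambda>i. \<alpha> (Suc i)) u"
  by (simp add: lab_def upt_conv_Cons map_Suc_upt[symmetric] o_def del: upt_Suc)

lemma lab_Nil [simp]: "lab \<alpha> [] = []" by (simp add: lab_def)

lemma map_snd_lab: "map snd (lab \<alpha> w) = w" by (simp add: lab_def)

lemma koszul_sign_Cons:
  "koszul_sign \<gamma> (x # w) = (\<Prod>j<length w. if \<gamma> 0 > \<gamma> (Suc j) then (-1) ^ (fst x * fst (w ! j)) else 1) * koszul_sign (\<lambda>i. \<gamma> (Suc i)) w"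
proof -
  let ?P = "\<lambda>\<gamma> w. {(i, j). i < j \<and> j < length w \<and> \<gamma> i > (\<gamma> j :: nat)}"
  let ?g = "\<lambda>w :: (nat \<times> 'b) list. \<lambda>(i, j). (-1 :: 'a) ^ (fst (w ! i) * fst (w ! j))"
  let ?S1 = "(\<lambda>j. (0, Suc j)) ` {j. j < length w \<and> \<gamma> 0 > \<gamma> (Suc j)}"
  let ?S2 = "(\<lambda>(i, j). (Suc i, Suc j)) ` ?P (\<lambda>i. \<gamma> (Suc i)) w"
  have fin: "finite (?P \<gamma> w)" for \<gamma> and w :: "(nat \<times> 'b) list"
    by (rule finite_subset[of _ "{..<length w} \<times> {..<length w}"]) auto
  have "?P \<gamma> (x # w) = ?S1 \<union> ?S2"
  proof (rule set_eqI)
    fix q :: "nat \<times> nat"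
    obtain i j where q: "q = (i, j)" by force
    show "q \<in> ?P \<gamma> (x # w) \<longleftrightarrow> q \<in> ?S1 \<union> ?S2"
      unfolding q by (cases i; cases j) (auto simp: image_iff)
  qed
  moreover have "?S1 \<inter> ?S2 = {}" by auto
  ultimately have "koszul_sign \<gamma> (x # w) = prod (?g (x # w)) ?S1 * prod (?g (x # w)) ?S2"
    unfolding koszul_sign_def using fin by (simp add: prod.union_disjoint)
  also have "prod (?g (x # w)) ?S1 = (\<Prod>j\<in>{j. j < length w \<and> \<gamma> 0 > \<gamma> (Suc j)}. (-1) ^ (fst x * fst (w ! j)))"
    by (subst prod.reindex) (auto simp: inj_on_def)
  also have "\<dots> = (\<Prod>j<length w. if \<gamma> 0 > \<gamma> (Suc j) then (-1) ^ (fst x * fst (w ! j)) else 1)"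
    by (subst prod.inter_filter[symmetric]) (auto intro!: prod.cong)
  also have "prod (?g (x # w)) ?S2 = koszul_sign (\<lambda>i. \<gamma> (Suc i)) w"
    unfolding koszul_sign_def by (subst prod.reindex) (auto simp: inj_on_def case_prod_unfold)
  finally show ?thesis .
qed

lemma sign_lab_eq: "koszul_sign \<gamma> w = (sign_lab (lab \<gamma> w) :: 'k::field)"
proof (induction w arbitrary: \<gamma>)
  case Nil then show ?case by (simp add: koszul_sign_def)
next
  case (Cons x w)
  have l: "lab (\<lambda>i. \<gamma> (Suc i)) w = map (\<lambda>j. (\<gamma> (Suc j), w ! j)) [0..<length w]"
    by (rule nth_equalityI) (auto simp: lab_def)
  have "(\<Prod>j<length w. if \<gamma> 0 > \<gamma> (Suc j) then (-1) ^ (fst x * fst (w ! j)) else 1)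
     = (\<Prod>h\<leftarrow>lab (\<lambda>i. \<gamma> (Suc i)) w. if \<gamma> 0 > fst h then (-1) ^ (fst x * fst (snd h)) else (1 :: 'k))"
    unfolding l by (simp add: o_def prod.distinct_set_conv_list[symmetric] atLeast0LessThan cong: if_cong)
  then show ?case by (simp add: koszul_sign_Cons Cons lab_Cons cong: if_cong)
qed

definition shift_lab :: "(nat \<times> 'b) list \<Rightarrow> (nat \<times> 'b) list" where
  "shift_lab L = map (\<lambda>q. (Suc (fst q), snd q)) L"

text \<open>The labelled words of a quasi-shuffle arise from those of a smaller one by adding a new first
  position, which receives the first letter of \<open>u\<close>, of \<open>v\<close>, or both.\<close>

definition ext :: "bool \<Rightarrow> (nat \<Rightarrow> nat) \<Rightarrow> nat \<Rightarrow> nat \<Rightarrow> nat" where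
  "ext b \<alpha> l = (\<lambda>i\<in>{..<l + of_bool b}. if b then (if i = 0 then 0 else Suc (\<alpha> (i - 1))) else Suc (\<alpha> i))"

definition red :: "bool \<Rightarrow> (nat \<Rightarrow> nat) \<Rightarrow> nat \<Rightarrow> nat \<Rightarrow> nat" where
  "red b \<alpha> l = (\<lambda>i\<in>{..<l}. \<alpha> (i + of_bool b) - 1)"

definition inc_maps :: "nat \<Rightarrow> nat \<Rightarrow> (nat \<Rightarrow> nat) set" where
  "inc_maps l n = {\<alpha>. \<alpha> \<in> {..<l} \<rightarrow>\<^sub>E {..<n} \<and> strict_mono_on {..<l} \<alpha>}"

lemma qshuffles_inc: "qshuffles l m n = {(\<alpha>, \<beta>). \<alpha> \<in> inc_maps l n \<and> \<beta> \<in> inc_maps m n \<and> \<alpha> ` {..<l} \<union> \<beta> ` {..<m} = {..<n}}"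
  by (auto simp: qshuffles_def inc_maps_def)

lemma ext_inc: "\<alpha> \<in> inc_maps l n \<Longrightarrow> ext b \<alpha> l \<in> inc_maps (l + of_bool b) (Suc n)"
proof -
  assume a: "\<alpha> \<in> inc_maps l n"
  have mono: "\<alpha> i < \<alpha> j" if "i < j" "j < l" for i j
    using a that by (auto simp: inc_maps_def strict_mono_on_def)
  have bd: "\<alpha> i < n" if "i < l" for i using a that by (auto simp: inc_maps_def)
  have "ext b \<alpha> l i < Suc n" if "i < l + of_bool b" for i
    using that bd[of i] bd[of "i - 1"] by (cases b) (auto simp: ext_def)
  moreover have "ext b \<alpha> l i < ext b \<alpha> l j" if "i < j" "j < l + of_bool b" for i j
    using that mono[of i j] mono[of "i - 1" "j - 1"] by (cases b) (auto simp: ext_def)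
  moreover have "ext b \<alpha> l i = undefined" if "\<not> i < l + of_bool b" for i using that by (simp add: ext_def)
  ultimately show ?thesis by (auto simp: inc_maps_def strict_mono_on_def PiE_def extensional_def)
qed

lemma ext_image: "ext b \<alpha> l ` {..<l + of_bool b} = (if b then {0} else {}) \<union> Suc ` (\<alpha> ` {..<l})"
proof (cases b)
  case True
  have "{..<l + of_bool b} = insert 0 (Suc ` {..<l})" using True by (simp add: lessThan_Suc_eq_insert_0)
  then have "ext b \<alpha> l ` {..<l + of_bool b} = insert (ext b \<alpha> l 0) ((\<lambda>i. ext b \<alpha> l (Suc i)) ` {..<l})"
    by (simp add: image_image)
  also have "\<dots> = insert 0 ((\<lambda>i. Suc (\<alpha> i)) ` {..<l})"
    using True by (intro arg_cong2[where f = insert] image_cong refl) (auto simp: ext_def)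
  finally show ?thesis using True by (simp add: image_image)
next
  case False
  then show ?thesis by (auto simp: ext_def image_iff)
qed

lemma red_ext: "\<alpha> \<in> inc_maps l n \<Longrightarrow> red b (ext b \<alpha> l) l = \<alpha>"
  by (rule ext) (auto simp: red_def ext_def inc_maps_def PiE_def extensional_def)

text \<open>An increasing map can take the value \<open>0\<close> only at its first argument. Once
  that argument is dropped, or if \<open>0\<close> is not taken at all, every value is positive and
  can be lowered by one.\<close>

lemma red_inc:
  assumes a: "\<alpha> \<in> inc_maps (l + of_bool b) (Suc n)" and b: "b \<longleftrightarrow> 0 \<in> \<alpha> ` {..<l + of_bool b}"
  shows "red b \<alpha> l \<in> inc_maps l n" "ext b (red b \<alpha> l) l = \<alpha>"
proof -
  have mono: "\<alpha> i < \<alpha> j" if "i < j" "j < l + of_bool b" for i j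
    using a that by (auto simp: inc_maps_def strict_mono_on_def)
  have bd: "\<alpha> i < Suc n" if "i < l + of_bool b" for i using a that by (auto simp: inc_maps_def)
  have und: "\<alpha> i = undefined" if "\<not> i < l + of_bool b" for i using a that by (auto simp: inc_maps_def PiE_def extensional_def)
  have pos: "\<alpha> (i + of_bool b) > 0" if i: "i < l" for i
  proof (cases b)
    case True
    then show ?thesis using mono[of 0 "Suc i"] i by simp
  next
    case False
    then show ?thesis using b i by (metis add.right_neutral gr0I image_eqI lessThan_iff of_bool_eq(1))
  qed
  have a0: "\<alpha> 0 = 0" if tb: b
  proof -
    obtain i where i: "i < l + 1" "\<alpha> i = 0" using b tb by auto
    then show ?thesis using mono[of 0 i] tb by (cases i) auto
  qed
  have "red b \<alpha> l i < n" if "i < l" for i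
    using bd[of "i + of_bool b"] pos[OF that] that by (simp add: red_def)
  moreover have "red b \<alpha> l i < red b \<alpha> l j" if "i < j" "j < l" for i j
    using mono[of "i + of_bool b" "j + of_bool b"] pos[of i] that by (simp add: red_def)
  ultimately show "red b \<alpha> l \<in> inc_maps l n"
    by (auto simp: inc_maps_def strict_mono_on_def red_def)
  show "ext b (red b \<alpha> l) l = \<alpha>"
  proof (rule HOL.ext)
    fix i
    show "ext b (red b \<alpha> l) l i = \<alpha> i"
    proof (cases "i < l + of_bool b")
      case False then show ?thesis using und by (simp add: ext_def)
    next
      case i: True
      show ?thesis
      proof (cases b)
        case True
        then show ?thesis using i a0 pos[of "i - 1"] by (cases i) (auto simp: ext_def red_def)
      next
        case False
        then show ?thesis using i pos[of i] by (auto simp: ext_def red_def)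
      qed
    qed
  qed
qed

lemma qshuffles_ext_bij:
  assumes "b \<or> c"
  shows "bij_betw (\<lambda>q. (ext b (fst q) l, ext c (snd q) m)) (qshuffles l m n)
     {q \<in> qshuffles (l + of_bool b) (m + of_bool c) (Suc n). (b \<longleftrightarrow> 0 \<in> fst q ` {..<l + of_bool b}) \<and> (c \<longleftrightarrow> 0 \<in> snd q ` {..<m + of_bool c})}"
proof (rule bij_betw_byWitness[where f' = "\<lambda>q. (red b (fst q) l, red c (snd q) m)"])
  have un: "((if b then {0} else {}) \<union> Suc ` S) \<union> ((if c then {0} else {}) \<union> Suc ` S') = {..<Suc n} \<longleftrightarrow> S \<union> S' = {..<n}" for S S'
  proof -
    have "((if b then {0} else {}) \<union> Suc ` S) \<union> ((if c then {0} else {}) \<union> Suc ` S') = insert 0 (Suc ` (S \<union> S'))"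
      using assms by auto
    moreover have "{..<Suc n} = insert 0 (Suc ` {..<n})" by (simp add: lessThan_Suc_eq_insert_0)
    moreover have "insert 0 (Suc ` P) = insert 0 (Suc ` Q) \<longleftrightarrow> P = Q" for P Q
      by (auto simp: set_eq_iff image_iff)
    ultimately show ?thesis by metis
  qed
  show "\<forall>q\<in>qshuffles l m n. (red b (fst (ext b (fst q) l, ext c (snd q) m)) l, red c (snd (ext b (fst q) l, ext c (snd q) m)) m) = q"
    using red_ext by (auto simp: qshuffles_inc)
  show "\<forall>q\<in>{q \<in> qshuffles (l + of_bool b) (m + of_bool c) (Suc n). (b \<longleftrightarrow> 0 \<in> fst q ` {..<l + of_bool b}) \<and> (c \<longleftrightarrow> 0 \<in> snd q ` {..<m + of_bool c})}.
      (ext b (fst (red b (fst q) l, red c (snd q) m)) l, ext c (snd (red b (fst q) l, red c (snd q) m)) m) = q"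
    using red_inc(2) by (auto simp: qshuffles_inc)
  show "(\<lambda>q. (ext b (fst q) l, ext c (snd q) m)) ` qshuffles l m n \<subseteq> {q \<in> qshuffles (l + of_bool b) (m + of_bool c) (Suc n). (b \<longleftrightarrow> 0 \<in> fst q ` {..<l + of_bool b}) \<and> (c \<longleftrightarrow> 0 \<in> snd q ` {..<m + of_bool c})}"
  proof
    fix q assume "q \<in> (\<lambda>q. (ext b (fst q) l, ext c (snd q) m)) ` qshuffles l m n"
    then obtain \<alpha> \<beta> where q: "q = (ext b \<alpha> l, ext c \<beta> m)" "\<alpha> \<in> inc_maps l n" "\<beta> \<in> inc_maps m n" "\<alpha> ` {..<l} \<union> \<beta> ` {..<m} = {..<n}"
      by (auto simp: qshuffles_inc)
    have "ext b \<alpha> l ` {..<l + of_bool b} \<union> ext c \<beta> m ` {..<m + of_bool c} = {..<Suc n}"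
      unfolding ext_image un by (rule q(4))
    then show "q \<in> {q \<in> qshuffles (l + of_bool b) (m + of_bool c) (Suc n). (b \<longleftrightarrow> 0 \<in> fst q ` {..<l + of_bool b}) \<and> (c \<longleftrightarrow> 0 \<in> snd q ` {..<m + of_bool c})}"
      unfolding q(1) qshuffles_inc using ext_inc[OF q(2)] ext_inc[OF q(3)] by (simp add: ext_image)
  qed
  show "(\<lambda>q. (red b (fst q) l, red c (snd q) m)) ` {q \<in> qshuffles (l + of_bool b) (m + of_bool c) (Suc n). (b \<longleftrightarrow> 0 \<in> fst q ` {..<l + of_bool b}) \<and> (c \<longleftrightarrow> 0 \<in> snd q ` {..<m + of_bool c})} \<subseteq> qshuffles l m n"
  proof
    fix q assume "q \<in> (\<lambda>q. (red b (fst q) l, red c (snd q) m)) ` {q \<in> qshuffles (l + of_bool b) (m + of_bool c) (Suc n). (b \<longleftrightarrow> 0 \<in> fst q ` {..<l + of_bool b}) \<and> (c \<longleftrightarrow> 0 \<in> snd q ` {..<m + of_bool c})}"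
    then obtain \<alpha> \<beta> where q: "q = (red b \<alpha> l, red c \<beta> m)" "\<alpha> \<in> inc_maps (l + of_bool b) (Suc n)" "\<beta> \<in> inc_maps (m + of_bool c) (Suc n)"
      "\<alpha> ` {..<l + of_bool b} \<union> \<beta> ` {..<m + of_bool c} = {..<Suc n}" "b \<longleftrightarrow> 0 \<in> \<alpha> ` {..<l + of_bool b}" "c \<longleftrightarrow> 0 \<in> \<beta> ` {..<m + of_bool c}"
      by (auto simp: qshuffles_inc)
    note ra = red_inc[OF q(2,5)] and rb = red_inc[OF q(3,6)]
    have "ext b (red b \<alpha> l) l ` {..<l + of_bool b} \<union> ext c (red c \<beta> m) m ` {..<m + of_bool c} = {..<Suc n}"
      using q(4) ra(2) rb(2) by simp
    then have "red b \<alpha> l ` {..<l} \<union> red c \<beta> m ` {..<m} = {..<n}" unfolding ext_image un .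
    then show "q \<in> qshuffles l m n" using q(1) ra(1) rb(1) by (simp add: qshuffles_inc)
  qed
qed

lemma finite_qshuffles [simp]: "finite (qshuffles l m n)"
  by (rule finite_subset[of _ "({..<l} \<rightarrow>\<^sub>E {..<n}) \<times> ({..<m} \<rightarrow>\<^sub>E {..<n})"]) (auto simp: qshuffles_def intro!: finite_PiE)

lemma qshuffles_empty: "n > l + m \<Longrightarrow> qshuffles l m n = {}"
proof (rule ccontr)
  assume n: "n > l + m" and "qshuffles l m n \<noteq> {}"
  then obtain \<alpha> \<beta> where "\<alpha> ` {..<l} \<union> \<beta> ` {..<m} = {..<n}" by (auto simp: qshuffles_inc)
  then have "n = card (\<alpha> ` {..<l} \<union> \<beta> ` {..<m})" by simp
  also have "\<dots> \<le> card (\<alpha> ` {..<l}) + card (\<beta> ` {..<m})" by (rule card_Un_le)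
  also have "\<dots> \<le> l + m" using card_image_le[of "{..<l}" \<alpha>] card_image_le[of "{..<m}" \<beta>] by simp
  finally show False using n by simp
qed

lemma qshuffles_0: "qshuffles l m 0 = (if l = 0 \<and> m = 0 then {(\<lambda>_. undefined, \<lambda>_. undefined)} else {})"
  by (auto simp: qshuffles_inc inc_maps_def strict_mono_on_def)

abbreviation "flags \<equiv> {(True, False), (False, True), (True, True)}"

text \<open>Joint surjectivity means that position \<open>0\<close> is hit by the first map, by the
  second, or by both; these disjoint classes are the three flags.\<close>

lemma sum_qshuffles_Suc:
  fixes F :: "(nat \<Rightarrow> nat) \<times> (nat \<Rightarrow> nat) \<Rightarrow> 'k::comm_monoid_add"
  shows "(\<Sum>q\<in>qshuffles l m (Suc n). F q) =
    (\<Sum>(b, c)\<in>flags. if of_bool b \<le> l \<and> of_bool c \<le> m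
       then \<Sum>q\<in>qshuffles (l - of_bool b) (m - of_bool c) n. F (ext b (fst q) (l - of_bool b), ext c (snd q) (m - of_bool c)) else 0)"
proof -
  define C where "C b c = {q \<in> qshuffles l m (Suc n). (b \<longleftrightarrow> 0 \<in> fst q ` {..<l}) \<and> (c \<longleftrightarrow> 0 \<in> snd q ` {..<m})}" for b c
  have un: "qshuffles l m (Suc n) = (\<Union>(b, c)\<in>flags. C b c)"
  proof
    show "qshuffles l m (Suc n) \<subseteq> (\<Union>(b, c)\<in>flags. C b c)"
    proof
      fix q assume q: "q \<in> qshuffles l m (Suc n)"
      then have "fst q ` {..<l} \<union> snd q ` {..<m} = {..<Suc n}" by (simp add: qshuffles_inc case_prod_unfold)
      then have "0 \<in> fst q ` {..<l} \<or> 0 \<in> snd q ` {..<m}" by blast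
      then show "q \<in> (\<Union>(b, c)\<in>flags. C b c)" using q unfolding C_def by auto
    qed
  qed (auto simp: C_def)
  have "(\<Sum>q\<in>qshuffles l m (Suc n). F q) = (\<Sum>bc\<in>flags. \<Sum>q\<in>(case bc of (b, c) \<Rightarrow> C b c). F q)"
    unfolding un by (rule sum.UNION_disjoint) (auto simp: C_def)
  also have "\<dots> = (\<Sum>(b, c)\<in>flags. if of_bool b \<le> l \<and> of_bool c \<le> m
       then \<Sum>q\<in>qshuffles (l - of_bool b) (m - of_bool c) n. F (ext b (fst q) (l - of_bool b), ext c (snd q) (m - of_bool c)) else 0)"
  proof (rule sum.cong[OF refl], clarify)
    fix b c assume bc: "(b, c) \<in> flags"
    show "(\<Sum>q\<in>C b c. F q) = (if of_bool b \<le> l \<and> of_bool c \<le> m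
       then \<Sum>q\<in>qshuffles (l - of_bool b) (m - of_bool c) n. F (ext b (fst q) (l - of_bool b), ext c (snd q) (m - of_bool c)) else 0)"
    proof (cases "of_bool b \<le> l \<and> of_bool c \<le> m")
      case False
      then have "(b \<and> l = 0) \<or> (c \<and> m = 0)" by (cases b; cases c) auto
      then have "C b c = {}" by (auto simp: C_def)
      then show ?thesis by (simp only: False if_False sum.empty)
    next
      case True
      have "bij_betw (\<lambda>q. (ext b (fst q) (l - of_bool b), ext c (snd q) (m - of_bool c))) (qshuffles (l - of_bool b) (m - of_bool c) n) (C b c)"
        using qshuffles_ext_bij[of b c "l - of_bool b" "m - of_bool c" n] bc True by (auto simp: C_def)
      from sum.reindex_bij_betw[OF this, of F] show ?thesis using True by simp
    qed
  qed
  finally show ?thesis .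
qed

section \<open>The recursion on the first letter of a quasi-shuffle\<close>

definition rest :: "bool \<Rightarrow> 'b list \<Rightarrow> 'b list" where "rest b u = (if b then tl u else u)"
definition front :: "bool \<Rightarrow> 'b list \<Rightarrow> 'b list" where "front b u = (if b then [hd u] else [])"

lemma lab_ext:
  assumes "of_bool b \<le> length u"
  shows "lab (ext b \<alpha> (length u - of_bool b)) u = map (\<lambda>x. (0, x)) (front b u) @ shift_lab (lab \<alpha> (rest b u))"
proof (cases b)
  case True
  then obtain x v where u: "u = x # v" using assms by (cases u) auto
  have "lab (\<lambda>i. ext True \<alpha> (length v) (Suc i)) v = shift_lab (lab \<alpha> v)"
    by (rule nth_equalityI) (auto simp: lab_def shift_lab_def ext_def)
  moreover have "ext True \<alpha> (length v) 0 = 0" by (simp add: ext_def)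
  ultimately show ?thesis using True u by (simp add: lab_Cons front_def rest_def)
next
  case False
  have "lab (ext False \<alpha> (length u)) u = shift_lab (lab \<alpha> u)"
    by (rule nth_equalityI) (auto simp: lab_def shift_lab_def ext_def)
  then show ?thesis using False by (simp add: front_def rest_def)
qed

lemma filter_shift:
  "map snd (filter (\<lambda>q. fst q = Suc i) (shift_lab L)) = map snd (filter (\<lambda>q. fst q = i) L)"
  "filter (\<lambda>q. fst q = 0) (shift_lab L) = []"
  by (induction L) (auto simp: shift_lab_def)

lemma filter_zero:
  "filter (\<lambda>q. fst q = 0) (map (\<lambda>x. (0 :: nat, x)) s) = map (\<lambda>x. (0, x)) s"
  "filter (\<lambda>q. fst q = Suc i) (map (\<lambda>x. (0 :: nat, x)) s) = []"
  by (induction s) auto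

lemma contract_lab_shift:
  "contract_lab A (Suc n) (map (\<lambda>x. (0, x)) s @ shift_lab L @ map (\<lambda>x. (0, x)) t @ shift_lab L') = lprod A (s @ t) # contract_lab A n (L @ L')"
  by (simp add: contract_lab_def upt_conv_Cons map_Suc_upt[symmetric] o_def filter_shift filter_zero del: upt_Suc)

lemma sign_lab_append_prod:
  "sign_lab (L @ L') = sign_lab L * (\<Prod>q\<leftarrow>L. \<Prod>h\<leftarrow>L'. if fst q > fst h then (-1) ^ (fst (snd q) * fst (snd h)) else 1) * sign_lab L'"
  by (induction L) (auto simp: mult_ac)

lemma sign_lab_shift: "sign_lab (shift_lab L) = sign_lab L"
  by (induction L) (auto simp: shift_lab_def o_def cong: if_cong)

lemma sign_lab_zero: "sign_lab (map (\<lambda>x. (0, x)) s) = (1 :: 'k::field)"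
proof (induction s)
  case (Cons x s)
  have "(\<Prod>h\<leftarrow>map (\<lambda>x. (0 :: nat, x)) s. if 0 > fst h then (-1) ^ (fst x * fst (snd h)) else (1 :: 'k)) = 1"
    by (induction s) auto
  then show ?case using Cons by simp
qed simp

text \<open>A letter of \<open>t\<close> has label \<open>0\<close> and therefore crosses each
  letter of \<open>L\<close>, whose labels are positive after the shift. The letters of
  \<open>s\<close> stand in front with the smallest label and cross nothing, and shifting all labels
  creates no new inversions.\<close>

lemma sign_lab_rec:
  "sign_lab (map (\<lambda>x. (0, x)) s @ shift_lab L @ map (\<lambda>x. (0, x)) t @ shift_lab L')
    = (-1) ^ (wdeg (map snd L) * wdeg t) * (sign_lab (L @ L') :: 'k::field)"
proof -
  let ?c = "\<lambda>L L'. (\<Prod>q\<leftarrow>L. \<Prod>h\<leftarrow>L'. if fst q > fst h then (-1 :: 'k) ^ (fst (snd q) * fst (snd h)) else 1)"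
  let ?z = "map (\<lambda>x. (0 :: nat, x)) :: (nat \<times> 'a) list \<Rightarrow> (nat \<times> nat \<times> 'a) list"
  have c0: "?c (?z s) L = 1" for s L
  proof -
    have "(\<Prod>h\<leftarrow>L. if fst q > fst h then (-1 :: 'k) ^ (fst (snd q) * fst (snd h)) else 1) = 1" if "fst q = 0" for q :: "nat \<times> nat \<times> 'a"
      using that by (induction L) auto
    then show ?thesis by (induction s) auto
  qed
  have cs: "?c (shift_lab L) (shift_lab L') = ?c L L'"
    by (simp add: shift_lab_def o_def cong: if_cong)
  have ct: "?c (shift_lab L) (?z t) = (-1) ^ (wdeg (map snd L) * wdeg t)"
  proof -
    have "(\<Prod>h\<leftarrow>?z t. if fst q > fst h then (-1 :: 'k) ^ (fst (snd q) * fst (snd h)) else 1) = (-1) ^ (fst (snd q) * wdeg t)" if "fst q > 0" for q :: "nat \<times> nat \<times> 'a"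
      using that by (induction t) (auto simp: power_add distrib_left cong: if_cong)
    then show ?thesis
      by (induction L) (auto simp: shift_lab_def power_add distrib_right cong: if_cong)
  qed
  have cap: "?c L (L1 @ L2) = ?c L L1 * ?c L L2" for L L1 L2
    by (induction L) (auto simp: mult_ac)
  show ?thesis
    by (simp only: sign_lab_append_prod c0 cs ct cap sign_lab_shift sign_lab_zero mult_1_left mult_1_right) (simp add: mult_ac)
qed

text \<open>The quasi-shuffle sum with a bound independent of the words. The three terms of the
  recursion concern words of different total length and can only be compared under a common
  bound.\<close>

definition qsum :: "('k::field, 'a, 'm) galgebra_scheme \<Rightarrow> nat \<Rightarrow> ((nat \<times> 'a) list \<Rightarrow> 'k) \<Rightarrow> (nat \<times> 'a) list \<Rightarrow> (nat \<times> 'a) list \<Rightarrow> 'k" where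
  "qsum A N \<phi> u v = (\<Sum>n\<le>N. \<Sum>q\<in>qshuffles (length u) (length v) n.
     sign_lab (lab (fst q) u @ lab (snd q) v) * \<phi> (contract_lab A n (lab (fst q) u @ lab (snd q) v)))"

lemma qsum_bound:
  assumes "length u + length v \<le> N"
  shows "qsum A N \<phi> u v = qshuffle_eval A \<phi> u v"
proof -
  have "qshuffle_eval A \<phi> u v = qsum A (length u + length v) \<phi> u v"
    by (simp add: qshuffle_eval_def qsum_def case_prod_unfold sign_lab_eq contract_lab_eq lab_append)
  also have "\<dots> = qsum A N \<phi> u v"
    unfolding qsum_def by (rule sum.mono_neutral_left) (use assms in \<open>auto simp: qshuffles_empty\<close>)
  finally show ?thesis by simp
qed

lemma qshuffle_eval_rec:
  assumes "u \<noteq> [] \<or> v \<noteq> []"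
  shows "qshuffle_eval A \<phi> u v = (\<Sum>(b, c)\<in>flags. if of_bool b \<le> length u \<and> of_bool c \<le> length v
     then (-1) ^ (wdeg (rest b u) * wdeg (front c v)) * qshuffle_eval A (\<lambda>t. \<phi> (lprod A (front b u @ front c v) # t)) (rest b u) (rest c v) else 0)"
proof -
  obtain N where N: "length u + length v = Suc N" using assms by (cases "length u + length v") auto
  let ?V = "\<lambda>b c. of_bool b \<le> length u \<and> of_bool c \<le> length v"
  have len: "length (rest b u) = length u - of_bool b" "length (rest c v) = length v - of_bool c" for b c
    by (auto simp: rest_def)
  define g where "g n b c = (\<Sum>q\<in>qshuffles (length (rest b u)) (length (rest c v)) n.
     (-1) ^ (wdeg (rest b u) * wdeg (front c v)) * (sign_lab (lab (fst q) (rest b u) @ lab (snd q) (rest c v)) *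
       \<phi> (lprod A (front b u @ front c v) # contract_lab A n (lab (fst q) (rest b u) @ lab (snd q) (rest c v)))))" for n b c
  have step: "(\<Sum>q\<in>qshuffles (length u) (length v) (Suc n). sign_lab (lab (fst q) u @ lab (snd q) v) * \<phi> (contract_lab A (Suc n) (lab (fst q) u @ lab (snd q) v)))
    = (\<Sum>(b, c)\<in>flags. if ?V b c then g n b c else 0)" for n
  proof -
    have E: "sign_lab (lab (ext b \<alpha> (length u - of_bool b)) u @ lab (ext c \<beta> (length v - of_bool c)) v) *
        \<phi> (contract_lab A (Suc n) (lab (ext b \<alpha> (length u - of_bool b)) u @ lab (ext c \<beta> (length v - of_bool c)) v))
      = (-1) ^ (wdeg (rest b u) * wdeg (front c v)) * (sign_lab (lab \<alpha> (rest b u) @ lab \<beta> (rest c v)) *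
       \<phi> (lprod A (front b u @ front c v) # contract_lab A n (lab \<alpha> (rest b u) @ lab \<beta> (rest c v))))" if "?V b c" for b c \<alpha> \<beta>
      using that by (simp add: lab_ext contract_lab_shift sign_lab_rec map_snd_lab mult_ac)
    show ?thesis
      unfolding sum_qshuffles_Suc g_def len fst_conv snd_conv
    proof (rule sum.cong[OF refl], clarify)
      fix b c
      show "(if ?V b c then \<Sum>q\<in>qshuffles (length u - of_bool b) (length v - of_bool c) n.
           sign_lab (lab (ext b (fst q) (length u - of_bool b)) u @ lab (ext c (snd q) (length v - of_bool c)) v) *
           \<phi> (contract_lab A (Suc n) (lab (ext b (fst q) (length u - of_bool b)) u @ lab (ext c (snd q) (length v - of_bool c)) v)) else 0) =
         (if ?V b c then \<Sum>q\<in>qshuffles (length u - of_bool b) (length v - of_bool c) n.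
           (-1) ^ (wdeg (rest b u) * wdeg (front c v)) * (sign_lab (lab (fst q) (rest b u) @ lab (snd q) (rest c v)) *
             \<phi> (lprod A (front b u @ front c v) # contract_lab A n (lab (fst q) (rest b u) @ lab (snd q) (rest c v)))) else 0)"
        by (cases "?V b c") (simp_all only: E if_True if_False refl)
    qed
  qed
  have "qshuffle_eval A \<phi> u v = qsum A (Suc N) \<phi> u v" by (rule qsum_bound[symmetric]) (simp add: N)
  \<comment> \<open>The words are not both empty, so no quasi-shuffle has target size
    \<open>0\<close> and the index can be shifted by one.\<close>
  also have "\<dots> = (\<Sum>n\<le>N. \<Sum>(b, c)\<in>flags. if ?V b c then g n b c else 0)"
    unfolding qsum_def using N by (subst sum.atMost_Suc_shift) (auto simp: step qshuffles_0)
  also have "\<dots> = (\<Sum>bc\<in>flags. \<Sum>n\<le>N. case bc of (b, c) \<Rightarrow> if ?V b c then g n b c else 0)"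
    by (rule sum.swap)
  also have "\<dots> = (\<Sum>(b, c)\<in>flags. if ?V b c
     then (-1) ^ (wdeg (rest b u) * wdeg (front c v)) * qshuffle_eval A (\<lambda>t. \<phi> (lprod A (front b u @ front c v) # t)) (rest b u) (rest c v) else 0)"
  proof (rule sum.cong[OF refl], clarify)
    fix b c assume bc: "(b, c) \<in> flags"
    show "(\<Sum>n\<le>N. if ?V b c then g n b c else 0) = (if ?V b c
     then (-1) ^ (wdeg (rest b u) * wdeg (front c v)) * qshuffle_eval A (\<lambda>t. \<phi> (lprod A (front b u @ front c v) # t)) (rest b u) (rest c v) else 0)"
    proof (cases "?V b c")
      case True
      have "length (rest b u) + length (rest c v) \<le> N" using bc True N by (auto simp: len)
      note l = this
      have "(\<Sum>n\<le>N. g n b c) = (-1) ^ (wdeg (rest b u) * wdeg (front c v)) * qsum A N (\<lambda>t. \<phi> (lprod A (front b u @ front c v) # t)) (rest b u) (rest c v)"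
        by (simp add: g_def qsum_def sum_distrib_left)
      with True show ?thesis by (simp only: if_True qsum_bound[OF l] simp_thms)
    next
      case False
      then show ?thesis by (simp only: if_False sum.neutral_const)
    qed
  qed
  finally show ?thesis .
qed

lemma qshuffle_eval_Nil: "qshuffle_eval A \<phi> [] [] = \<phi> []"
  by (simp add: qsum_bound[symmetric, of "[]" "[]" 0] qsum_def qshuffles_0 contract_lab_def)

section \<open>Coordinates of a graded algebra\<close>

text \<open>Basis vectors are indexed by letters rather than being letters themselves, so that
  algebras over different carriers can share one alphabet.\<close>

locale based = connected_comm_galgebra A + letters X u0
  for A :: "('k::field, 'a::ab_group_add) galgebra" and X :: "(nat \<times> 'x) set" and u0 :: "nat \<times> 'x" +
  fixes el :: "nat \<times> 'x \<Rightarrow> 'a"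
  assumes el_inj: "inj_on el {c \<in> insert u0 X. fst c = n}"
    and el_indep: "independent (el ` {c \<in> insert u0 X. fst c = n})"
    and el_span: "span (el ` {c \<in> insert u0 X. fst c = n}) = gr A n"
    and el_u0: "el u0 = unit A"
begin

definition Yd :: "nat \<Rightarrow> (nat \<times> 'x) set" where "Yd n = {c \<in> Y. fst c = n}"

definition crd :: "nat \<times> 'x \<Rightarrow> 'a \<Rightarrow> 'k" where "crd c v = representation (el ` Yd (fst c)) v (el c)"

lemma finite_Yd [simp]: "finite (Yd n)"
  by (rule finite_subset[OF _ finite_Yl[of n]]) (auto simp: Yd_def Yl_def)

lemma Yd_I: "c \<in> Y \<Longrightarrow> c \<in> Yd (fst c)" by (simp add: Yd_def)

lemma Yd_0: "Yd 0 = {u0}" unfolding Yd_def using Y_deg0 by auto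

lemma basis: "inj_on el (Yd n)" "independent (el ` Yd n)" "span (el ` Yd n) = gr A n"
  using el_inj el_indep el_span by (simp_all add: Yd_def)

lemma el_gr: "c \<in> Y \<Longrightarrow> el c \<in> gr A (fst c)"
  using basis(3)[of "fst c"] Yd_I span_base by blast

lemma gr_subspace: "subspace (gr A n)" using basis(3)[of n] subspace_span by metis

lemma crd_expand:
  assumes "v \<in> gr A n"
  shows "v = (\<Sum>c\<in>Yd n. scl A (crd c v) (el c))"
proof -
  have "v = (\<Sum>b\<in>el ` Yd n. scl A (representation (el ` Yd n) v b) b)"
    using sum_representation_eq[of "el ` Yd n" v "el ` Yd n"] basis[of n] assms by simp
  also have "\<dots> = (\<Sum>c\<in>Yd n. scl A (crd c v) (el c))"
    unfolding sum.reindex[OF basis(1)] by (rule sum.cong) (auto simp: crd_def Yd_def)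
  finally show ?thesis .
qed

lemma crd_add: "v \<in> gr A (fst c) \<Longrightarrow> w \<in> gr A (fst c) \<Longrightarrow> crd c (v + w) = crd c v + crd c w"
  unfolding crd_def using basis[of "fst c"] by (simp add: representation_add)

lemma crd_scl: "v \<in> gr A (fst c) \<Longrightarrow> crd c (scl A x v) = x * crd c v"
  unfolding crd_def using basis[of "fst c"] by (simp add: representation_scale)

lemma crd_el: "c \<in> Y \<Longrightarrow> d \<in> Y \<Longrightarrow> fst d = fst c \<Longrightarrow> crd c (el d) = (if c = d then 1 else 0)"
proof -
  assume a: "c \<in> Y" "d \<in> Y" "fst d = fst c"
  then have "c \<in> Yd (fst c)" "d \<in> Yd (fst c)" by (auto simp: Yd_def)
  then show ?thesis
    unfolding crd_def using basis[of "fst c"] by (auto simp: representation_basis inj_on_eq_iff)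
qed

lemma crd_eqI: "v \<in> gr A n \<Longrightarrow> w \<in> gr A n \<Longrightarrow> (\<And>c. c \<in> Yd n \<Longrightarrow> crd c v = crd c w) \<Longrightarrow> v = w"
  by (subst crd_expand, assumption, subst (2) crd_expand, assumption) (auto intro: sum.cong)

lemma lin_expand:
  fixes F :: "'a \<Rightarrow> 'k"
  assumes add: "\<And>v w. v \<in> gr A n \<Longrightarrow> w \<in> gr A n \<Longrightarrow> F (v + w) = F v + F w"
    and scl: "\<And>x v. v \<in> gr A n \<Longrightarrow> F (scl A x v) = x * F v"
    and v: "v \<in> gr A n"
  shows "F v = (\<Sum>c\<in>Yd n. crd c v * F (el c))"
proof -
  have 0: "F 0 = 0" using scl[of v 0] v by simp
  have el: "el c \<in> gr A n" if "c \<in> Yd n" for c using el_gr[of c] that by (auto simp: Yd_def)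
  have "finite S \<Longrightarrow> S \<subseteq> Yd n \<Longrightarrow> F (\<Sum>c\<in>S. scl A (crd c v) (el c)) = (\<Sum>c\<in>S. crd c v * F (el c))" for S
  proof (induction S rule: finite_induct)
    case (insert c S)
    have "scl A (crd c v) (el c) \<in> gr A n" using insert el by (intro subspace_scale gr_subspace) auto
    moreover have "(\<Sum>c\<in>S. scl A (crd c v) (el c)) \<in> gr A n" using insert el by (intro subspace_sum subspace_scale gr_subspace) auto
    ultimately show ?case using insert el by (simp add: add scl)
  qed (simp add: 0)
  from this[OF finite_Yd subset_refl] show ?thesis using crd_expand[OF v] by simp
qed

definition m :: "nat \<times> 'x \<Rightarrow> nat \<times> 'x \<Rightarrow> nat \<times> 'x \<Rightarrow> 'k" where
  "m a b c = (if a \<in> Y \<and> b \<in> Y \<and> c \<in> Y \<and> fst c = fst a + fst b then crd c (mul A (fst a) (fst b) (el a) (el b)) else 0)"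

lemma crd_mul_left:
  assumes "v \<in> gr A i" "c \<in> Y" "e \<in> Y" "fst e = i + fst c"
  shows "crd e (mul A i (fst c) v (el c)) = (\<Sum>d\<in>Yd i. crd d v * m d c e)"
proof -
  have g: "x \<in> gr A i \<Longrightarrow> mul A i (fst c) x (el c) \<in> gr A (fst e)" for x
    using mul_closed[of x i "el c" "fst c"] el_gr[OF assms(2)] assms by simp
  have "crd e (mul A i (fst c) v (el c)) = (\<Sum>d\<in>Yd i. crd d v * crd e (mul A i (fst c) (el d) (el c)))"
    by (rule lin_expand) (use assms g el_gr[of c] in \<open>auto simp: mul_add_left mul_scl_left crd_add crd_scl\<close>)
  also have "\<dots> = (\<Sum>d\<in>Yd i. crd d v * m d c e)"
    by (rule sum.cong) (use assms in \<open>auto simp: m_def Yd_def\<close>)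
  finally show ?thesis .
qed

lemma crd_mul_right:
  assumes "v \<in> gr A i" "c \<in> Y" "e \<in> Y" "fst e = fst c + i"
  shows "crd e (mul A (fst c) i (el c) v) = (\<Sum>d\<in>Yd i. crd d v * m c d e)"
proof -
  have g: "x \<in> gr A i \<Longrightarrow> mul A (fst c) i (el c) x \<in> gr A (fst e)" for x
    using mul_closed[of "el c" "fst c" x i] el_gr[OF assms(2)] assms by simp
  have "crd e (mul A (fst c) i (el c) v) = (\<Sum>d\<in>Yd i. crd d v * crd e (mul A (fst c) i (el c) (el d)))"
    by (rule lin_expand) (use assms g el_gr[of c] in \<open>auto simp: mul_add_right mul_scl_right crd_add crd_scl\<close>)
  also have "\<dots> = (\<Sum>d\<in>Yd i. crd d v * m c d e)"
    by (rule sum.cong) (use assms in \<open>auto simp: m_def Yd_def\<close>)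
  finally show ?thesis .
qed

lemma Yl_Yd: "i \<le> n \<Longrightarrow> (\<And>d. d \<in> Y \<Longrightarrow> fst d \<noteq> i \<Longrightarrow> h d = 0) \<Longrightarrow> (\<Sum>d\<in>Yl n. h d) = (\<Sum>d\<in>Yd i. h d)" for h :: "_ \<Rightarrow> 'k"
  by (rule sum.mono_neutral_right[OF finite_Yl]) (auto simp: Yl_def Yd_def)

sublocale M: qsh X u0 m
proof
  show "m a b c \<noteq> 0 \<Longrightarrow> a \<in> Y \<and> b \<in> Y \<and> c \<in> Y \<and> fst c = fst a + fst b" for a b c
    by (simp add: m_def split: if_splits)
  show "a \<in> Y \<Longrightarrow> m u0 a c = (if c = a then 1 else 0)" for a c
    using el_gr[of a] crd_el[of c a] by (auto simp: m_def el_u0 unit_left)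
  show "m a b c = (-1) ^ (fst a * fst b) * m b a c" for a b c
  proof (cases "a \<in> Y \<and> b \<in> Y \<and> c \<in> Y \<and> fst c = fst a + fst b")
    case True
    then have el: "el a \<in> gr A (fst a)" "el b \<in> gr A (fst b)" using el_gr by blast+
    have "mul A (fst b) (fst a) (el b) (el a) \<in> gr A (fst c)" using mul_closed[OF el(2,1)] True by (simp add: add.commute)
    then show ?thesis using True graded_comm[OF el] by (simp add: m_def crd_scl add.commute)
  qed (auto simp: m_def)
  show "(\<Sum>d\<in>Yl (fst e). m a b d * m d c e) = (\<Sum>d\<in>Yl (fst e). m b c d * m a d e)" for a b c e
  proof (cases "a \<in> Y \<and> b \<in> Y \<and> c \<in> Y \<and> e \<in> Y \<and> fst e = fst a + fst b + fst c")
    case True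
    then have el: "el a \<in> gr A (fst a)" "el b \<in> gr A (fst b)" "el c \<in> gr A (fst c)" using el_gr by blast+
    have "(\<Sum>d\<in>Yl (fst e). m a b d * m d c e) = (\<Sum>d\<in>Yd (fst a + fst b). m a b d * m d c e)"
      by (rule Yl_Yd) (use True in \<open>auto simp: m_def\<close>)
    also have "\<dots> = (\<Sum>d\<in>Yd (fst a + fst b). crd d (mul A (fst a) (fst b) (el a) (el b)) * m d c e)"
      by (rule sum.cong) (use True in \<open>auto simp: m_def Yd_def\<close>)
    also have "\<dots> = crd e (mul A (fst a + fst b) (fst c) (mul A (fst a) (fst b) (el a) (el b)) (el c))"
      by (rule crd_mul_left[symmetric]) (use True el mul_closed in auto)
    also have "\<dots> = crd e (mul A (fst a) (fst b + fst c) (el a) (mul A (fst b) (fst c) (el b) (el c)))"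
      by (simp add: mul_assoc el)
    also have "\<dots> = (\<Sum>d\<in>Yd (fst b + fst c). crd d (mul A (fst b) (fst c) (el b) (el c)) * m a d e)"
      by (rule crd_mul_right) (use True el mul_closed in auto)
    also have "\<dots> = (\<Sum>d\<in>Yd (fst b + fst c). m b c d * m a d e)"
      by (rule sum.cong) (use True in \<open>auto simp: m_def Yd_def\<close>)
    also have "\<dots> = (\<Sum>d\<in>Yl (fst e). m b c d * m a d e)"
      by (rule Yl_Yd[symmetric]) (use True in \<open>auto simp: m_def\<close>)
    finally show ?thesis .
  next
    case False
    have 1: "m a b d * m d c e = 0" for d using False by (auto simp: m_def)
    have 2: "m b c d * m a d e = 0" for d using False by (auto simp: m_def)
    show ?thesis by (simp only: 1 2)
  qed
qed

primrec pc :: "nat \<times> 'x \<Rightarrow> nat \<Rightarrow> nat \<times> 'x \<Rightarrow> 'k" where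
  "pc a 0 c = (if c = u0 then 1 else 0)"
| "pc a (Suc i) c = (\<Sum>b\<in>Yl (fst c). m a b c * pc a i b)"

lemma pc_crd:
  assumes "a \<in> Y"
  shows "c \<in> Y \<Longrightarrow> fst c = i * fst a \<Longrightarrow> pc a i c = crd c (snd (lprod A (replicate i (fst a, el a))))"
proof (induction i arbitrary: c)
  case 0
  then show ?case using Y_deg0[of c] crd_el[of c u0] by (simp add: el_u0)
next
  case (Suc i)
  let ?l = "replicate i (fst a, el a)"
  have l: "?l \<in> hom_words" using el_gr[OF assms] by (auto simp: hom_words_def)
  have w: "wdeg ?l = i * fst a" by (simp add: wdeg_def sum_list_replicate)
  have fl: "fst (lprod A ?l) = i * fst a" by (simp add: fst_lprod w)
  have "pc a (Suc i) c = (\<Sum>b\<in>Yd (i * fst a). m a b c * pc a i b)"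
    unfolding pc.simps(2) by (rule Yl_Yd) (use Suc.prems in \<open>auto simp: m_def\<close>)
  also have "\<dots> = (\<Sum>b\<in>Yd (i * fst a). crd b (snd (lprod A ?l)) * m a b c)"
    by (rule sum.cong) (auto simp: Yd_def Suc.IH)
  also have "\<dots> = crd c (mul A (fst a) (i * fst a) (el a) (snd (lprod A ?l)))"
    by (rule crd_mul_right[symmetric]) (use lprod_closed[OF l] assms Suc.prems w in auto)
  finally show ?case by (simp add: fl)
qed

definition f :: "nat \<Rightarrow> nat \<times> 'x \<Rightarrow> nat \<times> 'x \<Rightarrow> 'k" where
  "f p a c = (if a \<in> X \<and> c \<in> X \<and> fst c = p * fst a then crd c (snd (lprod A (replicate p (fst a, el a)))) else 0)"

lemma odd_power_zero:
  assumes a: "x \<in> gr A n" and n: "odd n" and p: "(2::'k) \<noteq> 0" "i \<ge> 2"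
  shows "snd (lprod A (replicate i (n, x))) = 0"
proof -
  obtain j where j: "i = Suc (Suc j)" using p(2) by (metis add_2_eq_Suc le_Suc_ex)
  let ?l = "replicate j (n, x)"
  have l: "?l \<in> hom_words" using a by (auto simp: hom_words_def)
  have "mul A n n x x = scl A (-1) (mul A n n x x)" using graded_comm[OF a a] n by simp
  then have "mul A n n x x + mul A n n x x = 0" by (simp add: eq_neg_iff_add_eq_0)
  then have "scl A 2 (mul A n n x x) = 0" using scale_left_distrib[of 1 1 "mul A n n x x"] by simp
  then have s: "mul A n n x x = 0" using p(1) by simp
  have zl: "mul A i k 0 y = 0" if "y \<in> gr A k" for i k y
    using mul_scl_left[of 0 i y k 0] that subspace_0[OF gr_subspace[of i]] by simp
  have "mul A (n + n) (wdeg ?l) (mul A n n x x) (snd (lprod A ?l)) = 0" using zl lprod_closed[OF l] s by simp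
  then show ?thesis using mul_assoc[OF a a lprod_closed[OF l]] by (simp add: j fst_lprod)
qed

lemma qshf_based:
  assumes "CHAR('k) = p" "p > 0" "\<And>x::'k. \<exists>y. y ^ p = x"
  shows "qshf X u0 m p (f p) pc"
proof -
  have pr: "prime p" using prime_CHAR_semidom[where 'a = 'k] assms by simp
  have p2: "p \<ge> 2" using pr by (rule prime_ge_2_nat)
  have two: "(2::'k) \<noteq> 0" if "p \<noteq> 2"
  proof
    assume "(2::'k) = 0"
    then have "p dvd 2" using of_nat_eq_0_iff_char_dvd[where 'a = 'k, of 2] assms(1) by simp
    then show False using that p2 by (meson dvd_imp_le nat_dvd_not_less le_antisym pos2)
  qed
  show ?thesis
  proof
    show "CHAR('k) = p" "p > 0" by (rule assms)+
    show "\<exists>y. y ^ p = x" for x :: 'k by (rule assms)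
    show "f p a c \<noteq> 0 \<Longrightarrow> a \<in> X \<and> c \<in> X \<and> fst c = p * fst a" for a c by (simp add: f_def split: if_splits)
    show "f p a c = 0" if "p \<noteq> 2" "odd (fst a)" for a c
    proof (cases "a \<in> X \<and> c \<in> X \<and> fst c = p * fst a")
      case True
      then have "snd (lprod A (replicate p (fst a, el a))) = 0" using odd_power_zero[of "el a" "fst a" p] el_gr[of a] that two p2 by auto
      moreover have "crd c 0 = 0" using crd_scl[of 0 c 0] subspace_0[OF gr_subspace] by simp
      ultimately show ?thesis by (simp add: f_def)
    qed (auto simp: f_def)
    show "pc a 0 c = (if c = u0 then 1 else 0)" for a c by simp
    show "pc a (Suc i) c = (\<Sum>b\<in>Yl (fst c). m a b c * pc a i b)" for a i c by simp
    show fp: "f p a c = pc a p c" if "a \<in> X" "c \<in> X" for a c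
    proof (cases "fst c = p * fst a")
      case True
      then show ?thesis using that pc_crd[of a c p] by (simp add: f_def)
    next
      case False
      have "pc a i c \<noteq> 0 \<Longrightarrow> fst c = i * fst a" for i c
      proof (induction i arbitrary: c)
        case (Suc i)
        have "\<exists>b. m a b c * pc a i b \<noteq> 0"
          using Suc.prems sum.neutral[of "Yl (fst c)" "\<lambda>b. m a b c * pc a i b"] unfolding pc.simps(2) by blast
        then obtain b where "m a b c \<noteq> 0" "pc a i b \<noteq> 0" by auto
        then show ?case using Suc.IH M.m_supp by fastforce
      qed (auto split: if_splits)
      from this[of p c] have "pc a p c = 0" using False by blast
      then show ?thesis using False by (simp add: f_def)
    qed
  qed
qed

end

lemma qshuffle_eval_scale: "qshuffle_eval A (\<lambda>t. x * \<phi> t) u v = x * qshuffle_eval A \<phi> u v"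
  by (simp add: qshuffle_eval_def sum_distrib_left case_prod_unfold mult_ac)

lemma tw_bs: "tw n (bs w) = sc ((-1) ^ (n * wdeg w)) (bs w)"
  by (auto simp: tw_def bs_def fun_eq_iff sc_def)

section \<open>The quasi-shuffle Hopf algebra in coordinates\<close>

context based
begin

text \<open>The multilinear form dual to the word \<open>w\<close> of basis elements. Tensors are
  functionals on forms, so their coordinates are their values at these forms.\<close>

primrec cf :: "(nat \<times> 'x) list \<Rightarrow> (nat \<times> 'a) list \<Rightarrow> 'k" where
  "cf [] v = (if v = [] then 1 else 0)"
| "cf (c # w) v = (case v of [] \<Rightarrow> 0 | y # v' \<Rightarrow> (if fst y = fst c then crd c (snd y) else 0) * cf w v')"

definition ew :: "(nat \<times> 'x) list \<Rightarrow> (nat \<times> 'a) list" where "ew w = map (\<lambda>c. (fst c, el c)) w"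

lemma ew_simps [simp]: "ew [] = []" "ew (c # w) = (fst c, el c) # ew w" "ew w = [] \<longleftrightarrow> w = []" "length (ew w) = length w"
  by (auto simp: ew_def)

lemma wdeg_ew [simp]: "wdeg (ew w) = wdeg w" by (simp add: ew_def wdeg_def o_def)

lemma ew_take: "ew (take r w) = take r (ew w)" "ew (drop r w) = drop r (ew w)"
  by (simp_all add: ew_def take_map drop_map)

lemma ew_aug: "w \<in> lists X \<Longrightarrow> ew w \<in> aug_words A"
  by (auto simp: aug_words_def ew_def letter_pos el_gr in_lists_conv_set)

lemma multilinear_cf: "w \<in> lists X \<Longrightarrow> multilinear_form A (cf w)"
proof (rule multilinear_formI)
  show "cf w (u @ (n, a + b) # v) = cf w (u @ (n, a) # v) + cf w (u @ (n, b) # v)" if "a \<in> gr A n" "b \<in> gr A n" for u v n a b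
    using that
  proof (induction w arbitrary: u)
    case (Cons c w)
    then show ?case by (cases u) (auto simp: crd_add algebra_simps)
  qed auto
  show "cf w (u @ (n, scl A x a) # v) = x * cf w (u @ (n, a) # v)" if "a \<in> gr A n" for u v n a x
    using that
  proof (induction w arbitrary: u)
    case (Cons c w)
    then show ?case by (cases u) (auto simp: crd_scl algebra_simps)
  qed auto
qed

lemma cf_ew: "w \<in> lists X \<Longrightarrow> v \<in> lists X \<Longrightarrow> cf w (ew v) = (if w = v then 1 else 0)"
proof (induction w arbitrary: v)
  case (Cons c w)
  then show ?case by (cases v) (auto simp: crd_el)
qed auto

lemma multilinear_Cons:
  assumes "multilinear_form A \<phi>" "n > 0" "a \<in> gr A n"
  shows "multilinear_form A (\<lambda>t. \<phi> ((n, a) # t))"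
proof (rule multilinear_formI)
  fix u v i b b' assume uv: "u \<in> aug_words A" "v \<in> aug_words A" "i > 0" "b \<in> gr A i"
  have au: "(n, a) # u \<in> aug_words A" using uv assms by simp
  note D = multilinear_formD[OF assms(1) au uv(2-4), simplified]
  show "\<phi> ((n, a) # u @ (i, b + b') # v) = \<phi> ((n, a) # u @ (i, b) # v) + \<phi> ((n, a) # u @ (i, b') # v)" if "b' \<in> gr A i"
    by (rule D(1)[OF that])
  show "\<phi> ((n, a) # u @ (i, scl A x b) # v) = x * \<phi> ((n, a) # u @ (i, b) # v)" for x by (rule D(2))
qed

lemma Yd_pos: "n > 0 \<Longrightarrow> Yd n = {c \<in> X. fst c = n}"
  unfolding Yd_def by (metis (no_types, lifting) fst_u0 insert_iff not_less0)

text \<open>Every multilinear form is a combination of dual forms in each degree; read in the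
  argument, this shows that tensors are determined by their coordinates.\<close>

lemma form_expand:
  "multilinear_form A \<phi> \<Longrightarrow> v \<in> aug_words A \<Longrightarrow> \<phi> v = (\<Sum>w\<in>W (wdeg v). cf w v * \<phi> (ew w))"
proof (induction v arbitrary: \<phi>)
  case Nil
  then show ?case by (simp add: W_0 wdeg_def)
next
  case (Cons y v)
  obtain n a where y: "y = (n, a)" by (cases y)
  have n: "n > 0" "a \<in> gr A n" "v \<in> aug_words A" using Cons.prems(2) y by auto
  have wd: "wdeg (y # v) = n + wdeg v" by (simp add: y wdeg_def)
  have "\<phi> (y # v) = (\<Sum>c\<in>Yd n. crd c a * \<phi> ((n, el c) # v))"
    unfolding y using multilinear_formD[OF Cons.prems(1), of "[]" v n] n
    by (intro lin_expand) auto
  also have "\<dots> = (\<Sum>c\<in>Yd n. \<Sum>w\<in>W (wdeg v). cf (c # w) (y # v) * \<phi> (ew (c # w)))"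
  proof (rule sum.cong[OF refl])
    fix c assume c: "c \<in> Yd n"
    then have c': "fst c = n" "el c \<in> gr A n" using el_gr[of c] by (auto simp: Yd_def)
    show "crd c a * \<phi> ((n, el c) # v) = (\<Sum>w\<in>W (wdeg v). cf (c # w) (y # v) * \<phi> (ew (c # w)))"
      using Cons.IH[OF multilinear_Cons[OF Cons.prems(1) n(1) c'(2)] n(3)]
      by (simp add: y c' sum_distrib_left mult_ac)
  qed
  also have "\<dots> = (\<Sum>c\<in>Yd n. \<Sum>w\<in>W (n + wdeg v - fst c). cf (c # w) (y # v) * \<phi> (ew (c # w)))"
    by (rule sum.cong) (auto simp: Yd_def)
  also have "\<dots> = (\<Sum>c\<in>{c \<in> X. fst c \<le> n + wdeg v}. \<Sum>w\<in>W (n + wdeg v - fst c). cf (c # w) (y # v) * \<phi> (ew (c # w)))"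
    by (rule sum.mono_neutral_left[OF finite_le]) (auto simp: Yd_pos n y)
  also have "\<dots> = (\<Sum>w\<in>W (wdeg (y # v)). cf w (y # v) * \<phi> (ew w))"
    unfolding wd by (rule W_split[symmetric]) (use n in simp)
  finally show ?case .
qed

definition Th :: "nat \<Rightarrow> ('k, 'x) ser \<Rightarrow> ('k, 'a) tensor_word" where
  "Th n y = (\<lambda>\<phi>. \<Sum>w\<in>W n. y w * tensor_word A (ew w) \<phi>)"

definition Ps :: "('k, 'a) tensor_word \<Rightarrow> ('k, 'x) ser" where
  "Ps x = (\<lambda>w. if w \<in> lists X then x (cf w) else 0)"

abbreviation "grJ \<equiv> gr (Jv_space A)"

lemma grJ_sub: "0 \<in> grJ n" "x \<in> grJ n \<Longrightarrow> y \<in> grJ n \<Longrightarrow> x + y \<in> grJ n" "x \<in> grJ n \<Longrightarrow> (\<lambda>\<phi>. c * x \<phi>) \<in> grJ n"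
proof -
  interpret J: vector_space "\<lambda>c (x :: ('k, 'a) tensor_word) \<phi>. c * x \<phi>"
    using vector_space_Jv by (simp add: Jv_def Jv_space_def)
  show "0 \<in> grJ n" "x \<in> grJ n \<Longrightarrow> y \<in> grJ n \<Longrightarrow> x + y \<in> grJ n" "x \<in> grJ n \<Longrightarrow> (\<lambda>\<phi>. c * x \<phi>) \<in> grJ n"
    by (simp_all add: Jv_space_def J.span_zero J.span_add J.span_scale)
qed

lemma Th_sum: "Th n y = (\<Sum>w\<in>W n. (\<lambda>\<phi>. y w * tensor_word A (ew w) \<phi>))"
  by (auto simp: Th_def fun_eq_iff sum_fun_apply)

lemma W_lists: "w \<in> W n \<Longrightarrow> w \<in> lists X" "w \<in> W n \<Longrightarrow> wdeg w = n" by (simp_all add: W_def)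

lemma grJ_word: "w \<in> W n \<Longrightarrow> tensor_word A (ew w) \<in> grJ n"
  using tensor_word_mem[OF ew_aug] W_lists by fastforce

lemma grJ_Th: "Th n y \<in> grJ n"
proof -
  have "finite S \<Longrightarrow> S \<subseteq> W n \<Longrightarrow> (\<Sum>w\<in>S. (\<lambda>\<phi>. y w * tensor_word A (ew w) \<phi>)) \<in> grJ n" for S
  proof (induction S rule: finite_induct)
    case empty
    show ?case unfolding sum.empty by (rule grJ_sub(1))
  next
    case (insert v S)
    have v: "(\<lambda>\<phi>. y v * tensor_word A (ew v) \<phi>) \<in> grJ n"
      by (rule grJ_sub(3), rule grJ_word) (use insert.prems in blast)
    have "(\<Sum>w\<in>S. (\<lambda>\<phi>. y w * tensor_word A (ew w) \<phi>)) \<in> grJ n" using insert by blast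
    from grJ_sub(2)[OF v this] show ?case by (simp only: sum.insert[OF insert.hyps])
  qed
  from this[OF finite_W subset_refl] show ?thesis unfolding Th_sum .
qed

lemma Ps_add: "Ps (x + y) = Ps x + Ps y" and Ps_scl: "Ps (\<lambda>\<phi>. c * x \<phi>) = sc c (Ps x)"
  by (auto simp: Ps_def fun_eq_iff fun_app sc_def)

lemma Th_add: "Th n (x + y) = Th n x + Th n y" and Th_scl: "Th n (sc c x) = (\<lambda>\<phi>. c * Th n x \<phi>)"
  by (auto simp: Th_def fun_eq_iff fun_app sc_def sum.distrib[symmetric] sum_distrib_left algebra_simps)

lemma Th_Ps: "x \<in> grJ n \<Longrightarrow> Th n (Ps x) = x"
proof -
  interpret J: vector_space "\<lambda>c (x :: ('k, 'a) tensor_word) \<phi>. c * x \<phi>"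
    using vector_space_Jv by (simp add: Jv_def Jv_space_def)
  assume "x \<in> grJ n"
  then have x: "x \<in> J.span (tensor_word A ` {w \<in> aug_words A. wdeg w = n})" by (simp add: Jv_space_def)
  show "Th n (Ps x) = x"
  proof (rule J.span_induct[OF x, of "\<lambda>x. Th n (Ps x) = x"])
    have a: "Th n (Ps (x + y)) = Th n (Ps x) + Th n (Ps y)" for x y
      by (simp only: Ps_add Th_add)
    moreover have "Th n (Ps (\<lambda>\<phi>. c * x \<phi>)) = (\<lambda>\<phi>. c * Th n (Ps x) \<phi>)" for c x
      by (simp only: Ps_scl Th_scl)
    moreover have "Th n (Ps 0) = 0" using a[of 0 0] by (simp del: plus_fun_apply zero_fun_apply)
    ultimately show "J.subspace {x. Th n (Ps x) = x}"
      using a by (simp add: J.subspace_def del: plus_fun_apply)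
    fix x assume "x \<in> tensor_word A ` {w \<in> aug_words A. wdeg w = n}"
    then obtain v where v: "v \<in> aug_words A" "wdeg v = n" "x = tensor_word A v" by auto
    have "Th n (Ps x) \<phi> = x \<phi>" for \<phi>
    proof (cases "multilinear_form A \<phi>")
      case True
      have "Th n (Ps x) \<phi> = (\<Sum>w\<in>W n. cf w v * \<phi> (ew w))"
        unfolding Th_def by (rule sum.cong) (use W_lists in \<open>auto simp: Ps_def v tensor_word_def True multilinear_cf\<close>)
      then show ?thesis using form_expand[OF True v(1)] v True by (simp add: tensor_word_def)
    qed (simp add: Th_def v tensor_word_def)
    then show "Th n (Ps x) = x" by (rule ext)
  qed
qed

lemma Ps_Th: "y \<in> hom n \<Longrightarrow> Ps (Th n y) = y"
proof
  fix w assume y: "y \<in> hom n"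
  show "Ps (Th n y) w = y w"
  proof (cases "w \<in> lists X")
    case True
    have "Ps (Th n y) w = (\<Sum>v\<in>W n. if w = v then y v else 0)"
      unfolding Ps_def Th_def if_P[OF True]
      by (rule sum.cong) (use True W_lists in \<open>auto simp: tensor_word_def multilinear_cf cf_ew\<close>)
    also have "\<dots> = y w" using y by (auto simp: hom_def)
    finally show ?thesis .
  next
    case False
    then show ?thesis using hom_notX[OF y] by (simp add: Ps_def)
  qed
qed

lemma Ps_hom: "x \<in> grJ n \<Longrightarrow> Ps x \<in> hom n"
proof -
  assume x: "x \<in> grJ n"
  have "w \<in> W n" if "Ps (Th n (Ps x)) w \<noteq> 0" for w
  proof -
    have w: "w \<in> lists X" "Th n (Ps x) (cf w) \<noteq> 0" using that by (auto simp: Ps_def split: if_splits)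
    then obtain v where "v \<in> W n" "tensor_word A (ew v) (cf w) \<noteq> 0" unfolding Th_def by (auto elim: sum.not_neutral_contains_not_neutral)
    then show ?thesis using cf_ew[OF w(1), of v] W_lists(1)[of v n] by (auto simp: tensor_word_def split: if_splits)
  qed
  then show ?thesis using Th_Ps[OF x] by (auto simp: hom_def)
qed

lemma Ps_bij: "bij_betw Ps (grJ n) (hom n)"
  by (rule bij_betwI[where g = "Th n"]) (auto simp: Ps_hom grJ_Th Th_Ps Ps_Th)

lemma Th_bij: "bij_betw (Th n) (hom n) (grJ n)"
  by (rule bij_betwI[where g = Ps]) (auto simp: Ps_hom grJ_Th Th_Ps Ps_Th)

lemma Ps_word: "w \<in> lists X \<Longrightarrow> Ps (tensor_word A (ew w)) = bs w"
  by (auto simp: Ps_def bs_def fun_eq_iff tensor_word_def multilinear_cf cf_ew)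

lemma Ps_unit: "Ps (unit (Jv A)) = bs []"
  using Ps_word[of "[]"] by (simp add: Jv_def)

lemma Ps_counit: "counit (Jv A) x = Ps x []"
proof -
  have "cf [] = (\<lambda>v. if v = [] then 1 else 0)" by (rule ext) simp
  then show ?thesis by (simp add: Jv_def Ps_def)
qed

lemma lprod_one: "c \<in> Y \<Longrightarrow> lprod A [(fst c, el c)] = (fst c, el c)"
  using unit_right[OF el_gr] by simp

lemma lprod_two: "c \<in> Y \<Longrightarrow> d \<in> Y \<Longrightarrow> lprod A [(fst c, el c), (fst d, el d)] = (fst c + fst d, mul A (fst c) (fst d) (el c) (el d))"
  using unit_right[OF el_gr] by simp

text \<open>Connects the combinatorial product with the recursive one. Stripping a letter from a
  basis word gives something nonzero only for the unit and for the actual first letter, so the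
  double sum over letters shrinks to \<open>S u\<close> and \<open>S v\<close>. The pair of units
  contributes nothing at a proper letter, and the other pairs are the terms of
  \<open>qshuffle_eval_rec\<close>.\<close>

lemma qshuffle_basis:
  "w \<in> lists X \<Longrightarrow> u \<in> lists X \<Longrightarrow> v \<in> lists X \<Longrightarrow> qshuffle_eval A (cf w) (ew u) (ew v) = M.qm (bs u) (bs v) w"
proof (induction w arbitrary: u v)
  case Nil
  show ?case
  proof (cases "u = [] \<and> v = []")
    case True
    then show ?thesis by (simp add: qshuffle_eval_Nil M.qm_Nil bs_def)
  next
    case False
    have 0: "qshuffle_eval A (\<lambda>t. cf [] (x # t)) u' v' = 0" for x u' v' by (simp add: qshuffle_eval_def)
    have "ew u \<noteq> [] \<or> ew v \<noteq> []" using False by simp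
    then have "qshuffle_eval A (cf []) (ew u) (ew v) = 0"
      by (subst qshuffle_eval_rec) (simp_all only: 0 mult_zero_right if_cancel sum.neutral_const case_prod_unfold simp_thms)
    moreover have "M.qm (bs u) (bs v) [] = (0 :: 'k)" using False by (auto simp: M.qm_Nil bs_def)
    ultimately show ?thesis by (simp only:)
  qed
next
  case (Cons c w)
  have c: "c \<in> X" "c \<noteq> u0" "w \<in> lists X" using Cons.prems u0_notin by auto
  define S where "S u = (case u of [] \<Rightarrow> {u0} | a # _ \<Rightarrow> {u0, a})" for u
  have S: "finite (S u)" "a \<in> S u \<Longrightarrow> a \<notin> Yl (fst c) \<Longrightarrow> u \<in> lists X \<Longrightarrow> m a b c = 0 \<and> m b a c = 0"
    "a \<in> Yl (fst c) \<Longrightarrow> a \<notin> S u \<Longrightarrow> Lo a (bs u :: ('k, 'x) ser) = 0" for u a b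
  proof -
    show "finite (S u)" by (auto simp: S_def split: list.splits)
    show "m a b c = 0 \<and> m b a c = 0" if "a \<in> S u" "a \<notin> Yl (fst c)" "u \<in> lists X"
      using that by (auto simp: S_def Yl_def m_def split: list.splits)
    show "Lo a (bs u :: ('k, 'x) ser) = 0" if a: "a \<in> Yl (fst c)" "a \<notin> S u"
    proof -
      have "a \<noteq> u0" "a \<in> Y" using a by (auto simp: S_def Yl_def split: list.splits)
      then have "fst a > 0" using Y_deg0[of a] by auto
      then show ?thesis using a by (cases u) (auto simp: Lo_bs S_def)
    qed
  qed
  define T where "T a b = m a b c * M.qm (tw (fst b) (Lo a (bs u))) (Lo b (bs v)) w" for a b
  have T0: "T a b = 0" if "a \<notin> S u \<or> b \<notin> S v" "a \<in> Yl (fst c)" "b \<in> Yl (fst c)" for a b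
    using that S(3)[of a u] S(3)[of b v] by (auto simp: T_def fun_app)
  have T1: "T a b = 0" if "a \<notin> Yl (fst c) \<or> b \<notin> Yl (fst c)" "a \<in> S u" "b \<in> S v" for a b
    using that S(2)[of a u b] S(2)[of b v a] Cons.prems by (auto simp: T_def)
  have R: "M.qm (bs u) (bs v) (c # w) = (\<Sum>a\<in>S u. \<Sum>b\<in>S v. T a b)"
  proof -
    have "M.qm (bs u) (bs v) (c # w) = (\<Sum>ab\<in>Yl (fst c) \<times> Yl (fst c). T (fst ab) (snd ab))"
      unfolding M.qm_word_Cons[OF c(1)] T_def sum.cartesian_product by (simp add: case_prod_unfold)
    also have "\<dots> = (\<Sum>ab\<in>S u \<times> S v. T (fst ab) (snd ab))"
      by (rule sum.mono_neutral_cong) (auto simp: S(1) intro: T0 T1)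
    finally show ?thesis unfolding sum.cartesian_product by (simp add: case_prod_unfold)
  qed
  have Tuu: "T u0 u0 = 0" using M.m_unit[of u0 c] c by (simp add: T_def)
  show ?case
  proof (cases "u = [] \<and> v = []")
    case True
    then show ?thesis using Tuu unfolding R by (simp add: S_def qshuffle_eval_Nil)
  next
    case False
    define g where "g l = (if fst (lprod A l) = fst c then crd c (snd (lprod A l)) else 0)" for l
    have E: "qshuffle_eval A (\<lambda>t. cf (c # w) (lprod A l # t)) (ew u') (ew v') = g l * M.qm (bs u') (bs v') w"
      if "u' \<in> lists X" "v' \<in> lists X" for l u' v'
      using Cons.IH[OF c(3) that] by (simp add: g_def qshuffle_eval_scale)
    have g1: "g [(fst a, el a)] = m a u0 c" "g [(fst a, el a)] = m u0 a c" if "a \<in> X" for a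
      using that c M.m_unit[of a c] M.m_unit_right[of a c] crd_el[of c a] lprod_one[of a] by (auto simp: g_def simp del: lprod_Cons)
    have g2: "g [(fst a, el a), (fst b, el b)] = m a b c" if "a \<in> X" "b \<in> X" for a b
      using that c by (auto simp: g_def lprod_two m_def simp del: lprod_Cons)
    have Tr: "T a u0 = m a u0 c * M.qm (bs u') (bs v) w" if "u = a # u'" for a u'
      using that Cons.prems letter_pos[of a] by (simp add: T_def Lo_bs)
    have Tl: "T u0 b = m u0 b c * ((-1) ^ (wdeg u * fst b) * M.qm (bs u) (bs v') w)" if "v = b # v'" for b v'
      using that Cons.prems letter_pos[of b] by (simp add: T_def Lo_bs tw_bs M.qm_sc fun_app mult.commute)
    have Tb: "T a b = m a b c * ((-1) ^ (wdeg u' * fst b) * M.qm (bs u') (bs v') w)" if "u = a # u'" "v = b # v'" for a b u' v'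
      using that Cons.prems letter_pos[of b] letter_pos[of a] by (simp add: T_def Lo_bs tw_bs M.qm_sc fun_app mult.commute)
    have wd1: "wdeg [(n, x)] = n" for n and x :: 'a by (simp add: wdeg_def)
    have wdC: "wdeg (x # t) = fst x + wdeg t" for x and t :: "(nat \<times> 'x) list" by (simp add: wdeg_def)
    have wdN: "wdeg ([] :: (nat \<times> 'x) list) = 0" "wdeg ([] :: (nat \<times> 'a) list) = 0" by (simp_all add: wdeg_def)
    have uv: "u \<in> lists X" "v \<in> lists X" using Cons.prems by auto
    have nu: "a \<noteq> u0" if "a \<in> X" for a using that u0_notin by auto
    have rec: "qshuffle_eval A (cf (c # w)) (ew u) (ew v) = (\<Sum>(b, d)\<in>flags. if of_bool b \<le> length (ew u) \<and> of_bool d \<le> length (ew v)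
     then (-1) ^ (wdeg (rest b (ew u)) * wdeg (front d (ew v))) * qshuffle_eval A (\<lambda>t. cf (c # w) (lprod A (front b (ew u) @ front d (ew v)) # t)) (rest b (ew u)) (rest d (ew v)) else 0)"
      by (rule qshuffle_eval_rec) (use False in auto)
    show ?thesis
    proof (cases u)
      case u: Nil
      with False obtain b v' where v: "v = b # v'" by (cases v) auto
      show ?thesis using uv nu[of b] Tl[OF v] Tuu M.m_comm[of b u0 c] E[of "[]" v']
        unfolding R rec by (simp add: S_def u v front_def rest_def wd1 g1 wdC wdN del: cf.simps lprod_Cons)
    next
      case u: (Cons a u')
      show ?thesis
      proof (cases v)
        case v: Nil
        show ?thesis using uv nu[of a] Tr[OF u] Tuu E[of u' "[]"]
          unfolding R rec by (simp add: S_def u v front_def rest_def wd1 g1 wdC wdN del: cf.simps lprod_Cons)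
      next
        case v: (Cons b v')
        have "a \<in> X" "b \<in> X" "u' \<in> lists X" "v' \<in> lists X" using uv u v by auto
        then show ?thesis using uv nu[of a] nu[of b] Tr[OF u] Tl[OF v] Tb[OF u v] Tuu M.m_comm[of b u0 c]
          E[of u' v] E[of u v'] E[of u' v']
          unfolding R rec by (simp add: S_def u v front_def rest_def wd1 g1 g2 wdC wdN mult_ac del: cf.simps lprod_Cons)
      qed
    qed
  qed
qed

lemma tensor_ml: "multilinear_form A \<phi> \<Longrightarrow> tensor_word A (ew v) \<phi> = \<phi> (ew v)"
  by (simp add: tensor_word_def)

lemma grJ_eval: "x \<in> grJ n \<Longrightarrow> multilinear_form A \<phi> \<Longrightarrow> x \<phi> = (\<Sum>w\<in>W n. Ps x w * \<phi> (ew w))"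
  using fun_cong[OF Th_Ps, of x n \<phi>] by (simp add: Th_def tensor_ml)

lemma mul_eval:
  assumes x: "x \<in> grJ i" and y: "y \<in> grJ j" and ml: "multilinear_form A \<phi>"
  shows "mul (Jv A) i j x y \<phi> = (\<Sum>u\<in>W i. \<Sum>v\<in>W j. Ps x u * Ps y v * qshuffle_eval A \<phi> (ew u) (ew v))"
proof -
  have ev: "y (qshuffle_eval A \<phi> u) = (\<Sum>v\<in>W j. Ps y v * qshuffle_eval A \<phi> u (ew v))" if u: "u \<in> aug_words A" for u
    using grJ_eval[OF y] multilinear_form_qshuffle_right[OF ml u] by simp
  have "multilinear_form A (\<lambda>u. \<Sum>v\<in>W j. Ps y v * qshuffle_eval A \<phi> u (ew v))"
  proof (rule multilinear_formI)
    fix u1 u2 n a b x assume u: "u1 \<in> aug_words A" "u2 \<in> aug_words A" "n > 0" "a \<in> gr A n"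
    have D: "b \<in> gr A n \<Longrightarrow> qshuffle_eval A \<phi> (u1 @ (n, a + b) # u2) (ew v) = qshuffle_eval A \<phi> (u1 @ (n, a) # u2) (ew v) + qshuffle_eval A \<phi> (u1 @ (n, b) # u2) (ew v)"
      "qshuffle_eval A \<phi> (u1 @ (n, scl A x a) # u2) (ew v) = x * qshuffle_eval A \<phi> (u1 @ (n, a) # u2) (ew v)" if "v \<in> W j" for v
      using multilinear_formD[OF multilinear_form_qshuffle_left[OF ml ew_aug[OF W_lists(1)[OF that]]] u] by blast+
    show "b \<in> gr A n \<Longrightarrow> (\<Sum>v\<in>W j. Ps y v * qshuffle_eval A \<phi> (u1 @ (n, a + b) # u2) (ew v)) =
       (\<Sum>v\<in>W j. Ps y v * qshuffle_eval A \<phi> (u1 @ (n, a) # u2) (ew v)) + (\<Sum>v\<in>W j. Ps y v * qshuffle_eval A \<phi> (u1 @ (n, b) # u2) (ew v))"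
      unfolding sum.distrib[symmetric] by (rule sum.cong) (simp_all add: D distrib_left)
    show "(\<Sum>v\<in>W j. Ps y v * qshuffle_eval A \<phi> (u1 @ (n, scl A x a) # u2) (ew v)) = x * (\<Sum>v\<in>W j. Ps y v * qshuffle_eval A \<phi> (u1 @ (n, a) # u2) (ew v))"
      unfolding sum_distrib_left by (rule sum.cong) (simp_all add: D mult_ac)
  qed
  then have ml2: "multilinear_form A (\<lambda>u. y (qshuffle_eval A \<phi> u))"
    using multilinear_form_cong[of "\<lambda>u. y (qshuffle_eval A \<phi> u)", OF ev] by blast
  have "mul (Jv A) i j x y \<phi> = x (\<lambda>u. y (qshuffle_eval A \<phi> u))"
    by (simp add: Jv_def ml)
  also have "\<dots> = (\<Sum>u\<in>W i. Ps x u * y (qshuffle_eval A \<phi> (ew u)))"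
    by (rule grJ_eval[OF x ml2])
  also have "\<dots> = (\<Sum>u\<in>W i. \<Sum>v\<in>W j. Ps x u * Ps y v * qshuffle_eval A \<phi> (ew u) (ew v))"
    by (rule sum.cong) (simp_all add: ev ew_aug W_lists(1) sum_distrib_left mult_ac)
  finally show ?thesis .
qed

lemma sum_list_upt: "(\<Sum>j\<leftarrow>[0..<n]. h j) = (\<Sum>j<n. h j)" for h :: "nat \<Rightarrow> nat"
  by (induction n) simp_all

lemma wdeg_nths:
  "wdeg (map (\<lambda>j. w ! j) (filter (\<lambda>j. \<gamma> j = i) [0..<n])) = (\<Sum>j\<in>{j \<in> {..<n}. \<gamma> j = i}. fst (w ! j))"
proof (induction n)
  case (Suc n)
  have "{j \<in> {..<Suc n}. \<gamma> j = i} = (if \<gamma> n = i then insert n {j \<in> {..<n}. \<gamma> j = i} else {j \<in> {..<n}. \<gamma> j = i})"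
    by (auto simp: less_Suc_eq)
  then show ?case using Suc.IH by (simp add: wdeg_def)
qed (simp add: wdeg_def)

lemma wdeg_map_lprod: "wdeg (map (\<lambda>i. lprod A (F i)) xs) = (\<Sum>i\<leftarrow>xs. wdeg (F i))"
proof (induction xs)
  case (Cons i xs)
  have "wdeg (x # t) = fst x + wdeg t" for x and t :: "(nat \<times> 'a) list" by (simp add: wdeg_def)
  with Cons show ?case by (simp add: fst_lprod)
qed (simp add: wdeg_def)

lemma wdeg_contract:
  assumes "\<gamma> ` {..<length w} \<subseteq> {..<n}"
  shows "wdeg (contract A n \<gamma> w) = wdeg w"
proof -
  have "wdeg (contract A n \<gamma> w) = (\<Sum>i\<leftarrow>[0..<n]. wdeg (map (\<lambda>j. w ! j) (filter (\<lambda>j. \<gamma> j = i) [0..<length w])))"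
    unfolding contract_def by (rule wdeg_map_lprod)
  also have "\<dots> = (\<Sum>i<n. \<Sum>j\<in>{j \<in> {..<length w}. \<gamma> j = i}. fst (w ! j))"
    unfolding sum_list_upt wdeg_nths ..
  also have "\<dots> = (\<Sum>j<length w. fst (w ! j))"
    by (rule sum.group[OF finite_lessThan finite_lessThan assms])
  also have "\<dots> = wdeg w"
  proof -
    have "map (\<lambda>j. fst (w ! j)) [0..<length w] = map fst w" by (rule nth_equalityI) simp_all
    then show ?thesis unfolding wdeg_def by (simp only: sum_list_upt[symmetric])
  qed
  finally show ?thesis .
qed

text \<open>Contraction along a quasi-shuffle preserves the total degree, so the expansion of the
  form on all contracted words uses the same finite set of dual forms.\<close>

lemma qshuffle_expand:
  assumes ml: "multilinear_form A \<phi>" and u: "u \<in> aug_words A" "v \<in> aug_words A"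
  shows "qshuffle_eval A \<phi> u v = (\<Sum>w\<in>W (wdeg u + wdeg v). qshuffle_eval A (cf w) u v * \<phi> (ew w))"
proof -
  define I where "I = (SIGMA n:{..length u + length v}. qshuffles (length u) (length v) n)"
  define C where "C = (\<lambda>(n, \<alpha>, \<beta>). contract A n (join (length u) \<alpha> \<beta>) (u @ v))"
  define K where "K = (\<lambda>(n :: nat, \<alpha>, \<beta>). koszul_sign (join (length u) \<alpha> \<beta>) (u @ v) :: 'k)"
  have Q: "qshuffle_eval A \<psi> u v = (\<Sum>q\<in>I. K q * \<psi> (C q))" for \<psi>
    unfolding qshuffle_eval_def I_def K_def C_def by (subst sum.Sigma) (simp, simp, rule sum.cong[OF refl], simp only: case_prod_unfold fst_conv snd_conv)
  have C: "C q \<in> aug_words A" "wdeg (C q) = wdeg u + wdeg v" if qI: "q \<in> I" for q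
  proof -
    obtain n \<alpha> \<beta> where q: "q = (n, \<alpha>, \<beta>)" "(\<alpha>, \<beta>) \<in> qshuffles (length u) (length v) n" using qI by (auto simp: I_def)
    have j: "join (length u) \<alpha> \<beta> ` {..<length (u @ v)} = {..<n}" using qshuffles_join[OF q(2)] by simp
    have uv: "u @ v \<in> aug_words A" using u by simp
    show "C q \<in> aug_words A" unfolding C_def q(1) prod.case by (rule contract_aug[OF uv]) (simp only: j subset_refl)
    have "wdeg (contract A n (join (length u) \<alpha> \<beta>) (u @ v)) = wdeg (u @ v)" by (rule wdeg_contract) (simp only: j subset_refl)
    also have "\<dots> = wdeg u + wdeg v" by (simp add: wdeg_def)
    finally show "wdeg (C q) = wdeg u + wdeg v" unfolding C_def q(1) prod.case .
  qed
  have "qshuffle_eval A \<phi> u v = (\<Sum>q\<in>I. \<Sum>w\<in>W (wdeg u + wdeg v). K q * cf w (C q) * \<phi> (ew w))"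
    unfolding Q
  proof (rule sum.cong[OF refl])
    fix q assume q: "q \<in> I"
    show "K q * \<phi> (C q) = (\<Sum>w\<in>W (wdeg u + wdeg v). K q * cf w (C q) * \<phi> (ew w))"
      unfolding form_expand[OF ml C(1)[OF q]] C(2)[OF q] by (simp only: sum_distrib_left mult.assoc)
  qed
  also have "\<dots> = (\<Sum>w\<in>W (wdeg u + wdeg v). \<Sum>q\<in>I. K q * cf w (C q) * \<phi> (ew w))" by (rule sum.swap)
  finally show ?thesis unfolding Q sum_distrib_right .
qed

lemma mul_Th:
  assumes x: "x \<in> grJ i" and y: "y \<in> grJ j"
  shows "mul (Jv A) i j x y = Th (i + j) (M.qm (Ps x) (Ps y))"
proof
  fix \<phi>
  show "mul (Jv A) i j x y \<phi> = Th (i + j) (M.qm (Ps x) (Ps y)) \<phi>"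
  proof (cases "multilinear_form A \<phi>")
    case True
    have qm: "M.qm (Ps x) (Ps y) w = (\<Sum>u\<in>W i. \<Sum>v\<in>W j. Ps x u * Ps y v * M.qm (bs u) (bs v) w)" for w
    proof -
      have "M.qm (Ps x) (Ps y) w = M.qm (\<Sum>u\<in>W i. sc (Ps x u) (bs u)) (\<Sum>v\<in>W j. sc (Ps y v) (bs v)) w"
        using hom_expand[OF Ps_hom[OF x]] hom_expand[OF Ps_hom[OF y]] by simp
      also have "M.qm (\<Sum>u\<in>W i. sc (Ps x u) (bs u)) (\<Sum>v\<in>W j. sc (Ps y v) (bs v)) = (\<Sum>u\<in>W i. M.qm (sc (Ps x u) (bs u)) (\<Sum>v\<in>W j. sc (Ps y v) (bs v)))"
        by (rule M.qm_sum(1))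
      also have "\<dots> = (\<Sum>u\<in>W i. \<Sum>v\<in>W j. M.qm (sc (Ps x u) (bs u)) (sc (Ps y v) (bs v)))"
        by (rule sum.cong[OF refl], rule M.qm_sum(2))
      also have "\<dots> = (\<Sum>u\<in>W i. \<Sum>v\<in>W j. sc (Ps x u * Ps y v) (M.qm (bs u) (bs v)))"
        by (simp only: M.qm_sc sc_simps(4) mult.commute)
      also have "\<dots> w = (\<Sum>u\<in>W i. \<Sum>v\<in>W j. Ps x u * Ps y v * M.qm (bs u) (bs v) w)"
        by (simp only: sum_fun_apply sc_simps(5))
      finally show ?thesis .
    qed
    have "Th (i + j) (M.qm (Ps x) (Ps y)) \<phi> = (\<Sum>w\<in>W (i + j). M.qm (Ps x) (Ps y) w * \<phi> (ew w))"
      by (simp add: Th_def tensor_ml True)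
    also have "\<dots> = (\<Sum>w\<in>W (i + j). \<Sum>u\<in>W i. \<Sum>v\<in>W j. Ps x u * Ps y v * M.qm (bs u) (bs v) w * \<phi> (ew w))"
      unfolding qm sum_distrib_right ..
    also have "\<dots> = (\<Sum>u\<in>W i. \<Sum>w\<in>W (i + j). \<Sum>v\<in>W j. Ps x u * Ps y v * M.qm (bs u) (bs v) w * \<phi> (ew w))"
      by (rule sum.swap)
    also have "\<dots> = (\<Sum>u\<in>W i. \<Sum>v\<in>W j. \<Sum>w\<in>W (i + j). Ps x u * Ps y v * M.qm (bs u) (bs v) w * \<phi> (ew w))"
      by (rule sum.cong[OF refl], rule sum.swap)
    also have "\<dots> = (\<Sum>u\<in>W i. \<Sum>v\<in>W j. Ps x u * Ps y v * qshuffle_eval A \<phi> (ew u) (ew v))"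
    proof (intro sum.cong refl)
      fix u v assume u: "u \<in> W i" and v: "v \<in> W j"
      have "qshuffle_eval A \<phi> (ew u) (ew v) = (\<Sum>w\<in>W (i + j). M.qm (bs u) (bs v) w * \<phi> (ew w))"
        unfolding qshuffle_expand[OF True ew_aug[OF W_lists(1)[OF u]] ew_aug[OF W_lists(1)[OF v]]] wdeg_ew W_lists(2)[OF u] W_lists(2)[OF v]
        by (rule sum.cong) (simp_all add: qshuffle_basis W_lists(1)[OF u] W_lists(1)[OF v] W_lists(1))
      then show "(\<Sum>w\<in>W (i + j). Ps x u * Ps y v * M.qm (bs u) (bs v) w * \<phi> (ew w)) = Ps x u * Ps y v * qshuffle_eval A \<phi> (ew u) (ew v)"
        by (simp add: sum_distrib_left mult_ac)
    qed
    finally show ?thesis using mul_eval[OF x y True] by simp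
  next
    case False
    then show ?thesis by (simp add: Jv_def Th_def tensor_word_def)
  qed
qed

lemma Ps_mul: "x \<in> grJ i \<Longrightarrow> y \<in> grJ j \<Longrightarrow> Ps (mul (Jv A) i j x y) = M.qm (Ps x) (Ps y)"
  by (simp add: mul_Th Ps_Th M.hom_qm Ps_hom)

lemma splits_sum:
  fixes h :: "(nat \<times> 'x) list \<Rightarrow> (nat \<times> 'x) list \<Rightarrow> 'k"
  shows "(\<Sum>w\<in>W n. \<Sum>r\<le>length w. h (take r w) (drop r w)) = (\<Sum>k\<le>n. \<Sum>s\<in>W k. \<Sum>t\<in>W (n - k). h s t)"
proof -
  have "(\<Sum>w\<in>W n. \<Sum>r\<le>length w. h (take r w) (drop r w)) = (\<Sum>(w, r)\<in>(SIGMA w:W n. {..length w}). h (take r w) (drop r w))"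
    by (rule sum.Sigma) auto
  also have "\<dots> = (\<Sum>(k, s, t)\<in>(SIGMA k:{..n}. W k \<times> W (n - k)). h s t)"
  proof (rule sum.reindex_bij_witness[where i = "\<lambda>(k, s, t). (s @ t, length s)" and j = "\<lambda>(w, r). (wdeg (take r w), take r w, drop r w)"])
    fix q assume "q \<in> (SIGMA w:W n. {..length w})"
    then obtain w r where q: "q = (w, r)" "w \<in> W n" "r \<le> length w" by auto
    have "wdeg (take r w) + wdeg (drop r w) = wdeg w" by (simp add: wdeg_def flip: sum_list_append map_append)
    then have "wdeg (take r w) \<le> n" "wdeg (drop r w) = n - wdeg (take r w)" using q by (auto simp: W_def)
    then show "(case q of (w, r) \<Rightarrow> (wdeg (take r w), take r w, drop r w)) \<in> (SIGMA k:{..n}. W k \<times> W (n - k))"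
      using q by (auto simp: W_def dest: in_set_takeD in_set_dropD)
  qed (auto simp: W_def wdeg_def)
  also have "\<dots> = (\<Sum>k\<le>n. \<Sum>(s, t)\<in>W k \<times> W (n - k). h s t)"
    by (subst sum.Sigma) auto
  finally show ?thesis by (simp add: sum.cartesian_product)
qed

lemma comul_eval:
  assumes x: "x \<in> grJ n" and b: "bilinear_form (Jv_space A) (Jv_space A) \<psi>"
  shows "comul (Jv A) n x \<psi> = (\<Sum>k\<le>n. \<Sum>s\<in>W k. \<Sum>t\<in>W (n - k). Ps x (s @ t) * \<psi> ((k, Th k (bs s)), (n - k, Th (n - k) (bs t))))"
proof -
  have Tb: "tensor_word A (ew s) = Th (wdeg s) (bs s)" if "s \<in> lists X" for s
    using Th_Ps[OF grJ_word[of s "wdeg s"]] that by (simp add: Ps_word W_def)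
  define h where "h = (\<lambda>w. \<Sum>r\<le>length w. \<psi> ((wdeg (take r w), tensor_word A (take r w)), (wdeg (drop r w), tensor_word A (drop r w))))"
  have c: "comul (Jv A) n x \<psi> = x h" for x by (simp add: Jv_def b h_def)
  have w: "tensor_word A (ew w) h = (\<Sum>r\<le>length w. \<psi> ((wdeg (take r w), Th (wdeg (take r w)) (bs (take r w))), (wdeg (drop r w), Th (wdeg (drop r w)) (bs (drop r w)))))"
    if w: "w \<in> W n" for w
  proof -
    have sub: "take r w \<in> lists X" "drop r w \<in> lists X" for r
      using W_lists(1)[OF w] by (auto dest: in_set_takeD in_set_dropD)
    have "tensor_word A (ew w) h = comul (Jv A) n (tensor_word A (ew w)) \<psi>" by (rule c[symmetric])
    also have "\<dots> = (\<Sum>r\<le>length w. \<psi> ((wdeg (take r w), tensor_word A (ew (take r w))), (wdeg (drop r w), tensor_word A (ew (drop r w)))))"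
      unfolding Jv_comul[OF ew_aug[OF W_lists(1)[OF w]]] sum_fun_apply
      by (simp add: tensor2_def b ew_take[symmetric])
    finally show ?thesis by (simp add: Tb sub)
  qed
  have "comul (Jv A) n x \<psi> = Th n (Ps x) h" unfolding c Th_Ps[OF x] ..
  also have "\<dots> = (\<Sum>w\<in>W n. \<Sum>r\<le>length w. Ps x (take r w @ drop r w) * \<psi> ((wdeg (take r w), Th (wdeg (take r w)) (bs (take r w))), (wdeg (drop r w), Th (wdeg (drop r w)) (bs (drop r w)))))"
    unfolding Th_def by (rule sum.cong) (simp_all add: w[unfolded Th_def] sum_distrib_left)
  also have "\<dots> = (\<Sum>k\<le>n. \<Sum>s\<in>W k. \<Sum>t\<in>W (n - k). Ps x (s @ t) * \<psi> ((wdeg s, Th (wdeg s) (bs s)), (wdeg t, Th (wdeg t) (bs t))))"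
    by (rule splits_sum)
  also have "\<dots> = (\<Sum>k\<le>n. \<Sum>s\<in>W k. \<Sum>t\<in>W (n - k). Ps x (s @ t) * \<psi> ((k, Th k (bs s)), (n - k, Th (n - k) (bs t))))"
    by (intro sum.cong refl) (simp add: W_lists(2))
  finally show ?thesis .
qed

end

section \<open>From equal Frobenius matrices to an isomorphism of Hopf algebras\<close>

lemma bilinear_sum:
  fixes M :: "('k::field, 'a::ab_group_add, 'm) gspace_scheme" and N :: "('k, 'b::ab_group_add, 'n) gspace_scheme"
  assumes b: "bilinear_form M N \<psi>"
    and M: "0 \<in> gr M i" "\<And>x y. x \<in> gr M i \<Longrightarrow> y \<in> gr M i \<Longrightarrow> x + y \<in> gr M i" "\<And>c x. x \<in> gr M i \<Longrightarrow> scl M c x \<in> gr M i"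
      "\<And>x. scl M 0 x = 0"
    and N: "0 \<in> gr N j" "\<And>x y. x \<in> gr N j \<Longrightarrow> y \<in> gr N j \<Longrightarrow> x + y \<in> gr N j" "\<And>c x. x \<in> gr N j \<Longrightarrow> scl N c x \<in> gr N j"
      "\<And>x. scl N 0 x = 0"
    and S: "finite S" "\<And>s. s \<in> S \<Longrightarrow> e s \<in> gr M i" and T: "finite T" "\<And>t. t \<in> T \<Longrightarrow> d t \<in> gr N j"
  shows "\<psi> ((i, \<Sum>s\<in>S. scl M (g s) (e s)), (j, \<Sum>t\<in>T. scl N (h t) (d t))) = (\<Sum>s\<in>S. \<Sum>t\<in>T. g s * h t * \<psi> ((i, e s), (j, d t)))"
proof -
  note B = b[unfolded bilinear_form_def, rule_format]
  have B1: "\<psi> ((i, x + x'), (j, y)) = \<psi> ((i, x), (j, y)) + \<psi> ((i, x'), (j, y))" "\<psi> ((i, scl M c x), (j, y)) = c * \<psi> ((i, x), (j, y))"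
    if "x \<in> gr M i" "x' \<in> gr M i" "y \<in> gr N j" for x x' y c using B that by blast+
  have B2: "\<psi> ((i, x), (j, y + y')) = \<psi> ((i, x), (j, y)) + \<psi> ((i, x), (j, y'))" "\<psi> ((i, x), (j, scl N c y)) = c * \<psi> ((i, x), (j, y))"
    if "x \<in> gr M i" "y \<in> gr N j" "y' \<in> gr N j" for x y y' c using B that by blast+
  have 1: "(\<Sum>s\<in>S'. scl M (g s) (e s)) \<in> gr M i \<and> \<psi> ((i, \<Sum>s\<in>S'. scl M (g s) (e s)), (j, y)) = (\<Sum>s\<in>S'. g s * \<psi> ((i, e s), (j, y)))"
    if y: "y \<in> gr N j" and S': "S' \<subseteq> S" for S' y
    using finite_subset[OF S' S(1)] S'
  proof (induction S' rule: finite_induct)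
    case empty
    show ?case using B1(2)[OF M(1) M(1) y, of 0] M(1,4) by simp
  next
    case (insert s F)
    have s: "e s \<in> gr M i" "scl M (g s) (e s) \<in> gr M i" using S(2)[of s] M(3) insert.prems by auto
    have F: "(\<Sum>s\<in>F. scl M (g s) (e s)) \<in> gr M i" "\<psi> ((i, \<Sum>s\<in>F. scl M (g s) (e s)), (j, y)) = (\<Sum>s\<in>F. g s * \<psi> ((i, e s), (j, y)))"
      using insert by auto
    show ?case unfolding sum.insert[OF insert.hyps] B1(1)[OF s(2) F(1) y] B1(2)[OF s(1) s(1) y] F(2) using M(2)[OF s(2) F(1)] by simp
  qed
  have 2: "(\<Sum>t\<in>T'. scl N (h t) (d t)) \<in> gr N j \<and> \<psi> ((i, x), (j, \<Sum>t\<in>T'. scl N (h t) (d t))) = (\<Sum>t\<in>T'. h t * \<psi> ((i, x), (j, d t)))"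
    if x: "x \<in> gr M i" and T': "T' \<subseteq> T" for T' x
    using finite_subset[OF T' T(1)] T'
  proof (induction T' rule: finite_induct)
    case empty
    show ?case using B2(2)[OF x N(1) N(1), of 0] N(1,4) by simp
  next
    case (insert t F)
    have t: "d t \<in> gr N j" "scl N (h t) (d t) \<in> gr N j" using T(2)[of t] N(3) insert.prems by auto
    have F: "(\<Sum>t\<in>F. scl N (h t) (d t)) \<in> gr N j" "\<psi> ((i, x), (j, \<Sum>t\<in>F. scl N (h t) (d t))) = (\<Sum>t\<in>F. h t * \<psi> ((i, x), (j, d t)))"
      using insert by auto
    show ?case unfolding sum.insert[OF insert.hyps] B2(1)[OF x t(2) F(1)] B2(2)[OF x t(1) t(1)] F(2) using N(2)[OF t(2) F(1)] by simp
  qed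
  have T0: "(\<Sum>t\<in>T. scl N (h t) (d t)) \<in> gr N j" using 2[OF M(1)] by blast
  have "\<psi> ((i, \<Sum>s\<in>S. scl M (g s) (e s)), (j, \<Sum>t\<in>T. scl N (h t) (d t))) = (\<Sum>s\<in>S. g s * \<psi> ((i, e s), (j, \<Sum>t\<in>T. scl N (h t) (d t))))"
    using 1[OF T0] by blast
  also have "\<dots> = (\<Sum>s\<in>S. \<Sum>t\<in>T. g s * h t * \<psi> ((i, e s), (j, d t)))"
  proof (rule sum.cong[OF refl])
    fix s assume "s \<in> S"
    then have "\<psi> ((i, e s), (j, \<Sum>t\<in>T. scl N (h t) (d t))) = (\<Sum>t\<in>T. h t * \<psi> ((i, e s), (j, d t)))" using 2 S(2) by blast
    then show "g s * \<psi> ((i, e s), (j, \<Sum>t\<in>T. scl N (h t) (d t))) = (\<Sum>t\<in>T. g s * h t * \<psi> ((i, e s), (j, d t)))"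
      by (simp only: sum_distrib_left mult.assoc)
  qed
  finally show ?thesis .
qed

lemma bilinear_pullback:
  assumes "bilinear_form M' N' \<psi>"
    and "\<And>i x. x \<in> gr M i \<Longrightarrow> f i x \<in> gr M' i" "\<And>i x y. x \<in> gr M i \<Longrightarrow> y \<in> gr M i \<Longrightarrow> f i (x + y) = f i x + f i y"
      "\<And>i c x. x \<in> gr M i \<Longrightarrow> f i (scl M c x) = scl M' c (f i x)"
    and "\<And>i y. y \<in> gr N i \<Longrightarrow> g i y \<in> gr N' i" "\<And>i x y. x \<in> gr N i \<Longrightarrow> y \<in> gr N i \<Longrightarrow> g i (x + y) = g i x + g i y"
      "\<And>i c y. y \<in> gr N i \<Longrightarrow> g i (scl N c y) = scl N' c (g i y)"
  shows "bilinear_form M N (\<lambda>((i, x), (j, y)). \<psi> ((i, f i x), (j, g j y)))"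
  using assms by (simp add: bilinear_form_def)

lemma Jv_simps [simp]: "gr (Jv A) = gr (Jv_space A)" "scl (Jv A) = (\<lambda>c x \<phi>. c * x \<phi>)" "scl (Jv_space A) = (\<lambda>c x \<phi>. c * x \<phi>)"
  "bilinear_form (Jv A) (Jv B) = bilinear_form (Jv_space A) (Jv_space B)"
  by (simp_all add: Jv_def Jv_space_def bilinear_form_def[abs_def])

locale based2 = A: based A X u0 elA + B: based B X u0 elB
  for A :: "('k::field, 'a::ab_group_add) galgebra" and B :: "('k, 'b::ab_group_add) galgebra"
    and X :: "(nat \<times> 'x) set" and u0 elA elB
begin

text \<open>The isomorphism of words is conjugated with the two coordinate systems. Compatibility
  with the coproduct is tested on an arbitrary bilinear form, where both sides become sums over
  pairs of words.\<close>

lemma ghopf_iso_ex: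
  assumes p: "CHAR('k) = p" "p > 0" "\<And>x::'k. \<exists>y. y ^ p = x" and f: "A.f p = B.f p"
  shows "\<exists>g. ghopf_iso (Jv A) (Jv B) g"
proof -
  interpret QA: qshf X u0 A.m p "A.f p" A.pc by (rule A.qshf_based[OF p])
  interpret QB: qshf X u0 B.m p "A.f p" B.pc unfolding f by (rule B.qshf_based[OF p])
  interpret Q: qsh2 X u0 p "A.f p" A.m A.pc B.m B.pc by unfold_locales
  obtain \<Phi> where \<Phi>: "\<And>x y. \<Phi> (x + y) = \<Phi> x + \<Phi> y" "\<And>a x. \<Phi> (sc a x) = sc a (\<Phi> x)" "\<And>n. bij_betw \<Phi> (A.hom n) (A.hom n)"
    "\<Phi> (bs []) = bs []" "\<And>i j x y. x \<in> A.hom i \<Longrightarrow> y \<in> A.hom j \<Longrightarrow> \<Phi> (A.M.qm x y) = B.M.qm (\<Phi> x) (\<Phi> y)"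
    "\<And>x. \<Phi> x [] = x []" "\<And>x u v. u \<in> lists X \<Longrightarrow> v \<in> lists X \<Longrightarrow>
       \<Phi> x (u @ v) = (\<Sum>s\<in>A.W (wdeg u). \<Sum>t\<in>A.W (wdeg v). x (s @ t) * (\<Phi> (bs s) u * \<Phi> (bs t) v))"
  proof (rule Q.coordinate_hopf_iso, goal_cases)
    case (1 \<Phi>)
    show ?case by (rule 1(1)[OF 1(2-8)])
  qed
  have \<Phi>h: "\<Phi> x \<in> A.hom n" if "x \<in> A.hom n" for x n by (rule bij_betw_apply[OF \<Phi>(3) that])
  define g where "g n x = B.Th n (\<Phi> (A.Ps x))" for n x
  have g_bij: "bij_betw (g n) (A.grJ n) (B.grJ n)" for n
  proof -
    have "bij_betw (B.Th n \<circ> (\<Phi> \<circ> A.Ps)) (A.grJ n) (B.grJ n)"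
      by (rule bij_betw_trans[OF bij_betw_trans[OF A.Ps_bij \<Phi>(3)] B.Th_bij])
    then show ?thesis by (simp add: g_def[abs_def] o_def)
  qed
  have g_gr: "g n x \<in> B.grJ n" for n x by (simp add: g_def B.grJ_Th)
  have g_add: "g n (x + y) = g n x + g n y" for n x y by (simp only: g_def A.Ps_add \<Phi>(1) B.Th_add)
  have g_scl: "g n (\<lambda>\<phi>. c * x \<phi>) = (\<lambda>\<phi>. c * g n x \<phi>)" for n c x by (simp only: g_def A.Ps_scl \<Phi>(2) B.Th_scl)
  have Pg: "B.Ps (g n x) = \<Phi> (A.Ps x)" if "x \<in> A.grJ n" for n x
    using B.Ps_Th[OF \<Phi>h[OF A.Ps_hom[OF that]]] by (simp add: g_def)
  have g_unit: "g 0 (unit (Jv A)) = unit (Jv B)"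
  proof -
    have "unit (Jv B) \<in> B.grJ 0" using B.grJ_word[of "[]" 0] by (simp add: A.W_0 Jv_def)
    then have "unit (Jv B) = B.Th 0 (bs [])" using B.Th_Ps B.Ps_unit by metis
    then show ?thesis by (simp add: g_def A.Ps_unit \<Phi>(4))
  qed
  have g_mul: "g (i + j) (mul (Jv A) i j x y) = mul (Jv B) i j (g i x) (g j y)" if x: "x \<in> A.grJ i" and y: "y \<in> A.grJ j" for i j x y
    unfolding B.mul_Th[OF g_gr g_gr] Pg[OF x] Pg[OF y] \<Phi>(5)[OF A.Ps_hom[OF x] A.Ps_hom[OF y], symmetric]
    by (simp only: g_def A.Ps_mul[OF x y])
  have g_counit: "counit (Jv B) (g 0 x) = counit (Jv A) x" if x: "x \<in> A.grJ 0" for x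
    unfolding A.Ps_counit B.Ps_counit Pg[OF x] \<Phi>(6) ..
  have g_comul: "comul (Jv B) n (g n x) = map_tensor2 (Jv B) (Jv B) g g (comul (Jv A) n x)" if x: "x \<in> A.grJ n" for n x
  proof
    fix \<psi>
    show "comul (Jv B) n (g n x) \<psi> = map_tensor2 (Jv B) (Jv B) g g (comul (Jv A) n x) \<psi>"
    proof (cases "bilinear_form (Jv_space B) (Jv_space B) \<psi>")
      case True
      \<comment> \<open>A tensor is a functional on forms, so applying the map to both factors means
        evaluating at the form pulled back along it.\<close>
      define \<psi>' where "\<psi>' = (\<lambda>((i, x), (j, y)). \<psi> ((i, g i x), (j, g j y)))"
      have b': "bilinear_form (Jv_space A) (Jv_space A) \<psi>'"
        unfolding \<psi>'_def by (rule bilinear_pullback[OF True]) (simp_all add: g_gr g_add g_scl del: plus_fun_apply)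
      have gb: "g k (A.Th k (bs s)) = (\<Sum>u\<in>A.W k. scl (Jv_space B) (\<Phi> (bs s) u) (B.Th k (bs u)))" if s: "s \<in> A.W k" for k s
      proof -
        have "g k (A.Th k (bs s)) = B.Th k (\<Phi> (bs s))" by (simp add: g_def A.Ps_Th A.hom_bs s)
        also have "\<dots> = B.Th k (\<Sum>u\<in>A.W k. sc (\<Phi> (bs s) u) (bs u))"
          by (rule arg_cong[OF A.hom_expand[OF \<Phi>h[OF A.hom_bs[OF s]]]])
        also have "\<dots> = (\<Sum>u\<in>A.W k. scl (Jv_space B) (\<Phi> (bs s) u) (B.Th k (bs u)))"
        proof -
          have 0: "B.Th k 0 = 0" using B.Th_add[of k 0 0] by (simp del: plus_fun_apply zero_fun_apply)
          have "B.Th k (\<Sum>u\<in>S. h u) = (\<Sum>u\<in>S. B.Th k (h u))" for S :: "(nat \<times> 'x) list set" and h :: "(nat \<times> 'x) list \<Rightarrow> ('k, 'x) ser"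
            by (induction S rule: infinite_finite_induct) (simp_all add: 0 B.Th_add del: plus_fun_apply zero_fun_apply)
          then show ?thesis by (simp only: B.Th_scl Jv_simps)
        qed
        finally show ?thesis .
      qed
      have R: "\<psi>' ((k, A.Th k (bs s)), (n - k, A.Th (n - k) (bs t))) =
          (\<Sum>u\<in>A.W k. \<Sum>v\<in>A.W (n - k). \<Phi> (bs s) u * \<Phi> (bs t) v * \<psi> ((k, B.Th k (bs u)), (n - k, B.Th (n - k) (bs v))))"
        if s: "s \<in> A.W k" and t: "t \<in> A.W (n - k)" for k s t
        unfolding \<psi>'_def prod.case gb[OF s] gb[OF t]
        by (rule bilinear_sum[OF True]) (auto simp: B.grJ_sub B.grJ_Th fun_eq_iff zero_fun_apply simp del: plus_fun_apply)
      have "comul (Jv B) n (g n x) \<psi> = (\<Sum>k\<le>n. \<Sum>u\<in>A.W k. \<Sum>v\<in>A.W (n - k). \<Phi> (A.Ps x) (u @ v) * \<psi> ((k, B.Th k (bs u)), (n - k, B.Th (n - k) (bs v))))"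
        unfolding B.comul_eval[OF g_gr True] Pg[OF x] ..
      also have "\<dots> = (\<Sum>k\<le>n. \<Sum>u\<in>A.W k. \<Sum>v\<in>A.W (n - k). \<Sum>s\<in>A.W k. \<Sum>t\<in>A.W (n - k).
           A.Ps x (s @ t) * (\<Phi> (bs s) u * \<Phi> (bs t) v * \<psi> ((k, B.Th k (bs u)), (n - k, B.Th (n - k) (bs v)))))"
        by (intro sum.cong refl) (simp add: \<Phi>(7) A.W_lists sum_distrib_left sum_distrib_right mult_ac)
      also have "\<dots> = (\<Sum>k\<le>n. \<Sum>s\<in>A.W k. \<Sum>t\<in>A.W (n - k). \<Sum>u\<in>A.W k. \<Sum>v\<in>A.W (n - k).
           A.Ps x (s @ t) * (\<Phi> (bs s) u * \<Phi> (bs t) v * \<psi> ((k, B.Th k (bs u)), (n - k, B.Th (n - k) (bs v)))))"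
      proof (rule sum.cong[OF refl])
        fix k
        have sw: "(\<Sum>u\<in>U. \<Sum>v\<in>V. \<Sum>s\<in>S. \<Sum>t\<in>T. h u v s t) = (\<Sum>s\<in>S. \<Sum>t\<in>T. \<Sum>u\<in>U. \<Sum>v\<in>V. h u v s t)"
          for U V S T :: "(nat \<times> 'x) list set" and h :: "_ \<Rightarrow> _ \<Rightarrow> _ \<Rightarrow> _ \<Rightarrow> 'k"
        proof -
          have "(\<Sum>u\<in>U. \<Sum>v\<in>V. \<Sum>s\<in>S. \<Sum>t\<in>T. h u v s t) = (\<Sum>u\<in>U. \<Sum>s\<in>S. \<Sum>v\<in>V. \<Sum>t\<in>T. h u v s t)"
            by (rule sum.cong[OF refl], rule sum.swap)
          also have "\<dots> = (\<Sum>s\<in>S. \<Sum>u\<in>U. \<Sum>v\<in>V. \<Sum>t\<in>T. h u v s t)" by (rule sum.swap)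
          also have "\<dots> = (\<Sum>s\<in>S. \<Sum>u\<in>U. \<Sum>t\<in>T. \<Sum>v\<in>V. h u v s t)" by (rule sum.cong[OF refl], rule sum.cong[OF refl], rule sum.swap)
          also have "\<dots> = (\<Sum>s\<in>S. \<Sum>t\<in>T. \<Sum>u\<in>U. \<Sum>v\<in>V. h u v s t)" by (rule sum.cong[OF refl], rule sum.swap)
          finally show ?thesis .
        qed
        show "(\<Sum>u\<in>A.W k. \<Sum>v\<in>A.W (n - k). \<Sum>s\<in>A.W k. \<Sum>t\<in>A.W (n - k).
           A.Ps x (s @ t) * (\<Phi> (bs s) u * \<Phi> (bs t) v * \<psi> ((k, B.Th k (bs u)), (n - k, B.Th (n - k) (bs v))))) =
         (\<Sum>s\<in>A.W k. \<Sum>t\<in>A.W (n - k). \<Sum>u\<in>A.W k. \<Sum>v\<in>A.W (n - k).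
           A.Ps x (s @ t) * (\<Phi> (bs s) u * \<Phi> (bs t) v * \<psi> ((k, B.Th k (bs u)), (n - k, B.Th (n - k) (bs v)))))" by (rule sw)
      qed
      also have "\<dots> = comul (Jv A) n x \<psi>'"
        unfolding A.comul_eval[OF x b'] by (intro sum.cong refl) (simp only: R sum_distrib_left)
      finally show ?thesis by (simp add: map_tensor2_def True \<psi>'_def)
    next
      case False
      then show ?thesis by (simp add: map_tensor2_def, simp add: Jv_def)
    qed
  qed
  have "ghopf_iso (Jv A) (Jv B) g"
    unfolding ghopf_iso_def galgebra_iso_def glinear_iso_def Jv_simps
    using g_bij g_add g_scl g_unit g_mul g_counit g_comul by blast
  then show ?thesis by blast
qed

end

section \<open>Maps of \<open>F\<close>-modules in coordinates\<close>

context based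
begin

lemma crd_sum: "c \<in> Yd n \<Longrightarrow> crd c (\<Sum>d\<in>Yd n. scl A (g d) (el d)) = g c"
proof -
  assume c: "c \<in> Yd n"
  have el: "scl A (g d) (el d) \<in> gr A n" if "d \<in> Yd n" for d using el_gr[of d] that subspace_scale[OF gr_subspace] by (auto simp: Yd_def)
  have 0: "crd c 0 = 0" using crd_scl[of 0 c 0] subspace_0[OF gr_subspace] by simp
  have "finite S \<Longrightarrow> S \<subseteq> Yd n \<Longrightarrow> crd c (\<Sum>d\<in>S. scl A (g d) (el d)) = (\<Sum>d\<in>S. if c = d then g d else 0)" for S
  proof (induction S rule: finite_induct)
    case (insert d S)
    have s: "(\<Sum>d\<in>S. scl A (g d) (el d)) \<in> gr A n" using insert.prems by (intro subspace_sum[OF gr_subspace] el) auto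
    have d: "d \<in> Yd n" using insert.prems by simp
    have "crd c (scl A (g d) (el d)) = (if c = d then g d else 0)"
      using crd_scl[of "el d" c "g d"] crd_el[of c d] el_gr[of d] c d by (auto simp: Yd_def)
    then show ?case using insert crd_add[of "scl A (g d) (el d)" c] s el[OF d] c by (simp add: Yd_def)
  qed (simp add: 0)
  from this[OF finite_Yd subset_refl] show ?thesis using c by simp
qed

lemma crd_0: "crd c 0 = 0" using crd_scl[of 0 c 0] subspace_0[OF gr_subspace] by simp

lemma crd_mul:
  assumes "v \<in> gr A i" "z \<in> gr A j" "e \<in> Y" "fst e = i + j"
  shows "crd e (mul A i j v z) = (\<Sum>a\<in>Yd i. \<Sum>b\<in>Yd j. m a b e * (crd a v * crd b z))"
proof -
  have g: "x \<in> gr A i \<Longrightarrow> mul A i j x z \<in> gr A (fst e)" for x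
    using mul_closed[of x i z j] assms by simp
  have "crd e (mul A i j v z) = (\<Sum>a\<in>Yd i. crd a v * crd e (mul A i j (el a) z))"
    by (rule lin_expand) (use assms g in \<open>auto simp: mul_add_left mul_scl_left crd_add crd_scl\<close>)
  also have "\<dots> = (\<Sum>a\<in>Yd i. \<Sum>b\<in>Yd j. m a b e * (crd a v * crd b z))"
  proof (rule sum.cong[OF refl])
    fix a assume "a \<in> Yd i"
    then have a: "a \<in> Y" "fst a = i" by (auto simp: Yd_def)
    have "crd e (mul A i j (el a) z) = (\<Sum>b\<in>Yd j. crd b z * m a b e)"
      using crd_mul_right[OF assms(2) a(1) assms(3)] a assms by simp
    then show "crd a v * crd e (mul A i j (el a) z) = (\<Sum>b\<in>Yd j. m a b e * (crd a v * crd b z))"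
      by (simp add: sum_distrib_left mult_ac)
  qed
  finally show ?thesis .
qed

text \<open>The vector \<open>v\<close> as a combination of words of one letter. Projection of a
  product to one-letter words remembers the multiplication of the algebra, so powers of
  \<open>v\<close> can be studied inside the quasi-shuffle algebra.\<close>

definition lin :: "nat \<Rightarrow> 'a \<Rightarrow> ('k, 'x) ser" where
  "lin n v = (\<lambda>w. if length w = 1 \<and> hd w \<in> X \<and> fst (hd w) = n then crd (hd w) v else 0)"

lemma lin_simps [simp]: "lin n v [] = 0" "lin n v [a] = (if a \<in> X \<and> fst a = n then crd a v else 0)"
  by (simp_all add: lin_def)

lemma hom_lin: "lin n v \<in> hom n"
  by (auto simp: hom_def lin_def W_def length_Suc_conv wdeg_def split: if_splits)

abbreviation pwr :: "nat \<Rightarrow> nat \<Rightarrow> 'a \<Rightarrow> 'a" where "pwr i n v \<equiv> snd (lprod A (replicate i (n, v)))"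

lemma pwr_Suc: "pwr (Suc i) n v = mul A n (i * n) v (pwr i n v)"
  by (simp add: fst_lprod wdeg_def sum_list_replicate)

lemma pwr_gr: "v \<in> gr A n \<Longrightarrow> pwr i n v \<in> gr A (i * n)"
  using lprod_closed[of "replicate i (n, v)"] by (simp add: hom_words_def wdeg_def sum_list_replicate)

lemma pw_lin:
  assumes v: "v \<in> gr A n" and n: "n > 0"
  shows "c \<in> Yd (Suc i * n) \<Longrightarrow> M.pw (lin n v) (Suc i) [c] = crd c (pwr (Suc i) n v)"
proof (induction i arbitrary: c)
  case 0
  then show ?case using v n M.pw_1[OF hom_lin] by (auto simp: Yd_pos unit_right simp del: M.pw.simps)
next
  case (Suc i)
  let ?y = "M.pw (lin n v) (Suc i)"
  have c: "c \<in> X" "c \<in> Y" "fst c = n + Suc i * n" using Suc.prems n by (auto simp: Yd_pos)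
  have y: "?y \<in> hom (Suc i * n)" by (rule M.pw_hom[OF hom_lin])
  have y0: "?y [] = 0" using hom_Nil[OF y] n by simp
  have x1: "Lo a (lin n v) [] = (if a \<in> X \<and> fst a = n then crd a v else 0)" if "a \<in> Y" for a
    using that letter_pos[of a] Y_deg0[of a] n by (cases "fst a = 0") auto
  have y1: "Lo b ?y [] = (if b \<in> X then ?y [b] else 0)" if "b \<in> Y" for b
    using that letter_pos[of b] Y_deg0[of b] y0 u0_notin by (cases "fst b = 0") (auto simp del: M.pw.simps)
  have y2: "?y [b] = 0" if "fst b \<noteq> Suc i * n" for b
    using y that by (auto simp: hom_def W_def wdeg_def simp del: M.pw.simps)
  have "M.pw (lin n v) (Suc (Suc i)) [c] = M.qm (lin n v) ?y [c]" by simp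
  also have "\<dots> = (\<Sum>a\<in>Yl (fst c). \<Sum>b\<in>Yl (fst c). m a b c * (Lo a (lin n v) [] * Lo b ?y []))"
    unfolding M.qm_word_Cons[OF c(1)] M.qm_Nil tw_simps ..
  also have "\<dots> = (\<Sum>a\<in>Yd n. \<Sum>b\<in>Yl (fst c). m a b c * (Lo a (lin n v) [] * Lo b ?y []))"
    by (rule Yl_Yd) (use c x1 in \<open>auto simp del: M.pw.simps\<close>)
  also have "\<dots> = (\<Sum>a\<in>Yd n. \<Sum>b\<in>Yd (Suc i * n). m a b c * (Lo a (lin n v) [] * Lo b ?y []))"
    by (rule sum.cong[OF refl], rule Yl_Yd) (use c y1 y2 in \<open>auto simp del: M.pw.simps\<close>)
  also have "\<dots> = (\<Sum>a\<in>Yd n. \<Sum>b\<in>Yd (Suc i * n). m a b c * (crd a v * crd b (pwr (Suc i) n v)))"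
  proof (intro sum.cong refl)
    fix a b assume a: "a \<in> Yd n" and b: "b \<in> Yd (Suc i * n)"
    have "a \<in> X" "fst a = n" "b \<in> X" using a b n by (auto simp: Yd_pos)
    then show "m a b c * (Lo a (lin n v) [] * Lo b ?y []) = m a b c * (crd a v * crd b (pwr (Suc i) n v))"
      using x1[of a] y1[of b] Suc.IH[OF b] by (simp del: M.pw.simps replicate.simps)
  qed
  also have "\<dots> = crd c (mul A n (Suc i * n) v (pwr (Suc i) n v))"
    by (rule crd_mul[OF v pwr_gr[OF v] c(2,3), symmetric])
  finally show ?case by (subst pwr_Suc)
qed

text \<open>The one-letter part of \<open>pw_Fr\<close> for \<open>lin n v\<close>. The additivity
  and semilinearity of the \<open>p\<close>-th power in the algebra are read off from this
  formula.\<close>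

lemma crd_pwr:
  assumes p: "CHAR('k) = p" "p > 0" "\<And>x::'k. \<exists>y. y ^ p = x"
    and v: "v \<in> gr A n" and n: "n > 0" and c: "c \<in> Yd (p * n)"
  shows "crd c (pwr p n v) = (\<Sum>a\<in>Yd n. crd a v ^ p * f p a c)"
proof -
  interpret Q: qshf X u0 m p "f p" pc by (rule qshf_based[OF p])
  obtain i where i: "p = Suc i" using p(2) by (cases p) auto
  have c': "wdeg [c] div p = n" using c p(2) by (simp add: Yd_def wdeg_def)
  have "crd c (pwr p n v) = M.pw (lin n v) p [c]" using pw_lin[OF v n, of c i] c unfolding i by simp
  also have "\<dots> = (\<Sum>w\<in>W n. lin n v w ^ p * Q.fr w [c])"
    unfolding Q.pw_Fr[OF hom_lin] Q.Fr_def c' ..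
  also have "\<dots> = (\<Sum>w\<in>(\<lambda>a. [a]) ` Yd n. lin n v w ^ p * Q.fr w [c])"
  proof (rule sum.mono_neutral_right[OF finite_W])
    show "(\<lambda>a. [a]) ` Yd n \<subseteq> W n" using n by (auto simp: Yd_pos W_def wdeg_def)
    have "lin n v w = 0" if "w \<notin> (\<lambda>a. [a]) ` Yd n" for w
      using that n by (cases w) (auto simp: lin_def Yd_pos image_iff)
    then show "\<forall>w\<in>W n - (\<lambda>a. [a]) ` Yd n. lin n v w ^ p * Q.fr w [c] = 0" using p(2) by simp
  qed
  also have "\<dots> = (\<Sum>a\<in>Yd n. lin n v [a] ^ p * Q.fr [a] [c])"
    by (subst sum.reindex) (auto simp: inj_on_def)
  also have "\<dots> = (\<Sum>a\<in>Yd n. crd a v ^ p * f p a c)"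
    by (rule sum.cong) (use n in \<open>auto simp: Yd_pos\<close>)
  finally show ?thesis .
qed

end

context based2
begin

definition tr :: "nat \<Rightarrow> 'a \<Rightarrow> 'b" where "tr n v = (\<Sum>c\<in>A.Yd n. scl B (A.crd c v) (elB c))"

lemma tr_gr: "tr n v \<in> gr B n"
  unfolding tr_def using B.el_gr by (intro B.subspace_sum B.subspace_scale B.gr_subspace) (auto simp: A.Yd_def)

lemma crd_tr: "c \<in> A.Yd n \<Longrightarrow> B.crd c (tr n v) = A.crd c v"
  unfolding tr_def by (rule B.crd_sum)

lemma fmodule_iso_ex:
  assumes p: "CHAR('k) = p" "p > 0" "\<And>x::'k. \<exists>y. y ^ p = x" and f: "A.f p = B.f p"
  shows "\<exists>g. fmodule_iso p (aug_fmodule p A) (aug_fmodule p B) g"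
proof -
  interpret AB: based2 A B X u0 elA elB by unfold_locales
  interpret BA: based2 B A X u0 elB elA by unfold_locales
  have cB: "B.crd c (tr n v) = A.crd c v" if "c \<in> A.Yd n" for c n v using that by (rule crd_tr)
  have cA: "A.crd c (BA.tr n v) = B.crd c v" if "c \<in> A.Yd n" for c n v using BA.crd_tr that by simp
  \<comment> \<open>The augmentation ideal has no component of degree \<open>0\<close>, so the map
    has to be zero there although \<open>tr 0\<close> is not.\<close>
  define g where "g n v = (if n = 0 then 0 else tr n v)" for n v
  have bij: "bij_betw (tr n) (gr A n) (gr B n)" for n
  proof (rule bij_betwI[where g = "BA.tr n"])
    show "BA.tr n (tr n x) = x" if "x \<in> gr A n" for x
      by (rule A.crd_eqI[OF BA.tr_gr that]) (simp add: cA cB)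
    show "tr n (BA.tr n y) = y" if "y \<in> gr B n" for y
      by (rule B.crd_eqI[OF tr_gr that]) (simp add: cA cB)
  qed (auto simp: tr_gr BA.tr_gr)
  have add: "tr n (x + y) = tr n x + tr n y" if "x \<in> gr A n" "y \<in> gr A n" for n x y
    unfolding tr_def sum.distrib[symmetric] using that
    by (intro sum.cong refl) (auto simp: A.Yd_def A.crd_add B.scale_left_distrib)
  have scl: "tr n (scl A c x) = scl B c (tr n x)" if "x \<in> gr A n" for n x c
    unfolding tr_def B.scale_sum_right using that
    by (intro sum.cong refl) (auto simp: A.Yd_def A.crd_scl)
  have F: "tr (p * n) (A.pwr p n x) = B.pwr p n (tr n x)" if x: "x \<in> gr A n" and n: "n > 0" for n x
  proof (rule B.crd_eqI[OF tr_gr B.pwr_gr[OF tr_gr]])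
    fix c assume "c \<in> B.Yd (p * n)"
    then have c: "c \<in> A.Yd (p * n)" "c \<in> B.Yd (p * n)" by simp_all
    have "B.crd c (tr (p * n) (A.pwr p n x)) = (\<Sum>a\<in>A.Yd n. A.crd a x ^ p * A.f p a c)"
      unfolding cB[OF c(1)] by (rule A.crd_pwr[OF p x n c(1)])
    also have "\<dots> = (\<Sum>a\<in>B.Yd n. B.crd a (tr n x) ^ p * B.f p a c)"
      unfolding f by (rule sum.cong) (simp_all add: cB)
    also have "\<dots> = B.crd c (B.pwr p n (tr n x))"
      by (rule B.crd_pwr[OF p tr_gr n c(2), symmetric])
    finally show "B.crd c (tr (p * n) (A.pwr p n x)) = B.crd c (B.pwr p n (tr n x))" .
  qed
  have z: "snd (lprod B (replicate p (0, 0))) = 0"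
  proof -
    obtain i where i: "p = Suc i" using p(2) by (cases p) auto
    have "mul B 0 0 (scl B 0 0) (B.pwr i 0 0) = scl B 0 (mul B 0 0 0 (B.pwr i 0 0))"
      by (rule B.mul_scl_left) (use B.pwr_gr[of 0 0 i] B.subspace_0[OF B.gr_subspace] in auto)
    then show ?thesis unfolding i B.pwr_Suc by simp
  qed
  have "bij_betw (g n) (if n = 0 then {0} else gr A n) (if n = 0 then {0} else gr B n)" for n
    using bij[of n] by (cases "n = 0") (simp_all add: g_def[abs_def] bij_betw_def)
  then have "glinear_iso (aug_fmodule p A) (aug_fmodule p B) g"
    by (simp add: glinear_iso_def aug_fmodule_def g_def add scl)
  moreover have "g (p * n) (frob (aug_fmodule p A) n x) = frob (aug_fmodule p B) n (g n x)" if "x \<in> gr (aug_fmodule p A) n" for n x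
  proof (cases "n = 0")
    case True
    then show ?thesis by (simp add: aug_fmodule_def g_def z)
  next
    case False
    then show ?thesis using F[of x n] that p(2) by (simp add: aug_fmodule_def g_def)
  qed
  ultimately have "fmodule_iso p (aug_fmodule p A) (aug_fmodule p B) g"
    unfolding fmodule_iso_def by blast
  then show ?thesis by blast
qed

end

section \<open>From isomorphisms of \<open>F\<close>-modules to isomorphisms of Hopf
  algebras\<close>

context based
begin

text \<open>The basis of \<open>A\<close> is transported by the given bijections in positive degrees
  and completed by the unit, so that the alphabet of \<open>A\<close> serves both algebras.\<close>

lemma relabel:
  fixes B :: "('k, 'b::ab_group_add) galgebra"
  assumes B: "connected_comm_galgebra B"
    and h: "\<And>n. n > 0 \<Longrightarrow> bij_betw (h n) (gr A n) (gr B n)"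
      "\<And>n x y. n > 0 \<Longrightarrow> x \<in> gr A n \<Longrightarrow> y \<in> gr A n \<Longrightarrow> h n (x + y) = h n x + h n y"
      "\<And>n c x. n > 0 \<Longrightarrow> x \<in> gr A n \<Longrightarrow> h n (scl A c x) = scl B c (h n x)"
  shows "based2 A B X u0 el (\<lambda>c. if fst c = 0 then unit B else h (fst c) (el c))"
proof -
  interpret B: connected_comm_galgebra B by (rule B)
  define e where "e c = (if fst c = 0 then unit B else h (fst c) (el c))" for c
  have YY: "{c \<in> insert u0 X. fst c = n} = Yd n" for n by (simp add: Yd_def)
  have main: "inj_on e (Yd n) \<and> B.independent (e ` Yd n) \<and> B.span (e ` Yd n) = gr B n" for n
  proof (cases "n = 0")
    case True
    then show ?thesis using B.connected by (simp add: Yd_0 e_def B.span_singleton)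
  next
    case False
    then have n: "n > 0" by simp
    have elg: "el c \<in> gr A n" if "c \<in> Yd n" for c using el_gr[of c] that by (auto simp: Yd_def)
    have e: "e c = h n (el c)" if "c \<in> Yd n" for c
    proof -
      have "fst c = n" using that by (simp add: Yd_def)
      then show ?thesis using n by (simp add: e_def)
    qed
    have h0: "h n 0 = 0" using h(3)[OF n, of 0 0] subspace_0[OF gr_subspace] by simp
    have hs: "h n (\<Sum>c\<in>Yd n. scl A (u c) (el c)) = (\<Sum>c\<in>Yd n. scl B (u c) (e c))" for u
    proof -
      have "finite S \<Longrightarrow> S \<subseteq> Yd n \<Longrightarrow> h n (\<Sum>c\<in>S. scl A (u c) (el c)) = (\<Sum>c\<in>S. scl B (u c) (e c))" for S
      proof (induction S rule: finite_induct)
        case (insert c S)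
        have c: "c \<in> Yd n" "S \<subseteq> Yd n" using insert.prems by simp_all
        have "scl A (u c) (el c) \<in> gr A n" by (intro subspace_scale[OF gr_subspace] elg c)
        moreover have "(\<Sum>c\<in>S. scl A (u c) (el c)) \<in> gr A n"
          by (intro subspace_sum[OF gr_subspace] subspace_scale[OF gr_subspace] elg) (use c in blast)
        ultimately show ?case using insert.hyps insert.IH[OF c(2)] elg[OF c(1)] e[OF c(1)] by (simp add: h(2)[OF n] h(3)[OF n])
      qed (simp add: h0)
      from this[OF finite_Yd subset_refl] show ?thesis .
    qed
    have inj: "inj_on e (Yd n)"
    proof (rule inj_onI)
      fix c d assume cd: "c \<in> Yd n" "d \<in> Yd n" "e c = e d"
      then have "el c = el d" using h(1)[OF n] elg by (auto simp: e bij_betw_def inj_on_def)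
      then show "c = d" using basis(1)[of n] cd by (auto simp: inj_on_def)
    qed
    have ind: "B.independent (e ` Yd n)"
    proof
      assume "B.dependent (e ` Yd n)"
      then obtain u where u: "\<exists>v\<in>e ` Yd n. u v \<noteq> 0" "(\<Sum>v\<in>e ` Yd n. scl B (u v) v) = 0"
        using B.dependent_finite[of "e ` Yd n"] by auto
      let ?x = "\<Sum>c\<in>Yd n. scl A (u (e c)) (el c)"
      have "h n ?x = h n 0" using u(2) hs[of "\<lambda>c. u (e c)"] h0 by (simp add: sum.reindex[OF inj])
      moreover have "?x \<in> gr A n" by (intro subspace_sum[OF gr_subspace] subspace_scale[OF gr_subspace] elg)
      moreover have "0 \<in> gr A n" by (rule subspace_0[OF gr_subspace])
      ultimately have x0: "?x = 0" using h(1)[OF n] by (auto simp: bij_betw_def inj_on_def)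
      have "u (e c) = 0" if "c \<in> Yd n" for c
        using crd_sum[OF that, of "\<lambda>c. u (e c)"] unfolding x0 crd_0 by simp
      then show False using u(1) by auto
    qed
    have "B.span (e ` Yd n) = gr B n"
    proof
      show "B.span (e ` Yd n) \<subseteq> gr B n"
        by (rule B.span_minimal) (use e elg h(1)[OF n] B.subspace_gr in \<open>auto simp: bij_betw_def\<close>)
      show "gr B n \<subseteq> B.span (e ` Yd n)"
      proof
        fix y assume "y \<in> gr B n"
        then obtain x where x: "x \<in> gr A n" "y = h n x" using h(1)[OF n] by (auto simp: bij_betw_def)
        have "y = (\<Sum>c\<in>Yd n. scl B (crd c x) (e c))" using hs[of "\<lambda>c. crd c x"] crd_expand[OF x(1)] x(2) by simp
        also have "\<dots> \<in> B.span (e ` Yd n)" by (intro B.span_sum B.span_scale, rule B.span_base) simp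
        finally show "y \<in> B.span (e ` Yd n)" .
      qed
    qed
    with inj ind show ?thesis by blast
  qed
  have "based B X u0 e"
  proof
    show "inj_on e {c \<in> Y. fst c = n}" "B.independent (e ` {c \<in> Y. fst c = n})"
      "B.span (e ` {c \<in> Y. fst c = n}) = gr B n" for n
      unfolding YY using main[of n] by blast+
    show "e u0 = unit B" by (simp add: e_def)
  qed
  then have "based2 A B X u0 el e" by (intro based2.intro based_axioms)
  then show ?thesis by (simp add: e_def[abs_def])
qed

text \<open>In the basis transported by \<open>h\<close>, commuting with Frobenius means that the
  two matrices agree. In odd degrees with \<open>p\<close> odd an \<open>F\<close>-module map
  carries no condition, but there both matrices vanish.\<close>

lemma hopf_from_fmodule:
  fixes B :: "('k, 'b::ab_group_add) galgebra"
  assumes B: "connected_comm_galgebra B"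
    and p: "CHAR('k) = p" "p > 0" "\<And>x::'k. \<exists>y. y ^ p = x"
    and h: "fmodule_iso p (aug_fmodule p A) (aug_fmodule p B) h"
  shows "\<exists>g. ghopf_iso (Jv A) (Jv B) g"
proof -
  have h1: "bij_betw (h n) (gr A n) (gr B n)" "x \<in> gr A n \<Longrightarrow> y \<in> gr A n \<Longrightarrow> h n (x + y) = h n x + h n y"
      "x \<in> gr A n \<Longrightarrow> h n (scl A c x) = scl B c (h n x)"
      "p = 2 \<or> even n \<Longrightarrow> x \<in> gr A n \<Longrightarrow> h (p * n) (pwr p n x) = snd (lprod B (replicate p (n, h n x)))" if "n > 0" for n x y c
    using h[unfolded fmodule_iso_def glinear_iso_def, THEN conjunct1, THEN spec[of _ n]]
      h[unfolded fmodule_iso_def glinear_iso_def, THEN conjunct2, THEN spec[of _ n]] that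
    by (simp_all add: aug_fmodule_def)
  define e where "e c = (if fst c = 0 then unit B else h (fst c) (el c))" for c
  interpret based2 A B X u0 el e unfolding e_def[abs_def] by (rule relabel[OF B h1(1-3)])
  interpret QA: qshf X u0 m p "f p" pc by (rule qshf_based[OF p])
  interpret QB: qshf X u0 B.m p "B.f p" B.pc by (rule B.qshf_based[OF p])
  have ht: "h n v = tr n v" if n: "n > 0" and v: "v \<in> gr A n" for n v
  proof -
    have elg: "el c \<in> gr A n" if "c \<in> Yd n" for c using el_gr[of c] that by (auto simp: Yd_def)
    have h0: "h n 0 = 0" using h1(3)[OF n, of 0 0] subspace_0[OF gr_subspace] by simp
    have "finite S \<Longrightarrow> S \<subseteq> Yd n \<Longrightarrow> h n (\<Sum>c\<in>S. scl A (u c) (el c)) = (\<Sum>c\<in>S. scl B (u c) (e c))" for S u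
    proof (induction S rule: finite_induct)
      case (insert c S)
      have c: "c \<in> Yd n" "S \<subseteq> Yd n" using insert.prems by simp_all
      have "scl A (u c) (el c) \<in> gr A n" by (intro subspace_scale[OF gr_subspace] elg c)
      moreover have "(\<Sum>c\<in>S. scl A (u c) (el c)) \<in> gr A n"
        by (intro subspace_sum[OF gr_subspace] subspace_scale[OF gr_subspace] elg) (use c in blast)
      moreover have "e c = h n (el c)"
      proof -
        have "fst c = n" using c(1) by (simp add: Yd_def)
        then show ?thesis using n by (simp add: e_def)
      qed
      ultimately show ?case using insert.hyps insert.IH[OF c(2)] elg[OF c(1)] by (simp add: h1(2)[OF n] h1(3)[OF n])
    qed (simp add: h0)
    from this[OF finite_Yd subset_refl, of "\<lambda>c. crd c v"] show ?thesis using crd_expand[OF v] by (simp add: tr_def)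
  qed
  have "f p a c = B.f p a c" for a c
  proof (cases "a \<in> X \<and> c \<in> X \<and> fst c = p * fst a \<and> (p = 2 \<or> even (fst a))")
    case True
    let ?n = "fst a"
    have n: "?n > 0" "p * ?n > 0" using True letter_pos p(2) by auto
    have el: "el a \<in> gr A ?n" using True el_gr by blast
    have ea: "e a = h ?n (el a)" using n by (simp add: e_def)
    have cY: "c \<in> Yd (p * ?n)" using True by (simp add: Yd_def)
    have "B.f p a c = B.crd c (h (p * ?n) (pwr p ?n (el a)))"
      using True h1(4)[OF n(1) _ el] by (simp add: B.f_def ea)
    also have "\<dots> = B.crd c (tr (p * ?n) (pwr p ?n (el a)))" by (simp only: ht[OF n(2) pwr_gr[OF el]])
    also have "\<dots> = f p a c" unfolding crd_tr[OF cY] using True by (simp add: f_def)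
    finally show ?thesis ..
  next
    case False
    then have "f p a c = 0" "B.f p a c = 0" using QA.f_supp[of a c] QA.f_odd[of a c] QB.f_supp[of a c] QB.f_odd[of a c] by blast+
    then show ?thesis by simp
  qed
  then have "f p = B.f p" by (intro ext)
  then show ?thesis by (rule ghopf_iso_ex[OF p])
qed

end

text \<open>Letters are pairs of a degree and a vector: the components may overlap in the ambient
  space, so a vector alone would not determine its degree.\<close>

lemma based_ex:
  fixes A :: "('k::field, 'a::ab_group_add) galgebra"
  assumes A: "connected_comm_galgebra A"
    and Bs: "\<And>n. n > 0 \<Longrightarrow> \<not> module.dependent (scl A) (Bs n) \<and> module.span (scl A) (Bs n) = gr A n"
  shows "based A {(n, b). n > 0 \<and> b \<in> Bs n} (0, unit A) snd"
proof -
  interpret A: connected_comm_galgebra A by (rule A)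
  let ?X = "{(n, b). n > 0 \<and> b \<in> Bs n}"
  have fin: "finite (Bs n)" if "n > 0" for n
  proof -
    obtain S where S: "finite S" "gr A n = A.span S" using A.finite_type by blast
    have "Bs n \<subseteq> A.span S" using Bs[OF that] S A.span_superset by blast
    then show ?thesis using A.independent_span_bound[OF S(1)] Bs[OF that] by blast
  qed
  have 0: "{c \<in> insert (0, unit A) ?X. fst c = 0} = {(0, unit A)}" by auto
  have Y: "{c \<in> insert (0, unit A) ?X. fst c = n} = Pair n ` Bs n" if "n > 0" for n using that by auto
  show ?thesis
  proof
    show "fst c > 0" if "c \<in> ?X" for c using that by auto
    show "finite {c \<in> ?X. fst c = n}" for n
    proof (cases "n > 0")
      case True
      have "{c \<in> ?X. fst c = n} \<subseteq> Pair n ` Bs n" by auto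
      then show ?thesis using fin[OF True] finite_subset by blast
    next
      case False
      then have "{c \<in> ?X. fst c = n} = {}" by auto
      then show ?thesis by (metis finite.emptyI)
    qed
    show "fst (0, unit A) = 0" "snd (0, unit A) = unit A" by simp_all
    fix n
    have *: "inj_on snd {c \<in> insert (0, unit A) ?X. fst c = n} \<and> A.independent (snd ` {c \<in> insert (0, unit A) ?X. fst c = n})
       \<and> A.span (snd ` {c \<in> insert (0, unit A) ?X. fst c = n}) = gr A n"
    proof (cases "n > 0")
      case True
      show ?thesis unfolding Y[OF True] using Bs[OF True] by (auto simp: inj_on_def image_image)
    next
      case False
      then have n: "n = 0" by simp
      show ?thesis unfolding n 0 using A.connected by (simp add: A.span_singleton)
    qed
    then show "inj_on snd {c \<in> insert (0, unit A) ?X. fst c = n}" "A.independent (snd ` {c \<in> insert (0, unit A) ?X. fst c = n})"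
      "A.span (snd ` {c \<in> insert (0, unit A) ?X. fst c = n}) = gr A n" by blast+
  qed
qed

section \<open>Bases adapted to Frobenius\<close>

text \<open>A largest independent set that contains \<open>S\<close> and is adapted to the
  filtration must span. If not, take \<open>v\<close> outside the span, from the first
  \<open>K j\<close> that is not contained in the span if there is one. Then each \<open>K i\<close>
  either lies in the span or contains \<open>v\<close>, and adding \<open>v\<close> keeps the set
  adapted.\<close>

lemma (in vector_space) adapted_basis_extend:
  fixes K :: "nat \<Rightarrow> 'b set"
  assumes V: "finite D" "V = span D"
    and K: "\<And>j. subspace (K j)" "\<And>j. K j \<subseteq> V" "\<And>j. K j \<subseteq> K (Suc j)"
    and S: "independent S" "S \<subseteq> V" "\<And>j. span S \<inter> K j \<subseteq> span (S \<inter> K j)"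
  shows "\<exists>T. S \<subseteq> T \<and> independent T \<and> span T = V \<and> (\<forall>j. K j \<subseteq> span (T \<inter> K j))"
proof -
  define P where "P T \<longleftrightarrow> S \<subseteq> T \<and> independent T \<and> T \<subseteq> V \<and> (\<forall>j. span T \<inter> K j \<subseteq> span (T \<inter> K j))" for T
  have fin: "finite T \<and> card T \<le> card D" if "P T" for T
    using independent_span_bound[OF V(1), of T] that by (simp add: P_def V(2))
  have "\<exists>T. P T \<and> (\<forall>T'. P T' \<longrightarrow> card T' \<le> card T)"
    by (rule ex_has_greatest_nat[of P S card "Suc (card D)"]) (use S fin in \<open>auto simp: P_def less_Suc_eq_le\<close>)
  then obtain T where T: "P T" "\<And>T'. P T' \<Longrightarrow> card T' \<le> card T" by blast
  have "V \<subseteq> span T"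
  proof (rule ccontr)
    assume nV: "\<not> V \<subseteq> span T"
    have "\<exists>v\<in>V - span T. \<forall>i. K i \<subseteq> span T \<or> v \<in> K i"
    proof (cases "\<exists>j. \<not> K j \<subseteq> span T")
      case True
      define j where "j = (LEAST j. \<not> K j \<subseteq> span T)"
      have j: "\<not> K j \<subseteq> span T" unfolding j_def by (rule LeastI_ex[OF True])
      then obtain v where v: "v \<in> K j" "v \<notin> span T" by blast
      have mono: "K j \<subseteq> K i" if "j \<le> i" for i by (rule lift_Suc_mono_le[of K, OF K(3) that])
      have "K i \<subseteq> span T" if "i < j" for i using not_less_Least[of i "\<lambda>j. \<not> K j \<subseteq> span T"] that by (simp add: j_def)
      then have "\<forall>i. K i \<subseteq> span T \<or> v \<in> K i" using mono v(1) by (meson not_le subsetD)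
      then show ?thesis using v K(2) by blast
    next
      case False
      then show ?thesis using nV by blast
    qed
    then obtain v where v: "v \<in> V" "v \<notin> span T" "\<And>i. K i \<subseteq> span T \<or> v \<in> K i" by blast
    have "span (insert v T) \<inter> K i \<subseteq> span (insert v T \<inter> K i)" for i
    proof
      fix x assume x: "x \<in> span (insert v T) \<inter> K i"
      show "x \<in> span (insert v T \<inter> K i)"
      proof (cases "v \<in> K i")
        case True
        obtain k where k: "x - scale k v \<in> span T" using x span_breakdown_eq by blast
        moreover have "x - scale k v \<in> K i" using x True by (intro subspace_diff subspace_scale K(1)) auto
        ultimately have "x - scale k v \<in> span (T \<inter> K i)" using T(1) by (auto simp: P_def)
        then have "x \<in> span (insert v (T \<inter> K i))" using span_breakdown_eq by blast
        then show ?thesis using True by simp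
      next
        case False
        then have "x \<in> span T \<inter> K i" using v(3)[of i] x by blast
        then have "x \<in> span (T \<inter> K i)" using T(1) by (auto simp: P_def)
        then show ?thesis by (rule rev_subsetD[OF _ span_mono]) auto
      qed
    qed
    then have "P (insert v T)" using T(1) v independent_insertI[OF v(2)] by (auto simp: P_def)
    from T(2)[OF this] have "card (insert v T) \<le> card T" .
    moreover have "v \<notin> T" using v(2) span_superset by blast
    ultimately show False using fin[OF T(1)] by simp
  qed
  moreover have "span T \<subseteq> V" using T(1) span_minimal[of T V] by (simp add: P_def V(2))
  ultimately have sp: "span T = V" by blast
  have "K j \<subseteq> span (T \<inter> K j)" for j using T(1) K(2)[of j] sp unfolding P_def by blast
  then show ?thesis using T(1) sp unfolding P_def by blast
qed

context based
begin

lemma pwr_add: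
  assumes p: "CHAR('k) = p" "p > 0" "\<And>x::'k. \<exists>y. y ^ p = x"
    and v: "v \<in> gr A n" "w \<in> gr A n" "n > 0"
  shows "pwr p n (v + w) = pwr p n v + pwr p n w"
proof -
  interpret Q: qshf X u0 m p "f p" pc by (rule qshf_based[OF p])
  have vw: "v + w \<in> gr A n" by (rule subspace_add[OF gr_subspace v(1,2)])
  have g: "pwr p n v \<in> gr A (p * n)" "pwr p n w \<in> gr A (p * n)" by (rule pwr_gr, rule v)+
  show ?thesis
  proof (rule crd_eqI[OF pwr_gr[OF vw] subspace_add[OF gr_subspace g]])
    fix c assume c: "c \<in> Yd (p * n)"
    then have fc: "fst c = p * n" by (simp add: Yd_def)
    have a: "crd a (v + w) = crd a v + crd a w" if "a \<in> Yd n" for a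
      by (rule crd_add) (use that v in \<open>simp_all add: Yd_def\<close>)
    have "crd c (pwr p n (v + w)) = (\<Sum>a\<in>Yd n. crd a (v + w) ^ p * f p a c)" by (rule crd_pwr[OF p vw v(3) c])
    also have "\<dots> = (\<Sum>a\<in>Yd n. crd a v ^ p * f p a c + crd a w ^ p * f p a c)"
      by (rule sum.cong[OF refl]) (simp only: a Q.pow_add distrib_right)
    also have "\<dots> = crd c (pwr p n v) + crd c (pwr p n w)"
      by (simp only: sum.distrib crd_pwr[OF p v(1) v(3) c] crd_pwr[OF p v(2) v(3) c])
    also have "\<dots> = crd c (pwr p n v + pwr p n w)" by (rule crd_add[symmetric]) (use g fc in simp_all)
    finally show "crd c (pwr p n (v + w)) = crd c (pwr p n v + pwr p n w)" .
  qed
qed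

lemma pwr_scl:
  assumes p: "CHAR('k) = p" "p > 0" "\<And>x::'k. \<exists>y. y ^ p = x"
    and v: "v \<in> gr A n" "n > 0"
  shows "pwr p n (scl A x v) = scl A (x ^ p) (pwr p n v)"
proof -
  have xv: "scl A x v \<in> gr A n" by (rule subspace_scale[OF gr_subspace v(1)])
  have g: "pwr p n v \<in> gr A (p * n)" by (rule pwr_gr, rule v)
  show ?thesis
  proof (rule crd_eqI[OF pwr_gr[OF xv] subspace_scale[OF gr_subspace g]])
    fix c assume c: "c \<in> Yd (p * n)"
    then have fc: "fst c = p * n" by (simp add: Yd_def)
    have a: "crd a (scl A x v) = x * crd a v" if "a \<in> Yd n" for a
      by (rule crd_scl) (use that v in \<open>simp_all add: Yd_def\<close>)
    have "crd c (pwr p n (scl A x v)) = (\<Sum>a\<in>Yd n. crd a (scl A x v) ^ p * f p a c)" by (rule crd_pwr[OF p xv v(2) c])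
    also have "\<dots> = (\<Sum>a\<in>Yd n. x ^ p * (crd a v ^ p * f p a c))"
      by (rule sum.cong[OF refl]) (simp only: a power_mult_distrib mult.assoc)
    also have "\<dots> = x ^ p * crd c (pwr p n v)"
      by (simp only: sum_distrib_left[symmetric] crd_pwr[OF p v c])
    also have "\<dots> = crd c (scl A (x ^ p) (pwr p n v))" by (rule crd_scl[symmetric]) (use g fc in simp_all)
    finally show "crd c (pwr p n (scl A x v)) = crd c (scl A (x ^ p) (pwr p n v))" .
  qed
qed

end

locale frob_algebra = connected_comm_galgebra A for A :: "('k::field, 'a::ab_group_add) galgebra" +
  fixes p :: nat and F :: "nat \<Rightarrow> 'a \<Rightarrow> 'a"
  assumes p_pos: "p \<ge> 2" and root: "\<And>x::'k. \<exists>y. y ^ p = x"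
    and F_gr: "n > 0 \<Longrightarrow> v \<in> gr A n \<Longrightarrow> F n v \<in> gr A (p * n)"
    and F_add: "n > 0 \<Longrightarrow> v \<in> gr A n \<Longrightarrow> w \<in> gr A n \<Longrightarrow> F n (v + w) = F n v + F n w"
    and F_scl: "n > 0 \<Longrightarrow> v \<in> gr A n \<Longrightarrow> F n (scl A x v) = scl A (x ^ p) (F n v)"
begin

primrec Fit :: "nat \<Rightarrow> nat \<Rightarrow> 'a \<Rightarrow> 'a" where
  "Fit 0 n v = v"
| "Fit (Suc j) n v = Fit j (p * n) (F n v)"

definition K :: "nat \<Rightarrow> nat \<Rightarrow> 'a set" where "K n j = {v \<in> gr A n. Fit j n v = 0}"

lemma gr_zero: "0 \<in> gr A n" using subspace_0[OF subspace_gr] .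

lemma F_0: "n > 0 \<Longrightarrow> F n 0 = 0"
  using F_add[of n 0 0] gr_zero by simp

lemma Fit_lin: "n > 0 \<Longrightarrow> v \<in> gr A n \<Longrightarrow> w \<in> gr A n \<Longrightarrow> Fit j n (v + w) = Fit j n v + Fit j n w"
  "n > 0 \<Longrightarrow> v \<in> gr A n \<Longrightarrow> Fit j n v = 0 \<Longrightarrow> Fit j n (scl A x v) = 0"
  "n > 0 \<Longrightarrow> Fit j n 0 = 0"
proof -
  have p0: "p > 0" using p_pos by simp
  then have pn: "p * n > 0" if "n > 0" for n using that by simp
  show "n > 0 \<Longrightarrow> v \<in> gr A n \<Longrightarrow> w \<in> gr A n \<Longrightarrow> Fit j n (v + w) = Fit j n v + Fit j n w"
    by (induction j arbitrary: n v w) (simp_all add: F_add F_gr p0)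
  show "n > 0 \<Longrightarrow> v \<in> gr A n \<Longrightarrow> Fit j n v = 0 \<Longrightarrow> Fit j n (scl A x v) = 0"
    by (induction j arbitrary: n v x) (simp_all add: F_scl F_gr p0)
  show "n > 0 \<Longrightarrow> Fit j n 0 = 0"
    by (induction j arbitrary: n) (simp_all add: F_0 p0)
qed

lemma K_subspace: "n > 0 \<Longrightarrow> subspace (K n j)"
  by (auto simp: K_def subspace_def gr_zero gr_add gr_scl Fit_lin)

lemma K_gr: "K n j \<subseteq> gr A n" by (simp add: K_def)

lemma K_Suc: "n > 0 \<Longrightarrow> K n j \<subseteq> K n (Suc j)"
proof -
  have p0: "p > 0" using p_pos by simp
  then have pn: "p * n > 0" if "n > 0" for n using that by simp
  have "n > 0 \<Longrightarrow> v \<in> gr A n \<Longrightarrow> Fit j n v = 0 \<Longrightarrow> Fit (Suc j) n v = 0" for v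
  proof (induction j arbitrary: n v)
    case 0
    then show ?case by (simp add: F_0)
  next
    case (Suc j)
    from Suc.IH[OF pn[OF Suc.prems(1)] F_gr[OF Suc.prems(1,2)]] Suc.prems(3) show ?case by simp
  qed
  then show "n > 0 \<Longrightarrow> K n j \<subseteq> K n (Suc j)" by (auto simp: K_def)
qed

lemma F_sum: "n > 0 \<Longrightarrow> finite S \<Longrightarrow> (\<And>b. b \<in> S \<Longrightarrow> b \<in> gr A n) \<Longrightarrow>
    F n (\<Sum>b\<in>S. scl A (d b) b) = (\<Sum>b\<in>S. scl A (d b ^ p) (F n b))"
proof -
  assume n: "n > 0"
  show "finite S \<Longrightarrow> (\<And>b. b \<in> S \<Longrightarrow> b \<in> gr A n) \<Longrightarrow> F n (\<Sum>b\<in>S. scl A (d b) b) = (\<Sum>b\<in>S. scl A (d b ^ p) (F n b))"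
  proof (induction S rule: finite_induct)
    case empty
    show ?case using n by (simp add: F_0)
  next
    case (insert b S)
    have "scl A (d b) b \<in> gr A n" "(\<Sum>b\<in>S. scl A (d b) b) \<in> gr A n"
      using insert.prems by (auto intro!: subspace_sum[OF subspace_gr] gr_scl)
    then show ?case using insert n by (simp add: F_add F_scl)
  qed
qed

text \<open>With \<open>p\<close>-th roots of the coefficients, a combination of vectors
  \<open>F m b\<close> is the image of a combination of the \<open>b\<close>. If the former is
  killed by \<open>i\<close> further steps, the latter lies in \<open>K m (Suc i)\<close>, and
  adaptedness puts every \<open>b\<close> that occurs there as well. For \<open>i = 0\<close> this
  contradicts the choice of \<open>S0\<close>, which gives injectivity and independence; for general
  \<open>i\<close> it shows that the images are adapted again.\<close>

lemma adapted_step: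
  assumes m: "m > 0" and Bs: "independent T" "span T = gr A m" "\<And>j. K m j \<subseteq> span (T \<inter> K m j)"
  defines "S0 \<equiv> {b \<in> T. F m b \<noteq> 0}"
  shows "inj_on (F m) S0" "independent (F m ` S0)" "F m ` S0 \<subseteq> gr A (p * m)"
    "span (F m ` S0) \<inter> K (p * m) j \<subseteq> span (F m ` S0 \<inter> K (p * m) j)"
proof -
  have Tgr: "b \<in> gr A m" if "b \<in> T" for b using Bs(2) that span_superset by blast
  have finT: "finite T"
  proof -
    obtain D where "finite D" "gr A m = span D" using finite_type by blast
    then show ?thesis using independent_span_bound[of D T] Bs(1) Tgr by auto
  qed
  have S0: "finite S0" "S0 \<subseteq> T" "\<And>b. b \<in> S0 \<Longrightarrow> b \<in> gr A m" using finT Tgr by (auto simp: S0_def)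
  have core: "b \<in> K m (Suc i)" if s: "(\<Sum>b\<in>S0. scl A (u b) (F m b)) \<in> K (p * m) i" and b: "b \<in> S0" "u b \<noteq> 0" for u i b
  proof -
    define d where "d b = (SOME y. y ^ p = u b)" for b
    have d: "d b ^ p = u b" for b unfolding d_def by (rule someI_ex[OF root])
    define x where "x = (\<Sum>b\<in>S0. scl A (d b) b)"
    have xg: "x \<in> gr A m" unfolding x_def using S0(3) by (auto intro!: subspace_sum[OF subspace_gr] gr_scl)
    have "F m x = (\<Sum>b\<in>S0. scl A (u b) (F m b))" unfolding x_def using F_sum[OF m S0(1) S0(3), of d] by (simp add: d)
    then have "x \<in> K m (Suc i)" using s xg by (simp add: K_def)
    then have xs: "x \<in> span (T \<inter> K m (Suc i))" using Bs(3) by blast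
    have 1: "representation T x b = d b"
    proof -
      have "representation T x = (\<lambda>b. if b \<in> S0 then d b else 0)"
      proof (rule representation_eqI[OF Bs(1)])
        show "x \<in> span T" using xg Bs(2) by simp
        show "(if b \<in> S0 then d b else 0) \<noteq> 0 \<Longrightarrow> b \<in> T" for b using S0(2) by (auto split: if_splits)
        show "finite {b. (if b \<in> S0 then d b else 0) \<noteq> 0}" by (rule finite_subset[OF _ S0(1)]) (auto split: if_splits)
        have sub: "{b. (if b \<in> S0 then d b else 0) \<noteq> 0} \<subseteq> S0" by (auto split: if_splits)
        have "(\<Sum>b\<in>{b. (if b \<in> S0 then d b else 0) \<noteq> 0}. scl A (if b \<in> S0 then d b else 0) b) = (\<Sum>b\<in>S0. scl A (if b \<in> S0 then d b else 0) b)"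
          by (rule sum.mono_neutral_left[OF S0(1) sub]) auto
        also have "\<dots> = x" unfolding x_def by (rule sum.cong) auto
        finally show "(\<Sum>b | (if b \<in> S0 then d b else 0) \<noteq> 0. scl A (if b \<in> S0 then d b else 0) b) = x" .
      qed
      then show ?thesis using b by simp
    qed
    have "d b \<noteq> 0" using d[of b] b(2) p_pos by (auto simp: power_0_left)
    then have "representation (T \<inter> K m (Suc i)) x b \<noteq> 0"
      using representation_extend[OF Bs(1) xs] 1 by simp
    then show ?thesis using representation_ne_zero by blast
  qed
  have no1: "b \<notin> K m (Suc 0)" if "b \<in> S0" for b using that by (simp add: S0_def K_def)
  have zero: "u b = 0" if "(\<Sum>b\<in>S0. scl A (u b) (F m b)) = 0" "b \<in> S0" for u b
    using core[of u 0 b] that no1[OF that(2)] by (auto simp: K_def gr_zero)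
  show inj: "inj_on (F m) S0"
  proof (rule inj_onI, rule ccontr)
    fix b b' assume b: "b \<in> S0" "b' \<in> S0" "F m b = F m b'" "b \<noteq> b'"
    have "(\<Sum>c\<in>S0. scl A (if c = b then 1 else if c = b' then -1 else 0) (F m c))
        = (\<Sum>c\<in>S0. (if c = b then F m b else 0) + (if c = b' then - F m b' else 0))"
      by (rule sum.cong) (use b(4) in auto)
    also have "\<dots> = 0" using b S0(1) by (simp add: sum.distrib)
    finally show False using zero[of "\<lambda>c. if c = b then 1 else if c = b' then -1 else 0" b] b by simp
  qed
  show "independent (F m ` S0)"
  proof
    assume "dependent (F m ` S0)"
    then obtain u where u: "\<exists>v\<in>F m ` S0. u v \<noteq> 0" "(\<Sum>v\<in>F m ` S0. scl A (u v) v) = 0"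
      using dependent_finite[of "F m ` S0"] S0(1) by auto
    then show False using zero[of "\<lambda>b. u (F m b)"] by (auto simp: sum.reindex[OF inj])
  qed
  show "F m ` S0 \<subseteq> gr A (p * m)" using F_gr[OF m] S0(3) by auto
  show "span (F m ` S0) \<inter> K (p * m) j \<subseteq> span (F m ` S0 \<inter> K (p * m) j)"
  proof
    fix x assume x: "x \<in> span (F m ` S0) \<inter> K (p * m) j"
    then obtain w where "x = (\<Sum>v\<in>F m ` S0. scl A (w v) v)" using span_finite[of "F m ` S0"] S0(1) by auto
    then have w: "x = (\<Sum>b\<in>S0. scl A (w (F m b)) (F m b))" by (simp add: sum.reindex[OF inj])
    have "scl A (w (F m b)) (F m b) \<in> span (F m ` S0 \<inter> K (p * m) j)" if b: "b \<in> S0" for b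
    proof (cases "w (F m b) = 0")
      case True
      then show ?thesis by (simp add: span_zero)
    next
      case False
      then have "b \<in> K m (Suc j)" using core[of "\<lambda>b. w (F m b)" j b] x w b by auto
      then have "F m b \<in> K (p * m) j" using F_gr[OF m S0(3)[OF b]] by (simp add: K_def)
      then show ?thesis using b by (intro span_scale span_base) auto
    qed
    then show "x \<in> span (F m ` S0 \<inter> K (p * m) j)" unfolding w by (intro span_sum)
  qed
qed

text \<open>Recursion on the degree: the basis in degree \<open>n\<close> extends the nonzero images
  of the basis in degree \<open>n div p\<close>. Adaptedness to the kernels of all iterates is
  carried along because the next step needs it.\<close>

lemma adapted_bases:
  "\<exists>Bs. \<forall>n>0. independent (Bs n) \<and> span (Bs n) = gr A n \<and> inj_on (F n) {b \<in> Bs n. F n b \<noteq> 0} \<and> F n ` {b \<in> Bs n. F n b \<noteq> 0} \<subseteq> Bs (p * n)"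
proof -
  define P where "P f n T \<longleftrightarrow> (n > 0 \<longrightarrow> independent T \<and> span T = gr A n \<and> (\<forall>j. K n j \<subseteq> span (T \<inter> K n j)) \<and>
     (p dvd n \<longrightarrow> F (n div p) ` {b \<in> f (n div p). F (n div p) b \<noteq> 0} \<subseteq> T))" for f n T
  have "\<exists>Bs. \<forall>n. P Bs n (Bs n)"
  proof (rule dependent_wellorder_choice)
    fix T f g and n :: nat assume fg: "\<And>y. y < n \<Longrightarrow> f y = (g y :: 'a set)"
    show "P f n T = P g n T"
    proof (cases "n > 0")
      case True
      then have "n div p < n" using p_pos by simp
      from fg[OF this] show ?thesis by (simp add: P_def)
    qed (simp add: P_def)
  next
    fix n :: nat and f assume IH: "\<And>y. y < n \<Longrightarrow> P f y (f y)"
    show "\<exists>T. P f n T"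
    proof (cases "n > 0")
      case n: True
      obtain D where D: "finite D" "gr A n = span D" using finite_type by blast
      define S where "S = (if p dvd n then F (n div p) ` {b \<in> f (n div p). F (n div p) b \<noteq> 0} else {})"
      have S: "independent S" "S \<subseteq> gr A n" "span S \<inter> K n j \<subseteq> span (S \<inter> K n j)" for j
      proof -
        have "independent S \<and> S \<subseteq> gr A n \<and> span S \<inter> K n j \<subseteq> span (S \<inter> K n j)"
        proof (cases "p dvd n")
          case True
          define q where "q = n div p"
          have q: "n = p * q" "q > 0" "q < n" using True n p_pos by (auto simp: q_def elim: dvdE)
          have Pq: "independent (f q)" "span (f q) = gr A q" "\<And>j. K q j \<subseteq> span (f q \<inter> K q j)"
            using IH[OF q(3)] q(2) by (auto simp: P_def)
          have S: "S = F q ` {b \<in> f q. F q b \<noteq> 0}" using True by (simp add: S_def q_def)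
          show ?thesis using adapted_step(2-4)[OF q(2) Pq] unfolding S q(1)[symmetric] by blast
        qed (simp add: S_def independent_empty K_def gr_zero)
        then show "independent S" "S \<subseteq> gr A n" "span S \<inter> K n j \<subseteq> span (S \<inter> K n j)" by blast+
      qed
      obtain T where T: "S \<subseteq> T" "independent T" "span T = gr A n" "\<forall>j. K n j \<subseteq> span (T \<inter> K n j)"
        using adapted_basis_extend[where K = "K n", OF D K_subspace[OF n] K_gr K_Suc[OF n] S] by blast
      have "P f n T" using T unfolding P_def S_def by auto
      then show ?thesis ..
    qed (simp add: P_def)
  qed
  then obtain Bs where Bs: "\<And>n. P Bs n (Bs n)" by blast
  have "independent (Bs n) \<and> span (Bs n) = gr A n \<and> inj_on (F n) {b \<in> Bs n. F n b \<noteq> 0} \<and> F n ` {b \<in> Bs n. F n b \<noteq> 0} \<subseteq> Bs (p * n)" if n: "n > 0" for n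
  proof -
    have 1: "independent (Bs n)" "span (Bs n) = gr A n" "\<And>j. K n j \<subseteq> span (Bs n \<inter> K n j)" using Bs[of n] n by (auto simp: P_def)
    have 2: "F n ` {b \<in> Bs n. F n b \<noteq> 0} \<subseteq> Bs (p * n)" using Bs[of "p * n"] n p_pos by (auto simp: P_def)
    show ?thesis using 1(1,2) adapted_step(1)[OF n 1] 2 by blast
  qed
  then show ?thesis by blast
qed

end

section \<open>Counting words and letters\<close>

context letters
begin

lemma card_W_rec: "n > 0 \<Longrightarrow> card (W n) = (\<Sum>d\<in>{1..n}. card {a \<in> X. fst a = d} * card (W (n - d)))"
proof -
  assume n: "n > 0"
  have "card (W n) = (\<Sum>w\<in>W n. 1)" by simp
  also have "\<dots> = (\<Sum>a\<in>{a \<in> X. fst a \<le> n}. \<Sum>w\<in>W (n - fst a). 1)" by (rule W_split[OF n])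
  also have "\<dots> = (\<Sum>a\<in>{a \<in> X. fst a \<le> n}. card (W (n - fst a)))" by simp
  also have "\<dots> = (\<Sum>d\<in>{1..n}. \<Sum>a\<in>{a \<in> {a \<in> X. fst a \<le> n}. fst a = d}. card (W (n - fst a)))"
    by (rule sum.group[symmetric, OF finite_le]) (use letter_pos in \<open>auto simp: Suc_le_eq\<close>)
  also have "\<dots> = (\<Sum>d\<in>{1..n}. card {a \<in> X. fst a = d} * card (W (n - d)))"
  proof (rule sum.cong[OF refl])
    fix d assume d: "d \<in> {1..n}"
    then have S: "{a \<in> {a \<in> X. fst a \<le> n}. fst a = d} = {a \<in> X. fst a = d}" by auto
    show "(\<Sum>a\<in>{a \<in> {a \<in> X. fst a \<le> n}. fst a = d}. card (W (n - fst a))) = card {a \<in> X. fst a = d} * card (W (n - d))"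
      unfolding S by simp
  qed
  finally show ?thesis .
qed

end

text \<open>The generating series of words is the inverse of one minus that of letters. In the
  recursion for words, the letters of degree \<open>n\<close> occur with coefficient
  \<open>card (W 0) = 1\<close>, so their number can be solved for.\<close>

lemma letter_card_eq:
  assumes "letters X u0" "letters Y v0" and W: "\<And>n. card (letters.W X n) = card (letters.W Y n)"
  shows "card {a \<in> X. fst a = n} = card {b \<in> Y. fst b = n}"
proof (induction n rule: less_induct)
  case (less n)
  interpret A: letters X u0 by (rule assms)
  interpret B: letters Y v0 by (rule assms)
  show ?case
  proof (cases "n > 0")
    case False
    then have "{a \<in> X. fst a = n} = {}" "{b \<in> Y. fst b = n} = {}" using A.letter_pos B.letter_pos by fastforce+
    then show ?thesis by (simp only: card.empty)
  next
    case True
    have i: "{1..n} = insert n {1..<n}" using True by auto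
    have "card {a \<in> X. fst a = n} + (\<Sum>d\<in>{1..<n}. card {a \<in> X. fst a = d} * card (A.W (n - d))) = card (A.W n)"
      unfolding A.card_W_rec[OF True] i by (simp add: A.W_0)
    also have "\<dots> = card (B.W n)" by (rule W)
    also have "\<dots> = card {b \<in> Y. fst b = n} + (\<Sum>d\<in>{1..<n}. card {b \<in> Y. fst b = d} * card (B.W (n - d)))"
      unfolding B.card_W_rec[OF True] i by (simp add: B.W_0)
    also have "(\<Sum>d\<in>{1..<n}. card {b \<in> Y. fst b = d} * card (B.W (n - d))) = (\<Sum>d\<in>{1..<n}. card {a \<in> X. fst a = d} * card (A.W (n - d)))"
      by (rule sum.cong[OF refl]) (use less.IH in \<open>simp add: W\<close>)
    finally show ?thesis by simp
  qed
qed

section \<open>Dimension counts and matchings of alphabets\<close>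

definition SP :: "(nat \<times> 'x) list set \<Rightarrow> ('k::field, 'x) ser set" where "SP S = {x. \<forall>w. x w \<noteq> 0 \<longrightarrow> w \<in> S}"

lemma SP_closed: "0 \<in> SP S" "x \<in> SP S \<Longrightarrow> y \<in> SP S \<Longrightarrow> x + y \<in> SP S" "x \<in> SP S \<Longrightarrow> sc c x \<in> SP S" "s \<in> S \<Longrightarrow> bs s \<in> SP S"
proof -
  show "x \<in> SP S \<Longrightarrow> y \<in> SP S \<Longrightarrow> x + y \<in> SP S" unfolding SP_def by (auto simp: fun_app) (metis add.right_neutral)
qed (auto simp: SP_def bs_def fun_app split: if_splits)

text \<open>The cardinality of \<open>S\<close> is the dimension of \<open>SP S\<close>, so this
  compares dimensions along an injective linear map.\<close>

lemma supp_card_le: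
  fixes G :: "('k::field, 'x) ser \<Rightarrow> ('k, 'y) ser"
  assumes fin: "finite S" "finite T"
    and G: "\<And>x y. x \<in> SP S \<Longrightarrow> y \<in> SP S \<Longrightarrow> G (x + y) = G x + G y" "\<And>c x. x \<in> SP S \<Longrightarrow> G (sc c x) = sc c (G x)"
      "\<And>x. x \<in> SP S \<Longrightarrow> G x = 0 \<Longrightarrow> x = 0" "\<And>x. x \<in> SP S \<Longrightarrow> G x \<in> SP T"
  shows "card S \<le> card T"
proof -
  interpret U: vector_space "sc :: 'k \<Rightarrow> ('k, 'y) ser \<Rightarrow> ('k, 'y) ser" by (rule vector_space_sc)
  define e where "e s = G (bs s)" for s
  have G0: "G 0 = 0" using G(2)[of 0 0] by (simp add: SP_closed(1))
  have GS: "G (\<Sum>s\<in>S'. sc (u s) (bs s)) = (\<Sum>s\<in>S'. sc (u s) (e s)) \<and> (\<Sum>s\<in>S'. sc (u s) (bs s)) \<in> SP S"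
    if "S' \<subseteq> S" for S' u
    using finite_subset[OF that fin(1)] that
  proof (induction S' rule: finite_induct)
    case empty
    show ?case by (simp add: G0 SP_closed(1))
  next
    case (insert s S')
    have IH: "G (\<Sum>s\<in>S'. sc (u s) (bs s)) = (\<Sum>s\<in>S'. sc (u s) (e s))" "(\<Sum>s\<in>S'. sc (u s) (bs s)) \<in> SP S"
      using insert by auto
    have s: "bs s \<in> SP S" "sc (u s) (bs s) \<in> SP S" using insert.prems by (simp_all add: SP_closed)
    show ?case unfolding sum.insert[OF insert.hyps] G(1)[OF s(2) IH(2)] G(2)[OF s(1)] IH(1) e_def
      using SP_closed(2)[OF s(2) IH(2)] by simp
  qed
  have ev: "(\<Sum>s\<in>S. sc (u s) (bs s)) w = u w" if "w \<in> S" for u :: "_ \<Rightarrow> 'k" and w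
  proof -
    have "(\<Sum>s\<in>S. sc (u s) (bs s)) w = (\<Sum>s\<in>S. if w = s then u s else 0)"
      unfolding sum_fun_apply by (rule sum.cong) (auto simp: bs_def sc_def)
    then show ?thesis using that fin by simp
  qed
  have zero: "u w = 0" if "(\<Sum>s\<in>S. sc (u s) (e s)) = 0" "w \<in> S" for u w
  proof -
    have "(\<Sum>s\<in>S. sc (u s) (bs s)) = 0" using G(3) GS[OF subset_refl, of u] that(1) by metis
    then show ?thesis using ev[OF that(2), of u] by (simp add: fun_app)
  qed
  have inj: "inj_on e S"
  proof (rule inj_onI, rule ccontr)
    fix s t assume st: "s \<in> S" "t \<in> S" "e s = e t" "s \<noteq> t"
    let ?u = "\<lambda>r. if r = s then 1 else if r = t then -1 else (0 :: 'k)"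
    have "(\<Sum>r\<in>S. sc (?u r) (e r)) = (\<Sum>r\<in>S. (if r = s then e s else 0) + (if r = t then - e t else 0))"
      by (rule sum.cong) (use st(4) in \<open>auto simp: sc_minus\<close>)
    also have "\<dots> = 0" using st fin by (simp add: sum.distrib)
    finally show False using zero[of ?u s] st by simp
  qed
  have ind: "U.independent (e ` S)"
  proof
    assume "U.dependent (e ` S)"
    then obtain u where u: "\<exists>v\<in>e ` S. u v \<noteq> 0" "(\<Sum>v\<in>e ` S. sc (u v) v) = 0"
      using U.dependent_finite[of "e ` S"] fin by auto
    then show False using zero[of "\<lambda>s. u (e s)"] by (auto simp: sum.reindex[OF inj])
  qed
  have sp: "x \<in> U.span (bs ` T)" if "x \<in> SP T" for x
  proof -
    have "x = (\<Sum>t\<in>T. sc (x t) (bs t))"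
    proof
      fix w
      have "(\<Sum>t\<in>T. sc (x t) (bs t)) w = (\<Sum>t\<in>T. if w = t then x t else 0)"
        unfolding sum_fun_apply by (rule sum.cong) (auto simp: bs_def sc_def)
      then show "x w = (\<Sum>t\<in>T. sc (x t) (bs t)) w" using that fin by (auto simp: SP_def)
    qed
    also have "\<dots> \<in> U.span (bs ` T)" by (intro U.span_sum U.span_scale, rule U.span_base) simp
    finally show ?thesis .
  qed
  have "e ` S \<subseteq> U.span (bs ` T)" using sp G(4) SP_closed(4) by (auto simp: e_def)
  then have "card (e ` S) \<le> card (bs ` T :: ('k, 'y) ser set)"
    using U.independent_span_bound[of "bs ` T" "e ` S"] ind fin by simp
  also have "\<dots> \<le> card T" by (rule card_image_le[OF fin(2)])
  finally show ?thesis by (simp add: card_image[OF inj])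
qed

lemma supp_card_eq:
  fixes G :: "('k::field, 'x) ser \<Rightarrow> ('k, 'y) ser"
  assumes fin: "finite S" "finite T"
    and G: "\<And>x y. x \<in> SP S \<Longrightarrow> y \<in> SP S \<Longrightarrow> G (x + y) = G x + G y" "\<And>c x. x \<in> SP S \<Longrightarrow> G (sc c x) = sc c (G x)"
    and b: "bij_betw G (SP S) (SP T)"
  shows "card S = card T"
proof (rule antisym)
  have G0: "G 0 = 0" using G(2)[of 0 0] by (simp add: SP_closed(1))
  show "card S \<le> card T"
  proof (rule supp_card_le[OF fin G])
    show "G x \<in> SP T" if "x \<in> SP S" for x by (rule bij_betw_apply[OF b that])
    show "x = 0" if "x \<in> SP S" "G x = 0" for x
      using b that G0 SP_closed(1) unfolding bij_betw_def inj_on_def by metis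
  qed
  define H where "H = inv_into (SP S) G"
  have H: "H y \<in> SP S" "G (H y) = y" if "y \<in> SP T" for y
    using that b by (auto simp: H_def bij_betw_def inv_into_into f_inv_into_f)
  have HG: "H (G x) = x" if "x \<in> SP S" for x using that b by (simp add: H_def bij_betw_def)
  show "card T \<le> card S"
  proof (rule supp_card_le[OF fin(2,1)])
    show "H (x + y) = H x + H y" if "x \<in> SP T" "y \<in> SP T" for x y
      using HG[OF SP_closed(2)[OF H(1)[OF that(1)] H(1)[OF that(2)]]] by (simp only: G(1) H that)
    show "H (sc c x) = sc c (H x)" if "x \<in> SP T" for c x
      using HG[OF SP_closed(3)[OF H(1)[OF that]], of c] by (simp only: G(2) H that)
    show "x = 0" if "x \<in> SP T" "H x = 0" for x using H(2)[OF that(1)] that(2) G0 by simp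
    show "H x \<in> SP S" if "x \<in> SP T" for x by (rule H(1)[OF that])
  qed
qed

text \<open>Says that the partial map \<open>nx\<close>, defined where \<open>al\<close> holds, can
  be applied \<open>j\<close> times starting from \<open>a\<close>.\<close>

primrec alv :: "('c \<Rightarrow> bool) \<Rightarrow> ('c \<Rightarrow> 'c) \<Rightarrow> nat \<Rightarrow> 'c \<Rightarrow> bool" where
  "alv al nx 0 a = True"
| "alv al nx (Suc j) a = (al a \<and> alv al nx j (nx a))"

lemma alv_mono: "alv al nx (Suc j) a \<Longrightarrow> alv al nx j a"
  by (induction j arbitrary: a) auto

text \<open>Each element has a lifetime, possibly infinite, and the counts determine how many
  elements have a given finite lifetime. The induction removes an element of shortest lifetime
  \<open>J\<close> on either side; if nobody dies, any bijection works.\<close>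

lemma bij_preserving:
  assumes "finite R" "finite R'"
    and "\<And>j. card {a \<in> R. P j a} = card {b \<in> R'. Q j b}"
    and P: "\<And>a. P 0 a" "\<And>j a. P (Suc j) a \<Longrightarrow> P j a" and Q: "\<And>b. Q 0 b" "\<And>j b. Q (Suc j) b \<Longrightarrow> Q j b"
  shows "\<exists>\<pi>. bij_betw \<pi> R R' \<and> (\<forall>a\<in>R. \<forall>j. P j a = Q j (\<pi> a))"
  using assms(1-3)
proof (induction "card R" arbitrary: R R')
  case 0
  have "card R' = card R" using 0(4)[of 0] P(1) Q(1) by simp
  then have "R = {}" "R' = {}" using 0 by auto
  then show ?case by (auto simp: bij_betw_def)
next
  case (Suc k)
  have cRR: "card R' = card R" using Suc.prems(3)[of 0] P(1) Q(1) by simp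
  show ?case
  proof (cases "\<exists>j. card {a \<in> R. P j a} < card R")
    case False
    have "{a \<in> R. P j a} = R" for j
    proof (rule card_subset_eq[OF Suc.prems(1)])
      show "card {a \<in> R. P j a} = card R"
      proof (rule antisym)
        show "card {a \<in> R. P j a} \<le> card R" by (rule card_mono[OF Suc.prems(1)]) blast
        show "card R \<le> card {a \<in> R. P j a}" using False by (simp add: not_less)
      qed
    qed auto
    then have PR: "P j a" if "a \<in> R" for j a using that by blast
    have "{b \<in> R'. Q j b} = R'" for j
    proof (rule card_subset_eq[OF Suc.prems(2)])
      show "card {b \<in> R'. Q j b} = card R'" using Suc.prems(3)[of j] \<open>\<And>j. {a \<in> R. P j a} = R\<close> cRR by simp
    qed auto
    then have QR: "Q j b" if "b \<in> R'" for j b using that by blast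
    obtain \<pi> where \<pi>: "bij_betw \<pi> R R'" using finite_same_card_bij[OF Suc.prems(1,2)] cRR by metis
    have "\<forall>a\<in>R. \<forall>j. P j a = Q j (\<pi> a)" using PR QR bij_betw_apply[OF \<pi>] by blast
    then show ?thesis using \<pi> by blast
  next
    case True
    define J where "J = (LEAST j. card {a \<in> R. P j a} < card R)"
    have J: "card {a \<in> R. P J a} < card R" unfolding J_def by (rule LeastI_ex[OF True])
    have J': "card {b \<in> R'. Q J b} < card R'" using J Suc.prems(3)[of J] cRR by simp
    have "\<exists>a\<in>R. \<not> P J a"
    proof (rule ccontr)
      assume "\<not> (\<exists>a\<in>R. \<not> P J a)"
      then have "{a \<in> R. P J a} = R" by blast
      then show False using J by simp
    qed
    then obtain a where a: "a \<in> R" "\<not> P J a" by blast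
    have "\<exists>b\<in>R'. \<not> Q J b"
    proof (rule ccontr)
      assume "\<not> (\<exists>b\<in>R'. \<not> Q J b)"
      then have "{b \<in> R'. Q J b} = R'" by blast
      then show False using J' by simp
    qed
    then obtain b where b: "b \<in> R'" "\<not> Q J b" by blast
    have full: "{a \<in> R. P j a} = R \<and> {b \<in> R'. Q j b} = R'" if "j < J" for j
    proof -
      have c: "\<not> card {a \<in> R. P j a} < card R" using not_less_Least[of j "\<lambda>j. card {a \<in> R. P j a} < card R"] that by (simp add: J_def)
      have 1: "{a \<in> R. P j a} = R"
      proof (rule card_subset_eq[OF Suc.prems(1)])
        show "card {a \<in> R. P j a} = card R"
        proof (rule antisym)
          show "card {a \<in> R. P j a} \<le> card R" by (rule card_mono[OF Suc.prems(1)]) blast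
          show "card R \<le> card {a \<in> R. P j a}" using c by (simp only: not_less)
        qed
      qed blast
      have "{b \<in> R'. Q j b} = R'"
      proof (rule card_subset_eq[OF Suc.prems(2)])
        show "card {b \<in> R'. Q j b} = card R'" using Suc.prems(3)[of j] unfolding 1 cRR by (rule sym)
      qed blast
      with 1 show ?thesis by blast
    qed
    have Pm: "P j c \<Longrightarrow> P J c" if "J \<le> j" for j c using that by (induction j rule: dec_induct) (auto dest: P(2))
    have Qm: "Q j c \<Longrightarrow> Q J c" if "J \<le> j" for j c using that by (induction j rule: dec_induct) (auto dest: Q(2))
    have Pa: "P j a \<longleftrightarrow> j < J" for j
    proof (cases "j < J")
      case True
      have "a \<in> {a \<in> R. P j a}" unfolding full[OF True, THEN conjunct1] by (rule a(1))
      then show ?thesis using True by simp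
    next
      case False
      then show ?thesis using Pm[of j a] a(2) by auto
    qed
    have Qb: "Q j b \<longleftrightarrow> j < J" for j
    proof (cases "j < J")
      case True
      have "b \<in> {b \<in> R'. Q j b}" unfolding full[OF True, THEN conjunct2] by (rule b(1))
      then show ?thesis using True by simp
    next
      case False
      then show ?thesis using Qm[of j b] b(2) by auto
    qed
    have "\<exists>\<pi>. bij_betw \<pi> (R - {a}) (R' - {b}) \<and> (\<forall>c\<in>R - {a}. \<forall>j. P j c = Q j (\<pi> c))"
    proof (rule Suc.hyps(1))
      show "k = card (R - {a})" using Suc.hyps(2) a(1) Suc.prems(1) by simp
      show "card {c \<in> R - {a}. P j c} = card {c \<in> R' - {b}. Q j c}" for j
      proof -
        have "{c \<in> R - {a}. P j c} = {c \<in> R. P j c} - {a}" "{c \<in> R' - {b}. Q j c} = {c \<in> R'. Q j c} - {b}" by auto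
        then show ?thesis using Suc.prems a(1) b(1) Pa[of j] Qb[of j] by (simp add: card_Diff_singleton_if)
      qed
    qed (use Suc.prems in auto)
    then obtain \<pi> where \<pi>: "bij_betw \<pi> (R - {a}) (R' - {b})" "\<And>c j. c \<in> R - {a} \<Longrightarrow> P j c = Q j (\<pi> c)" by blast
    define \<pi>' where "\<pi>' c = (if c = a then b else \<pi> c)" for c
    have "bij_betw \<pi>' (R - {a}) (R' - {b})" using \<pi>(1) by (rule bij_betw_cong[THEN iffD1, rotated]) (simp add: \<pi>'_def)
    moreover have "bij_betw \<pi>' {a} {b}" by (simp add: \<pi>'_def bij_betw_def)
    ultimately have "bij_betw \<pi>' ((R - {a}) \<union> {a}) ((R' - {b}) \<union> {b})" by (rule bij_betw_combine) auto
    then have "bij_betw \<pi>' R R'" using a(1) b(1) by (simp add: insert_absorb)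
    moreover have "\<forall>c\<in>R. \<forall>j. P j c = Q j (\<pi>' c)" using \<pi>(2) Pa Qb by (auto simp: \<pi>'_def)
    ultimately show ?thesis by blast
  qed
qed

locale fletters = letters X u0 for X :: "(nat \<times> 'x) set" and u0 +
  fixes q :: nat and al :: "nat \<times> 'x \<Rightarrow> bool" and nx :: "nat \<times> 'x \<Rightarrow> nat \<times> 'x"
  assumes q2: "q \<ge> 2" and nx_mem: "a \<in> X \<Longrightarrow> al a \<Longrightarrow> nx a \<in> X"
    and nx_deg: "a \<in> X \<Longrightarrow> al a \<Longrightarrow> fst (nx a) = q * fst a" and nx_inj: "inj_on nx {a \<in> X. al a}"

text \<open>Built degree by degree. On letters of the form \<open>nx a\<close> the bijection is
  forced by the one in the degree of \<open>a\<close>. The forced part matches lifetimes, so by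
  subtraction the counts agree on the remaining letters too, and \<open>bij_preserving\<close>
  matches these.\<close>

lemma letter_bijection:
  assumes "fletters X u0 q al nx" "fletters Y v0 q al' nx'"
    and cards: "\<And>n j. card {a \<in> X. fst a = n \<and> alv al nx j a} = card {b \<in> Y. fst b = n \<and> alv al' nx' j b}"
  shows "\<exists>\<sigma>. bij_betw \<sigma> X Y \<and> (\<forall>a\<in>X. fst (\<sigma> a) = fst a \<and> (al' (\<sigma> a) \<longleftrightarrow> al a) \<and> (al a \<longrightarrow> \<sigma> (nx a) = nx' (\<sigma> a)))"
proof -
  interpret A: fletters X u0 q al nx by (rule assms)
  interpret B: fletters Y v0 q al' nx' by (rule assms)
  define Xn where "Xn n = {a \<in> X. fst a = n}" for n
  define Yn where "Yn n = {b \<in> Y. fst b = n}" for n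
  define P where "P s n r \<longleftrightarrow> bij_betw r (Xn n) (Yn n) \<and> (\<forall>a\<in>Xn n. \<forall>j. alv al nx j a = alv al' nx' j (r a)) \<and>
     (\<forall>m<n. n = q * m \<longrightarrow> (\<forall>a\<in>Xn m. al a \<longrightarrow> r (nx a) = nx' (s m a)))" for s :: "nat \<Rightarrow> nat \<times> 'a \<Rightarrow> nat \<times> 'b" and n r
  have fin: "finite (Xn n)" "finite (Yn n)" for n using A.letter_fin B.letter_fin by (simp_all add: Xn_def Yn_def)
  have "\<exists>s. \<forall>n. P s n (s n)"
  proof (rule dependent_wellorder_choice)
    show "P f n r = P g n r" if "\<And>y. y < n \<Longrightarrow> f y = g y" for r f g n unfolding P_def by (auto simp: that)
  next
    fix n :: nat and s assume IH: "\<And>y. y < n \<Longrightarrow> P s y (s y)"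
    define m where "m = n div q"
    define S where "S = {a \<in> X. al a \<and> q * fst a = n}"
    define S' where "S' = {b \<in> Y. al' b \<and> q * fst b = n}"
    have Sm: "fst a = m" if "q * fst a = n" for a :: "nat \<times> 'c" using that A.q2 by (auto simp: m_def)
    have Sm': "m < n" "a \<in> Xn m" if "a \<in> S" for a
    proof -
      have "fst a = m" "fst a > 0" using Sm[of a] that A.letter_pos[of a] by (auto simp: S_def)
      then show "m < n" "a \<in> Xn m" using that A.q2 by (auto simp: S_def Xn_def)
    qed
    have SmB: "m < n" "b \<in> Yn m" if "b \<in> S'" for b
    proof -
      have "fst b = m" "fst b > 0" using Sm[of b] that B.letter_pos[of b] by (auto simp: S'_def)
      then show "m < n" "b \<in> Yn m" using that B.q2 by (auto simp: S'_def Yn_def)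
    qed
    have bS: "bij_betw (s m) S S' \<and> (\<forall>a\<in>S. \<forall>j. alv al nx j a = alv al' nx' j (s m a))"
    proof (cases "S = {} \<and> S' = {}")
      case True
      then show ?thesis by (simp add: bij_betw_def)
    next
      case False
      then have mn: "m < n" using Sm' SmB by blast
      have nm: "n = q * m" using False Sm by (auto simp: S_def S'_def)
      have Pm: "bij_betw (s m) (Xn m) (Yn m)" "\<And>a j. a \<in> Xn m \<Longrightarrow> alv al nx j a = alv al' nx' j (s m a)"
        using IH[OF mn] by (auto simp: P_def)
      have "S = {a \<in> Xn m. alv al nx (Suc 0) a}" using Sm'(2) nm by (auto simp: S_def Xn_def)
      moreover have "S' = {b \<in> Yn m. alv al' nx' (Suc 0) b}" using SmB(2) nm by (auto simp: S'_def Yn_def)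
      moreover have "bij_betw (s m) {a \<in> Xn m. alv al nx (Suc 0) a} {b \<in> Yn m. alv al' nx' (Suc 0) b}"
        by (rule bij_betw_Collect[OF Pm(1)]) (use Pm(2)[of _ "Suc 0"] in blast)
      ultimately show ?thesis using Pm(2) by simp
    qed
    have N: "nx ` S \<subseteq> Xn n" "nx' ` S' \<subseteq> Yn n"
      using A.nx_mem A.nx_deg B.nx_mem B.nx_deg by (auto simp: S_def S'_def Xn_def Yn_def)
    have inj: "inj_on nx S" "inj_on nx' S'" using A.nx_inj B.nx_inj by (auto simp: S_def S'_def intro: inj_on_subset)
    have fS: "finite S" "finite S'" using finite_imageD[OF finite_subset[OF N(1) fin(1)] inj(1)] finite_imageD[OF finite_subset[OF N(2) fin(2)] inj(2)] by blast+
    \<comment> \<open>Surviving \<open>j\<close> steps after \<open>nx\<close> means surviving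
      \<open>Suc j\<close> steps before it, so the counts on images come from the matching in degree
      \<open>m\<close>.\<close>
    have cS: "card {a \<in> nx ` S. alv al nx j a} = card {b \<in> nx' ` S'. alv al' nx' j b}" for j
    proof -
      have 1: "{a \<in> nx ` S. alv al nx j a} = nx ` {a \<in> S. alv al nx (Suc j) a}" by (auto simp: S_def)
      have 2: "{b \<in> nx' ` S'. alv al' nx' j b} = nx' ` {b \<in> S'. alv al' nx' (Suc j) b}" by (auto simp: S'_def)
      have "bij_betw (s m) {a \<in> S. alv al nx (Suc j) a} {b \<in> S'. alv al' nx' (Suc j) b}"
        by (rule bij_betw_Collect) (use bS in blast)+
      then have "card {a \<in> S. alv al nx (Suc j) a} = card {b \<in> S'. alv al' nx' (Suc j) b}" by (rule bij_betw_same_card)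
      then show ?thesis unfolding 1 2 using inj
        by (simp add: card_image inj_on_subset[OF inj(1)] inj_on_subset[OF inj(2)] del: alv.simps)
    qed
    have "\<exists>\<pi>. bij_betw \<pi> (Xn n - nx ` S) (Yn n - nx' ` S') \<and> (\<forall>a\<in>Xn n - nx ` S. \<forall>j. alv al nx j a = alv al' nx' j (\<pi> a))"
    proof (rule bij_preserving)
      show "card {a \<in> Xn n - nx ` S. alv al nx j a} = card {b \<in> Yn n - nx' ` S'. alv al' nx' j b}" for j
      proof -
        have 1: "{a \<in> Xn n - nx ` S. alv al nx j a} = {a \<in> X. fst a = n \<and> alv al nx j a} - {a \<in> nx ` S. alv al nx j a}"
          by (auto simp: Xn_def)
        have 2: "{b \<in> Yn n - nx' ` S'. alv al' nx' j b} = {b \<in> Y. fst b = n \<and> alv al' nx' j b} - {b \<in> nx' ` S'. alv al' nx' j b}"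
          by (auto simp: Yn_def)
        have "card ({a \<in> X. fst a = n \<and> alv al nx j a} - {a \<in> nx ` S. alv al nx j a}) = card {a \<in> X. fst a = n \<and> alv al nx j a} - card {a \<in> nx ` S. alv al nx j a}"
          by (rule card_Diff_subset) (use fS N in \<open>auto simp: Xn_def\<close>)
        moreover have "card ({b \<in> Y. fst b = n \<and> alv al' nx' j b} - {b \<in> nx' ` S'. alv al' nx' j b}) = card {b \<in> Y. fst b = n \<and> alv al' nx' j b} - card {b \<in> nx' ` S'. alv al' nx' j b}"
          by (rule card_Diff_subset) (use fS N in \<open>auto simp: Yn_def\<close>)
        ultimately show ?thesis unfolding 1 2 by (simp only: cards cS)
      qed
    next
      show "alv al nx (Suc j) a \<Longrightarrow> alv al nx j a" "alv al' nx' (Suc j) b \<Longrightarrow> alv al' nx' j b" for j a b by (erule alv_mono)+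
    qed (simp_all add: fin)
    then obtain \<pi> where \<pi>: "bij_betw \<pi> (Xn n - nx ` S) (Yn n - nx' ` S')"
      "\<And>a j. a \<in> Xn n - nx ` S \<Longrightarrow> alv al nx j a = alv al' nx' j (\<pi> a)" by blast
    define \<rho> where "\<rho> = nx' \<circ> (s m \<circ> inv_into S nx)"
    have \<rho>: "bij_betw \<rho> (nx ` S) (nx' ` S')"
      unfolding \<rho>_def using bS inj
      by (intro bij_betw_trans[of _ "nx ` S" S'] bij_betw_trans[of _ "nx ` S" S] bij_betw_inv_into) (auto simp: bij_betw_def)
    have \<rho>n: "\<rho> (nx a) = nx' (s m a)" if "a \<in> S" for a using inv_into_f_f[OF inj(1) that] by (simp add: \<rho>_def)
    define r where "r c = (if c \<in> nx ` S then \<rho> c else \<pi> c)" for c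
    have "bij_betw r (nx ` S) (nx' ` S')" using \<rho> by (rule bij_betw_cong[THEN iffD1, rotated]) (simp add: r_def)
    moreover have "bij_betw r (Xn n - nx ` S) (Yn n - nx' ` S')" using \<pi>(1) by (rule bij_betw_cong[THEN iffD1, rotated]) (simp add: r_def)
    ultimately have "bij_betw r (nx ` S \<union> (Xn n - nx ` S)) (nx' ` S' \<union> (Yn n - nx' ` S'))" by (rule bij_betw_combine) auto
    then have "bij_betw r (Xn n) (Yn n)" using N by (simp add: Un_absorb1)
    moreover have "alv al nx j c = alv al' nx' j (r c)" if c: "c \<in> Xn n" for c j
    proof (cases "c \<in> nx ` S")
      case True
      then obtain a where a: "a \<in> S" "c = nx a" by blast
      have "s m a \<in> S'" using bS a(1) bij_betw_apply by metis
      then have "al' (s m a)" by (simp add: S'_def)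
      moreover have "al a" using a by (simp add: S_def)
      moreover have "alv al nx (Suc j) a = alv al' nx' (Suc j) (s m a)" using bS a(1) by blast
      ultimately show ?thesis using True a \<rho>n[OF a(1)] by (simp add: r_def)
    next
      case False
      then show ?thesis using \<pi>(2)[of c j] c by (simp add: r_def)
    qed
    moreover have "r (nx a) = nx' (s k a)" if "n = q * k" "a \<in> Xn k" "al a" for k a
    proof -
      have "a \<in> S" using that by (simp add: S_def Xn_def)
      moreover have "k = m" using that(1) A.q2 by (simp add: m_def)
      ultimately show ?thesis using \<rho>n by (simp add: r_def)
    qed
    ultimately have "P s n r" unfolding P_def by blast
    then show "\<exists>r. P s n r" by (rule exI[of "P s n" r])
  qed
  then obtain s where s: "\<And>n. P s n (s n)" by blast
  have bij: "bij_betw (s n) (Xn n) (Yn n)" for n using s[of n] by (simp add: P_def)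
  define \<sigma> where "\<sigma> a = s (fst a) a" for a
  have mem: "\<sigma> a \<in> Y" "fst (\<sigma> a) = fst a" if "a \<in> X" for a
    using bij_betw_apply[OF bij[of "fst a"], of a] that by (simp_all add: \<sigma>_def Xn_def Yn_def)
  have "bij_betw \<sigma> X Y"
  proof (rule bij_betw_imageI)
    show "inj_on \<sigma> X"
    proof (rule inj_onI)
      fix a b assume ab: "a \<in> X" "b \<in> X" "\<sigma> a = \<sigma> b"
      then have "fst a = fst b" using mem by metis
      then show "a = b" using inj_onD[OF bij_betw_imp_inj_on[OF bij[of "fst a"]], of a b] ab by (simp add: \<sigma>_def Xn_def)
    qed
    show "\<sigma> ` X = Y"
    proof
      show "\<sigma> ` X \<subseteq> Y" using mem by blast
      show "Y \<subseteq> \<sigma> ` X"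
      proof
        fix b assume "b \<in> Y"
        then have "b \<in> s (fst b) ` Xn (fst b)" using bij[of "fst b"] by (simp add: bij_betw_def Yn_def)
        then obtain a where "a \<in> X" "fst a = fst b" "b = s (fst b) a" unfolding Xn_def by blast
        then have "b = \<sigma> a" by (simp add: \<sigma>_def)
        with \<open>a \<in> X\<close> show "b \<in> \<sigma> ` X" by blast
      qed
    qed
  qed
  moreover have "al' (\<sigma> a) \<longleftrightarrow> al a" if a: "a \<in> X" for a
  proof -
    have "alv al nx (Suc 0) a = alv al' nx' (Suc 0) (s (fst a) a)" using s[of "fst a"] a unfolding P_def Xn_def by blast
    then show ?thesis by (simp add: \<sigma>_def)
  qed
  moreover have "\<sigma> (nx a) = nx' (\<sigma> a)" if a: "a \<in> X" "al a" for a
  proof -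
    have d: "fst (nx a) = q * fst a" by (rule A.nx_deg[OF a])
    have "fst a < q * fst a" using A.letter_pos[OF a(1)] A.q2 by simp
    moreover have "a \<in> Xn (fst a)" using a(1) by (simp add: Xn_def)
    ultimately have "s (q * fst a) (nx a) = nx' (s (fst a) a)" using s[of "q * fst a"] a(2) unfolding P_def by blast
    then show ?thesis by (simp add: \<sigma>_def d)
  qed
  ultimately show ?thesis using mem by blast
qed

section \<open>Kernels of iterated \<open>p\<close>-th powers in an adapted basis\<close>

locale adapted = based A X u0 el + fletters X u0 p al nx
  for A :: "('k::field, 'a::ab_group_add) galgebra" and X :: "(nat \<times> 'x) set" and u0 el and p :: nat and al nx +
  assumes char: "CHAR('k) = p" and perf: "\<And>x::'k. \<exists>y. y ^ p = x"
    and pwr_nx: "a \<in> X \<Longrightarrow> al a \<Longrightarrow> pwr p (fst a) (el a) = el (nx a)"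
    and pwr_dead: "a \<in> X \<Longrightarrow> \<not> al a \<Longrightarrow> pwr p (fst a) (el a) = 0"
begin

lemma p_pos: "p > 0" using q2 by simp

sublocale Q: qshf X u0 m p "f p" pc by (rule qshf_based[OF char p_pos perf])

lemma f_al: "f p a c = (if a \<in> X \<and> al a \<and> c = nx a then 1 else 0)"
proof (cases "a \<in> X \<and> c \<in> X \<and> fst c = p * fst a")
  case True
  then show ?thesis
    using pwr_nx[of a] pwr_dead[of a] crd_el[of c "nx a"] nx_mem[of a] nx_deg[of a] crd_0 by (cases "al a") (auto simp: f_def)
next
  case False
  then have "\<not> (a \<in> X \<and> al a \<and> c = nx a)" using nx_mem nx_deg by blast
  then show ?thesis using False by (auto simp: f_def)
qed

lemma fr_al: "Q.fr w u = (if w \<in> lists X \<and> (\<forall>a\<in>set w. al a) \<and> u = map nx w then 1 else 0)"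
proof (induction w arbitrary: u)
  case (Cons a w)
  note IH = Cons.IH
  show ?case
  proof (cases u)
    case (Cons c u')
    have "Q.fr (a # w) (c # u') = f p a c * Q.fr w u'" by simp
    then show ?thesis unfolding Cons f_al[of a c] IH by auto
  qed simp
qed simp

lemma nx_map_inj: "w \<in> lists X \<Longrightarrow> v \<in> lists X \<Longrightarrow> \<forall>a\<in>set w. al a \<Longrightarrow> \<forall>a\<in>set v. al a \<Longrightarrow> map nx w = map nx v \<Longrightarrow> w = v"
  by (rule map_inj_on) (use nx_inj in \<open>auto intro: inj_on_subset\<close>)

lemma Fr_map:
  assumes x: "x \<in> hom n" and w: "w \<in> W n" "\<forall>a\<in>set w. al a"
  shows "Q.Fr x (map nx w) = x w ^ p"
proof -
  have "Q.Fr x (map nx w) = (\<Sum>v\<in>W n. if v = w then x w ^ p else 0)"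
    unfolding Q.Fr_expand[OF x] sum_fun_apply sc_simps(5)
    by (rule sum.cong[OF refl]) (use w nx_map_inj[of _ w] W_lists in \<open>auto simp: fr_al\<close>)
  then show ?thesis using w by simp
qed

lemma Fr_nonzero: "Q.Fr x u \<noteq> 0 \<Longrightarrow> \<exists>w. x w \<noteq> 0 \<and> (\<forall>a\<in>set w. al a) \<and> u = map nx w"
  using Q.Fr_supp[of x u] by (auto simp: fr_al split: if_splits)

text \<open>The iterate sends words whose letters all survive \<open>j\<close> steps to distinct
  words and all other words to zero, so no cancellation can occur between different words.\<close>

lemma Fj_kernel: "x \<in> hom n \<Longrightarrow> Q.Fj j x = 0 \<longleftrightarrow> (\<forall>w\<in>W n. (\<forall>a\<in>set w. alv al nx j a) \<longrightarrow> x w = 0)"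
proof (induction j arbitrary: x n)
  case 0
  then show ?case by (auto simp: hom_def fun_eq_iff fun_app)
next
  case (Suc j)
  have "Q.Fj (Suc j) x = Q.Fj j (Q.Fr x)" using Q.Fj_Fj[of j 1 x] by simp
  then have "Q.Fj (Suc j) x = 0 \<longleftrightarrow> (\<forall>u\<in>W (p * n). (\<forall>a\<in>set u. alv al nx j a) \<longrightarrow> Q.Fr x u = 0)"
    using Suc.IH[OF Q.hom_Fr[OF Suc.prems]] by simp
  also have "\<dots> \<longleftrightarrow> (\<forall>w\<in>W n. (\<forall>a\<in>set w. alv al nx (Suc j) a) \<longrightarrow> x w = 0)"
  proof (intro iffI ballI impI)
    fix w assume H: "\<forall>u\<in>W (p * n). (\<forall>a\<in>set u. alv al nx j a) \<longrightarrow> Q.Fr x u = 0" and w: "w \<in> W n" "\<forall>a\<in>set w. alv al nx (Suc j) a"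
    have "wdeg (map nx w) = p * wdeg w" using w nx_deg W_lists(1)[OF w(1)]
      by (induction w arbitrary: n) (auto simp: wdeg_def W_def distrib_left)
    then have "map nx w \<in> W (p * n)" using w nx_mem by (auto simp: W_def)
    moreover have "\<forall>a\<in>set (map nx w). alv al nx j a" using w by auto
    ultimately have "Q.Fr x (map nx w) = 0" using H by blast
    then have "x w ^ p = 0" using Fr_map[OF Suc.prems w(1)] w(2) by simp
    then show "x w = 0" by simp
  next
    fix u assume H: "\<forall>w\<in>W n. (\<forall>a\<in>set w. alv al nx (Suc j) a) \<longrightarrow> x w = 0" and u: "u \<in> W (p * n)" "\<forall>a\<in>set u. alv al nx j a"
    show "Q.Fr x u = 0"
    proof (rule ccontr)
      assume "Q.Fr x u \<noteq> 0"
      then obtain w where w: "x w \<noteq> 0" "\<forall>a\<in>set w. al a" "u = map nx w" using Fr_nonzero by blast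
      then have "w \<in> W n" using Suc.prems by (auto simp: hom_def)
      moreover have "\<forall>a\<in>set w. alv al nx (Suc j) a" using w u by auto
      ultimately show False using H w(1) by blast
    qed
  qed
  finally show ?case .
qed

lemma pw_Fj: "x \<in> hom n \<Longrightarrow> M.pw x (p ^ j) = Q.Fj j x"
proof (induction j)
  case 0
  then show ?case using M.pw_1[of x n] by (simp del: M.pw.simps)
next
  case (Suc j)
  have "M.pw x (p ^ Suc j) = M.pw (M.pw x (p ^ j)) p" using M.pw_mult[OF Suc.prems, of "p ^ j" p] by (simp add: mult.commute)
  also have "\<dots> = Q.Fr (Q.Fj j x)" unfolding Suc.IH[OF Suc.prems] by (rule Q.pw_Fr[OF Q.hom_Fj[OF Suc.prems]])
  finally show ?case by simp
qed

definition dead :: "nat \<Rightarrow> nat \<Rightarrow> (nat \<times> 'x) list set" where "dead j n = {w \<in> W n. \<not> (\<forall>a\<in>set w. alv al nx j a)}"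

lemma dead_kernel: "SP (dead j n) = {x \<in> hom n. M.pw x (p ^ j) = 0}"
proof -
  have "x \<in> SP (dead j n) \<longleftrightarrow> x \<in> hom n \<and> Q.Fj j x = 0" for x :: "('k, 'x) ser"
    using Fj_kernel[of x n j] by (auto simp: SP_def dead_def hom_def)
  then show ?thesis using pw_Fj by auto
qed

lemma letters_alv: "letters {a \<in> X. alv al nx j a} u0"
  by unfold_locales (auto simp: letter_pos intro: finite_subset[OF _ letter_fin])

lemma card_W_alv: "card (letters.W {a \<in> X. alv al nx j a} n) = card (W n) - card (dead j n)"
proof -
  interpret L: letters "{a \<in> X. alv al nx j a}" u0 by (rule letters_alv)
  have "L.W n = W n - dead j n" by (auto simp: L.W_def W_def dead_def)
  then show ?thesis by (simp add: card_Diff_subset dead_def)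
qed

end

text \<open>The kernel of the \<open>p ^ j\<close>-th power in a given degree is preserved by every
  isomorphism of graded algebras, and by \<open>dead_kernel\<close> its dimension is a number of
  words.\<close>

lemma dead_eq:
  fixes A :: "('k::field, 'a::ab_group_add) galgebra" and B :: "('k, 'b::ab_group_add) galgebra"
  assumes "adapted A X u0 elA p al nx" "adapted B Y v0 elB p al' nx'" and g: "galgebra_iso (Jv A) (Jv B) g"
  shows "card (letters.W X n) = card (letters.W Y n)" "card (adapted.dead X al nx j n) = card (adapted.dead Y al' nx' j n)"
proof -
  interpret A: adapted A X u0 elA p al nx by (rule assms)
  interpret B: adapted B Y v0 elB p al' nx' by (rule assms)
  have g: "bij_betw (g n) (A.grJ n) (B.grJ n)" "x \<in> A.grJ n \<Longrightarrow> y \<in> A.grJ n \<Longrightarrow> g n (x + y) = g n x + g n y"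
    "x \<in> A.grJ n \<Longrightarrow> g n (\<lambda>\<phi>. c * x \<phi>) = (\<lambda>\<phi>. c * g n x \<phi>)" "g 0 (unit (Jv A)) = unit (Jv B)"
    "x \<in> A.grJ i \<Longrightarrow> y \<in> A.grJ j \<Longrightarrow> g (i + j) (mul (Jv A) i j x y) = mul (Jv B) i j (g i x) (g j y)" for n i j x y c
    using g by (simp_all add: galgebra_iso_def glinear_iso_def)
  define G where "G n x = B.Ps (g n (A.Th n x))" for n x
  have gB: "g n (A.Th n x) \<in> B.grJ n" for n x by (rule bij_betw_apply[OF g(1) A.grJ_Th])
  have bij: "bij_betw (G n) (A.hom n) (B.hom n)" for n
  proof -
    have "bij_betw (B.Ps \<circ> (g n \<circ> A.Th n)) (A.hom n) (B.hom n)"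
      by (rule bij_betw_trans[OF bij_betw_trans[OF A.Th_bij g(1)] B.Ps_bij])
    then show ?thesis by (simp add: G_def[abs_def] o_def)
  qed
  have add: "G n (x + y) = G n x + G n y" for n x y by (simp only: G_def A.Th_add g(2)[OF A.grJ_Th A.grJ_Th] B.Ps_add)
  have scl: "G n (sc c x) = sc c (G n x)" for n c x by (simp only: G_def A.Th_scl g(3)[OF A.grJ_Th] B.Ps_scl)
  have G0: "G n 0 = 0" for n using scl[of n 0 0] by simp
  have Gh: "G n x \<in> B.hom n" if "x \<in> A.hom n" for n x by (rule bij_betw_apply[OF bij that])
  have one: "G 0 (bs []) = bs []"
  proof -
    have "unit (Jv A) \<in> A.grJ 0" using A.grJ_word[of "[]" 0] by (simp add: A.W_0 Jv_def)
    then have "A.Th 0 (bs []) = unit (Jv A)" using A.Th_Ps A.Ps_unit by metis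
    then show ?thesis by (simp add: G_def g(4) B.Ps_unit)
  qed
  have mul: "G (i + j) (A.M.qm x y) = B.M.qm (G i x) (G j y)" if "x \<in> A.hom i" "y \<in> A.hom j" for i j x y
  proof -
    have "A.Th (i + j) (A.M.qm x y) = mul (Jv A) i j (A.Th i x) (A.Th j y)"
      by (simp only: A.mul_Th[OF A.grJ_Th A.grJ_Th] A.Ps_Th that)
    then show ?thesis by (simp only: G_def g(5)[OF A.grJ_Th A.grJ_Th] B.Ps_mul[OF gB gB])
  qed
  have pw: "G (k * n) (A.M.pw x k) = B.M.pw (G n x) k" if "x \<in> A.hom n" for k n x
  proof (induction k)
    case (Suc k)
    have "G (n + k * n) (A.M.qm x (A.M.pw x k)) = B.M.qm (G n x) (G (k * n) (A.M.pw x k))"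
      by (rule mul[OF that A.M.pw_hom[OF that]])
    then show ?case using Suc.IH by simp
  qed (simp add: one)
  have fA: "finite (A.dead j n)" "finite (B.dead j n)" for j n by (simp_all add: A.dead_def B.dead_def)
  have z: "B.M.pw (G n x) k = 0 \<longleftrightarrow> A.M.pw x k = 0" if x: "x \<in> A.hom n" for k x n
  proof
    assume "B.M.pw (G n x) k = 0"
    then have "G (k * n) (A.M.pw x k) = G (k * n) 0" using pw[OF x] G0 by simp
    then show "A.M.pw x k = 0" using bij[of "k * n"] A.M.pw_hom[OF x, of k] A.hom_0[of "k * n"]
      by (auto simp: bij_betw_def inj_on_def)
  next
    assume "A.M.pw x k = 0"
    then show "B.M.pw (G n x) k = 0" using pw[OF x, of k] G0 by simp
  qed
  have "bij_betw (G n) (SP (A.dead j n)) (SP (B.dead j n))"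
    unfolding A.dead_kernel B.dead_kernel by (rule bij_betw_Collect[OF bij]) (simp add: z)
  from supp_card_eq[OF fA add scl this] show "card (A.dead j n) = card (B.dead j n)" .
  have "bij_betw (G n) (SP (A.W n)) (SP (B.W n))" using bij[of n] by (simp only: SP_def A.hom_def B.hom_def)
  from supp_card_eq[OF A.finite_W B.finite_W add scl this] show "card (A.W n) = card (B.W n)" .
qed

section \<open>Choice of bases and the equivalences\<close>

lemma adapted_ex:
  fixes A :: "('k::field, 'a::ab_group_add) galgebra"
  assumes A: "connected_comm_galgebra A" and p: "CHAR('k) = p" "p > 0" "\<And>x::'k. \<exists>y. y ^ p = x"
  shows "\<exists>(X :: (nat \<times> 'a) set) al nx. adapted A X (0, unit A) snd p al nx"
proof -
  interpret A: connected_comm_galgebra A by (rule A)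
  have p2: "p \<ge> 2" using prime_CHAR_semidom[where 'a = 'k] p prime_ge_2_nat by auto
  have "\<exists>T. A.independent T \<and> A.span T = gr A n" for n
  proof -
    obtain T where T: "T \<subseteq> gr A n" "A.independent T" "gr A n \<subseteq> A.span T" using A.maximal_independent_subset by blast
    then show ?thesis using A.span_minimal[OF T(1) A.subspace_gr] by blast
  qed
  then obtain T where T: "\<And>n. A.independent (T n) \<and> A.span (T n) = gr A n" by metis
  \<comment> \<open>An auxiliary basis: additivity and semilinearity of the \<open>p\<close>-th
    power were obtained through coordinates.\<close>
  interpret T: based A "{(n, b). n > 0 \<and> b \<in> T n}" "(0, unit A)" snd
    by (rule based_ex[OF A T])
  interpret F: frob_algebra A p "\<lambda>n v. snd (lprod A (replicate p (n, v)))"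
    by unfold_locales (use p2 p T.pwr_gr T.pwr_add[OF p] T.pwr_scl[OF p] in auto)
  let ?F = "\<lambda>n v. snd (lprod A (replicate p (n, v)))"
  obtain Bs where Bs: "\<And>n. n > 0 \<Longrightarrow> A.independent (Bs n) \<and> A.span (Bs n) = gr A n \<and> inj_on (?F n) {b \<in> Bs n. ?F n b \<noteq> 0} \<and> ?F n ` {b \<in> Bs n. ?F n b \<noteq> 0} \<subseteq> Bs (p * n)"
    using F.adapted_bases by blast
  let ?X = "{(n, b). n > 0 \<and> b \<in> Bs n}"
  interpret Bs: based A ?X "(0, unit A)" snd
    by (rule based_ex[OF A]) (use Bs in blast)
  define al where "al = (\<lambda>a :: nat \<times> 'a. ?F (fst a) (snd a) \<noteq> 0)"
  define nx where "nx = (\<lambda>a :: nat \<times> 'a. (p * fst a, ?F (fst a) (snd a)))"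
  have "adapted A ?X (0, unit A) snd p al nx"
  proof unfold_locales
    show "2 \<le> p" by (rule p2)
    show "CHAR('k) = p" by (rule p)
    show "\<exists>y. y ^ p = x" for x :: 'k by (rule p)
    show "nx a \<in> ?X" if "a \<in> ?X" "al a" for a
      using that Bs[of "fst a"] p(2) by (auto simp: al_def nx_def image_subset_iff)
    show "fst (nx a) = p * fst a" "?F (fst a) (snd a) = snd (nx a)" for a by (simp_all add: nx_def)
    show "inj_on nx {a \<in> ?X. al a}"
    proof (rule inj_onI)
      fix a b assume ab: "a \<in> {a \<in> ?X. al a}" "b \<in> {a \<in> ?X. al a}" "nx a = nx b"
      then have n: "fst a = fst b" "fst a > 0" using p(2) by (auto simp: nx_def)
      have "snd a = snd b"
        using Bs[OF n(2)] ab n(1) by (auto simp: nx_def al_def inj_on_def)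
      then show "a = b" using n(1) by (simp add: prod_eq_iff)
    qed
    show "?F (fst a) (snd a) = 0" if "\<not> al a" for a using that by (simp add: al_def)
  qed
  then show ?thesis by blast
qed

text \<open>The words with only letters that survive \<open>j\<close> steps are the complement of
  the dead words, so their number is an invariant of the algebra; \<open>letter_card_eq\<close>
  extracts the number of such letters in each degree. The resulting matching of letters reindexes
  the basis of \<open>B\<close> by the letters of \<open>A\<close>, and in this indexing the
  Frobenius matrices coincide.\<close>

lemma fmodule_from_algebra:
  fixes A :: "('k::field, 'a::ab_group_add) galgebra" and B :: "('k, 'b::ab_group_add) galgebra"
  assumes A: "connected_comm_galgebra A" and B: "connected_comm_galgebra B"
    and p: "CHAR('k) = p" "p > 0" "\<And>x::'k. \<exists>y. y ^ p = x" and g: "galgebra_iso (Jv A) (Jv B) g"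
  shows "\<exists>h. fmodule_iso p (aug_fmodule p A) (aug_fmodule p B) h"
proof -
  obtain X al nx where aA: "adapted A (X :: (nat \<times> 'a) set) (0, unit A) snd p al nx" using adapted_ex[OF A p] by blast
  obtain Y al' nx' where aB: "adapted B (Y :: (nat \<times> 'b) set) (0, unit B) snd p al' nx'" using adapted_ex[OF B p] by blast
  interpret A: adapted A X "(0, unit A)" snd p al nx by (rule aA)
  interpret B: adapted B Y "(0, unit B)" snd p al' nx' by (rule aB)
  have "card {a \<in> X. fst a = n \<and> alv al nx j a} = card {b \<in> Y. fst b = n \<and> alv al' nx' j b}" for n j
  proof -
    have "card {a \<in> {a \<in> X. alv al nx j a}. fst a = n} = card {b \<in> {b \<in> Y. alv al' nx' j b}. fst b = n}"
      by (rule letter_card_eq[OF A.letters_alv B.letters_alv]) (simp only: A.card_W_alv B.card_W_alv dead_eq[OF aA aB g])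
    then show ?thesis by (simp add: conj_ac cong: conj_cong)
  qed
  from letter_bijection[OF A.fletters_axioms B.fletters_axioms this]
  obtain \<sigma> where \<sigma>: "bij_betw \<sigma> X Y" "\<And>a. a \<in> X \<Longrightarrow> fst (\<sigma> a) = fst a" "\<And>a. a \<in> X \<Longrightarrow> al' (\<sigma> a) \<longleftrightarrow> al a"
    "\<And>a. a \<in> X \<Longrightarrow> al a \<Longrightarrow> \<sigma> (nx a) = nx' (\<sigma> a)" by blast
  define e where "e c = (if fst c = 0 then unit B else snd (\<sigma> c))" for c
  have \<sigma>Y: "\<sigma> a \<in> Y" if "a \<in> X" for a using \<sigma>(1) that by (rule bij_betw_apply)
  have eX: "e a = snd (\<sigma> a)" if "a \<in> X" for a using A.letter_pos[OF that] by (simp add: e_def)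
  have main: "inj_on e {c \<in> insert (0, unit A) X. fst c = n} \<and> e ` {c \<in> insert (0, unit A) X. fst c = n} = snd ` {c \<in> insert (0, unit B) Y. fst c = n}" for n
  proof (cases "n = 0")
    case True
    have "{c \<in> insert (0, unit A) X. fst c = n} = {(0, unit A)}" "{c \<in> insert (0, unit B) Y. fst c = n} = {(0, unit B)}"
      using A.Yd_0 B.Yd_0 True by (simp_all add: A.Yd_def B.Yd_def)
    then show ?thesis by (simp add: e_def)
  next
    case False
    have 1: "{c \<in> insert (0, unit A) X. fst c = n} = {c \<in> X. fst c = n}" "{c \<in> insert (0, unit B) Y. fst c = n} = {c \<in> Y. fst c = n}"
      using False by auto
    have bij: "bij_betw \<sigma> {c \<in> X. fst c = n} {c \<in> Y. fst c = n}"
      by (rule bij_betw_Collect[OF \<sigma>(1)]) (simp add: \<sigma>(2))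
    have snd_inj: "inj_on snd {c \<in> Y. fst c = n}" by (auto simp: inj_on_def prod_eq_iff)
    have "bij_betw (snd \<circ> \<sigma>) {c \<in> X. fst c = n} (snd ` {c \<in> Y. fst c = n})"
      by (rule bij_betw_trans[OF bij inj_on_imp_bij_betw[OF snd_inj]])
    then have "bij_betw e {c \<in> X. fst c = n} (snd ` {c \<in> Y. fst c = n})"
      by (rule bij_betw_cong[THEN iffD1, rotated]) (simp add: eX)
    then show ?thesis unfolding 1 by (simp add: bij_betw_def)
  qed
  have bB: "based B X (0, unit A) e"
  proof unfold_locales
    show "inj_on e {c \<in> insert (0, unit A) X. fst c = n}" "B.independent (e ` {c \<in> insert (0, unit A) X. fst c = n})"
      "B.span (e ` {c \<in> insert (0, unit A) X. fst c = n}) = gr B n" for n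
      using main[of n] B.el_indep[of n] B.el_span[of n] by simp_all
    show "e (0, unit A) = unit B" by (simp add: e_def)
  qed
  interpret E: based B X "(0, unit A)" e by (rule bB)
  have ad: "adapted B X (0, unit A) e p al nx"
  proof unfold_locales
    show "CHAR('k) = p" by (rule p)
    show "\<exists>y. y ^ p = x" for x :: 'k by (rule p)
    fix a assume a: "a \<in> X"
    show "E.pwr p (fst a) (e a) = e (nx a)" if "al a"
      using B.pwr_nx[OF \<sigma>Y[OF a]] \<sigma>(2-4)[OF a] that A.nx_mem[OF a that] by (simp add: eX a)
    show "E.pwr p (fst a) (e a) = 0" if "\<not> al a"
      using B.pwr_dead[OF \<sigma>Y[OF a]] \<sigma>(2,3)[OF a] that by (simp add: eX a)
  qed
  interpret E: adapted B X "(0, unit A)" e p al nx by (rule ad)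
  interpret AB: based2 A B X "(0, unit A)" snd e by unfold_locales
  have "A.f p = E.f p" by (intro ext) (simp only: A.f_al E.f_al)
  then show ?thesis by (rule AB.fmodule_iso_ex[OF p])
qed

theorem theorem1p8:
  fixes p :: nat
    and A :: "('k::field, 'a::ab_group_add) galgebra"
    and B :: "('k, 'b::ab_group_add) galgebra"
  assumes "CHAR('k) = p" and "p > 0"
    and perfect: "\<forall>x::'k. \<exists>y. y ^ p = x"
    and "connected_comm_galgebra A" and "connected_comm_galgebra B"
  shows "((\<exists>f. fmodule_iso p (aug_fmodule p A) (aug_fmodule p B) f) \<longleftrightarrow>
            (\<exists>f. galgebra_iso (Jv A) (Jv B) f)) \<and>
         ((\<exists>f. galgebra_iso (Jv A) (Jv B) f) \<longleftrightarrow> (\<exists>f. ghopf_iso (Jv A) (Jv B) f))"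
proof -
  have p: "\<And>x::'k. \<exists>y. y ^ p = x" using perfect by blast
  \<comment> \<open>Supplies a basis of \<open>A\<close>, which \<open>hopf_from_fmodule\<close>
    carries over to \<open>B\<close>.\<close>
  obtain X al nx where "adapted A (X :: (nat \<times> 'a) set) (0, unit A) snd p al nx"
    using adapted_ex[OF assms(4,1,2) p] by blast
  then interpret adapted A X "(0, unit A)" snd p al nx .
  have "\<exists>f. ghopf_iso (Jv A) (Jv B) f" if "fmodule_iso p (aug_fmodule p A) (aug_fmodule p B) f" for f
    by (rule hopf_from_fmodule[OF assms(5,1,2) p that])
  moreover have "galgebra_iso (Jv A) (Jv B) f" if "ghopf_iso (Jv A) (Jv B) f" for f
    using that by (simp add: ghopf_iso_def)
  moreover have "\<exists>h. fmodule_iso p (aug_fmodule p A) (aug_fmodule p B) h" if "galgebra_iso (Jv A) (Jv B) f" for f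
    by (rule fmodule_from_algebra[OF assms(4,5,1,2) p that])
  ultimately show ?thesis by blast
qed

end
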